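(* Consider the liquidation model described in the context and let $l>l_0$. Let $C(l,\cdot)$ be the unique solution of $C'=C^\top\Lambda^{-1}C+C^\top\tilde CC-\alpha\Sigma$, $C(T)=lI$, $\tilde C=\operatorname{diag}(\theta_i/c_{i,i})$. Then for all $(t,x)\in[0,T)\times\mathbb{R}^n$ the value function of the problem $$\tilde v(l,t,x):=\inf_{u\in\tilde{\mathbb{A}}(t)}\tilde J(l,t,x,u),\qquad \tilde J(l,t,x,u)=\mathbb{E}\Big[\int_t^T\big(\xi(s)^\top\Lambda\xi(s)+\alpha X^u(s)^\top\Sigma X^u(s)\big)ds+l\,X^u(T)^\top X^u(T)\Big],$$ is given by $\tilde v(l,t,x)=x^\top C(l,t)x$, and the $\mathbb{P}\otimes\lambda$-almost surely unique optimal strategy is the Markovian strategy $u^*(l)=(\xi^*(l),\eta^*(l))$ with $\xi(s)=\Lambda^{-1}C(l,s)X(s)$ and $\eta(s)=\tilde I\,\bar C(l,s)C(l,s)X(s-)$.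
   Context: Model: Fix $T>0$, $n\ge1$, $\alpha\ge0$, a symmetric positive definite $\Lambda\in\mathbb{R}^{n\times n}$ and a symmetric nonnegative definite $\Sigma\in\mathbb{R}^{n\times n}$. On a filtered probability space, $\tilde P$ is an $n$-dimensional square-integrable càdlàg martingale with $\mathrm{Cov}(\tilde P_i(t),\tilde P_j(t))=t\Sigma_{i,j}$, and $\pi=(\pi_1,\dots,\pi_n)$ is an $n$-dimensional Poisson process with intensities $\theta_1,\dots,\theta_n\ge0$, independent components, independent of $\tilde P$; the filtration is the completion of $\sigma(\tilde P(s),\pi(r):0\le s\le t,0\le r<t)$. A trading strategy on $[t,T)$ is $u=(\xi,\eta)$ with $\xi$ progressively measurable and $\eta$ predictable; the position is $dX^u(s)=-\xi(s)ds-\eta(s)d\pi(s)$, $X^u(t)=x$, and $X^u(T):=\lim_{s\to T-}X^u(s)$. $u\in\tilde{\mathbb{A}}(t)$ (admissible) if (i) the SDE has a unique solution on $[t,T)$, (ii) $\mathbb{E}\int_t^T\|\xi\|_2^4ds<\infty$, $\mathbb{E}\int_t^T\|\eta\|_2^8ds<\infty$, (iii) $\theta_i=0\Rightarrow\eta_i\equiv0$. Notation: $\theta=\sum_i\theta_i$; $D=\sqrt{\Lambda^{-1}}\Sigma\sqrt{\Lambda^{-1}}$ with extreme eigenvalues $d_{\min},d_{\max}$; $\lambda_{\min},\lambda_{\max}$ extreme eigenvalues of $\Lambda$; $l_0:=\max\{\lambda_{\max}(\sqrt{\theta^2/4+\alpha d_{\min}}-\theta/2),\lambda_{\min}\sqrt{\alpha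 d_{\max}}\}$; for $l>l_0$ the matrix ODE above has a unique solution on $(-\infty,T]$. $\bar C(l,s)=\operatorname{diag}(1/c_{i,i}(l,s))$; $\tilde I$ is diagonal with entries $1$ if $\theta_i>0$ and $0$ otherwise; $\lambda$ is Lebesgue measure. *)

theory Defs
  imports "HOL-Probability.Probability"
begin

definition cadlag_on_nonneg :: "(real \<Rightarrow> 'a::topological_space) \<Rightarrow> bool" where
  "cadlag_on_nonneg f \<longleftrightarrow>
     (\<forall>t\<ge>0. continuous (at_right t) f) \<and> (\<forall>t>0. \<exists>L. (f \<longlongrightarrow> L) (at_left t))"

definition left_lim :: "(real \<Rightarrow> 'a::t2_space) \<Rightarrow> real \<Rightarrow> 'a" where
  "left_lim f t = Lim (at_left t) f"

definition sym_mat :: "real^'n^'n \<Rightarrow> bool" where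
  "sym_mat A \<longleftrightarrow> transpose A = A"

definition pos_def :: "real^'n^'n \<Rightarrow> bool" where
  "pos_def A \<longleftrightarrow> sym_mat A \<and> (\<forall>x. x \<noteq> 0 \<longrightarrow> x \<bullet> (A *v x) > 0)"

definition nonneg_def :: "real^'n^'n \<Rightarrow> bool" where
  "nonneg_def A \<longleftrightarrow> sym_mat A \<and> (\<forall>x. x \<bullet> (A *v x) \<ge> 0)"

definition eigvals :: "real^'n^'n \<Rightarrow> real set" where
  "eigvals A = {c. \<exists>v. v \<noteq> 0 \<and> A *v v = c *\<^sub>R v}"

definition eig_max :: "real^'n^'n \<Rightarrow> real" where
  "eig_max A = Max (eigvals A)"

definition eig_min :: "real^'n^'n \<Rightarrow> real" where
  "eig_min A = Min (eigvals A)"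

definition mat_sqrt :: "real^'n^'n \<Rightarrow> real^'n^'n" where
  "mat_sqrt A = (THE S. nonneg_def S \<and> S ** S = A)"

definition diag_mat :: "('n \<Rightarrow> real) \<Rightarrow> real^'n^'n" where
  "diag_mat d = (\<chi> i j. if i = j then d i else 0)"

definition D_mat :: "real^'n^'n \<Rightarrow> real^'n^'n \<Rightarrow> real^'n^'n" where
  "D_mat \<Lambda> \<Sigma> = mat_sqrt (matrix_inv \<Lambda>) ** \<Sigma> ** mat_sqrt (matrix_inv \<Lambda>)"

definition l0 :: "('n::finite \<Rightarrow> real) \<Rightarrow> real \<Rightarrow> real^'n^'n \<Rightarrow> real^'n^'n \<Rightarrow> real" where
  "l0 \<theta> \<alpha> \<Lambda> \<Sigma> =
     (let th = (\<Sum>i\<in>UNIV. \<theta> i); D = D_mat \<Lambda> \<Sigma> in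
      max (eig_max \<Lambda> * (sqrt (th\<^sup>2 / 4 + \<alpha> * eig_min D) - th / 2))
          (eig_min \<Lambda> * sqrt (\<alpha> * eig_max D)))"

definition Ctilde :: "('n \<Rightarrow> real) \<Rightarrow> real^'n^'n \<Rightarrow> real^'n^'n" where
  "Ctilde \<theta> C = diag_mat (\<lambda>i. \<theta> i / C $ i $ i)"

definition Cbar :: "real^'n^'n \<Rightarrow> real^'n^'n" where
  "Cbar C = diag_mat (\<lambda>i. 1 / C $ i $ i)"

definition Itilde :: "('n \<Rightarrow> real) \<Rightarrow> real^'n^'n" where
  "Itilde \<theta> = diag_mat (\<lambda>i. if \<theta> i > 0 then 1 else 0)"

definition riccati_sol ::
  "('n::finite \<Rightarrow> real) \<Rightarrow> real \<Rightarrow> real^'n^'n \<Rightarrow> real^'n^'n \<Rightarrow> real \<Rightarrow> real \<Rightarrow> (real \<Rightarrow> real^'n^'n) \<Rightarrow> bool" where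
  "riccati_sol \<theta> \<alpha> \<Lambda> \<Sigma> T l C \<longleftrightarrow>
     C T = l *\<^sub>R mat 1 \<and>
     (\<forall>s\<le>T. (C has_vector_derivative
        (transpose (C s) ** matrix_inv \<Lambda> ** C s + transpose (C s) ** Ctilde \<theta> (C s) ** C s
         - \<alpha> *\<^sub>R \<Sigma>)) (at s within {..T}))"

definition (in prob_space) poisson_process :: "real \<Rightarrow> (real \<Rightarrow> 'a \<Rightarrow> real) \<Rightarrow> bool" where
  "poisson_process \<theta> N \<longleftrightarrow> \<theta> \<ge> 0 \<and>
     (\<forall>t\<ge>0. N t \<in> borel_measurable M) \<and>
     (\<forall>\<omega>\<in>space M. N 0 \<omega> = 0 \<and> (\<forall>t\<ge>0. N t \<omega> \<in> \<nat>) \<and>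
        mono_on {0..} (\<lambda>t. N t \<omega>) \<and> cadlag_on_nonneg (\<lambda>t. N t \<omega>)) \<and>
     (\<forall>s t. 0 \<le> s \<longrightarrow> s \<le> t \<longrightarrow> (\<forall>k::nat.
        prob {\<omega>\<in>space M. N t \<omega> - N s \<omega> = real k}
          = exp (- (\<theta> * (t - s))) * (\<theta> * (t - s)) ^ k / fact k)) \<and>
     (\<forall>ts::real list. sorted ts \<longrightarrow> (\<forall>r\<in>set ts. 0 \<le> r) \<longrightarrow>
        indep_vars (\<lambda>_. borel) (\<lambda>i \<omega>. N (ts ! Suc i) \<omega> - N (ts ! i) \<omega>) {..<length ts - 1})"

definition (in prob_space) gen_filtration ::
  "(real \<Rightarrow> 'a \<Rightarrow> real^'n) \<Rightarrow> (real \<Rightarrow> 'a \<Rightarrow> real^'n) \<Rightarrow> real \<Rightarrow> 'a measure" where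
  "gen_filtration P N t = sigma (space M)
     ({P s -` B \<inter> space M | s B. 0 \<le> s \<and> s \<le> t \<and> B \<in> sets borel}
      \<union> {N r -` B \<inter> space M | r B. 0 \<le> r \<and> r < t \<and> B \<in> sets borel}
      \<union> null_sets M)"

definition (in prob_space) sq_int_martingale ::
  "(real \<Rightarrow> 'a measure) \<Rightarrow> (real \<Rightarrow> 'a \<Rightarrow> real) \<Rightarrow> bool" where
  "sq_int_martingale F X \<longleftrightarrow>
     (\<forall>t\<ge>0. X t \<in> borel_measurable M \<and> X t \<in> borel_measurable (F t)
            \<and> integrable M (X t) \<and> integrable M (\<lambda>\<omega>. (X t \<omega>)\<^sup>2)) \<and>
     (\<forall>s t. 0 \<le> s \<longrightarrow> s \<le> t \<longrightarrow> (AE \<omega> in M. real_cond_exp M (F s) (X t) \<omega> = X s \<omega>))"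

definition progressive ::
  "(real \<Rightarrow> 'w measure) \<Rightarrow> real \<Rightarrow> real \<Rightarrow> (real \<Rightarrow> 'w \<Rightarrow> real^'n) \<Rightarrow> bool" where
  "progressive F t T \<xi> \<longleftrightarrow>
     (\<forall>s\<in>{t..<T}. (\<lambda>(r, \<omega>). \<xi> r \<omega>) \<in> borel_measurable (restrict_space borel {t..s} \<Otimes>\<^sub>M F s))"

definition predictable_sigma :: "(real \<Rightarrow> 'w measure) \<Rightarrow> real \<Rightarrow> real \<Rightarrow> (real \<times> 'w) measure" where
  "predictable_sigma F t T = sigma ({t..<T} \<times> space (F t))
     ({({a<..b} \<inter> {t..<T}) \<times> A | a b A. t \<le> a \<and> a \<le> b \<and> A \<in> sets (F a)}
      \<union> {{t} \<times> A | A. A \<in> sets (F t)})"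

definition predictable ::
  "(real \<Rightarrow> 'w measure) \<Rightarrow> real \<Rightarrow> real \<Rightarrow> (real \<Rightarrow> 'w \<Rightarrow> real^'n) \<Rightarrow> bool" where
  "predictable F t T \<eta> \<longleftrightarrow> (\<lambda>(r, \<omega>). \<eta> r \<omega>) \<in> borel_measurable (predictable_sigma F t T)"

text \<open>Pathwise solution of $dX = -\xi\,ds - \eta\,d\pi$, $X(t) = x$: since each $\pi_i$ is a
  counting (step) path, the $d\pi$ integral over $(t,s]$ is the sum over its jumps.\<close>
definition jump_times :: "(real \<Rightarrow> real) \<Rightarrow> real \<Rightarrow> real \<Rightarrow> real set" where
  "jump_times f a b = {r \<in> {a<..b}. f r \<noteq> left_lim f r}"

definition position ::
  "(real \<Rightarrow> 'w \<Rightarrow> real^'n) \<Rightarrow> real^'n \<Rightarrow> real \<Rightarrow> (real \<Rightarrow> 'w \<Rightarrow> real^'n) \<Rightarrow> (real \<Rightarrow> 'w \<Rightarrow> real^'n)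
     \<Rightarrow> real \<Rightarrow> 'w \<Rightarrow> real^'n" where
  "position \<pi> x t \<xi> \<eta> s \<omega> = (\<chi> i. x $ i
      - set_lebesgue_integral lborel {t..s} (\<lambda>r. \<xi> r \<omega> $ i)
      - (\<Sum>r\<in>jump_times (\<lambda>q. \<pi> q \<omega> $ i) t s.
            \<eta> r \<omega> $ i * (\<pi> r \<omega> $ i - left_lim (\<lambda>q. \<pi> q \<omega> $ i) r)))"

definition terminal_position ::
  "(real \<Rightarrow> 'w \<Rightarrow> real^'n) \<Rightarrow> real^'n \<Rightarrow> real \<Rightarrow> real \<Rightarrow> (real \<Rightarrow> 'w \<Rightarrow> real^'n) \<Rightarrow> (real \<Rightarrow> 'w \<Rightarrow> real^'n)
     \<Rightarrow> 'w \<Rightarrow> real^'n" where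
  "terminal_position \<pi> x t T \<xi> \<eta> \<omega> = Lim (at_left T) (\<lambda>s. position \<pi> x t \<xi> \<eta> s \<omega>)"

definition admissible ::
  "'w measure \<Rightarrow> (real \<Rightarrow> 'w measure) \<Rightarrow> ('n::finite \<Rightarrow> real) \<Rightarrow> real \<Rightarrow> real
     \<Rightarrow> (real \<Rightarrow> 'w \<Rightarrow> real^'n) \<Rightarrow> (real \<Rightarrow> 'w \<Rightarrow> real^'n) \<Rightarrow> bool" where
  "admissible M F \<theta> T t \<xi> \<eta> \<longleftrightarrow>
     progressive F t T \<xi> \<and> predictable F t T \<eta> \<and>
     (AE \<omega> in M. \<forall>s\<in>{t..<T}. \<forall>i. set_integrable lborel {t..s} (\<lambda>r. \<xi> r \<omega> $ i)) \<and>
     (\<integral>\<^sup>+ \<omega>. (\<integral>\<^sup>+ s. indicator {t..<T} s * ennreal (norm (\<xi> s \<omega>) ^ 4) \<partial>lborel) \<partial>M) < \<infinity> \<and>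
     (\<integral>\<^sup>+ \<omega>. (\<integral>\<^sup>+ s. indicator {t..<T} s * ennreal (norm (\<eta> s \<omega>) ^ 8) \<partial>lborel) \<partial>M) < \<infinity> \<and>
     (\<forall>i. \<theta> i = 0 \<longrightarrow> (\<forall>s\<in>{t..<T}. \<forall>\<omega>\<in>space M. \<eta> s \<omega> $ i = 0))"

definition cost ::
  "'w measure \<Rightarrow> (real \<Rightarrow> 'w \<Rightarrow> real^'n) \<Rightarrow> real \<Rightarrow> real^'n^'n \<Rightarrow> real^'n^'n \<Rightarrow> real \<Rightarrow> real
     \<Rightarrow> real \<Rightarrow> real^'n \<Rightarrow> (real \<Rightarrow> 'w \<Rightarrow> real^'n) \<Rightarrow> (real \<Rightarrow> 'w \<Rightarrow> real^'n) \<Rightarrow> ennreal" where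
  "cost M \<pi> \<alpha> \<Lambda> \<Sigma> T l t x \<xi> \<eta> =
     (\<integral>\<^sup>+ \<omega>. (\<integral>\<^sup>+ s. indicator {t..<T} s *
          ennreal (\<xi> s \<omega> \<bullet> (\<Lambda> *v \<xi> s \<omega>)
                   + \<alpha> * (position \<pi> x t \<xi> \<eta> s \<omega> \<bullet> (\<Sigma> *v position \<pi> x t \<xi> \<eta> s \<omega>))) \<partial>lborel)
        + ennreal (l * (terminal_position \<pi> x t T \<xi> \<eta> \<omega> \<bullet> terminal_position \<pi> x t T \<xi> \<eta> \<omega>)) \<partial>M)"

end

theory Submission
  imports Defs
begin

text \<open>Pathwise, a position is an absolutely continuous path with finitely many jumps, so $X \cdot C(s) X$ obeys an
  elementary chain rule along it. Jumps of a Poisson process integrated against a predictable integrand have the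
  expectation of $\theta_i$ times the time integral, because the increments are independent of the past. Taking
  expectations, inserting the Riccati equation and completing squares, the cost of an admissible strategy equals
  $x \cdot C(t) x$ plus the expected time integral of a nonnegative expression, the gap, that vanishes exactly for the
  feedback strategy. This gives the lower bound and reduces optimality to attaining gap $0$. The closed-loop equation is
  solved path by path: the fundamental matrix of its drift reduces it to a pure jump equation, which is an explicit
  recursion over the jump times. The solution is bounded, hence admissible, since $e^{-\theta s} X \cdot C(s) X$ does
  not increase along it.\<close>

subsection \<open>Symmetric matrices\<close>

text \<open>The quotients by the diagonal of C make sense only while C is positive, and neither
  symmetry nor positivity of the solution is assumed. Both are derived from the equation, backwards
  from C(T) = l I, where l > l0 \<ge> 0. Trades enter X through jump sums. The square of such a sum
  is dominated by a sum of fourth powers of \<eta> and an exponential of the number of jumps; this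
  reduces second moments of X to means of plain jump sums and is where the moment conditions enter.
  The compensation formula needs integrands that are predictable for every outcome, while left
  limits of X are known to exist only off a null set. As the filtration contains all null sets, X
  may be set to 0 on the exceptional set. The same fact makes \<pi>(t) measurable at time t,
  although the filtration lists \<pi>(r) for r < t only. Expectations of the gap are taken in the
  extended nonnegative reals; only the centred jump term has to be integrable as a real
  function.\<close>

lemma sym_mat_inner: "sym_mat A \<Longrightarrow> x \<bullet> (A *v y) = (A *v x) \<bullet> y"
  by (metis dot_lmul_matrix sym_mat_def transpose_matrix_vector)

lemma quadratic_form_add:
  assumes "sym_mat A"
  shows "(u + e *\<^sub>R w) \<bullet> (A *v (u + e *\<^sub>R w)) =
    u \<bullet> (A *v u) + 2 * e * (u \<bullet> (A *v w)) + e\<^sup>2 * (w \<bullet> (A *v w))"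
proof -
  have wu: "w \<bullet> (A *v u) = u \<bullet> (A *v w)" by (metis assms inner_commute sym_mat_inner)
  have "(u + e *\<^sub>R w) \<bullet> (A *v (u + e *\<^sub>R w)) =
      u \<bullet> (A *v u) + e * (w \<bullet> (A *v u)) + (e * (u \<bullet> (A *v w)) + e * (e * (w \<bullet> (A *v w))))"
    by (simp add: matrix_vector_right_distrib matrix_vector_mult_scaleR inner_add_left inner_add_right
        distrib_left)
  then show ?thesis unfolding wu by (simp add: power2_eq_square)
qed

text \<open>The polynomial in \<open>e\<close> has its minimum at 0, so its derivative
  \<open>2 * a\<close> vanishes there. First variations are used in this form, both for eigenvectors
  and for null vectors of a form.\<close>

lemma linear_coeff_zero:
  fixes a b :: real
  assumes "\<And>e. 2 * e * a + e\<^sup>2 * b \<ge> 0"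
  shows "a = 0"
proof -
  \<comment> \<open>Any \<open>k\<close> that is positive and at least \<open>b\<close> works: at
    \<open>e = - a / k\<close> the polynomial is at most \<open>- a\<^sup>2 / k\<close>.\<close>
  define k where "k = \<bar>b\<bar> + 1"
  have k: "k > 0" "b \<le> k" by (auto simp: k_def)
  have "2 * (- a / k) * a + (- a / k)\<^sup>2 * b \<ge> 0" by (rule assms)
  also have "(- a / k)\<^sup>2 * b \<le> (- a / k)\<^sup>2 * k" using k by (intro mult_left_mono) auto
  also have "2 * (- a / k) * a + (- a / k)\<^sup>2 * k = - a\<^sup>2 / k"
    using k by (simp add: field_simps power2_eq_square)
  finally have "a\<^sup>2 / k \<le> 0" by simp
  then have "a\<^sup>2 \<le> 0" using k by (simp add: field_simps)
  then show ?thesis by simp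
qed

text \<open>Variational argument: \<open>v\<close> maximises the Rayleigh quotient on the unit
  sphere of \<open>V\<close>. The first variation in the directions of \<open>V\<close> makes
  \<open>\<mu> v - A v\<close> orthogonal to \<open>V\<close>, and invariance puts it into
  \<open>V\<close>, so it is 0. The subspace is there so that the lemma applies to orthogonal
  complements.\<close>

lemma sym_mat_eigenvector_in_subspace:
  fixes A :: "real^'n^'n"
  assumes A: "sym_mat A" and V: "subspace V" "V \<noteq> {0}" and inv: "\<And>x. x \<in> V \<Longrightarrow> A *v x \<in> V"
  obtains v \<mu> where "v \<in> V" "norm v = 1" "A *v v = \<mu> *\<^sub>R v"
    "\<And>w. w \<in> V \<Longrightarrow> w \<bullet> (A *v w) \<le> \<mu> * (w \<bullet> w)"
proof -
  let ?S = "V \<inter> sphere 0 1"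
  have comp: "compact ?S" using V(1) by (intro closed_Int_compact closed_subspace) auto
  obtain w where w: "w \<in> V" "w \<noteq> 0" using V subspace_0 by blast
  then have "w /\<^sub>R norm w \<in> ?S" using V(1) by (auto simp: subspace_scale)
  then have ne: "?S \<noteq> {}" by blast
  have "continuous_on ?S (\<lambda>x. x \<bullet> (A *v x))"
    by (intro continuous_intros matrix_vector_mult_linear_continuous_on)
  from continuous_attains_sup[OF comp ne this] obtain v where
    v: "v \<in> V" "norm v = 1" and max: "\<And>y. y \<in> ?S \<Longrightarrow> y \<bullet> (A *v y) \<le> v \<bullet> (A *v v)" by auto
  define \<mu> where "\<mu> = v \<bullet> (A *v v)"
  have ub: "w \<bullet> (A *v w) \<le> \<mu> * (w \<bullet> w)" if "w \<in> V" for w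
  proof (cases "w = 0")
    case False
    have "w /\<^sub>R norm w \<in> ?S" using V(1) that False by (auto simp: subspace_scale)
    from max[OF this] have "(w \<bullet> (A *v w)) / (norm w)\<^sup>2 \<le> \<mu>"
      unfolding \<mu>_def
      by (simp add: matrix_vector_mult_scaleR power2_eq_square divide_simps)
    then show ?thesis using False by (simp add: divide_simps power2_norm_eq_inner)
  qed simp
  have "(\<mu> *\<^sub>R v - A *v v) \<bullet> w = 0" if w: "w \<in> V" for w
  proof (rule linear_coeff_zero[where b = "\<mu> * (w \<bullet> w) - w \<bullet> (A *v w)"])
    fix e :: real
    have "v + e *\<^sub>R w \<in> V" using v w V(1) by (simp add: subspace_add subspace_scale)
    from ub[OF this] have "v \<bullet> (A *v v) + 2 * e * (v \<bullet> (A *v w)) + e\<^sup>2 * (w \<bullet> (A *v w))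
        \<le> \<mu> * ((v + e *\<^sub>R w) \<bullet> (v + e *\<^sub>R w))"
      unfolding quadratic_form_add[OF A] .
    moreover have "v \<bullet> v = 1" using v by (simp add: norm_eq_sqrt_inner)
    then have "(v + e *\<^sub>R w) \<bullet> (v + e *\<^sub>R w) = 1 + 2 * e * (v \<bullet> w) + e\<^sup>2 * (w \<bullet> w)"
      by (simp add: inner_add_left inner_add_right inner_commute[of w v] power2_eq_square distrib_left)
    moreover have "(\<mu> *\<^sub>R v - A *v v) \<bullet> w = \<mu> * (v \<bullet> w) - v \<bullet> (A *v w)"
      by (simp add: inner_diff_left sym_mat_inner[OF A])
    ultimately have "\<mu> + 2 * e * (v \<bullet> (A *v w)) + e\<^sup>2 * (w \<bullet> (A *v w))
        \<le> \<mu> * (1 + 2 * e * (v \<bullet> w) + e\<^sup>2 * (w \<bullet> w))"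
      and eq: "(\<mu> *\<^sub>R v - A *v v) \<bullet> w = \<mu> * (v \<bullet> w) - v \<bullet> (A *v w)"
      unfolding \<mu>_def by (simp_all only:)
    then show "2 * e * ((\<mu> *\<^sub>R v - A *v v) \<bullet> w) + e\<^sup>2 * (\<mu> * (w \<bullet> w) - w \<bullet> (A *v w)) \<ge> 0"
      unfolding eq by (simp add: algebra_simps)
  qed
  moreover have "\<mu> *\<^sub>R v - A *v v \<in> V" using v V(1) inv by (simp add: subspace_diff subspace_scale)
  ultimately have "(\<mu> *\<^sub>R v - A *v v) \<bullet> (\<mu> *\<^sub>R v - A *v v) = 0" by blast
  then have "A *v v = \<mu> *\<^sub>R v" by simp
  with v ub that show thesis by blast
qed

text \<open>An orthonormal set of eigenvectors of the largest possible size must span: the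
  orthogonal complement of its span is invariant under \<open>A\<close>, and a nonzero complement
  would contain one more unit eigenvector. Sizes are bounded by the dimension because orthonormal
  sets are independent.\<close>

lemma sym_mat_eigenbasis:
  fixes A :: "real^'n^'n"
  assumes A: "sym_mat A"
  obtains B where "finite B" "pairwise orthogonal B" "\<And>b. b \<in> B \<Longrightarrow> norm b = 1"
    "\<And>b. b \<in> B \<Longrightarrow> \<exists>\<mu>. A *v b = \<mu> *\<^sub>R b" "span B = UNIV"
proof -
  define good where "good B \<longleftrightarrow> finite B \<and> pairwise orthogonal B \<and> (\<forall>b\<in>B. norm b = 1) \<and>
      (\<forall>b\<in>B. \<exists>\<mu>. A *v b = \<mu> *\<^sub>R b)" for B :: "(real^'n) set"
  have card: "card B \<le> DIM(real^'n)" if "good B" for B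
    using that unfolding good_def
    by (intro independent_card_le pairwise_orthogonal_independent) auto
  have "\<exists>B. good B \<and> (\<forall>B'. good B' \<longrightarrow> card B' \<le> card B)"
    by (rule ex_has_greatest_nat[where k = "{}" and b = "Suc (DIM(real^'n))"])
      (use card in \<open>auto simp: good_def less_Suc_eq_le\<close>)
  then obtain B where B: "good B" and mx: "\<And>B'. good B' \<Longrightarrow> card B' \<le> card B" by blast
  have "span B = UNIV"
  proof (rule ccontr)
    assume ns: "span B \<noteq> UNIV"
    let ?V = "orthogonal_comp (span B)"
    have V: "subspace ?V" by (rule subspace_orthogonal_comp)
    have V0: "?V \<noteq> {0}"
      using ns orthogonal_comp_self[OF subspace_span, of B] by (metis orthogonal_comp_null)
    have mem: "x \<in> ?V \<longleftrightarrow> (\<forall>b\<in>B. b \<bullet> x = 0)" for x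
    proof -
      have "(\<forall>b\<in>B. orthogonal x b) \<Longrightarrow> y \<in> span B \<Longrightarrow> orthogonal x y" for y
        by (auto intro: orthogonal_to_span)
      then show ?thesis
        unfolding orthogonal_comp_def
        by (auto simp: orthogonal_def inner_commute intro: span_base)
    qed
    have inv: "A *v x \<in> ?V" if "x \<in> ?V" for x
    proof -
      have "b \<bullet> (A *v x) = 0" if b: "b \<in> B" for b
      proof -
        obtain \<mu> where "A *v b = \<mu> *\<^sub>R b" using B b by (auto simp: good_def)
        then show ?thesis using b \<open>x \<in> ?V\<close> mem by (simp add: sym_mat_inner[OF A])
      qed
      then show ?thesis using mem by blast
    qed
    from sym_mat_eigenvector_in_subspace[OF A V V0 inv] obtain v \<mu> where
      v: "v \<in> ?V" "norm v = 1" "A *v v = \<mu> *\<^sub>R v" by metis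
    have "v \<notin> B" using v mem by (metis norm_eq_zero inner_eq_zero_iff zero_neq_one)
    moreover have "good (insert v B)"
      using B v mem unfolding good_def
      by (auto simp: pairwise_insert orthogonal_def inner_commute)
    ultimately show False using mx[of "insert v B"] B by (auto simp: good_def)
  qed
  with B that show thesis by (auto simp: good_def)
qed

lemma orthonormal_expansion:
  fixes x :: "'a::euclidean_space"
  assumes B: "finite B" "pairwise orthogonal B" "\<And>b. b \<in> B \<Longrightarrow> norm b = 1" "span B = UNIV"
  shows "x = (\<Sum>b\<in>B. (b \<bullet> x) *\<^sub>R b)"
proof -
  let ?d = "x - (\<Sum>b\<in>B. (b \<bullet> x) *\<^sub>R b)"
  have "orthogonal ?d b" if b: "b \<in> B" for b
  proof -
    have "(\<Sum>c\<in>B. (c \<bullet> x) * (c \<bullet> b)) = (\<Sum>c\<in>B. if c = b then b \<bullet> x else 0)"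
    proof (rule sum.cong)
      fix c assume "c \<in> B"
      then show "(c \<bullet> x) * (c \<bullet> b) = (if c = b then b \<bullet> x else 0)"
        using B(2) B(3)[OF b] b by (auto simp: pairwise_def orthogonal_def norm_eq_sqrt_inner)
    qed simp
    also have "\<dots> = b \<bullet> x" using b B(1) by simp
    finally show ?thesis by (simp add: orthogonal_def inner_diff_left inner_sum_left inner_commute[of x])
  qed
  then have "orthogonal ?d ?d" using B(4) by (intro orthogonal_to_span[of ?d B]) auto
  then show ?thesis by (simp add: orthogonal_self)
qed

text \<open>\<open>eig_max\<close> and \<open>eig_min\<close> are \<open>Max\<close> and
  \<open>Min\<close> of a set and mean something only if it is finite and nonempty. An eigenvector
  has a nonzero component along some member of the eigenbasis, which forces its eigenvalue to be the
  one of that member.\<close>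

lemma eigvals_sym_mat:
  fixes A :: "real^'n^'n"
  assumes A: "sym_mat A"
  shows "finite (eigvals A)" "eigvals A \<noteq> {}"
proof -
  obtain B where B: "finite B" "pairwise orthogonal B" "\<And>b. b \<in> B \<Longrightarrow> norm b = 1"
    "\<And>b. b \<in> B \<Longrightarrow> \<exists>\<mu>. A *v b = \<mu> *\<^sub>R b" "span B = UNIV"
    using sym_mat_eigenbasis[OF A] by blast
  obtain \<mu> where \<mu>: "\<And>b. b \<in> B \<Longrightarrow> A *v b = \<mu> b *\<^sub>R b" using B(4) by metis
  have "eigvals A \<subseteq> \<mu> ` B"
  proof
    fix c assume "c \<in> eigvals A"
    then obtain v where v: "v \<noteq> 0" "A *v v = c *\<^sub>R v" by (auto simp: eigvals_def)
    obtain b where b: "b \<in> B" "b \<bullet> v \<noteq> 0"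
    proof -
      have "(\<Sum>b\<in>B. (b \<bullet> v) *\<^sub>R b) \<noteq> 0"
        using orthonormal_expansion[OF B(1,2,3,5), of v] v(1) by simp
      then show thesis using that by (metis (mono_tags, lifting) scale_zero_left sum.neutral)
    qed
    have "c * (b \<bullet> v) = \<mu> b * (b \<bullet> v)"
      using sym_mat_inner[OF A, of b v] v \<mu>[OF b(1)] by simp
    with b show "c \<in> \<mu> ` B" by auto
  qed
  then show "finite (eigvals A)" using B(1) finite_surj by blast
  have "UNIV \<noteq> {0 :: real^'n}" by (metis UNIV_I axis_eq_0_iff singletonD zero_neq_one)
  from sym_mat_eigenvector_in_subspace[OF A subspace_UNIV this] obtain v \<mu>'
    where "norm v = 1" "A *v v = \<mu>' *\<^sub>R v" by (metis UNIV_I)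
  then have "v \<noteq> 0 \<and> A *v v = \<mu>' *\<^sub>R v" by auto
  then show "eigvals A \<noteq> {}" unfolding eigvals_def by blast
qed

lemma eigvals_nonneg_def:
  assumes "nonneg_def A" "c \<in> eigvals A"
  shows "c \<ge> 0"
proof -
  obtain v where v: "v \<noteq> 0" "A *v v = c *\<^sub>R v" using assms by (auto simp: eigvals_def)
  have "v \<bullet> (A *v v) \<ge> 0" using assms by (simp add: nonneg_def_def)
  moreover have "v \<bullet> v > 0" using v by simp
  ultimately show ?thesis using v by (simp add: zero_le_mult_iff)
qed

lemma pos_def_imp_nonneg_def: "pos_def A \<Longrightarrow> nonneg_def A"
  unfolding pos_def_def nonneg_def_def by (metis inner_zero_left less_eq_real_def)

text \<open>A vector at which a nonnegative form vanishes is a minimiser of the form, so the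
  gradient \<open>2 * A v\<close> is zero there.\<close>

lemma nonneg_def_null:
  assumes A: "nonneg_def A" and v: "v \<bullet> (A *v v) = 0"
  shows "A *v v = 0"
proof -
  have "v \<bullet> (A *v w) = 0" for w
  proof (rule linear_coeff_zero[where b = "w \<bullet> (A *v w)"])
    fix e :: real
    have sA: "sym_mat A" and "(v + e *\<^sub>R w) \<bullet> (A *v (v + e *\<^sub>R w)) \<ge> 0"
      using A by (auto simp: nonneg_def_def)
    then show "2 * e * (v \<bullet> (A *v w)) + e\<^sup>2 * (w \<bullet> (A *v w)) \<ge> 0"
      unfolding quadratic_form_add[OF sA] v by simp
  qed
  then have "(A *v v) \<bullet> (A *v v) = 0" using A unfolding nonneg_def_def by (metis sym_mat_inner)
  then show ?thesis by simp
qed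

lemma nonneg_def_Cauchy_Schwarz:
  assumes A: "nonneg_def A"
  shows "(u \<bullet> (A *v v))\<^sup>2 \<le> (u \<bullet> (A *v u)) * (v \<bullet> (A *v v))"
proof (cases "u \<bullet> (A *v u) = 0")
  case True
  then have "A *v u = 0" using A nonneg_def_null by blast
  then have "u \<bullet> (A *v v) = 0" using A by (simp add: nonneg_def_def sym_mat_inner)
  then show ?thesis using True by simp
next
  case False
  define a b c where "a = u \<bullet> (A *v u)" and "b = u \<bullet> (A *v v)" and "c = v \<bullet> (A *v v)"
  have a: "a > 0" using False A by (simp add: a_def nonneg_def_def order_less_le)
  have sA: "sym_mat A" using A by (simp add: nonneg_def_def)
  have vu: "v \<bullet> (A *v u) = b" unfolding b_def by (metis sA inner_commute sym_mat_inner)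
  \<comment> \<open>The coefficient \<open>- (b / a)\<close> minimises the form on the line through
    \<open>v\<close> in direction \<open>u\<close>; the minimum is
    \<open>c - b * b / a\<close>.\<close>
  have "(v + (- (b / a)) *\<^sub>R u) \<bullet> (A *v (v + (- (b / a)) *\<^sub>R u)) \<ge> 0"
    using A unfolding nonneg_def_def by blast
  then have "c - 2 * (b / a) * b + (b / a)\<^sup>2 * a \<ge> 0"
    unfolding quadratic_form_add[OF sA] vu by (simp add: a_def c_def)
  moreover have "(b / a)\<^sup>2 * a = b * b / a" "2 * (b / a) * b = 2 * (b * b / a)"
    using a by (simp_all add: power2_eq_square)
  ultimately have "b * b / a \<le> c" by linarith
  then have "b * b \<le> a * c" using a by (simp add: field_simps)
  then show ?thesis unfolding a_def b_def c_def by (simp add: power2_eq_square)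
qed

section \<open>Inverse and square root of a positive definite matrix\<close>

lemma matrix_inv_inverse:
  assumes "invertible (A :: real^'n^'n)"
  shows "A ** matrix_inv A = mat 1" "matrix_inv A ** A = mat 1"
  using someI_ex[of "\<lambda>A'. A ** A' = mat 1 \<and> A' ** A = mat 1"] assms
  unfolding matrix_inv_def invertible_def by auto

lemma pos_def_invertible:
  assumes "pos_def (A :: real^'n^'n)"
  shows "invertible A"
proof -
  have "\<forall>x. A *v x = 0 \<longrightarrow> x = 0"
    using assms unfolding pos_def_def by (metis inner_zero_right less_irrefl)
  then show ?thesis
    by (metis invertible_def matrix_left_invertible_ker matrix_left_right_inverse)
qed

lemma pos_def_matrix_inv:
  assumes A: "pos_def (A :: real^'n^'n)"
  shows "pos_def (matrix_inv A)"
proof -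
  note inv = matrix_inv_inverse[OF pos_def_invertible[OF A]]
  have symA: "transpose A = A" using A by (simp add: pos_def_def sym_mat_def)
  have "transpose (matrix_inv A) ** A = mat 1"
    by (metis inv(1) matrix_transpose_mul symA transpose_mat)
  then have "transpose (matrix_inv A) = matrix_inv A"
    by (metis inv(1) matrix_mul_assoc matrix_mul_lid matrix_mul_rid)
  moreover have "x \<bullet> (matrix_inv A *v x) > 0" if "x \<noteq> 0" for x
  proof -
    define y where "y = matrix_inv A *v x"
    have x: "x = A *v y" by (simp add: y_def matrix_vector_mul_assoc inv)
    then have "y \<noteq> 0" using that by auto
    then have "y \<bullet> (A *v y) > 0" using A by (simp add: pos_def_def)
    then show ?thesis using x y_def by (metis inner_commute)
  qed
  ultimately show ?thesis by (simp add: pos_def_def sym_mat_def)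
qed

lemma sym_matI:
  assumes "\<And>x y. x \<bullet> (A *v y) = (A *v x) \<bullet> y"
  shows "sym_mat A"
proof -
  have "transpose A *v x = A *v x" for x
    using assms by (metis dot_lmul_matrix inner_commute transpose_matrix_vector vector_eq_rdot)
  then show ?thesis by (simp add: sym_mat_def matrix_eq)
qed

text \<open>On an orthonormal eigenbasis of \<open>A\<close>, let \<open>S\<close> multiply by the
  square roots of the eigenvalues. Writing this map with inner products makes linearity and symmetry
  visible.\<close>

lemma pos_def_sqrt_exists:
  assumes A: "pos_def (A :: real^'n^'n)"
  shows "\<exists>S. nonneg_def S \<and> S ** S = A"
proof -
  have sA: "sym_mat A" using A by (simp add: pos_def_def)
  obtain B where B: "finite B" "pairwise orthogonal B" "\<And>b. b \<in> B \<Longrightarrow> norm b = 1"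
    "\<And>b. b \<in> B \<Longrightarrow> \<exists>\<mu>. A *v b = \<mu> *\<^sub>R b" "span B = UNIV"
    using sym_mat_eigenbasis[OF sA] by blast
  obtain \<mu> where \<mu>: "\<And>b. b \<in> B \<Longrightarrow> A *v b = \<mu> b *\<^sub>R b" using B(4) by metis
  have \<mu>0: "\<mu> b \<ge> 0" if "b \<in> B" for b
  proof (rule eigvals_nonneg_def[OF pos_def_imp_nonneg_def[OF A]])
    have "b \<noteq> 0" using B(3)[OF that] by auto
    then show "\<mu> b \<in> eigvals A" using \<mu>[OF that] by (auto simp: eigvals_def)
  qed
  define f where "f x = (\<Sum>b\<in>B. (sqrt (\<mu> b) * (b \<bullet> x)) *\<^sub>R b)" for x
  define S where "S = matrix f"
  have "linear f"
    unfolding f_def by (intro linearI)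
      (simp_all add: inner_add_right scaleR_sum_right algebra_simps sum.distrib)
  then have S: "S *v x = f x" for x by (simp add: S_def matrix_works)
  have bf: "b \<bullet> f x = sqrt (\<mu> b) * (b \<bullet> x)" if b: "b \<in> B" for b x
  proof -
    have "b \<bullet> f x = (\<Sum>c\<in>B. if c = b then sqrt (\<mu> b) * (b \<bullet> x) else 0)"
      unfolding f_def inner_sum_right
      using B(2) B(3)[OF b] b
      by (intro sum.cong) (auto simp: pairwise_def orthogonal_def norm_eq_sqrt_inner inner_commute)
    then show ?thesis using b B(1) by simp
  qed
  have "x \<bullet> (S *v y) = (S *v x) \<bullet> y" for x y
    unfolding S f_def by (simp add: inner_sum_left inner_sum_right inner_commute mult_ac)
  moreover have "x \<bullet> (S *v x) \<ge> 0" for x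
  proof -
    have "x \<bullet> (S *v x) = (\<Sum>b\<in>B. sqrt (\<mu> b) * (b \<bullet> x)\<^sup>2)"
      unfolding S f_def by (simp add: inner_sum_right inner_commute power2_eq_square mult_ac)
    then show ?thesis using \<mu>0 by (auto intro!: sum_nonneg)
  qed
  moreover have "S ** S = A"
  proof -
    have "S *v (S *v x) = A *v x" for x
    proof -
      have "S *v (S *v x) = (\<Sum>b\<in>B. (\<mu> b * (b \<bullet> x)) *\<^sub>R b)"
        unfolding S f_def[of "f x"]
        using \<mu>0 by (intro sum.cong) (auto simp: bf simp flip: mult.assoc)
      also have "\<dots> = (\<Sum>b\<in>B. (b \<bullet> x) *\<^sub>R (A *v b))"
        using \<mu> by (intro sum.cong) (auto simp: mult.commute)
      also have "\<dots> = A *v (\<Sum>b\<in>B. (b \<bullet> x) *\<^sub>R b)"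
        by (simp add: linear_sum[OF matrix_vector_mul_linear] matrix_vector_mult_scaleR o_def)
      also have "\<dots> = A *v x" using orthonormal_expansion[OF B(1,2,3,5), of x] by simp
      finally show ?thesis .
    qed
    then show ?thesis by (simp add: matrix_eq matrix_vector_mul_assoc)
  qed
  ultimately show ?thesis using sym_matI unfolding nonneg_def_def by blast
qed

text \<open>\<open>mat_sqrt\<close> is a definite description, so it denotes a square root only if
  there is exactly one. For a unit eigenvector \<open>v\<close> of \<open>S - R\<close> with
  eigenvalue \<open>\<mu>\<close>, equal squares give \<open>S v\<close> and \<open>R v\<close> the
  same norm, hence \<open>\<mu> * (v \<bullet> S v + v \<bullet> R v) = 0\<close>. If
  \<open>\<mu> \<noteq> 0\<close>, both forms vanish at \<open>v\<close>, so \<open>S v = 0\<close>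
  and \<open>A v = 0\<close>, against positivity. A symmetric matrix whose only eigenvalue is 0 is
  the zero matrix.\<close>

lemma pos_def_sqrt_unique:
  assumes A: "pos_def (A :: real^'n^'n)"
    and S: "nonneg_def S" "S ** S = A" and R: "nonneg_def R" "R ** R = A"
  shows "S = R"
proof -
  have sS: "sym_mat S" and sR: "sym_mat R" using S R by (auto simp: nonneg_def_def)
  let ?D = "S - R"
  have D: "?D *v x = S *v x - R *v x" for x by (rule matrix_vector_mult_diff_rdistrib)
  have sD: "sym_mat ?D"
    by (rule sym_matI) (simp add: D inner_diff_left inner_diff_right sym_mat_inner[OF sS] sym_mat_inner[OF sR])
  have SR: "S *v (S *v v) = R *v (R *v v)" for v
    by (simp add: matrix_vector_mul_assoc S R)
  have eig0: "\<mu> = 0" if v: "norm v = 1" "?D *v v = \<mu> *\<^sub>R v" for v \<mu>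
  proof (rule ccontr)
    assume "\<mu> \<noteq> 0"
    have Sv: "S *v v = R *v v + \<mu> *\<^sub>R v" using v D[of v] by (simp add: algebra_simps)
    have "v \<bullet> (S *v (S *v v)) = v \<bullet> (R *v (R *v v))" by (simp add: SR)
    then have "(S *v v) \<bullet> (S *v v) = (R *v v) \<bullet> (R *v v)"
      by (simp add: sym_mat_inner[OF sS] sym_mat_inner[OF sR])
    then have "((S *v v) - (R *v v)) \<bullet> ((S *v v) + (R *v v)) = 0"
      by (simp add: inner_simps inner_commute)
    moreover have "(S *v v) - (R *v v) = \<mu> *\<^sub>R v" using Sv by simp
    ultimately have "\<mu> * (v \<bullet> (S *v v) + v \<bullet> (R *v v)) = 0"
      by (simp add: inner_add_right distrib_left)
    then have "v \<bullet> (S *v v) + v \<bullet> (R *v v) = 0" using \<open>\<mu> \<noteq> 0\<close> by simp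
    moreover have "v \<bullet> (S *v v) \<ge> 0" "v \<bullet> (R *v v) \<ge> 0" using S R by (auto simp: nonneg_def_def)
    ultimately have "S *v v = 0" using nonneg_def_null[OF S(1), of v] by (simp add: add_nonneg_eq_0_iff)
    then have "A *v v = 0" using S(2) by (metis matrix_vector_mul_assoc matrix_vector_mult_0_right)
    moreover have "v \<noteq> 0" using v by auto
    ultimately show False using A unfolding pos_def_def by (metis inner_zero_right less_irrefl)
  qed
  obtain B where B: "finite B" "pairwise orthogonal B" "\<And>b. b \<in> B \<Longrightarrow> norm b = 1"
    "\<And>b. b \<in> B \<Longrightarrow> \<exists>\<mu>. ?D *v b = \<mu> *\<^sub>R b" "span B = UNIV"
    using sym_mat_eigenbasis[OF sD] by blast
  have "?D *v b = 0" if b: "b \<in> B" for b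
  proof -
    obtain \<mu> where \<mu>: "?D *v b = \<mu> *\<^sub>R b" using B(4)[OF b] by blast
    have "\<mu> = 0" by (rule eig0[OF B(3)[OF b] \<mu>])
    then show ?thesis using \<mu> by simp
  qed
  then have "?D *v x = 0" for x
    using linear_eq_0_on_span[OF matrix_vector_mul_linear, of B ?D x] B(5) by auto
  then show ?thesis by (simp add: D matrix_eq)
qed

lemma nonneg_def_mat_sqrt:
  assumes "pos_def (A :: real^'n^'n)"
  shows "nonneg_def (mat_sqrt A)"
proof -
  have "\<exists>!S. nonneg_def S \<and> S ** S = A"
    using pos_def_sqrt_exists[OF assms] pos_def_sqrt_unique[OF assms] by blast
  from theI'[OF this] show ?thesis by (simp add: mat_sqrt_def)
qed

text \<open>The second entry of the maximum is already nonnegative. The sign of the largest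
  eigenvalue of \<open>D_mat\<close> matters, because \<open>sqrt\<close> is an odd function in HOL;
  it follows since \<open>D_mat\<close> is \<open>\<Sigma>\<close> conjugated by a symmetric
  matrix.\<close>

lemma l0_nonneg:
  assumes L: "pos_def \<Lambda>" and S: "nonneg_def \<Sigma>" and "\<alpha> \<ge> 0"
  shows "l0 \<theta> \<alpha> \<Lambda> \<Sigma> \<ge> 0"
proof -
  let ?R = "mat_sqrt (matrix_inv \<Lambda>)"
  have R: "sym_mat ?R"
    using nonneg_def_mat_sqrt[OF pos_def_matrix_inv[OF L]] by (simp add: nonneg_def_def)
  have sS: "sym_mat \<Sigma>" using S by (simp add: nonneg_def_def)
  have D: "x \<bullet> (D_mat \<Lambda> \<Sigma> *v y) = (?R *v x) \<bullet> (\<Sigma> *v (?R *v y))" for x y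
    unfolding D_mat_def matrix_vector_mul_assoc[symmetric] by (rule sym_mat_inner[OF R])
  have nD: "nonneg_def (D_mat \<Lambda> \<Sigma>)"
    unfolding nonneg_def_def
  proof (intro conjI allI sym_matI)
    fix x y
    show "x \<bullet> (D_mat \<Lambda> \<Sigma> *v y) = (D_mat \<Lambda> \<Sigma> *v x) \<bullet> y"
      by (subst inner_commute[of _ y], unfold D, subst sym_mat_inner[OF sS], rule inner_commute)
    show "x \<bullet> (D_mat \<Lambda> \<Sigma> *v x) \<ge> 0" unfolding D using S by (simp add: nonneg_def_def)
  qed
  have sD: "sym_mat (D_mat \<Lambda> \<Sigma>)" and sL: "sym_mat \<Lambda>"
    using nD L by (auto simp: nonneg_def_def pos_def_def)
  have "eig_max (D_mat \<Lambda> \<Sigma>) \<ge> 0"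
    unfolding eig_max_def using eigvals_sym_mat[OF sD] eigvals_nonneg_def[OF nD] by simp
  moreover have "eig_min \<Lambda> \<ge> 0"
    unfolding eig_min_def
    using eigvals_sym_mat[OF sL] eigvals_nonneg_def[OF pos_def_imp_nonneg_def[OF L]] by simp
  ultimately show ?thesis using \<open>\<alpha> \<ge> 0\<close> by (simp add: l0_def Let_def le_max_iff_disj)
qed

subsection \<open>The Riccati equation\<close>

text \<open>\<open>norm\<close> on matrices is the Frobenius norm, and the estimate is
  Cauchy-Schwarz in every row.\<close>

lemma norm_matrix_vector_mult_le: "norm ((A :: real^'n^'m) *v x) \<le> norm A * norm x"
proof -
  have "norm (A *v x) = L2_set (\<lambda>i. \<bar>A $ i \<bullet> x\<bar>) UNIV"
    by (simp add: norm_vec_def matrix_vector_mul_component)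
  also have "\<dots> \<le> L2_set (\<lambda>i. norm (A $ i) * norm x) UNIV"
    by (intro L2_set_mono) (auto simp: Cauchy_Schwarz_ineq2)
  also have "\<dots> = L2_set (\<lambda>i. norm (A $ i)) UNIV * norm x"
    by (rule L2_set_left_distrib[symmetric]) simp
  also have "\<dots> = norm A * norm x" by (simp add: norm_vec_def)
  finally show ?thesis .
qed

lemma bounded_bilinear_matrix_vector_mult:
  "bounded_bilinear ((*v) :: real^'n^'m \<Rightarrow> real^'n \<Rightarrow> real^'m)"
proof
  show "\<exists>K. \<forall>(a::real^'n^'m) b. norm (a *v b) \<le> norm a * norm b * K"
    by (intro exI[of _ 1]) (simp add: norm_matrix_vector_mult_le)
qed (auto simp: matrix_vector_mult_add_rdistrib matrix_vector_right_distrib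
    matrix_vector_mult_scaleR scaleR_matrix_vector_assoc)

lemmas continuous_on_matrix_vector_mult [continuous_intros] =
  bounded_bilinear.continuous_on[OF bounded_bilinear_matrix_vector_mult]
lemmas tendsto_matrix_vector_mult [tendsto_intros] =
  bounded_bilinear.tendsto[OF bounded_bilinear_matrix_vector_mult]

lemma quadratic_form_le_norm: "\<bar>x \<bullet> ((A :: real^'n^'n) *v x)\<bar> \<le> norm A * (x \<bullet> x)"
proof -
  have "\<bar>x \<bullet> (A *v x)\<bar> \<le> norm x * norm (A *v x)" by (rule Cauchy_Schwarz_ineq2)
  also have "\<dots> \<le> norm x * (norm A * norm x)"
    by (intro mult_left_mono norm_matrix_vector_mult_le) simp
  finally show ?thesis by (simp add: dot_square_norm power2_eq_square mult_ac)
qed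

lemma diag_mat_vector_mult: "diag_mat d *v x = (\<chi> i. d i * x $ i)"
  by (simp add: diag_mat_def matrix_vector_mult_def vec_eq_iff if_distrib if_distribR sum.delta cong: if_cong)

lemma transpose_diag_mat: "transpose (diag_mat d) = diag_mat d"
  by (simp add: diag_mat_def transpose_def vec_eq_iff)

locale riccati =
  fixes \<theta> :: "'n::finite \<Rightarrow> real" and \<alpha> T l :: real and \<Lambda> \<Sigma> :: "real^'n^'n"
    and C :: "real \<Rightarrow> real^'n^'n"
  assumes \<theta>_nonneg: "\<And>i. \<theta> i \<ge> 0" and \<alpha>_nonneg: "\<alpha> \<ge> 0"
    and \<Lambda>_pos: "pos_def \<Lambda>" and \<Sigma>_nonneg: "nonneg_def \<Sigma>" and l_pos: "l > 0"
    and riccati: "riccati_sol \<theta> \<alpha> \<Lambda> \<Sigma> T l C"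
begin

definition C' :: "real \<Rightarrow> real^'n^'n" where
  "C' s = transpose (C s) ** matrix_inv \<Lambda> ** C s + transpose (C s) ** Ctilde \<theta> (C s) ** C s - \<alpha> *\<^sub>R \<Sigma>"

lemma C_T: "C T = l *\<^sub>R mat 1"
  using riccati by (simp add: riccati_sol_def)

lemma C_deriv: "s \<le> T \<Longrightarrow> (C has_vector_derivative C' s) (at s within {..T})"
  using riccati by (simp add: riccati_sol_def C'_def)

lemma C_continuous: "continuous_on {..T} C"
  by (meson C_deriv atMost_iff continuous_on_eq_continuous_within has_vector_derivative_continuous)

text \<open>Every term of the right-hand side is symmetric whatever \<open>C\<close> is, because the
  equation contains \<open>transpose (C s)\<close>. So \<open>C - transpose C\<close> has derivative
  0, and it vanishes at \<open>T\<close>.\<close>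

lemma C_sym: "s \<le> T \<Longrightarrow> sym_mat (C s)"
proof -
  assume s: "s \<le> T"
  have inv: "transpose (matrix_inv \<Lambda>) = matrix_inv \<Lambda>"
    using pos_def_matrix_inv[OF \<Lambda>_pos] by (simp add: pos_def_def sym_mat_def)
  have \<Sigma>: "transpose \<Sigma> = \<Sigma>" using \<Sigma>_nonneg by (simp add: nonneg_def_def sym_mat_def)
  have bl: "bounded_linear (transpose :: real^'n^'n \<Rightarrow> real^'n^'n)"
    by (intro linear_conv_bounded_linear[THEN iffD1] linearI)
      (simp_all add: transpose_def vec_eq_iff)
  have tr: "transpose (A + B) = transpose A + transpose B" "transpose (A - B) = transpose A - transpose B"
    "transpose (c *\<^sub>R A) = c *\<^sub>R transpose A" for A B :: "real^'n^'n" and c :: real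
    by (simp_all add: transpose_def vec_eq_iff)
  have C': "transpose (C' r) = C' r" for r
    unfolding C'_def Ctilde_def
    by (simp add: tr matrix_transpose_mul inv \<Sigma> transpose_diag_mat matrix_mul_assoc)
  have "((\<lambda>s. C s - transpose (C s)) has_vector_derivative 0) (at r within {..T})" if "r \<in> {..T}" for r
  proof -
    have "((\<lambda>s. C s - transpose (C s)) has_vector_derivative (C' r - transpose (C' r))) (at r within {..T})"
      using that by (intro has_vector_derivative_diff bounded_linear.has_vector_derivative[OF bl] C_deriv) auto
    then show ?thesis by (simp add: C')
  qed
  then obtain c where c: "\<And>r. r \<in> {..T} \<Longrightarrow> C r - transpose (C r) = c"
    using has_vector_derivative_zero_constant[OF convex_real_interval(2)] by blast
  have "c = 0" using c[of T] by (simp add: C_T tr transpose_mat)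
  with c[of s] s show ?thesis by (simp add: sym_mat_def)
qed

lemma C'_quadratic:
  assumes "s \<le> T"
  shows "v \<bullet> (C' s *v v) = (C s *v v) \<bullet> (matrix_inv \<Lambda> *v (C s *v v))
     + (\<Sum>i\<in>UNIV. \<theta> i * ((C s *v v) $ i)\<^sup>2 / C s $ i $ i) - \<alpha> * (v \<bullet> (\<Sigma> *v v))"
proof -
  have tr: "transpose (C s) = C s" using C_sym[OF assms] by (simp add: sym_mat_def)
  have 1: "v \<bullet> ((C s ** A ** C s) *v v) = (C s *v v) \<bullet> (A *v (C s *v v))" for A
    unfolding matrix_vector_mul_assoc[symmetric] by (rule sym_mat_inner[OF C_sym[OF assms]])
  have "(C s *v v) \<bullet> (Ctilde \<theta> (C s) *v (C s *v v)) = (\<Sum>i\<in>UNIV. \<theta> i * ((C s *v v) $ i)\<^sup>2 / C s $ i $ i)"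
    unfolding Ctilde_def diag_mat_vector_mult by (simp add: inner_vec_def power2_eq_square mult_ac)
  then show ?thesis
    unfolding C'_def tr
    by (simp add: matrix_vector_mult_add_rdistrib matrix_vector_mult_diff_rdistrib inner_add_right
        inner_diff_right 1 flip: scaleR_matrix_vector_assoc)
qed

lemma C_entry: "C s $ i $ j = axis i 1 \<bullet> (C s *v axis j 1)"
  by (simp add: inner_axis' matrix_vector_mul_component inner_axis)

lemma quadratic_deriv:
  "s \<le> T \<Longrightarrow> ((\<lambda>s. v \<bullet> (C s *v v)) has_vector_derivative (v \<bullet> (C' s *v v))) (at s within {..T})"
  by (intro bounded_linear.has_vector_derivative[OF bounded_linear_inner_right]
      bounded_linear.has_vector_derivative[OF bounded_bilinear.bounded_linear_left[OF bounded_bilinear_matrix_vector_mult]]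
      C_deriv)

section \<open>Positive definiteness of the Riccati solution\<close>

text \<open>While $C$ is nonnegative definite, Cauchy--Schwarz for the form $C$ bounds the quadratic right-hand side
  linearly, so that going backwards in time $v \cdot C v$ decays at most exponentially.\<close>

lemma jump_term_le:
  assumes "nonneg_def (C s)" "s \<le> T"
  shows "(\<Sum>i\<in>UNIV. \<theta> i * ((C s *v v) $ i)\<^sup>2 / C s $ i $ i) \<le> (\<Sum>i\<in>UNIV. \<theta> i) * (v \<bullet> (C s *v v))"
proof -
  have "\<theta> i * ((C s *v v) $ i)\<^sup>2 / C s $ i $ i \<le> \<theta> i * (v \<bullet> (C s *v v))" for i
  proof -
    have "((C s *v v) $ i)\<^sup>2 \<le> C s $ i $ i * (v \<bullet> (C s *v v))"
      using nonneg_def_Cauchy_Schwarz[OF assms(1), of "axis i 1" v] by (simp add: C_entry inner_axis')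
    moreover have "C s $ i $ i \<ge> 0" "v \<bullet> (C s *v v) \<ge> 0"
      using assms by (auto simp: C_entry nonneg_def_def)
    \<comment> \<open>Only nonnegativity of \<open>C\<close> is available here, so the diagonal
      entry may be 0; the quotient is then 0 by the convention for division.\<close>
    ultimately have "((C s *v v) $ i)\<^sup>2 / C s $ i $ i \<le> v \<bullet> (C s *v v)"
      by (cases "C s $ i $ i = 0") (auto simp: divide_le_eq mult.commute)
    then show ?thesis using \<theta>_nonneg[of i] by (metis mult_left_mono times_divide_eq_right)
  qed
  then show ?thesis by (simp add: sum_distrib_right sum_mono)
qed

lemma C_norm_bound:
  obtains K where "K > 0" "\<And>s. s \<in> {a..T} \<Longrightarrow> norm (C s) \<le> K"
proof -
  have "bounded (C ` {a..T})"
    by (intro compact_imp_bounded compact_continuous_image continuous_on_subset[OF C_continuous]) auto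
  then obtain K where "K > 0" "\<forall>y\<in>C ` {a..T}. norm y \<le> K" using bounded_pos by blast
  with that show thesis by blast
qed

text \<open>Continuation backwards from \<open>T\<close>, where \<open>C\<close> is \<open>l\<close>
  times the identity. As long as \<open>C\<close> is nonnegative definite, its form is at least
  \<open>l * exp (- k * (T - s))\<close> times the square norm. At the earliest time
  \<open>s0\<close> down to which nonnegativity holds the form is therefore still strictly positive,
  and by continuity it stays nonnegative a little further to the left, unless
  \<open>s0 = a\<close>.\<close>

lemma C_lower_bound:
  assumes "a \<le> T"
  obtains m where "m > 0" "\<And>s v. s \<in> {a..T} \<Longrightarrow> m * (v \<bullet> v) \<le> v \<bullet> (C s *v v)"
proof -
  obtain K where K: "K > 0" "\<And>s. s \<in> {a..T} \<Longrightarrow> norm (C s) \<le> K" using C_norm_bound[of a] by blast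
  define \<Theta> where "\<Theta> = (\<Sum>i\<in>UNIV. \<theta> i)"
  \<comment> \<open>The linear growth rate of the form: the term with the inverse of
    \<open>\<Lambda>\<close> contributes its norm times \<open>K\<close>, the jump term contributes
    the total intensity.\<close>
  define k where "k = norm (matrix_inv \<Lambda>) * K + \<Theta>"
  have deriv_le: "v \<bullet> (C' s *v v) \<le> k * (v \<bullet> (C s *v v))" if s: "s \<in> {a..T}" and nn: "nonneg_def (C s)" for s v
  proof -
    define u where "u = C s *v v"
    have vCv: "v \<bullet> (C s *v v) \<ge> 0" using nn by (simp add: nonneg_def_def)
    have sym: "sym_mat (C s)" using nn by (simp add: nonneg_def_def)
    \<comment> \<open>Cauchy-Schwarz for the form \<open>C s\<close> gives \<open>(u \<bullet>
      u)\<^sup>2 \<le> K * (u \<bullet> u) * (v \<bullet> (C s *v v))\<close> for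
      \<open>u = C s *v v\<close>. Dividing by \<open>u \<bullet> u\<close> bounds a term quadratic
      in \<open>u\<close> by the form itself.\<close>
    have "(u \<bullet> u)\<^sup>2 \<le> (u \<bullet> (C s *v u)) * (v \<bullet> (C s *v v))"
      using nonneg_def_Cauchy_Schwarz[OF nn, of u v] by (simp add: u_def)
    also have "u \<bullet> (C s *v u) \<le> K * (u \<bullet> u)"
      using quadratic_form_le_norm[of u "C s"] K(2)[OF s]
      by (smt (verit) inner_ge_zero mult_right_mono)
    finally have "(u \<bullet> u) * (u \<bullet> u) \<le> (K * (v \<bullet> (C s *v v))) * (u \<bullet> u)"
      using vCv by (simp add: power2_eq_square mult_right_mono mult_ac)
    then have uu: "u \<bullet> u \<le> K * (v \<bullet> (C s *v v))"
      using vCv K(1) by (cases "u \<bullet> u = 0") (auto simp: mult_le_cancel_right)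
    have "u \<bullet> (matrix_inv \<Lambda> *v u) \<le> norm (matrix_inv \<Lambda>) * (u \<bullet> u)"
      using quadratic_form_le_norm[of u "matrix_inv \<Lambda>"] by linarith
    also have "\<dots> \<le> norm (matrix_inv \<Lambda>) * (K * (v \<bullet> (C s *v v)))"
      using uu by (intro mult_left_mono) auto
    finally have 1: "u \<bullet> (matrix_inv \<Lambda> *v u) \<le> norm (matrix_inv \<Lambda>) * K * (v \<bullet> (C s *v v))" by simp
    have "\<alpha> * (v \<bullet> (\<Sigma> *v v)) \<ge> 0" using \<alpha>_nonneg \<Sigma>_nonneg by (simp add: nonneg_def_def)
    moreover have "v \<bullet> (C' s *v v) = u \<bullet> (matrix_inv \<Lambda> *v u)
        + (\<Sum>i\<in>UNIV. \<theta> i * (u $ i)\<^sup>2 / C s $ i $ i) - \<alpha> * (v \<bullet> (\<Sigma> *v v))"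
      unfolding u_def using s by (intro C'_quadratic) auto
    moreover have "(\<Sum>i\<in>UNIV. \<theta> i * (u $ i)\<^sup>2 / C s $ i $ i) \<le> \<Theta> * (v \<bullet> (C s *v v))"
      unfolding u_def \<Theta>_def using jump_term_le[OF nn] s by auto
    ultimately show ?thesis using 1 unfolding k_def by (simp add: distrib_right)
  qed
  have decay: "l * exp (- k * (T - s)) * (v \<bullet> v) \<le> v \<bullet> (C s *v v)"
    if s: "s \<in> {a..T}" and nn: "\<And>r. r \<in> {s..T} \<Longrightarrow> nonneg_def (C r)" for s v
  proof -
    define g where "g r = exp (k * (T - r)) * (v \<bullet> (C r *v v))" for r
    have cont: "continuous_on {s..T} g"
      unfolding g_def by (intro continuous_intros continuous_on_subset[OF C_continuous]) auto
    have "\<exists>y. DERIV g r :> y \<and> y \<le> 0" if r: "s < r" "r < T" for r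
    proof -
      have "((\<lambda>r. v \<bullet> (C r *v v)) has_vector_derivative (v \<bullet> (C' r *v v))) (at r within {..T})"
        using r by (intro quadratic_deriv) auto
      moreover have "at r within {..T} = at r" using r by (intro at_within_nhd[of r "{..<T}"]) auto
      ultimately have "((\<lambda>r. v \<bullet> (C r *v v)) has_real_derivative (v \<bullet> (C' r *v v))) (at r)"
        by (simp add: has_real_derivative_iff_has_vector_derivative)
      then have "(g has_real_derivative (exp (k * (T - r)) * (v \<bullet> (C' r *v v))
          + exp (k * (T - r)) * (- k) * (v \<bullet> (C r *v v)))) (at r)"
        unfolding g_def by (auto intro!: derivative_eq_intros)
      moreover have "exp (k * (T - r)) * (v \<bullet> (C' r *v v))
          + exp (k * (T - r)) * (- k) * (v \<bullet> (C r *v v)) \<le> 0"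
        using deriv_le[of r v] nn[of r] r s by (simp add: mult.assoc)
      ultimately show ?thesis by blast
    qed
    from DERIV_nonpos_imp_decreasing_open[OF _ this cont] have "g T \<le> g s" using s by auto
    then have "l * (v \<bullet> v) \<le> exp (k * (T - s)) * (v \<bullet> (C s *v v))"
      by (simp add: g_def C_T flip: scaleR_matrix_vector_assoc)
    then have "exp (- k * (T - s)) * (l * (v \<bullet> v))
        \<le> exp (- k * (T - s)) * (exp (k * (T - s)) * (v \<bullet> (C s *v v)))"
      by (intro mult_left_mono) auto
    also have "\<dots> = v \<bullet> (C s *v v)" by (simp flip: exp_add mult.assoc)
    finally show ?thesis by (simp add: mult_ac)
  qed
  \<comment> \<open>The times from which nonnegativity holds up to \<open>T\<close>. Nonnegativity
    also holds at the infimum \<open>s0\<close>, since limits of nonnegative forms are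
    nonnegative.\<close>
  define S where "S = {s \<in> {a..T}. \<forall>r\<in>{s..T}. nonneg_def (C r)}"
  have TS: "T \<in> S"
    using assms l_pos C_sym[of T] unfolding S_def
    by (auto simp: nonneg_def_def C_T simp flip: scaleR_matrix_vector_assoc)
  define s0 where "s0 = Inf S"
  have bdd: "bdd_below S" by (auto simp: S_def bdd_below_def)
  have Sa: "\<And>s. s \<in> S \<Longrightarrow> a \<le> s" by (simp add: S_def)
  have s0: "a \<le> s0" "s0 \<le> T"
    unfolding s0_def using TS bdd by (blast intro: cInf_greatest[OF _ Sa] cInf_lower)+
  have above: "nonneg_def (C r)" if "s0 < r" "r \<le> T" for r
  proof -
    have "\<exists>s\<in>S. s < r" using that(1) TS bdd cInf_less_iff[of S r] unfolding s0_def by blast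
    then obtain s where "s \<in> S" "s < r" by blast
    then show ?thesis using that by (auto simp: S_def)
  qed
  have "nonneg_def (C s0)"
  proof (cases "s0 = T")
    case True then show ?thesis using TS by (auto simp: S_def)
  next
    case False
    then have lt: "s0 < T" using s0 by simp
    have "v \<bullet> (C s0 *v v) \<ge> 0" for v
    proof (rule tendsto_lowerbound)
      have "continuous_on {..T} (\<lambda>s. v \<bullet> (C s *v v))" by (intro continuous_intros C_continuous)
      then have "((\<lambda>s. v \<bullet> (C s *v v)) \<longlongrightarrow> v \<bullet> (C s0 *v v)) (at s0 within {..T})"
        using s0 by (auto simp: continuous_on_def)
      then show "((\<lambda>s. v \<bullet> (C s *v v)) \<longlongrightarrow> v \<bullet> (C s0 *v v)) (at s0 within {s0..T})"
        by (rule tendsto_within_subset) auto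
      show "\<forall>\<^sub>F s in at s0 within {s0..T}. v \<bullet> (C s *v v) \<ge> 0"
        using above unfolding eventually_at_filter by (auto simp: nonneg_def_def intro!: always_eventually)
      show "at s0 within {s0..T} \<noteq> bot" using lt by (simp add: at_within_Icc_at_right trivial_limit_at_right_real)
    qed
    then show ?thesis using C_sym[OF s0(2)] by (simp add: nonneg_def_def)
  qed
  then have s0S: "nonneg_def (C r)" if "r \<in> {s0..T}" for r
    using above[of r] that by (cases "r = s0") auto
  have "s0 = a"
  proof (rule ccontr)
    assume "s0 \<noteq> a"
    then have as: "a < s0" using s0 by simp
    \<comment> \<open>\<open>e\<close> bounds the form of \<open>C s0\<close> from below on unit
      vectors, so a perturbation of norm at most \<open>e\<close> cannot make the form
      negative.\<close>
    define e where "e = l * exp (- k * (T - s0))"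
    have e: "e > 0" using l_pos by (simp add: e_def)
    have "continuous (at s0 within {..T}) C" using C_continuous s0 by (simp add: continuous_on_eq_continuous_within)
    then obtain d where d: "d > 0" "\<And>r. r \<in> {..T} \<Longrightarrow> dist r s0 < d \<Longrightarrow> dist (C r) (C s0) < e"
      using e unfolding continuous_within_eps_delta by blast
    define s1 where "s1 = max a (s0 - d / 2)"
    have s1: "a \<le> s1" "s1 < s0" "s0 - s1 < d" using as d(1) by (auto simp: s1_def)
    have "nonneg_def (C r)" if r: "r \<in> {s1..T}" for r
    proof (cases "r \<ge> s0")
      case True then show ?thesis using s0S r by auto
    next
      case False
      then have "dist (C r) (C s0) < e" using d(2)[of r] r s1 by (auto simp: dist_real_def)
      then have n: "norm (C r - C s0) \<le> e" by (simp add: dist_norm)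
      have "v \<bullet> (C r *v v) \<ge> 0" for v
      proof -
        have "\<bar>v \<bullet> ((C r - C s0) *v v)\<bar> \<le> norm (C r - C s0) * (v \<bullet> v)" by (rule quadratic_form_le_norm)
        also have "\<dots> \<le> e * (v \<bullet> v)" using n by (intro mult_right_mono) auto
        also have "\<dots> \<le> v \<bullet> (C s0 *v v)" unfolding e_def using s0 s0S by (intro decay) auto
        finally show ?thesis by (simp add: matrix_vector_mult_diff_rdistrib inner_diff_right abs_le_iff)
      qed
      then show ?thesis using C_sym[of r] False s0 by (simp add: nonneg_def_def)
    qed
    then have "s1 \<in> S" using s1 s0 by (auto simp: S_def)
    then have "s0 \<le> s1" unfolding s0_def using bdd by (rule cInf_lower)
    with s1 show False by simp
  qed
  show thesis
  proof (rule that)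
    have k0: "k \<ge> 0" using K \<theta>_nonneg by (auto simp: k_def \<Theta>_def intro!: add_nonneg_nonneg sum_nonneg mult_nonneg_nonneg)
    show "l * exp (- k * (T - a)) > 0" using l_pos by simp
    fix s and v :: "real^'n" assume s: "s \<in> {a..T}"
    have "l * exp (- k * (T - a)) * (v \<bullet> v) \<le> l * exp (- k * (T - s)) * (v \<bullet> v)"
      using l_pos s k0 by (intro mult_right_mono mult_left_mono) (auto simp: mult_left_mono)
    also have "\<dots> \<le> v \<bullet> (C s *v v)" using s s0S \<open>s0 = a\<close> by (intro decay) auto
    finally show "l * exp (- k * (T - a)) * (v \<bullet> v) \<le> v \<bullet> (C s *v v)" .
  qed
qed

lemma C_pos_def: "s \<le> T \<Longrightarrow> pos_def (C s)"
proof -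
  assume s: "s \<le> T"
  obtain m where "m > 0" "\<And>r v. r \<in> {s..T} \<Longrightarrow> m * (v \<bullet> v) \<le> v \<bullet> (C r *v v)"
    using C_lower_bound[OF s] by blast
  then have "v \<bullet> (C s *v v) > 0" if "v \<noteq> 0" for v
    using that s by (metis atLeastAtMost_iff inner_gt_zero_iff less_le_trans mult_pos_pos order_refl)
  then show ?thesis using C_sym[OF s] by (simp add: pos_def_def)
qed

lemma C_diag_pos: "s \<le> T \<Longrightarrow> C s $ i $ i > 0"
  using C_pos_def[of s] by (simp add: C_entry pos_def_def axis_eq_0_iff)

text \<open>The quotients in \<open>Ctilde\<close> are continuous because the diagonal of
  \<open>C\<close> is now known to be positive. The chain rule below is stated for continuously
  differentiable matrix functions.\<close>

lemma C'_continuous: "continuous_on {..T} C'"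
proof -
  have [continuous_intros]: "continuous_on {..T} (\<lambda>s. f s ** g s)"
    if "continuous_on {..T} f" "continuous_on {..T} g" for f g :: "real \<Rightarrow> real^'n^'n"
    unfolding matrix_matrix_mult_def using that
    by (intro continuous_on_vec_lambda continuous_on_sum continuous_on_mult continuous_on_component)
  have [continuous_intros]: "continuous_on {..T} (\<lambda>s. transpose (f s))"
    if "continuous_on {..T} f" for f :: "real \<Rightarrow> real^'n^'n"
    unfolding transpose_def using that
    by (intro continuous_on_vec_lambda continuous_on_component)
  have [continuous_intros]: "continuous_on {..T} (\<lambda>s. Ctilde \<theta> (C s))"
    unfolding Ctilde_def diag_mat_def
  proof (intro continuous_on_vec_lambda)
    fix i j
    show "continuous_on {..T} (\<lambda>s. if i = j then \<theta> i / C s $ i $ i else 0)"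
      using C_diag_pos[of _ i]
      by (cases "i = j") (force intro!: continuous_intros C_continuous)+
  qed
  show ?thesis unfolding C'_def by (intro continuous_intros C_continuous)
qed

end

subsection \<open>Paths with integrable drift and finitely many jumps\<close>

text \<open>Fubini on a square that is split along its diagonal. This is integration by parts for
  absolutely continuous functions in a form free of derivatives, and it is the jump-free case of the
  product rule.\<close>

lemma set_integral_product_triangle:
  fixes f g :: "real \<Rightarrow> real"
  assumes f: "set_integrable lborel {t..s} f" and g: "set_integrable lborel {t..s} g"
  shows "(LINT p:{t..s}|lborel. f p) * (LINT q:{t..s}|lborel. g q)
    = (LINT q:{t..s}|lborel. (LINT p:{t..q}|lborel. f p) * g q)
      + (LINT p:{t..s}|lborel. f p * (LINT q:{t..p}|lborel. g q))"
proof -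
  define \<phi> where "\<phi> p = indicator {t..s} p * f p" for p
  define \<psi> where "\<psi> p = indicator {t..s} p * g p" for p
  have i\<phi>: "integrable lborel \<phi>" and i\<psi>: "integrable lborel \<psi>"
    using f g by (simp_all add: \<phi>_def[abs_def] \<psi>_def[abs_def] set_integrable_def)
  then have [measurable]: "\<phi> \<in> borel_measurable borel" "\<psi> \<in> borel_measurable borel"
    using borel_measurable_integrable by fastforce+
  have K: "integrable (lborel \<Otimes>\<^sub>M lborel) (\<lambda>(p, q). \<phi> p * \<psi> q)"
  proof (rule lborel_pair.Fubini_integrable)
    show "integrable lborel (\<lambda>p. \<integral>q. norm (case (p, q) of (p, q) \<Rightarrow> \<phi> p * \<psi> q) \<partial>lborel)"
      using i\<phi> by (simp add: abs_mult)
  qed (use i\<psi> in auto)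
  \<comment> \<open>One half contains the diagonal and the other does not, so the two kernels add up
    to the product exactly. In the second half the missing diagonal point is restored later as a
    Lebesgue null set.\<close>
  have K1: "integrable (lborel \<Otimes>\<^sub>M lborel) (\<lambda>(p, q). if p \<le> q then \<phi> p * \<psi> q else 0)"
    and K2: "integrable (lborel \<Otimes>\<^sub>M lborel) (\<lambda>(p, q). if q < p then \<phi> p * \<psi> q else 0)"
    by (rule Bochner_Integration.integrable_bound[OF K]; auto)+
  have "(\<integral>p. \<phi> p \<partial>lborel) * (\<integral>q. \<psi> q \<partial>lborel) = (\<integral>z. (\<lambda>(p, q). \<phi> p * \<psi> q) z \<partial>(lborel \<Otimes>\<^sub>M lborel))"
    by (subst lborel_pair.integral_fst'[OF K, symmetric]) simp
  also have "\<dots> = (\<integral>z. (\<lambda>(p, q). if p \<le> q then \<phi> p * \<psi> q else 0) z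
       + (\<lambda>(p, q). if q < p then \<phi> p * \<psi> q else 0) z \<partial>(lborel \<Otimes>\<^sub>M lborel))"
    by (intro Bochner_Integration.integral_cong) auto
  also have "\<dots> = (\<integral>z. (\<lambda>(p, q). if p \<le> q then \<phi> p * \<psi> q else 0) z \<partial>(lborel \<Otimes>\<^sub>M lborel))
       + (\<integral>z. (\<lambda>(p, q). if q < p then \<phi> p * \<psi> q else 0) z \<partial>(lborel \<Otimes>\<^sub>M lborel))"
    by (rule Bochner_Integration.integral_add[OF K1 K2])
  also have "(\<integral>z. (\<lambda>(p, q). if p \<le> q then \<phi> p * \<psi> q else 0) z \<partial>(lborel \<Otimes>\<^sub>M lborel))
     = (\<integral>q. (\<integral>p. (if p \<le> q then \<phi> p * \<psi> q else 0) \<partial>lborel) \<partial>lborel)"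
    using lborel_pair.integral_snd[OF K1] by simp
  also have "\<dots> = (LINT q:{t..s}|lborel. (LINT p:{t..q}|lborel. f p) * g q)"
    unfolding set_lebesgue_integral_def
  proof (rule Bochner_Integration.integral_cong[OF refl])
    fix q
    have "(\<integral>p. (if p \<le> q then \<phi> p * \<psi> q else 0) \<partial>lborel) = (\<integral>p. (indicator {t..q} p * f p) * \<psi> q \<partial>lborel)"
      by (intro Bochner_Integration.integral_cong) (auto simp: \<phi>_def \<psi>_def indicator_def)
    then show "(\<integral>p. (if p \<le> q then \<phi> p * \<psi> q else 0) \<partial>lborel)
       = indicator {t..s} q *\<^sub>R ((\<integral>p. indicator {t..q} p *\<^sub>R f p \<partial>lborel) * g q)"
      by (simp add: \<psi>_def)
  qed
  also have "(\<integral>z. (\<lambda>(p, q). if q < p then \<phi> p * \<psi> q else 0) z \<partial>(lborel \<Otimes>\<^sub>M lborel))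
     = (\<integral>p. (\<integral>q. (if q < p then \<phi> p * \<psi> q else 0) \<partial>lborel) \<partial>lborel)"
    using lborel_pair.integral_fst'[OF K2] by simp
  also have "\<dots> = (LINT p:{t..s}|lborel. f p * (LINT q:{t..p}|lborel. g q))"
    unfolding set_lebesgue_integral_def
  proof (rule Bochner_Integration.integral_cong[OF refl])
    fix p
    have "(\<integral>q. (if q < p then \<phi> p * \<psi> q else 0) \<partial>lborel) = (\<integral>q. \<phi> p * (if p \<in> {t..s} then indicator {t..p} q * g q else 0) \<partial>lborel)"
    proof (rule integral_cong_AE)
      show "AE q in lborel. (if q < p then \<phi> p * \<psi> q else 0) = \<phi> p * (if p \<in> {t..s} then indicator {t..p} q * g q else 0)"
        using AE_lborel_singleton[of p] by eventually_elim (auto simp: \<phi>_def \<psi>_def indicator_def)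
      have eq: "(\<lambda>q. \<phi> p * (if p \<in> {t..s} then indicator {t..p} q * g q else 0))
          = (\<lambda>q. \<phi> p * (indicator {t..p} q * \<psi> q))"
        by (auto simp: \<phi>_def \<psi>_def indicator_def)
      show "(\<lambda>q. \<phi> p * (if p \<in> {t..s} then indicator {t..p} q * g q else 0)) \<in> borel_measurable lborel"
        unfolding eq by measurable
    qed simp
    then show "(\<integral>q. (if q < p then \<phi> p * \<psi> q else 0) \<partial>lborel)
       = indicator {t..s} p *\<^sub>R (f p * (\<integral>q. indicator {t..p} q *\<^sub>R g q \<partial>lborel))"
      by (cases "p \<in> {t..s}") (auto simp: \<phi>_def)
  qed
  finally show ?thesis by (simp add: set_lebesgue_integral_def \<phi>_def \<psi>_def)
qed

lemma continuous_on_set_integral_upper: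
  fixes f :: "real \<Rightarrow> real"
  assumes "set_integrable lborel {t..T} f"
  shows "continuous_on {t..T} (\<lambda>s. LINT r:{t..s}|lborel. f r)"
proof -
  have "f integrable_on {t..T}" using assms set_borel_integral_eq_integral(1) by blast
  then have "continuous_on {t..T} (\<lambda>s. integral {t..s} f)" by (rule indefinite_integral_continuous_1)
  moreover have "(LINT r:{t..s}|lborel. f r) = integral {t..s} f" if "s \<in> {t..T}" for s
    using that by (intro set_borel_integral_eq_integral set_integrable_subset[OF assms]) auto
  ultimately show ?thesis by (subst continuous_on_cong[OF refl]) auto
qed

text \<open>Integral form of "absolutely continuous with density \<open>g\<close>, apart from
  finitely many jumps of size \<open>d r\<close> at \<open>r \<in> J\<close>". Jumps are counted
  from their own time on, so paths are right-continuous; a jump is possible at \<open>T\<close> but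
  not at \<open>t\<close>. Values of \<open>d\<close> off \<open>J\<close> are irrelevant.\<close>

definition jump_path :: "real \<Rightarrow> real \<Rightarrow> real set \<Rightarrow> (real \<Rightarrow> real) \<Rightarrow> (real \<Rightarrow> real) \<Rightarrow> (real \<Rightarrow> real) \<Rightarrow> bool" where
  "jump_path t T J f g d \<longleftrightarrow> t \<le> T \<and> finite J \<and> J \<subseteq> {t<..T} \<and> set_integrable lborel {t..T} g \<and>
     (\<forall>s\<in>{t..T}. f s = f t + (LINT r:{t..s}|lborel. g r) + (\<Sum>r\<in>J \<inter> {..s}. d r))"

lemma jump_pathI:
  assumes "t \<le> T" "finite J" "J \<subseteq> {t<..T}" "set_integrable lborel {t..T} g"
    "\<And>s. s \<in> {t..T} \<Longrightarrow> f s = f t + (LINT r:{t..s}|lborel. g r) + (\<Sum>r\<in>J \<inter> {..s}. d r)"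
  shows "jump_path t T J f g d"
  using assms unfolding jump_path_def by blast

lemma jump_path_props:
  assumes "jump_path t T J f g d"
  shows "t \<le> T" "finite J" "J \<subseteq> {t<..T}" "set_integrable lborel {t..T} g"
  using assms unfolding jump_path_def by blast+

lemma jump_pathD:
  assumes "jump_path t T J f g d" "s \<in> {t..T}"
  shows "f s = f t + (LINT r:{t..s}|lborel. g r) + (\<Sum>r\<in>J \<inter> {..s}. d r)"
    "set_integrable lborel {t..s} g"
proof -
  show "f s = f t + (LINT r:{t..s}|lborel. g r) + (\<Sum>r\<in>J \<inter> {..s}. d r)"
    using assms unfolding jump_path_def by blast
  show "set_integrable lborel {t..s} g"
    using assms(2) by (intro set_integrable_subset[OF jump_path_props(4)[OF assms(1)]]) auto
qed

text \<open>A jump path is a continuous function plus finitely many steps, hence bounded and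
  measurable on \<open>{t..T}\<close>.\<close>

lemma jump_path_mult_integrable:
  assumes f: "jump_path t T J f f' d" and g: "set_integrable lborel {t..T} g"
  shows "set_integrable lborel {t..T} (\<lambda>s. f s * g s)"
proof -
  note fin = jump_path_props(2)[OF f] and int = jump_path_props(4)[OF f]
  define c where "c s = f t + (LINT r:{t..s}|lborel. f' r)" for s
  have c: "continuous_on {t..T} c"
    unfolding c_def by (intro continuous_intros continuous_on_set_integral_upper int)
  have feq: "f s = c s + (\<Sum>r\<in>J. d r * indicator {r..} s)" if "s \<in> {t..T}" for s
  proof -
    have "(\<Sum>r\<in>J \<inter> {..s}. d r) = (\<Sum>r\<in>J. d r * indicator {r..} s)"
      using fin by (intro sum.mono_neutral_cong_left) (auto simp: indicator_def)
    then show ?thesis using jump_pathD(1)[OF f that] by (simp add: c_def)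
  qed
  have "bounded (c ` {t..T})" by (intro compact_imp_bounded compact_continuous_image c compact_Icc)
  then obtain K where K: "\<And>s. s \<in> {t..T} \<Longrightarrow> \<bar>c s\<bar> \<le> K"
    unfolding bounded_iff by (metis image_eqI real_norm_def)
  have [measurable]: "(\<lambda>s. indicator {t..T} s * c s) \<in> borel_measurable borel"
    using borel_measurable_continuous_on_indicator[OF _ c] by simp
  have [measurable]: "(\<lambda>s. indicator {t..T} s * g s) \<in> borel_measurable borel"
    using borel_measurable_integrable[of lborel "\<lambda>s. indicator {t..T} s * g s"] g by (simp add: set_integrable_def)
  have eq: "indicator {t..T} s * (f s * g s) =
      (indicator {t..T} s * c s + (\<Sum>r\<in>J. d r * indicator {r..} s)) * (indicator {t..T} s * g s)" for s
    using feq by (auto simp: indicator_def)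
  have "integrable lborel (\<lambda>s. indicator {t..T} s * (f s * g s))"
  proof (rule Bochner_Integration.integrable_bound)
    show "integrable lborel (\<lambda>s. (K + (\<Sum>r\<in>J. \<bar>d r\<bar>)) * (indicator {t..T} s * g s))"
      using g by (intro integrable_mult_right) (simp add: set_integrable_def)
    show "(\<lambda>s. indicator {t..T} s * (f s * g s)) \<in> borel_measurable lborel"
      unfolding eq by measurable
    show "AE s in lborel. norm (indicator {t..T} s * (f s * g s)) \<le> norm ((K + (\<Sum>r\<in>J. \<bar>d r\<bar>)) * (indicator {t..T} s * g s))"
    proof (intro AE_I2)
      fix s
      show "norm (indicator {t..T} s * (f s * g s)) \<le> norm ((K + (\<Sum>r\<in>J. \<bar>d r\<bar>)) * (indicator {t..T} s * g s))"
      proof (cases "s \<in> {t..T}")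
        case True
        have "\<bar>\<Sum>r\<in>J. d r * indicator {r..} s\<bar> \<le> (\<Sum>r\<in>J. \<bar>d r\<bar>)"
          by (rule order_trans[OF sum_abs sum_mono]) (auto simp: indicator_def)
        then have "\<bar>f s\<bar> \<le> K + (\<Sum>r\<in>J. \<bar>d r\<bar>)" using feq[OF True] K[OF True] by linarith
        then have "\<bar>f s\<bar> * \<bar>g s\<bar> \<le> \<bar>K + (\<Sum>r\<in>J. \<bar>d r\<bar>)\<bar> * \<bar>g s\<bar>" by (intro mult_right_mono) auto
        then show ?thesis using True by (simp add: abs_mult)
      qed simp
    qed
  qed
  then show ?thesis by (simp add: set_integrable_def)
qed

text \<open>At a jump time \<open>f r - d r\<close> and \<open>g r - e r\<close> are the left
  limits, so the last term is the jump of the product. The proof is an induction in which the latest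
  jump is removed from both factors; without jumps the claim is integration by parts.\<close>

lemma jump_path_mult:
  assumes "jump_path t T J f f' d" "jump_path t T J g g' e"
  shows "jump_path t T J (\<lambda>s. f s * g s) (\<lambda>s. f s * g' s + f' s * g s)
    (\<lambda>r. f r * g r - (f r - d r) * (g r - e r))"
proof -
  note props = jump_path_props(1-3)[OF assms(1)]
  have int: "set_integrable lborel {t..T} (\<lambda>s. f s * g' s + f' s * g s)"
    if "jump_path t T J f f' d" "jump_path t T J g g' e" for f g J
    using jump_path_mult_integrable[OF that(1) jump_path_props(4)[OF that(2)]]
      jump_path_mult_integrable[OF that(2) jump_path_props(4)[OF that(1)]]
    by (simp add: mult.commute[of "f' _"])
  have "f s * g s = f t * g t + (LINT r:{t..s}|lborel. f r * g' r + f' r * g r)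
      + (\<Sum>r\<in>J \<inter> {..s}. f r * g r - (f r - d r) * (g r - e r))" if "s \<in> {t..T}" for s
    using props(2) assms that
  proof (induction J arbitrary: f g s rule: finite_linorder_max_induct)
    case empty
    note fs = jump_pathD[OF empty(1)] and gs = jump_pathD[OF empty(2)]
    have s: "s \<in> {t..T}" by fact
    note int = int[OF empty(1,2)]
    have sub: "set_integrable lborel {t..s} h" if "set_integrable lborel {t..T} h" for h :: "real \<Rightarrow> real"
      using s by (intro set_integrable_subset[OF that]) auto
    have i1: "set_integrable lborel {t..s} (\<lambda>q. f q * g' q)"
      and i2: "set_integrable lborel {t..s} (\<lambda>q. f' q * g q)"
      using sub[OF jump_path_mult_integrable[OF empty(1) jump_path_props(4)[OF empty(2)]]]
        sub[OF jump_path_mult_integrable[OF empty(2) jump_path_props(4)[OF empty(1)]]]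
      by (simp_all add: mult.commute)
    note f'i = fs(2)[OF s] and g'i = gs(2)[OF s]
    have "(f s - f t) * (g s - g t) = (LINT p:{t..s}|lborel. f' p) * (LINT q:{t..s}|lborel. g' q)"
      using fs(1)[OF s] gs(1)[OF s] by simp
    also have "\<dots> = (LINT q:{t..s}|lborel. (LINT p:{t..q}|lborel. f' p) * g' q)
      + (LINT p:{t..s}|lborel. f' p * (LINT q:{t..p}|lborel. g' q))"
      by (rule set_integral_product_triangle) (use f'i g'i in auto)
    also have "(LINT q:{t..s}|lborel. (LINT p:{t..q}|lborel. f' p) * g' q) = (LINT q:{t..s}|lborel. f q * g' q - f t * g' q)"
    proof (intro set_lebesgue_integral_cong allI impI)
      fix q assume "q \<in> {t..s}"
      then have "(LINT p:{t..q}|lborel. f' p) = f q - f t" using fs(1)[of q] s by auto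
      then show "(LINT p:{t..q}|lborel. f' p) * g' q = f q * g' q - f t * g' q" by (simp add: left_diff_distrib)
    qed simp
    also have "\<dots> = (LINT q:{t..s}|lborel. f q * g' q) - f t * (g s - g t)"
      using i1 g'i gs(1)[OF s] by (subst set_integral_diff(2)) auto
    also have "(LINT p:{t..s}|lborel. f' p * (LINT q:{t..p}|lborel. g' q)) = (LINT p:{t..s}|lborel. f' p * g p - g t * f' p)"
    proof (intro set_lebesgue_integral_cong allI impI)
      fix q assume "q \<in> {t..s}"
      then have "(LINT p:{t..q}|lborel. g' p) = g q - g t" using gs(1)[of q] s by auto
      then show "f' q * (LINT p:{t..q}|lborel. g' p) = f' q * g q - g t * f' q" by (simp add: right_diff_distrib)
    qed simp
    also have "\<dots> = (LINT p:{t..s}|lborel. f' p * g p) - g t * (f s - f t)"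
      using i2 f'i fs(1)[OF s] by (subst set_integral_diff(2)) auto
    finally have "f s * g s = f t * g t + (LINT q:{t..s}|lborel. f q * g' q) + (LINT p:{t..s}|lborel. f' p * g p)"
      by (simp add: algebra_simps)
    then show ?case using i1 i2 by simp
  next
    case (insert b A)
    have s: "s \<in> {t..T}" by fact
    have b: "b \<in> {t<..T}" using jump_path_props(3)[OF insert.prems(1)] by auto
    \<comment> \<open>\<open>F\<close> and \<open>G\<close> are the paths with the jump at
      \<open>b\<close> undone. Before \<open>b\<close> they agree with \<open>f\<close> and
      \<open>g\<close>; from \<open>b\<close> on they have no jumps, so their increments there are
      plain integrals.\<close>
    define F where "F r = f r - (if b \<le> r then d b else 0)" for r
    define G where "G r = g r - (if b \<le> r then e b else 0)" for r
    have split: "(\<Sum>q\<in>insert b A \<inter> {..r}. k q) = (\<Sum>q\<in>A \<inter> {..r}. k q) + (if b \<le> r then k b else 0)"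
      for r and k :: "real \<Rightarrow> real"
    proof -
      have "b \<notin> A" using insert.hyps by auto
      then show ?thesis using insert.hyps(1) by (auto simp: Int_insert_left)
    qed
    have "jump_path t T A (\<lambda>r. k r - (if b \<le> r then c b else 0)) k' c" if k: "jump_path t T (insert b A) k k' c" for k k' c
    proof -
      have "k r - (if b \<le> r then c b else 0) = (k t - (if b \<le> t then c b else 0))
          + (LINT r:{t..r}|lborel. k' r) + (\<Sum>r\<in>A \<inter> {..r}. c r)" if "r \<in> {t..T}" for r
        using jump_pathD(1)[OF k that] b unfolding split by simp
      then show ?thesis using jump_path_props[OF k] by (intro jump_pathI) auto
    qed
    from this[OF insert.prems(1)] this[OF insert.prems(2)]
    have F: "jump_path t T A F f' d" and G: "jump_path t T A G g' e" unfolding F_def G_def .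
    note IH = insert.IH[OF F G]
    have Ft: "F t = f t" "G t = g t" using b by (auto simp: F_def G_def)
    have FG: "F r * G r - (F r - d r) * (G r - e r) = f r * g r - (f r - d r) * (g r - e r)" if "r \<in> A" for r
      using insert.hyps(2) that by (force simp: F_def G_def)
    have sumFG: "(\<Sum>r\<in>A \<inter> {..s}. F r * G r - (F r - d r) * (G r - e r))
        = (\<Sum>r\<in>A \<inter> {..s}. f r * g r - (f r - d r) * (g r - e r))"
      by (intro sum.cong) (auto simp: FG)
    show ?case
    proof (cases "b \<le> s")
      case False
      have "(LINT r:{t..s}|lborel. f r * g' r + f' r * g r) = (LINT r:{t..s}|lborel. F r * g' r + f' r * G r)"
        using False by (intro set_lebesgue_integral_cong) (auto simp: F_def G_def)
      then show ?thesis using IH[OF s] False Ft sumFG by (simp add: split) (simp add: F_def G_def)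
    next
      case True
      have f'i: "set_integrable lborel {b..s} f'" and g'i: "set_integrable lborel {b..s} g'"
        using b s jump_pathD(2)[OF insert.prems(1) s] jump_pathD(2)[OF insert.prems(2) s]
        by (auto elim!: set_integrable_subset)
      have from_b: "h s = h b + (LINT r:{b..s}|lborel. h' r)"
        if h: "jump_path t T A h h' c" for h h' c
      proof -
        have "h s - h b = (LINT r:{t..s}|lborel. h' r) - (LINT r:{t..b}|lborel. h' r)"
        proof -
          have "A \<inter> {..s} = A" "A \<inter> {..b} = A" using insert.hyps(2) True by force+
          then show ?thesis using jump_pathD(1)[OF h s] jump_pathD(1)[OF h, of b] b by simp
        qed
        moreover have "(LINT r:{t..s}|lborel. h' r) = (LINT r:{t..b}|lborel. h' r) + (LINT r:{b..s}|lborel. h' r)"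
        proof -
          have "{t..s} = {t..b} \<union> {b<..s}" using b True by auto
          moreover have "(LINT r:{t..b} \<union> {b<..s}|lborel. h' r) = (LINT r:{t..b}|lborel. h' r) + (LINT r:{b<..s}|lborel. h' r)"
            using b True s jump_pathD(2)[OF h s]
            by (intro set_integral_Un) (auto elim!: set_integrable_subset)
          moreover have "(LINT r:{b<..s}|lborel. h' r) = (LINT r:{b..s}|lborel. h' r)"
            by (rule set_integral_discrete_difference[of "{b}"]) auto
          ultimately show ?thesis by simp
        qed
        ultimately show ?thesis by simp
      qed
      have i1: "set_integrable lborel {t..s} (\<lambda>r. F r * g' r + f' r * G r)"
        using s by (intro set_integrable_subset[OF int[OF F G]]) auto
      have ib: "set_integrable lborel {b..s} (\<lambda>r. d b * g' r + e b * f' r)"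
        using f'i g'i by auto
      have i2: "set_integrable lborel {t..s} (\<lambda>r. indicator {b..s} r * (d b * g' r + e b * f' r))"
      proof -
        have "(\<lambda>r. indicator {t..s} r *\<^sub>R (indicator {b..s} r * (d b * g' r + e b * f' r)))
            = (\<lambda>r. indicator {b..s} r *\<^sub>R (d b * g' r + e b * f' r))"
          using b by (auto simp: indicator_def)
        then show ?thesis using ib unfolding set_integrable_def by simp
      qed
      have "(LINT r:{t..s}|lborel. f r * g' r + f' r * g r)
         = (LINT r:{t..s}|lborel. (F r * g' r + f' r * G r) + indicator {b..s} r * (d b * g' r + e b * f' r))"
        by (intro set_lebesgue_integral_cong) (auto simp: F_def G_def algebra_simps indicator_def)
      also have "\<dots> = (LINT r:{t..s}|lborel. F r * g' r + f' r * G r)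
          + (LINT r:{t..s}|lborel. indicator {b..s} r * (d b * g' r + e b * f' r))"
        by (rule set_integral_add(2)[OF i1 i2])
      also have "(LINT r:{t..s}|lborel. indicator {b..s} r * (d b * g' r + e b * f' r))
         = (LINT r:{b..s}|lborel. d b * g' r + e b * f' r)"
        unfolding set_lebesgue_integral_def
        using b by (intro Bochner_Integration.integral_cong) (auto simp: indicator_def)
      also have "\<dots> = d b * (G s - G b) + e b * (F s - F b)"
        using f'i g'i from_b[OF F] from_b[OF G] by simp
      finally have I: "(LINT r:{t..s}|lborel. f r * g' r + f' r * g r) =
          (LINT r:{t..s}|lborel. F r * g' r + f' r * G r) + (d b * (G s - G b) + e b * (F s - F b))" .
      have fg: "f s = F s + d b" "g s = G s + e b" "f b = F b + d b" "g b = G b + e b"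
        using True by (auto simp: F_def G_def)
      have "F s * G s = f t * g t + (LINT r:{t..s}|lborel. F r * g' r + f' r * G r)
          + (\<Sum>r\<in>A \<inter> {..s}. f r * g r - (f r - d r) * (g r - e r))"
        using IH[OF s] unfolding sumFG Ft .
      then show ?thesis
        unfolding split I fg using True by (simp add: algebra_simps)
    qed
  qed
  then show ?thesis using int[OF assms] props by (intro jump_pathI)
qed

lemma jump_path_add:
  assumes "jump_path t T J f f' d" "jump_path t T J g g' e"
  shows "jump_path t T J (\<lambda>s. f s + g s) (\<lambda>s. f' s + g' s) (\<lambda>r. d r + e r)"
proof -
  have eq: "f s + g s = f t + g t + (LINT r:{t..s}|lborel. f' r + g' r) + (\<Sum>r\<in>J \<inter> {..s}. d r + e r)"
    if "s \<in> {t..T}" for s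
    using jump_pathD[OF assms(1) that] jump_pathD[OF assms(2) that] by (simp add: sum.distrib)
  show ?thesis
    by (intro jump_pathI[OF jump_path_props(1-3)[OF assms(1)] _ eq] set_integral_add(1)
        jump_path_props(4)[OF assms(1)] jump_path_props(4)[OF assms(2)])
qed

lemma jump_path_zero:
  "t \<le> T \<Longrightarrow> finite J \<Longrightarrow> J \<subseteq> {t<..T} \<Longrightarrow> jump_path t T J (\<lambda>s. 0) (\<lambda>s. 0) (\<lambda>r. 0)"
  by (simp add: jump_path_def set_integrable_def)

lemma jump_path_sum:
  assumes "finite I" "t \<le> T" "finite J" "J \<subseteq> {t<..T}" "\<And>i. i \<in> I \<Longrightarrow> jump_path t T J (f i) (f' i) (d i)"
  shows "jump_path t T J (\<lambda>s. \<Sum>i\<in>I. f i s) (\<lambda>s. \<Sum>i\<in>I. f' i s) (\<lambda>r. \<Sum>i\<in>I. d i r)"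
  using assms by (induction I rule: finite_induct) (auto intro: jump_path_zero jump_path_add)

lemma jump_path_C1:
  assumes "t \<le> T" "finite J" "J \<subseteq> {t<..T}"
    and deriv: "\<And>s. s \<in> {t..T} \<Longrightarrow> (f has_vector_derivative f' s) (at s within {t..T})"
    and cont: "continuous_on {t..T} f'"
  shows "jump_path t T J f f' (\<lambda>r. 0)"
proof -
  have "(LINT r:{t..s}|lborel. f' r) = f s - f t" if "s \<in> {t..T}" for s
    unfolding set_lebesgue_integral_def
    using that cont deriv
    by (intro integral_FTC_Icc)
      (auto intro: has_vector_derivative_within_subset[where S = "{t..T}"] continuous_on_subset)
  then show ?thesis
    using assms borel_integrable_compact[OF compact_Icc cont]
    by (intro jump_pathI) (auto simp: set_integrable_def)
qed

text \<open>The product rule applied to every \<open>B i j * (X i * X j)\<close>, for a path with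
  drift \<open>- \<xi>\<close> and jumps \<open>- h\<close>. \<open>Xm r\<close> is the position
  just before the jump at \<open>r\<close>. Coordinates never jump together, so each jump moves
  \<open>X\<close> along one axis and only a diagonal entry of \<open>B\<close> meets
  \<open>h\<^sup>2\<close>.\<close>

theorem quadratic_form_jump_formula:
  fixes X \<xi> h Xm :: "real \<Rightarrow> real^'n::finite" and B B' :: "real \<Rightarrow> real^'n^'n"
  assumes tT: "t \<le> T" and fin: "\<And>i. finite (J i)" and J: "\<And>i. J i \<subseteq> {t<..T}"
    and disj: "\<And>i j. i \<noteq> j \<Longrightarrow> J i \<inter> J j = {}"
    and \<xi>: "\<And>i. set_integrable lborel {t..T} (\<lambda>r. \<xi> r $ i)"
    and X: "\<And>i s. s \<in> {t..T} \<Longrightarrow> X s $ i = x $ i - (LINT r:{t..s}|lborel. \<xi> r $ i) - (\<Sum>r\<in>J i \<inter> {..s}. h r $ i)"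
    and Xm: "\<And>i r. r \<in> J i \<Longrightarrow> Xm r = X r + h r $ i *\<^sub>R axis i 1"
    and B: "\<And>s. s \<in> {t..T} \<Longrightarrow> (B has_vector_derivative B' s) (at s within {t..T})"
    and B': "continuous_on {t..T} B'" and sym: "\<And>s. s \<in> {t..T} \<Longrightarrow> sym_mat (B s)"
  shows "set_integrable lborel {t..T} (\<lambda>r. X r \<bullet> (B' r *v X r) - 2 * (\<xi> r \<bullet> (B r *v X r)))"
    and "s \<in> {t..T} \<Longrightarrow> X s \<bullet> (B s *v X s) = x \<bullet> (B t *v x)
      + (LINT r:{t..s}|lborel. X r \<bullet> (B' r *v X r) - 2 * (\<xi> r \<bullet> (B r *v X r)))
      + (\<Sum>i\<in>UNIV. \<Sum>r\<in>J i \<inter> {..s}. B r $ i $ i * (h r $ i)\<^sup>2 - 2 * h r $ i * (B r *v Xm r) $ i)"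
proof -
  define JJ where "JJ = (\<Union>i. J i)"
  have JJ: "finite JJ" "JJ \<subseteq> {t<..T}" using fin J by (auto simp: JJ_def)
  \<comment> \<open>\<open>jump_path_mult\<close> wants one jump set for both factors, so the jumps
    of each coordinate are extended by 0 to the union of all jump sets.\<close>
  define d where "d i r = (if r \<in> J i then - h r $ i else 0)" for i r
  have Xt: "X t = x"
  proof -
    have "J i \<inter> {..t} = {}" for i using J[of i] by auto
    moreover have "(LINT r:{t..t}|lborel. \<xi> r $ i) = 0" for i
      using set_integral_discrete_difference[of "{t}" "{t..t}" "{}" lborel "\<lambda>r. \<xi> r $ i"]
      by (simp add: set_lebesgue_integral_def)
    ultimately show ?thesis using X[of t] tT by (simp add: vec_eq_iff)
  qed
  have pX: "jump_path t T JJ (\<lambda>s. X s $ i) (\<lambda>s. - \<xi> s $ i) (d i)" for i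
  proof -
    have "(\<Sum>r\<in>JJ \<inter> {..s}. d i r) = - (\<Sum>r\<in>J i \<inter> {..s}. h r $ i)" for s
      unfolding sum_negf[symmetric] using JJ
      by (intro sum.mono_neutral_cong_right) (auto simp: d_def JJ_def)
    moreover have "(LINT r:{t..s}|lborel. - \<xi> r $ i) = - (LINT r:{t..s}|lborel. \<xi> r $ i)" if "s \<in> {t..T}" for s
      using that by (intro set_integral_uminus set_integrable_subset[OF \<xi>[of i]]) auto
    moreover have "set_integrable lborel {t..T} (\<lambda>s. - \<xi> s $ i)"
      using set_integrable_mult_right[of "-1" lborel "{t..T}" "\<lambda>s. \<xi> s $ i"] \<xi>[of i] by simp
    ultimately show ?thesis using JJ tT X[of _ i] Xt by (intro jump_pathI) auto
  qed
  have pB: "jump_path t T JJ (\<lambda>s. B s $ i $ j) (\<lambda>s. B' s $ i $ j) (\<lambda>r. 0)" for i j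
  proof (rule jump_path_C1[OF tT JJ])
    show "((\<lambda>s. B s $ i $ j) has_vector_derivative B' s $ i $ j) (at s within {t..T})" if "s \<in> {t..T}" for s
      by (intro bounded_linear.has_vector_derivative[OF bounded_linear_vec_nth] B that)
    show "continuous_on {t..T} (\<lambda>s. B' s $ i $ j)"
      by (intro continuous_on_component B')
  qed
  define D where "D r = (\<chi> i. d i r)" for r
  have V: "(\<Sum>i\<in>UNIV. \<Sum>j\<in>UNIV. A $ i $ j * (u $ i * v $ j)) = u \<bullet> (A *v v)" for A :: "real^'n^'n" and u v
    by (simp add: inner_vec_def matrix_vector_mult_def sum_distrib_left mult_ac)
  have p: "jump_path t T JJ (\<lambda>s. \<Sum>i\<in>UNIV. \<Sum>j\<in>UNIV. B s $ i $ j * (X s $ i * X s $ j))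
     (\<lambda>s. \<Sum>i\<in>UNIV. \<Sum>j\<in>UNIV. B s $ i $ j * (X s $ i * - \<xi> s $ j + - \<xi> s $ i * X s $ j) + B' s $ i $ j * (X s $ i * X s $ j))
     (\<lambda>r. \<Sum>i\<in>UNIV. \<Sum>j\<in>UNIV. B r $ i $ j * (X r $ i * X r $ j)
        - (B r $ i $ j - 0) * (X r $ i * X r $ j - (X r $ i * X r $ j - (X r $ i - d i r) * (X r $ j - d j r))))"
    by (intro jump_path_sum finite tT JJ jump_path_mult pB pX)
  have drift: "(\<Sum>i\<in>UNIV. \<Sum>j\<in>UNIV. B s $ i $ j * (X s $ i * - \<xi> s $ j + - \<xi> s $ i * X s $ j) + B' s $ i $ j * (X s $ i * X s $ j))
      = X s \<bullet> (B' s *v X s) - 2 * (\<xi> s \<bullet> (B s *v X s))" if "s \<in> {t..T}" for s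
  proof -
    have "(\<Sum>i\<in>UNIV. \<Sum>j\<in>UNIV. B s $ i $ j * (X s $ i * - \<xi> s $ j + - \<xi> s $ i * X s $ j) + B' s $ i $ j * (X s $ i * X s $ j))
      = X s \<bullet> (B' s *v X s) - X s \<bullet> (B s *v \<xi> s) - \<xi> s \<bullet> (B s *v X s)"
      unfolding V[symmetric] by (simp add: algebra_simps sum.distrib sum_subtractf sum_negf)
    also have "X s \<bullet> (B s *v \<xi> s) = \<xi> s \<bullet> (B s *v X s)" by (metis inner_commute sym sym_mat_inner that)
    finally show ?thesis by simp
  qed
  have jump: "(\<Sum>i\<in>UNIV. \<Sum>j\<in>UNIV. B r $ i $ j * (X r $ i * X r $ j)
        - (B r $ i $ j - 0) * (X r $ i * X r $ j - (X r $ i * X r $ j - (X r $ i - d i r) * (X r $ j - d j r))))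
      = X r \<bullet> (B r *v X r) - (X r - D r) \<bullet> (B r *v (X r - D r))" for r
    unfolding V[symmetric] by (simp add: D_def sum_subtractf)
  have jump1: "X r \<bullet> (B r *v X r) - (X r - D r) \<bullet> (B r *v (X r - D r))
      = B r $ i $ i * (h r $ i)\<^sup>2 - 2 * h r $ i * (B r *v Xm r) $ i" if r: "r \<in> J i" for r i
  proof -
    have "r \<notin> J j" if "j \<noteq> i" for j using disj[OF that] r by auto
    then have Dr: "D r = - (h r $ i) *\<^sub>R axis i 1"
      using r by (auto simp: D_def d_def vec_eq_iff axis_def)
    have rT: "r \<in> {t..T}" using r J[of i] by auto
    have "X r = Xm r + (- (h r $ i)) *\<^sub>R axis i 1" using Xm[OF r] by simp
    moreover have "X r - D r = Xm r" using Dr Xm[OF r] by simp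
    moreover have "Xm r \<bullet> (B r *v axis i 1) = (B r *v Xm r) $ i"
      by (simp add: sym_mat_inner[OF sym[OF rT]] inner_axis)
    moreover have "axis i 1 \<bullet> (B r *v axis i 1) = B r $ i $ i"
      by (simp add: inner_axis' matrix_vector_mul_component inner_axis)
    ultimately show ?thesis
      using quadratic_form_add[OF sym[OF rT], of "Xm r" "- (h r $ i)" "axis i 1"]
      by (simp only:) (simp add: mult_ac)
  qed
  show "set_integrable lborel {t..T} (\<lambda>r. X r \<bullet> (B' r *v X r) - 2 * (\<xi> r \<bullet> (B r *v X r)))"
    by (rule iffD1[OF set_integrable_cong jump_path_props(4)[OF p]]) (rule refl, rule refl, erule drift)
  show "X s \<bullet> (B s *v X s) = x \<bullet> (B t *v x)
      + (LINT r:{t..s}|lborel. X r \<bullet> (B' r *v X r) - 2 * (\<xi> r \<bullet> (B r *v X r)))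
      + (\<Sum>i\<in>UNIV. \<Sum>r\<in>J i \<inter> {..s}. B r $ i $ i * (h r $ i)\<^sup>2 - 2 * h r $ i * (B r *v Xm r) $ i)"
    if s: "s \<in> {t..T}"
  proof -
    have "(LINT r:{t..s}|lborel. (\<Sum>i\<in>UNIV. \<Sum>j\<in>UNIV. B r $ i $ j * (X r $ i * - \<xi> r $ j + - \<xi> r $ i * X r $ j) + B' r $ i $ j * (X r $ i * X r $ j)))
       = (LINT r:{t..s}|lborel. X r \<bullet> (B' r *v X r) - 2 * (\<xi> r \<bullet> (B r *v X r)))"
      using s by (intro set_lebesgue_integral_cong allI impI drift) auto
    moreover have "(\<Sum>r\<in>JJ \<inter> {..s}. X r \<bullet> (B r *v X r) - (X r - D r) \<bullet> (B r *v (X r - D r)))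
       = (\<Sum>i\<in>UNIV. \<Sum>r\<in>J i \<inter> {..s}. B r $ i $ i * (h r $ i)\<^sup>2 - 2 * h r $ i * (B r *v Xm r) $ i)"
    proof -
      have "JJ \<inter> {..s} = (\<Union>i\<in>UNIV. J i \<inter> {..s})" by (auto simp: JJ_def)
      then have "(\<Sum>r\<in>JJ \<inter> {..s}. X r \<bullet> (B r *v X r) - (X r - D r) \<bullet> (B r *v (X r - D r)))
         = (\<Sum>i\<in>UNIV. \<Sum>r\<in>J i \<inter> {..s}. X r \<bullet> (B r *v X r) - (X r - D r) \<bullet> (B r *v (X r - D r)))"
        using fin disj by (simp only:, intro sum.UNION_disjoint) (simp_all, blast)
      also have "\<dots> = (\<Sum>i\<in>UNIV. \<Sum>r\<in>J i \<inter> {..s}. B r $ i $ i * (h r $ i)\<^sup>2 - 2 * h r $ i * (B r *v Xm r) $ i)"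
        by (intro sum.cong refl jump1) auto
      finally show ?thesis .
    qed
    ultimately show ?thesis using jump_pathD(1)[OF p s] unfolding V jump Xt by simp
  qed
qed

subsection \<open>Counting paths\<close>

lemma Nats_diff_less_one:
  fixes x y :: real
  assumes "x \<in> \<nat>" "y \<in> \<nat>" "\<bar>x - y\<bar> < 1"
  shows "x = y"
proof -
  obtain m n where "x = real m" "y = real n" using assms(1,2) by (auto elim!: Nats_cases)
  with assms(3) have "\<bar>int m - int n\<bar> < 1" by linarith
  then show ?thesis using \<open>x = real m\<close> \<open>y = real n\<close> by simp
qed

lemma Nats_less_imp_le:
  fixes x y :: real
  assumes "x \<in> \<nat>" "y \<in> \<nat>" "x < y"
  shows "x + 1 \<le> y"
  using assms Nats_diff_less_one[of x y] by fastforce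

lemma left_lim_eqI:
  fixes f :: "real \<Rightarrow> 'a::t2_space"
  assumes "(f \<longlongrightarrow> L) (at_left t)"
  shows "left_lim f t = L"
  unfolding left_lim_def using assms by (intro tendsto_Lim trivial_limit_at_left_real)

lemma left_lim_eq_const:
  fixes f :: "real \<Rightarrow> 'a::t2_space"
  assumes "u < t" "\<And>r. u < r \<Longrightarrow> r < t \<Longrightarrow> f r = c"
  shows "left_lim f t = c"
proof (rule left_lim_eqI, rule tendsto_eventually)
  show "\<forall>\<^sub>F r in at_left t. f r = c"
    using eventually_at_left_real[OF assms(1)] assms(2) by (auto elim: eventually_mono)
qed

definition counting_path :: "(real \<Rightarrow> real) \<Rightarrow> bool" where
  "counting_path f \<longleftrightarrow> f 0 = 0 \<and> (\<forall>t\<ge>0. f t \<in> \<nat>) \<and> mono_on {0..} f \<and> cadlag_on_nonneg f"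

text \<open>Induction on the integer part of \<open>f b - f a\<close>. The first time
  \<open>\<tau>\<close> at which the path exceeds \<open>f a\<close> is a jump of size at least 1,
  nothing jumps before it, and the increment left over after \<open>\<tau>\<close> is smaller by at
  least 1.\<close>

lemma counting_path_jumps:
  assumes f: "counting_path f" and "0 \<le> a" "a \<le> b"
  shows "finite (jump_times f a b)
    \<and> (\<Sum>r\<in>jump_times f a b. f r - left_lim f r) = f b - f a
    \<and> (\<forall>r\<in>jump_times f a b. f r - left_lim f r \<ge> 1)"
  using assms(2,3)
proof (induction "nat \<lfloor>f b - f a\<rfloor>" arbitrary: a rule: less_induct)
  case less
  have nat: "\<And>r. r \<ge> 0 \<Longrightarrow> f r \<in> \<nat>" and mono: "\<And>r s. 0 \<le> r \<Longrightarrow> r \<le> s \<Longrightarrow> f r \<le> f s"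
    and rc: "\<And>r. r \<ge> 0 \<Longrightarrow> continuous (at_right r) f"
    using f by (auto simp: counting_path_def mono_on_def cadlag_on_nonneg_def)
  show ?case
  proof (cases "f b = f a")
    case True
    have const: "f r = f a" if "a \<le> r" "r \<le> b" for r
      using mono[of a r] mono[of r b] that less.prems True by auto
    have "jump_times f a b = {}"
    proof -
      have "left_lim f r = f a" if "a < r" "r \<le> b" for r
        by (rule left_lim_eq_const[OF that(1)]) (rule const, use that in auto)
      moreover have "f r = f a" if "a < r" "r \<le> b" for r by (rule const) (use that in auto)
      ultimately show ?thesis unfolding jump_times_def by auto
    qed
    with True show ?thesis by simp
  next
    case False
    then have fab: "f a < f b" using mono[of a b] less.prems by auto
    define S where "S = {r\<in>{a..b}. f a < f r}"
    define \<tau> where "\<tau> = Inf S"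
    have bS: "b \<in> S" using fab less.prems by (simp add: S_def)
    have bdd: "bdd_below S" by (auto simp: S_def bdd_below_def)
    have \<tau>le: "\<tau> \<le> r" if "r \<in> S" for r unfolding \<tau>_def using that bdd by (rule cInf_lower)
    have \<tau>: "a \<le> \<tau>" "\<tau> \<le> b"
    proof -
      show "\<tau> \<le> b" by (rule \<tau>le[OF bS])
      show "a \<le> \<tau>" unfolding \<tau>_def using bS by (intro cInf_greatest) (auto simp: S_def)
    qed
    have below: "f r = f a" if "a \<le> r" "r < \<tau>" for r
    proof -
      have "r \<notin> S" using \<tau>le[of r] that by auto
      then have "\<not> f a < f r" using that \<tau> by (auto simp: S_def)
      then show ?thesis using mono[of a r] that less.prems by simp
    qed
    \<comment> \<open>Otherwise right-continuity and integer values would keep the path at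
      \<open>f a\<close> on an interval to the right of \<open>\<tau>\<close>, against the choice of
      \<open>\<tau>\<close> as an infimum.\<close>
    have f\<tau>: "f a < f \<tau>"
    proof (rule ccontr)
      assume "\<not> f a < f \<tau>"
      then have eq: "f \<tau> = f a" using mono[of a \<tau>] \<tau> less.prems by auto
      have "(f \<longlongrightarrow> f \<tau>) (at_right \<tau>)" using rc[of \<tau>] \<tau> less.prems by (auto simp: continuous_within)
      then have "\<forall>\<^sub>F r in at_right \<tau>. dist (f r) (f \<tau>) < 1" by (rule tendstoD) simp
      then obtain u where u: "u > \<tau>" "\<And>r. \<tau> < r \<Longrightarrow> r < u \<Longrightarrow> dist (f r) (f \<tau>) < 1"
        unfolding eventually_at_right_field by blast
      have "u \<le> r" if "r \<in> S" for r
      proof (rule ccontr)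
        assume "\<not> u \<le> r"
        moreover have "r \<noteq> \<tau>" using that eq by (auto simp: S_def)
        ultimately have "dist (f r) (f \<tau>) < 1" using \<tau>le[OF that] u(2)[of r] by simp
        then have "f r = f \<tau>" using \<tau> less.prems that
          by (intro Nats_diff_less_one nat) (auto simp: dist_real_def S_def)
        then show False using that eq by (simp add: S_def)
      qed
      then have "u \<le> \<tau>" unfolding \<tau>_def using bS by (intro cInf_greatest) auto
      with u(1) show False by simp
    qed
    then have a\<tau>: "a < \<tau>" using \<tau> by (cases "a = \<tau>") auto
    have ll: "left_lim f \<tau> = f a" by (rule left_lim_eq_const[OF a\<tau>]) (rule below, auto)
    have "left_lim f r = f r" if "a < r" "r < \<tau>" for r
    proof -
      have "left_lim f r = f a" by (rule left_lim_eq_const[OF that(1)]) (rule below, use that in auto)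
      also have "\<dots> = f r" by (rule below[symmetric]) (use that in auto)
      finally show ?thesis .
    qed
    then have "r \<in> jump_times f a b \<longleftrightarrow> r \<in> insert \<tau> (jump_times f \<tau> b)" for r
      using a\<tau> \<tau> ll f\<tau> unfolding jump_times_def
      by (cases r \<tau> rule: linorder_cases) auto
    then have J: "jump_times f a b = insert \<tau> (jump_times f \<tau> b)" by blast
    have "nat \<lfloor>f b - f \<tau>\<rfloor> < nat \<lfloor>f b - f a\<rfloor>"
      using Nats_less_imp_le[OF nat nat f\<tau>] less.prems \<tau> mono[of \<tau> b] by linarith
    from less.hyps[OF this] \<tau> less.prems
    have IH: "finite (jump_times f \<tau> b)" "(\<Sum>r\<in>jump_times f \<tau> b. f r - left_lim f r) = f b - f \<tau>"
      "\<forall>r\<in>jump_times f \<tau> b. 1 \<le> f r - left_lim f r" by auto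
    have "\<tau> \<notin> jump_times f \<tau> b" by (simp add: jump_times_def)
    then show ?thesis
      using IH ll Nats_less_imp_le[OF nat nat f\<tau>] less.prems \<tau> unfolding J by simp
  qed
qed

text \<open>From the last of the finitely many jumps before \<open>s\<close> on, the path is
  constant. Statements about left limits thereby become statements about values at earlier
  times.\<close>

lemma counting_path_left_lim:
  assumes f: "counting_path f" and "0 < s"
  obtains u where "0 \<le> u" "u < s" "\<And>r. u \<le> r \<Longrightarrow> r < s \<Longrightarrow> f r = left_lim f s"
proof -
  let ?J = "jump_times f 0 s - {s}"
  have fin: "finite ?J" using counting_path_jumps[OF f, of 0 s] assms by auto
  define u where "u = Max (insert 0 ?J)"
  have "u \<in> insert 0 ?J" unfolding u_def using fin by (intro Max_in) auto
  then have u: "0 \<le> u" "u < s" using assms by (auto simp: jump_times_def)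
  have const: "f r = f u" if "u \<le> r" "r < s" for r
  proof -
    have max: "q \<le> u" if "q \<in> ?J" for q unfolding u_def using fin that by (intro Max_ge) auto
    have "False" if "q \<in> jump_times f u r" for q
    proof -
      have "u < q" "q \<le> r" "q \<in> ?J" using that u \<open>r < s\<close> by (auto simp: jump_times_def)
      with max[of q] show False by simp
    qed
    then have "jump_times f u r = {}" by blast
    then show ?thesis using counting_path_jumps[OF f, of u r] that u by auto
  qed
  have "left_lim f s = f u" by (rule left_lim_eq_const[OF u(2)]) (rule const, auto)
  with const show thesis by (intro that[OF u]) metis
qed

lemma counting_path_left_lim_le:
  assumes f: "counting_path f" and "0 \<le> q" "q < s"
  shows "f q \<le> left_lim f s" "left_lim f s \<le> f s" "left_lim f s \<in> \<nat>"
proof -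
  obtain u where u: "0 \<le> u" "u < s" "\<And>r. u \<le> r \<Longrightarrow> r < s \<Longrightarrow> f r = left_lim f s"
    using counting_path_left_lim[OF f, of s] assms by (metis le_less_trans)
  have eq: "f (max u q) = left_lim f s" using u assms by auto
  have mono: "\<And>r s. 0 \<le> r \<Longrightarrow> r \<le> s \<Longrightarrow> f r \<le> f s" using f by (auto simp: counting_path_def mono_on_def)
  show "f q \<le> left_lim f s" "left_lim f s \<le> f s"
    using mono[of q "max u q"] mono[of "max u q" s] u assms unfolding eq by auto
  show "left_lim f s \<in> \<nat>" using f u unfolding eq[symmetric] by (auto simp: counting_path_def)
qed

lemma counting_path_mono: "counting_path f \<Longrightarrow> 0 \<le> r \<Longrightarrow> r \<le> s \<Longrightarrow> f r \<le> f s"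
  by (auto simp: counting_path_def mono_on_def)

subsection \<open>Poisson processes\<close>

lemma partition_index:
  fixes r T :: real
  assumes "0 < r" "r \<le> T" "n > 0"
  obtains k where "k < n" "real k * T / real n < r" "r \<le> real (Suc k) * T / real n"
proof -
  define m where "m = nat \<lceil>r * real n / T\<rceil>"
  have T: "T > 0" using assms by simp
  have pos: "0 < r * real n / T" using assms T by simp
  have m1: "r * real n / T \<le> real m" "real m < r * real n / T + 1"
    unfolding m_def using pos by linarith+
  have "r * real n / T \<le> real n" using assms T by (simp add: divide_le_eq mult.commute)
  then have m: "0 < m" "m \<le> n" unfolding m_def using pos by (auto simp: ceiling_le_iff nat_le_iff)
  then obtain k where k: "m = Suc k" by (cases m) auto
  show thesis
  proof (rule that[of k])
    show "k < n" using m k by simp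
    show "real k * T / real n < r" using m1(2) k T assms by (simp add: field_simps)
    show "r \<le> real (Suc k) * T / real n" using m1(1) k T assms by (simp add: field_simps)
  qed
qed

section \<open>Increments of a Poisson process and the almost sure shape of its jumps\<close>

context prob_space
begin

lemma poisson_process_counting_path:
  "poisson_process \<theta> N \<Longrightarrow> \<omega> \<in> space M \<Longrightarrow> counting_path (\<lambda>t. N t \<omega>)"
  by (auto simp: poisson_process_def counting_path_def)

lemma poisson_process_measurable: "poisson_process \<theta> N \<Longrightarrow> t \<ge> 0 \<Longrightarrow> N t \<in> borel_measurable M"
  by (auto simp: poisson_process_def)

lemma poisson_process_nonneg: "poisson_process \<theta> N \<Longrightarrow> \<theta> \<ge> 0"
  by (auto simp: poisson_process_def)

lemma poisson_process_prob:
  "poisson_process \<theta> N \<Longrightarrow> 0 \<le> s \<Longrightarrow> s \<le> t \<Longrightarrow>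
    prob {\<omega>\<in>space M. N t \<omega> - N s \<omega> = real k} = exp (- (\<theta> * (t - s))) * (\<theta> * (t - s)) ^ k / fact k"
  unfolding poisson_process_def by blast

lemma poisson_increment_Nats:
  assumes N: "poisson_process \<theta> N" and "0 \<le> s" "s \<le> t" "\<omega> \<in> space M"
  obtains k where "N t \<omega> - N s \<omega> = real k"
proof -
  have "counting_path (\<lambda>t. N t \<omega>)" by (rule poisson_process_counting_path[OF N assms(4)])
  then have "N t \<omega> \<in> \<nat>" "N s \<omega> \<in> \<nat>" "N s \<omega> \<le> N t \<omega>"
    using assms by (auto simp: counting_path_def mono_on_def)
  then obtain m n where "N t \<omega> = real m" "N s \<omega> = real n" "n \<le> m" by (auto elim!: Nats_cases)
  with that[of "m - n"] show thesis by (simp add: of_nat_diff)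
qed

lemma poisson_increment_nn_integral:
  assumes N: "poisson_process \<theta> N" and st: "0 \<le> s" "s \<le> t" and g: "\<And>k. g (real k) \<ge> 0"
  shows "(\<integral>\<^sup>+\<omega>. ennreal (g (N t \<omega> - N s \<omega>)) \<partial>M)
    = (\<Sum>k. ennreal (g (real k) * (exp (- (\<theta> * (t - s))) * (\<theta> * (t - s)) ^ k / fact k)))"
proof -
  have [measurable]: "N t \<in> borel_measurable M" "N s \<in> borel_measurable M"
    using st by (intro poisson_process_measurable[OF N]; simp)+
  have "(\<integral>\<^sup>+\<omega>. ennreal (g (N t \<omega> - N s \<omega>)) \<partial>M)
      = (\<integral>\<^sup>+\<omega>. (\<Sum>k. ennreal (g (real k)) * indicator {\<omega>\<in>space M. N t \<omega> - N s \<omega> = real k} \<omega>) \<partial>M)"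
  proof (rule nn_integral_cong)
    fix \<omega> assume \<omega>: "\<omega> \<in> space M"
    obtain k where k: "N t \<omega> - N s \<omega> = real k" using poisson_increment_Nats[OF N st \<omega>] by blast
    have "(\<Sum>j. ennreal (g (real j)) * indicator {\<omega>\<in>space M. N t \<omega> - N s \<omega> = real j} \<omega>)
        = (\<Sum>j\<in>{k}. ennreal (g (real j)) * indicator {\<omega>\<in>space M. N t \<omega> - N s \<omega> = real j} \<omega>)"
      using k by (intro suminf_finite) auto
    then show "ennreal (g (N t \<omega> - N s \<omega>))
        = (\<Sum>k. ennreal (g (real k)) * indicator {\<omega>\<in>space M. N t \<omega> - N s \<omega> = real k} \<omega>)"
      using k \<omega> by simp
  qed
  also have "\<dots> = (\<Sum>k. \<integral>\<^sup>+\<omega>. ennreal (g (real k)) * indicator {\<omega>\<in>space M. N t \<omega> - N s \<omega> = real k} \<omega> \<partial>M)"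
    by (intro nn_integral_suminf) measurable
  also have "\<dots> = (\<Sum>k. ennreal (g (real k) * (exp (- (\<theta> * (t - s))) * (\<theta> * (t - s)) ^ k / fact k)))"
  proof (rule suminf_cong)
    fix k
    have "(\<integral>\<^sup>+\<omega>. ennreal (g (real k)) * indicator {\<omega>\<in>space M. N t \<omega> - N s \<omega> = real k} \<omega> \<partial>M)
       = ennreal (g (real k)) * emeasure M {\<omega>\<in>space M. N t \<omega> - N s \<omega> = real k}"
      by (intro nn_integral_cmult_indicator) measurable
    also have "\<dots> = ennreal (g (real k)) * ennreal (exp (- (\<theta> * (t - s))) * (\<theta> * (t - s)) ^ k / fact k)"
      by (simp add: emeasure_eq_measure poisson_process_prob[OF N st])
    also have "\<dots> = ennreal (g (real k) * (exp (- (\<theta> * (t - s))) * (\<theta> * (t - s)) ^ k / fact k))"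
      using g poisson_process_nonneg[OF N] st by (intro ennreal_mult[symmetric]) auto
    finally show "(\<integral>\<^sup>+\<omega>. ennreal (g (real k)) * indicator {\<omega>\<in>space M. N t \<omega> - N s \<omega> = real k} \<omega> \<partial>M)
      = ennreal (g (real k) * (exp (- (\<theta> * (t - s))) * (\<theta> * (t - s)) ^ k / fact k))" .
  qed
  finally show ?thesis .
qed

text \<open>The factor \<open>k\<close> cancels against \<open>fact k\<close> and leaves an
  exponential series shifted by one index.\<close>

lemma poisson_increment_mean:
  assumes N: "poisson_process \<theta> N" and st: "0 \<le> s" "s \<le> t"
  shows "(\<integral>\<^sup>+\<omega>. ennreal (N t \<omega> - N s \<omega>) \<partial>M) = ennreal (\<theta> * (t - s))"
proof -
  define c where "c = \<theta> * (t - s)"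
  have c: "c \<ge> 0" using poisson_process_nonneg[OF N] st by (simp add: c_def)
  have "(\<lambda>k. c ^ k / fact k) sums exp c"
    using exp_converges[of c] by (simp add: divide_inverse mult.commute)
  then have "(\<lambda>k. exp (- c) * c * (c ^ k / fact k)) sums (exp (- c) * c * exp c)" by (rule sums_mult)
  also have "exp (- c) * c * exp c = c" by (simp add: exp_minus)
  finally have "(\<lambda>k. exp (- c) * c * (c ^ k / fact k)) sums c" .
  moreover have "real (Suc k) * (exp (- c) * c ^ Suc k / fact (Suc k)) = exp (- c) * c * (c ^ k / fact k)" for k
    by (simp add: divide_simps del: of_nat_Suc)
  ultimately have "(\<lambda>k. real (Suc k) * (exp (- c) * c ^ Suc k / fact (Suc k))) sums c" by (simp only:)
  then have "(\<lambda>k. real k * (exp (- c) * c ^ k / fact k)) sums (c + real 0 * (exp (- c) * c ^ 0 / fact 0))"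
    by (rule sums_Suc)
  then have "(\<lambda>k. real k * (exp (- c) * c ^ k / fact k)) sums c" by simp
  then have "(\<Sum>k. ennreal (real k * (exp (- c) * c ^ k / fact k))) = ennreal c"
    using c by (intro suminf_ennreal_eq) auto
  then show ?thesis
    using poisson_increment_nn_integral[OF N st, of "\<lambda>x. x"] by (simp add: c_def)
qed

text \<open>An exponential moment serves all powers of the number of jumps at once; up to a factor
  the series is that of \<open>exp (exp 1 * c)\<close>.\<close>

lemma poisson_increment_exp_moment:
  assumes N: "poisson_process \<theta> N" and st: "0 \<le> s" "s \<le> t"
  shows "(\<integral>\<^sup>+\<omega>. ennreal (exp (N t \<omega> - N s \<omega>)) \<partial>M) < \<infinity>"
proof -
  define c where "c = \<theta> * (t - s)"
  have c: "c \<ge> 0" using poisson_process_nonneg[OF N] st by (simp add: c_def)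
  have "(\<lambda>k. (exp 1 * c) ^ k / fact k) sums exp (exp 1 * c)"
    using exp_converges[of "exp 1 * c"] by (simp add: divide_inverse mult.commute)
  then have "(\<lambda>k. exp (- c) * ((exp 1 * c) ^ k / fact k)) sums (exp (- c) * exp (exp 1 * c))" by (rule sums_mult)
  then have "(\<lambda>k. exp (real k) * (exp (- c) * c ^ k / fact k)) sums (exp (- c) * exp (exp 1 * c))"
    by (simp add: power_mult_distrib mult_ac flip: exp_of_nat_mult)
  then have "(\<Sum>k. ennreal (exp (real k) * (exp (- c) * c ^ k / fact k))) = ennreal (exp (- c) * exp (exp 1 * c))"
    using c by (intro suminf_ennreal_eq) auto
  then show ?thesis
    using poisson_increment_nn_integral[OF N st, of exp] by (simp add: c_def)
qed

lemma poisson_no_jump_prob: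
  assumes N: "poisson_process \<theta> N" and st: "0 \<le> s" "s \<le> t"
  shows "prob {\<omega>\<in>space M. N t \<omega> - N s \<omega> \<noteq> 0} \<le> \<theta> * (t - s)"
proof -
  have [measurable]: "N t \<in> borel_measurable M" "N s \<in> borel_measurable M"
    using st by (intro poisson_process_measurable[OF N]; simp)+
  have "prob {\<omega>\<in>space M. N t \<omega> - N s \<omega> \<noteq> 0} = prob (space M - {\<omega>\<in>space M. N t \<omega> - N s \<omega> = real 0})"
    by (intro arg_cong[of _ _ prob]) auto
  also have "\<dots> = 1 - exp (- (\<theta> * (t - s)))"
    using poisson_process_prob[OF N st, of 0] by (subst prob_compl) auto
  finally show ?thesis using exp_ge_add_one_self[of "- (\<theta> * (t - s))"] by linarith
qed

lemma poisson_two_jumps_prob: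
  assumes N: "poisson_process \<theta> N" and st: "0 \<le> s" "s \<le> t"
  shows "prob {\<omega>\<in>space M. N t \<omega> - N s \<omega> \<ge> 2} \<le> (\<theta> * (t - s))\<^sup>2"
proof -
  have [measurable]: "N t \<in> borel_measurable M" "N s \<in> borel_measurable M"
    using st by (intro poisson_process_measurable[OF N]; simp)+
  define c where "c = \<theta> * (t - s)"
  have c: "c \<ge> 0" using poisson_process_nonneg[OF N] st by (simp add: c_def)
  have "{\<omega>\<in>space M. N t \<omega> - N s \<omega> \<ge> 2} = space M -
      ({\<omega>\<in>space M. N t \<omega> - N s \<omega> = real 0} \<union> {\<omega>\<in>space M. N t \<omega> - N s \<omega> = real 1})" (is "_ = space M - (?A \<union> ?B)")
  proof -
    have "N t \<omega> - N s \<omega> \<ge> 2 \<longleftrightarrow> N t \<omega> - N s \<omega> \<noteq> real 0 \<and> N t \<omega> - N s \<omega> \<noteq> real 1" if \<omega>: "\<omega> \<in> space M" for \<omega>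
    proof -
      obtain k where "N t \<omega> - N s \<omega> = real k" using poisson_increment_Nats[OF N st \<omega>] by blast
      moreover have "real k \<ge> 2 \<longleftrightarrow> k \<noteq> 0 \<and> k \<noteq> 1" by auto
      ultimately show ?thesis by auto
    qed
    then show ?thesis by auto
  qed
  then have "prob {\<omega>\<in>space M. N t \<omega> - N s \<omega> \<ge> 2} = 1 - prob (?A \<union> ?B)"
    by (simp only:) (rule prob_compl, measurable)
  also have "prob (?A \<union> ?B) = prob ?A + prob ?B"
    by (rule finite_measure_Union) auto
  also have "prob ?A = exp (- c)" using poisson_process_prob[OF N st, of 0] by (simp add: c_def)
  also have "prob ?B = exp (- c) * c" using poisson_process_prob[OF N st, of 1] by (simp add: c_def)
  finally have "prob {\<omega>\<in>space M. N t \<omega> - N s \<omega> \<ge> 2} = 1 - exp (- c) * (1 + c)" by (simp add: algebra_simps)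
  \<comment> \<open>The lower bound \<open>1 - c\<close> for \<open>exp (- c)\<close> leaves
    \<open>1 - (1 - c) * (1 + c)\<close>, which is \<open>c\<^sup>2\<close>.\<close>
  moreover have "(1 - c) * (1 + c) \<le> exp (- c) * (1 + c)"
    using exp_ge_add_one_self[of "- c"] c by (intro mult_right_mono) auto
  ultimately show ?thesis unfolding c_def[symmetric] by (simp add: algebra_simps power2_eq_square)
qed

text \<open>For every \<open>n\<close> the bad outcomes are covered by \<open>n\<close> events of
  probability at most \<open>c / n\<^sup>2\<close>, hence by one event of probability at most
  \<open>c / n\<close>. The set of bad outcomes is not assumed measurable; it lies in the null set
  formed by intersecting the covers.\<close>

lemma AE_not_bad_partition:
  assumes E: "\<And>n k. E n k \<in> events" and p: "\<And>n k. n > 0 \<Longrightarrow> k < n \<Longrightarrow> prob (E n k) \<le> c / (real n)\<^sup>2"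
    and bad: "\<And>n \<omega>. \<omega> \<in> space M \<Longrightarrow> bad \<omega> \<Longrightarrow> n > 0 \<Longrightarrow> \<exists>k<n. \<omega> \<in> E n k"
  shows "AE \<omega> in M. \<not> bad \<omega>"
proof -
  define U where "U n = (\<Union>k<Suc n. E (Suc n) k)" for n
  have U: "prob (U n) \<le> c / real (Suc n)" for n
  proof -
    have "prob (U n) \<le> (\<Sum>k<Suc n. prob (E (Suc n) k))"
      unfolding U_def using E by (intro finite_measure_subadditive_finite) auto
    also have "\<dots> \<le> (\<Sum>k<Suc n. c / (real (Suc n))\<^sup>2)" by (intro sum_mono p) auto
    also have "\<dots> = c / real (Suc n)" by (simp add: power2_eq_square)
    finally show ?thesis .
  qed
  have Uev: "U n \<in> events" for n unfolding U_def using E by auto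
  have "prob (\<Inter>n. U n) \<le> c / real (Suc n)" for n
    by (rule order_trans[OF finite_measure_mono U[of n]]) (use Uev in auto)
  moreover have "(\<lambda>n. c / real (Suc n)) \<longlonglongrightarrow> 0"
    using LIMSEQ_inverse_real_of_nat[THEN tendsto_mult_right_zero, of c] by (simp add: divide_inverse)
  ultimately have "prob (\<Inter>n. U n) \<le> 0"
    by (intro LIMSEQ_le_const) auto
  then have "prob (\<Inter>n. U n) = 0" using measure_nonneg[of M "\<Inter>n. U n"] by linarith
  then have null: "(\<Inter>n. U n) \<in> null_sets M" using Uev by (intro null_setsI) (auto simp: emeasure_eq_measure)
  show ?thesis
  proof (rule AE_I'[OF null])
    show "{\<omega> \<in> space M. \<not> \<not> bad \<omega>} \<subseteq> (\<Inter>n. U n)"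
    proof (intro subsetI INT_I)
      fix \<omega> n assume "\<omega> \<in> {\<omega> \<in> space M. \<not> \<not> bad \<omega>}"
      then have "\<exists>k<Suc n. \<omega> \<in> E (Suc n) k" by (intro bad) auto
      then show "\<omega> \<in> U n" by (auto simp: U_def)
    qed
  qed
qed

text \<open>A jump at \<open>s\<close> forces an increment over every interval that ends at
  \<open>s\<close>. The lengths are of order \<open>1 / n\<^sup>2\<close>, so a single event, the
  one with \<open>k = 0\<close>, already meets the bound of \<open>AE_not_bad_partition\<close>;
  \<open>Suc n\<close> keeps the interval within \<open>{0..s}\<close> also for
  \<open>n = 0\<close>.\<close>

lemma poisson_no_jump_at:
  assumes N: "poisson_process \<theta> N" and s: "0 < s"
  shows "AE \<omega> in M. left_lim (\<lambda>q. N q \<omega>) s = N s \<omega>"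
proof -
  define E where "E n k = {\<omega>\<in>space M. k = 0 \<and> N s \<omega> - N (s - s / (real (Suc n))\<^sup>2) \<omega> \<noteq> 0}" for n k :: nat
  have le: "s / (real (Suc n))\<^sup>2 \<le> s" for n
    using s by (simp add: divide_le_eq power2_eq_square mult_ge1_I)
  have [measurable]: "N s \<in> borel_measurable M" "N (s - s / (real (Suc n))\<^sup>2) \<in> borel_measurable M" for n
    using s le[of n] by (intro poisson_process_measurable[OF N]; simp)+
  have "AE \<omega> in M. \<not> (left_lim (\<lambda>q. N q \<omega>) s \<noteq> N s \<omega>)"
  proof (rule AE_not_bad_partition)
    fix n k
    show "E n k \<in> events" unfolding E_def by measurable
    show "\<exists>k<n. \<omega> \<in> E n k" if "\<omega> \<in> space M" "left_lim (\<lambda>q. N q \<omega>) s \<noteq> N s \<omega>" "n > 0" for \<omega>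
    proof -
      have q: "0 \<le> s - s / (real (Suc n))\<^sup>2" "s - s / (real (Suc n))\<^sup>2 < s" using le[of n] s by auto
      note counting_path_left_lim_le[OF poisson_process_counting_path[OF N that(1)] q]
      then show ?thesis using that by (intro exI[of _ 0]) (auto simp: E_def)
    qed
    assume n: "n > 0"
    show "prob (E n k) \<le> \<theta> * s / (real n)\<^sup>2"
    proof (cases "k = 0")
      case True
      then have "prob (E n k) \<le> \<theta> * (s - (s - s / (real (Suc n))\<^sup>2))"
        unfolding E_def using poisson_no_jump_prob[OF N, of "s - s / (real (Suc n))\<^sup>2" s] le[of n] s by simp
      also have "\<dots> = \<theta> * s / (real (Suc n))\<^sup>2" by simp
      also have "\<dots> \<le> \<theta> * s / (real n)\<^sup>2"
        using poisson_process_nonneg[OF N] s n by (intro divide_left_mono power_mono) auto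
      finally show ?thesis .
    next
      case False
      then show ?thesis using poisson_process_nonneg[OF N] s by (simp add: E_def)
    qed
  qed
  then show ?thesis by simp
qed

text \<open>A jump of size 2 or more makes the increment over its grid cell at least 2, which has
  probability at most \<open>(\<theta> * T / n)\<^sup>2\<close>.\<close>

lemma poisson_simple_jumps:
  assumes N: "poisson_process \<theta> N" and T: "0 < T"
  shows "AE \<omega> in M. \<forall>r\<in>{0<..T}. N r \<omega> - left_lim (\<lambda>q. N q \<omega>) r < 2"
proof -
  define E where "E n k = {\<omega>\<in>space M. N (real (Suc k) * T / real n) \<omega> - N (real k * T / real n) \<omega> \<ge> 2}" for n k :: nat
  have "AE \<omega> in M. \<not> (\<exists>r\<in>{0<..T}. N r \<omega> - left_lim (\<lambda>q. N q \<omega>) r \<ge> 2)"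
  proof (rule AE_not_bad_partition)
    fix n k
    have [measurable]: "N (real k * T / real n) \<in> borel_measurable M" for k
      using T by (intro poisson_process_measurable[OF N]) auto
    show "E n k \<in> events" unfolding E_def by measurable
    show "\<exists>k<n. \<omega> \<in> E n k" if \<omega>: "\<omega> \<in> space M" "\<exists>r\<in>{0<..T}. N r \<omega> - left_lim (\<lambda>q. N q \<omega>) r \<ge> 2" "n > 0" for \<omega>
    proof -
      obtain r where r: "0 < r" "r \<le> T" "N r \<omega> - left_lim (\<lambda>q. N q \<omega>) r \<ge> 2" using \<omega> by auto
      obtain k where k: "k < n" "real k * T / real n < r" "r \<le> real (Suc k) * T / real n"
        using partition_index[OF r(1,2) \<omega>(3)] by blast
      note cp = poisson_process_counting_path[OF N \<omega>(1)]
      have "N (real k * T / real n) \<omega> \<le> left_lim (\<lambda>q. N q \<omega>) r"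
        using counting_path_left_lim_le(1)[OF cp _ k(2)] T by simp
      moreover have "N r \<omega> \<le> N (real (Suc k) * T / real n) \<omega>"
        using counting_path_mono[OF cp _ k(3)] r by simp
      ultimately show ?thesis using k r \<omega> by (auto simp: E_def)
    qed
    assume n: "n > 0"
    have "prob (E n k) \<le> (\<theta> * (real (Suc k) * T / real n - real k * T / real n))\<^sup>2"
      unfolding E_def using T n by (intro poisson_two_jumps_prob[OF N]) (auto simp: divide_right_mono)
    also have "real (Suc k) * T / real n - real k * T / real n = T / real n"
      by (simp add: distrib_right add_divide_distrib)
    finally show "prob (E n k) \<le> (\<theta> * T)\<^sup>2 / (real n)\<^sup>2" by (simp add: power_divide power_mult_distrib)
  qed
  then show ?thesis by (auto simp: not_le)
qed

text \<open>A common jump makes both increments over the same grid cell nonzero. Each has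
  probability of order \<open>1 / n\<close>, and independence multiplies the two bounds.\<close>

lemma poisson_no_common_jumps:
  assumes N: "poisson_process \<theta> N" and N': "poisson_process \<theta>' N'" and T: "0 < T"
    and indep: "\<And>s t. 0 \<le> s \<Longrightarrow> s \<le> t \<Longrightarrow>
      indep_var borel (\<lambda>\<omega>. N t \<omega> - N s \<omega>) borel (\<lambda>\<omega>. N' t \<omega> - N' s \<omega>)"
  shows "AE \<omega> in M. \<forall>r\<in>{0<..T}. N r \<omega> = left_lim (\<lambda>q. N q \<omega>) r \<or> N' r \<omega> = left_lim (\<lambda>q. N' q \<omega>) r"
proof -
  define E where "E n k = {\<omega>\<in>space M. N (real (Suc k) * T / real n) \<omega> - N (real k * T / real n) \<omega> \<noteq> 0
    \<and> N' (real (Suc k) * T / real n) \<omega> - N' (real k * T / real n) \<omega> \<noteq> 0}" for n k :: nat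
  have "AE \<omega> in M. \<not> (\<exists>r\<in>{0<..T}. N r \<omega> \<noteq> left_lim (\<lambda>q. N q \<omega>) r \<and> N' r \<omega> \<noteq> left_lim (\<lambda>q. N' q \<omega>) r)"
  proof (rule AE_not_bad_partition)
    fix n k
    have [measurable]: "N (real k * T / real n) \<in> borel_measurable M" "N' (real k * T / real n) \<in> borel_measurable M" for k
      using T by (intro poisson_process_measurable[OF N] poisson_process_measurable[OF N']; simp)+
    show "E n k \<in> events" unfolding E_def by measurable
    show "\<exists>k<n. \<omega> \<in> E n k" if \<omega>: "\<omega> \<in> space M"
      "\<exists>r\<in>{0<..T}. N r \<omega> \<noteq> left_lim (\<lambda>q. N q \<omega>) r \<and> N' r \<omega> \<noteq> left_lim (\<lambda>q. N' q \<omega>) r" "n > 0" for \<omega>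
    proof -
      obtain r where r: "0 < r" "r \<le> T" "N r \<omega> \<noteq> left_lim (\<lambda>q. N q \<omega>) r" "N' r \<omega> \<noteq> left_lim (\<lambda>q. N' q \<omega>) r" using \<omega> by auto
      obtain k where k: "k < n" "real k * T / real n < r" "r \<le> real (Suc k) * T / real n"
        using partition_index[OF r(1,2) \<omega>(3)] by blast
      have "K (real (Suc k) * T / real n) \<omega> - K (real k * T / real n) \<omega> \<noteq> 0"
        if K: "poisson_process c K" "K r \<omega> \<noteq> left_lim (\<lambda>q. K q \<omega>) r" for K c
      proof -
        note cp = poisson_process_counting_path[OF K(1) \<omega>(1)]
        have "K (real k * T / real n) \<omega> \<le> left_lim (\<lambda>q. K q \<omega>) r" "left_lim (\<lambda>q. K q \<omega>) r \<le> K r \<omega>"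
          using counting_path_left_lim_le(1,2)[OF cp _ k(2)] T by auto
        moreover have "K r \<omega> \<le> K (real (Suc k) * T / real n) \<omega>"
          using counting_path_mono[OF cp _ k(3)] r by simp
        ultimately show ?thesis using K(2) by linarith
      qed
      from this[OF N r(3)] this[OF N' r(4)] show ?thesis using k \<omega> by (auto simp: E_def)
    qed
    assume n: "n > 0"
    let ?a = "real k * T / real n" and ?b = "real (Suc k) * T / real n"
    have ab: "0 \<le> ?a" "?a \<le> ?b" using T n by (auto simp: divide_right_mono)
    have d: "?b - ?a = T / real n" by (simp add: distrib_right add_divide_distrib)
    have "prob (E n k) = prob (((\<lambda>\<omega>. N ?b \<omega> - N ?a \<omega>) -` (- {0}) \<inter> space M) \<inter> ((\<lambda>\<omega>. N' ?b \<omega> - N' ?a \<omega>) -` (- {0}) \<inter> space M))"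
      unfolding E_def by (intro arg_cong[of _ _ prob]) auto
    also have "\<dots> = prob ((\<lambda>\<omega>. N ?b \<omega> - N ?a \<omega>) -` (- {0}) \<inter> space M) * prob ((\<lambda>\<omega>. N' ?b \<omega> - N' ?a \<omega>) -` (- {0}) \<inter> space M)"
      using indep_varD[OF indep[OF ab], of "- {0}" "- {0}"] by (auto simp: Int_def vimage_def conj_ac)
    also have "\<dots> = prob {\<omega>\<in>space M. N ?b \<omega> - N ?a \<omega> \<noteq> 0} * prob {\<omega>\<in>space M. N' ?b \<omega> - N' ?a \<omega> \<noteq> 0}"
      by (intro arg_cong2[of _ _ _ _ "(*)"] arg_cong[of _ _ prob]) auto
    also have "\<dots> \<le> (\<theta> * (?b - ?a)) * (\<theta>' * (?b - ?a))"
      using ab poisson_process_nonneg[OF N]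
      by (intro mult_mono poisson_no_jump_prob N N') auto
    also have "\<dots> = \<theta> * \<theta>' * T\<^sup>2 / (real n)\<^sup>2" unfolding d by (simp add: power2_eq_square)
    finally show "prob (E n k) \<le> \<theta> * \<theta>' * T\<^sup>2 / (real n)\<^sup>2" .
  qed
  then show ?thesis by simp
qed

end

lemma borel_measurable_vec_iff:
  fixes f :: "'a \<Rightarrow> real^'n::finite"
  shows "f \<in> borel_measurable M \<longleftrightarrow> (\<forall>i. (\<lambda>x. f x $ i) \<in> borel_measurable M)"
  unfolding borel_measurable_euclidean_space[of f] Basis_vec_def by (auto simp: inner_axis)

lemma borel_measurable_vec_nth [measurable]:
  "f \<in> borel_measurable M \<Longrightarrow> (\<lambda>x. (f x :: real^'n::finite) $ i) \<in> borel_measurable M"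
  using borel_measurable_vec_iff by blast

subsection \<open>Independence of the increments from the filtration\<close>

text \<open>Values at finitely many past times are partial sums of increments over a sorted list of
  times, and the increment from \<open>a\<close> to \<open>b\<close> is the last member of the same
  independent family.\<close>

lemma (in prob_space) poisson_past_indep:
  assumes N: "poisson_process \<theta> N" and ab: "0 \<le> a" "a \<le> b"
    and R: "finite R" "R \<subseteq> {0..a}" and D: "\<And>r. D r \<in> sets borel" and B: "B \<in> sets borel"
  shows "prob ({\<omega>\<in>space M. \<forall>r\<in>R. N r \<omega> \<in> D r} \<inter> {\<omega>\<in>space M. N b \<omega> - N a \<omega> \<in> B})
    = prob {\<omega>\<in>space M. \<forall>r\<in>R. N r \<omega> \<in> D r} * prob {\<omega>\<in>space M. N b \<omega> - N a \<omega> \<in> B}"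
proof -
  \<comment> \<open>Adding 0 makes every past value a sum of increments that starts from
    \<open>N 0 = 0\<close>; adding \<open>a\<close> makes the last increment start exactly at
    \<open>a\<close>.\<close>
  define S where "S = insert 0 (insert a R)"
  define us where "us = sorted_list_of_set S"
  define ts where "ts = us @ [b]"
  have S: "finite S" "S \<subseteq> {0..a}" using R ab by (auto simp: S_def)
  have us: "set us = S" "sorted us" "distinct us" using S by (auto simp: us_def)
  define m where "m = length us - 1"
  have len: "length us = Suc m" using us(1) by (cases us) (auto simp: m_def S_def)
  have us0: "us ! 0 = 0"
  proof -
    obtain q where q: "q < length us" "us ! q = 0" using us(1) by (metis S_def in_set_conv_nth insertI1)
    then have "us ! 0 \<le> 0" using sorted_nth_mono[OF us(2), of 0 q] by simp
    moreover have "us ! 0 \<in> S" using us(1) len nth_mem by fastforce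
    ultimately show ?thesis using S by force
  qed
  have usm: "us ! m = a"
  proof -
    have "a \<in> set us" using us(1) by (simp add: S_def)
    then obtain q where q: "q < length us" "us ! q = a" by (auto simp: in_set_conv_nth)
    then have "a \<le> us ! m" using sorted_nth_mono[OF us(2), of q m] len by simp
    moreover have "us ! m \<in> S" using us(1) len nth_mem by fastforce
    ultimately show ?thesis using S by force
  qed
  have ts: "sorted ts" "\<forall>r\<in>set ts. 0 \<le> r" "length ts - 1 = Suc m"
    using us S ab len by (auto simp: ts_def sorted_append)
  define X where "X k \<omega> = N (ts ! Suc k) \<omega> - N (ts ! k) \<omega>" for k \<omega>
  have indep: "indep_vars (\<lambda>_. borel) X {..<Suc m}"
  proof -
    have "\<forall>ts::real list. sorted ts \<longrightarrow> (\<forall>r\<in>set ts. 0 \<le> r) \<longrightarrow>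
        indep_vars (\<lambda>_. borel) (\<lambda>i \<omega>. N (ts ! Suc i) \<omega> - N (ts ! i) \<omega>) {..<length ts - 1}"
      using N unfolding poisson_process_def by blast
    from this[rule_format, OF ts(1)] ts show ?thesis unfolding X_def[abs_def] by auto
  qed
  have tsn: "ts ! k = us ! k" if "k \<le> m" for k using that len by (simp add: ts_def nth_append)
  have Xm: "X m \<omega> = N b \<omega> - N a \<omega>" for \<omega>
    using len tsn[of m] usm by (simp add: X_def ts_def nth_append)
  have N0: "N 0 \<omega> = 0" if "\<omega> \<in> space M" for \<omega>
    using poisson_process_counting_path[OF N that] by (simp add: counting_path_def)
  have "\<exists>q\<le>m. r = us ! q" if "r \<in> R" for r
  proof -
    have "r \<in> set us" using that us(1) by (simp add: S_def)
    then show ?thesis using len by (auto simp: in_set_conv_nth less_Suc_eq_le)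
  qed
  then obtain q where q: "\<And>r. r \<in> R \<Longrightarrow> q r \<le> m" "\<And>r. r \<in> R \<Longrightarrow> us ! q r = r" by metis
  have Nr: "N r \<omega> = (\<Sum>k<q r. X k \<omega>)" if "r \<in> R" "\<omega> \<in> space M" for r \<omega>
  proof -
    have "(\<Sum>k<q r. X k \<omega>) = N (ts ! q r) \<omega> - N (ts ! 0) \<omega>"
      unfolding X_def by (rule sum_lessThan_telescope)
    then show ?thesis using q[OF that(1)] tsn[of "q r"] tsn[of 0] us0 N0[OF that(2)] by simp
  qed
  have ind2: "indep_var (PiM {..<m} (\<lambda>_. borel)) (\<lambda>\<omega>. restrict (\<lambda>i. X i \<omega>) {..<m})
      (PiM {m} (\<lambda>_. borel)) (\<lambda>\<omega>. restrict (\<lambda>i. X i \<omega>) {m})"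
    by (rule indep_var_restrict[OF indep]) auto
  define Z where "Z = {f \<in> space (PiM {..<m} (\<lambda>_. borel)). \<forall>r\<in>R. (\<Sum>k<q r. f k) \<in> D r}"
  define Y where "Y = {f \<in> space (PiM {m} (\<lambda>_. borel)). f m \<in> B}"
  have Zs: "Z \<in> sets (PiM {..<m} (\<lambda>_. borel))"
    unfolding Z_def
  proof (rule sets.sets_Collect_finite_All[OF _ R(1)])
    fix r assume r: "r \<in> R"
    have [measurable]: "D r \<in> sets borel" by (rule D)
    have [measurable]: "(\<lambda>f. \<Sum>k<q r. f k) \<in> borel_measurable (PiM {..<m} (\<lambda>_. borel :: real measure))"
      using q(1)[OF r] by (intro borel_measurable_sum[where f = "\<lambda>k f. f k"] measurable_component_singleton) auto
    show "{f \<in> space (PiM {..<m} (\<lambda>_. borel)). (\<Sum>k<q r. f k) \<in> D r} \<in> sets (PiM {..<m} (\<lambda>_. borel))"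
      by measurable
  qed
  have Ys: "Y \<in> sets (PiM {m} (\<lambda>_. borel))"
  proof -
    have [measurable]: "(\<lambda>f. f m) \<in> borel_measurable (PiM {m} (\<lambda>_. borel))"
      by (rule measurable_component_singleton) simp
    have [measurable]: "B \<in> sets borel" by (rule B)
    show ?thesis unfolding Y_def by measurable
  qed
  have preZ: "(\<lambda>\<omega>. restrict (\<lambda>i. X i \<omega>) {..<m}) -` Z \<inter> space M = {\<omega>\<in>space M. \<forall>r\<in>R. N r \<omega> \<in> D r}"
  proof -
    have "(\<Sum>k<q r. restrict (\<lambda>i. X i \<omega>) {..<m} k) = N r \<omega>" if "r \<in> R" "\<omega> \<in> space M" for r \<omega>
      unfolding Nr[OF that] using q(1)[OF that(1)] by (intro sum.cong) auto
    then show ?thesis by (auto simp: Z_def space_PiM)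
  qed
  have preY: "(\<lambda>\<omega>. restrict (\<lambda>i. X i \<omega>) {m}) -` Y \<inter> space M = {\<omega>\<in>space M. N b \<omega> - N a \<omega> \<in> B}"
    by (auto simp: Y_def space_PiM Xm)
  show ?thesis
    using indep_varD[OF ind2 Zs Ys] unfolding preZ[symmetric] preY[symmetric]
    by (simp add: vimage_Int[symmetric] Int_ac) (simp add: vimage_def Int_def conj_ac)
qed

locale poisson_filtration = prob_space M for M :: "'w measure" +
  fixes P \<pi> :: "real \<Rightarrow> 'w \<Rightarrow> real^'n::finite" and \<theta> :: "'n \<Rightarrow> real"
  assumes P_measurable: "\<And>s. s \<ge> 0 \<Longrightarrow> P s \<in> borel_measurable M"
    and poisson: "\<And>i. poisson_process (\<theta> i) (\<lambda>s \<omega>. \<pi> s \<omega> $ i)"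
    and indep_components: "indep_vars (\<lambda>_. Pi\<^sub>M UNIV (\<lambda>_. borel)) (\<lambda>i \<omega> s. \<pi> s \<omega> $ i) UNIV"
    and indep_P: "indep_var (Pi\<^sub>M UNIV (\<lambda>_. borel)) (\<lambda>\<omega> s. P s \<omega>)
                            (Pi\<^sub>M UNIV (\<lambda>_. borel)) (\<lambda>\<omega> s. \<pi> s \<omega>)"
begin

abbreviation F :: "real \<Rightarrow> 'w measure" where "F \<equiv> gen_filtration P \<pi>"

lemma \<theta>_nonneg: "\<theta> i \<ge> 0"
  using poisson poisson_process_nonneg by blast

lemma counting: "\<omega> \<in> space M \<Longrightarrow> counting_path (\<lambda>s. \<pi> s \<omega> $ i)"
  using poisson_process_counting_path[OF poisson] .

lemma \<pi>_measurable: "s \<ge> 0 \<Longrightarrow> (\<lambda>\<omega>. \<pi> s \<omega> $ i) \<in> borel_measurable M"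
  using poisson_process_measurable[OF poisson] .

lemma \<pi>_measurable_vec: "s \<ge> 0 \<Longrightarrow> \<pi> s \<in> borel_measurable M"
  using \<pi>_measurable borel_measurable_vec_iff by blast

abbreviation "F_gen s \<equiv> {P r -` B \<inter> space M | r B. 0 \<le> r \<and> r \<le> s \<and> B \<in> sets borel}
      \<union> {\<pi> r -` B \<inter> space M | r B. 0 \<le> r \<and> r < s \<and> B \<in> sets borel}
      \<union> null_sets M"

lemma F_gen_events: "F_gen s \<subseteq> events"
  using P_measurable \<pi>_measurable_vec by (auto intro: measurable_sets)

lemma space_F [simp]: "space (F s) = space M"
  unfolding gen_filtration_def by (rule space_measure_of) (use F_gen_events sets.space_closed in blast)

lemma sets_F: "sets (F s) = sigma_sets (space M) (F_gen s)"
  unfolding gen_filtration_def by (rule sets_measure_of) (use F_gen_events sets.space_closed in blast)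

lemma sets_F_events: "sets (F s) \<subseteq> events"
  unfolding sets_F by (rule sets.sigma_sets_subset[OF F_gen_events])

lemma sets_F_mono: "s \<le> s' \<Longrightarrow> sets (F s) \<subseteq> sets (F s')"
  unfolding sets_F by (intro sigma_sets_mono' Un_mono subset_refl) (fastforce)+

lemma null_sets_F: "A \<in> null_sets M \<Longrightarrow> A \<in> sets (F s)"
  unfolding sets_F by (intro sigma_sets.Basic) blast

lemma measurable_F_mono: "f \<in> measurable (F s) N \<Longrightarrow> s \<le> s' \<Longrightarrow> f \<in> measurable (F s') N"
  using sets_F_mono[of s s'] unfolding measurable_def by auto

lemma measurable_F_M: "f \<in> measurable (F s) N \<Longrightarrow> f \<in> measurable M N"
  using sets_F_events[of s] unfolding measurable_def by auto

text \<open>All null sets belong to \<open>F s\<close>, so changing a function on a null set keeps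
  it measurable for \<open>F s\<close>, provided that the new function is measurable at all.\<close>

lemma measurable_F_AE_cong:
  fixes f g :: "'w \<Rightarrow> 'b::topological_space"
  assumes f: "f \<in> borel_measurable (F s)" and g: "g \<in> borel_measurable M" and eq: "AE \<omega> in M. f \<omega> = g \<omega>"
  shows "g \<in> borel_measurable (F s)"
proof (rule measurableI)
  fix B :: "'b set" assume B: "B \<in> sets borel"
  obtain N where N: "{\<omega>\<in>space M. f \<omega> \<noteq> g \<omega>} \<subseteq> N" "N \<in> null_sets M"
    using eq by (auto elim!: AE_E simp: null_sets_def)
  have 1: "N \<in> sets (F s)" using N null_sets_F by blast
  have 2: "f -` B \<inter> space M \<in> sets (F s)" using measurable_sets[OF f B] by simp
  have 3: "(g -` B \<inter> space M) \<inter> N \<in> sets (F s)"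
    using measurable_sets[OF g B] N(2) by (intro null_sets_F null_set_Int1) auto
  have "g -` B \<inter> space (F s) = ((f -` B \<inter> space M) - N) \<union> ((g -` B \<inter> space M) \<inter> N)" using N(1) by auto
  then show "g -` B \<inter> space (F s) \<in> sets (F s)" using 1 2 3 by (simp only: sets.Un sets.Diff)
qed auto

lemma left_lim_tendsto:
  assumes "\<omega> \<in> space M" "0 < s"
  shows "((\<lambda>q. \<pi> q \<omega> $ i) \<longlongrightarrow> left_lim (\<lambda>q. \<pi> q \<omega> $ i) s) (at_left s)"
proof -
  obtain u where u: "0 \<le> u" "u < s" "\<And>r. u \<le> r \<Longrightarrow> r < s \<Longrightarrow> \<pi> r \<omega> $ i = left_lim (\<lambda>q. \<pi> q \<omega> $ i) s"
    using counting_path_left_lim[OF counting[OF assms(1)] assms(2)] by blast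
  have "\<forall>\<^sub>F r in at_left s. r \<in> {u<..<s}" by (rule eventually_at_left_real[OF u(2)])
  then show ?thesis using u(3) by (intro tendsto_eventually) (auto elim!: eventually_mono)
qed

text \<open>The filtration knows \<pi> strictly before \<open>s\<close>, which is just enough for a
  left limit at \<open>s\<close>, taken along \<open>s - s / Suc n\<close>.\<close>

lemma left_lim_measurable_F:
  assumes "0 < s"
  shows "(\<lambda>\<omega>. left_lim (\<lambda>q. \<pi> q \<omega> $ i) s) \<in> borel_measurable (F s)"
proof (rule borel_measurable_LIMSEQ_metric)
  fix n :: nat
  have "\<pi> (s - s / real (Suc n)) \<in> borel_measurable (F s)"
  proof (rule measurableI)
    fix B :: "(real^'n) set" assume "B \<in> sets borel"
    then show "\<pi> (s - s / real (Suc n)) -` B \<inter> space (F s) \<in> sets (F s)"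
      unfolding sets_F using assms
      by (intro sigma_sets.Basic) (auto simp: divide_le_eq intro!: exI[of _ "s - s / real (Suc n)"] exI[of _ B])
  qed simp
  then show "(\<lambda>\<omega>. \<pi> (s - s / real (Suc n)) \<omega> $ i) \<in> borel_measurable (F s)" by measurable
next
  fix \<omega> assume "\<omega> \<in> space (F s)"
  then have lim: "((\<lambda>q. \<pi> q \<omega> $ i) \<longlongrightarrow> left_lim (\<lambda>q. \<pi> q \<omega> $ i) s) (at_left s)"
    using assms left_lim_tendsto by simp
  have "(\<lambda>n. s - s / real (Suc n)) \<longlonglongrightarrow> s - 0"
    using LIMSEQ_inverse_real_of_nat[THEN tendsto_mult_right_zero, of s]
    by (intro tendsto_diff tendsto_const) (simp add: divide_inverse)
  then have "filterlim (\<lambda>n. s - s / real (Suc n)) (at_left s) sequentially"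
    using assms by (simp add: filterlim_at)
  from filterlim_compose[OF lim this]
  show "(\<lambda>n. \<pi> (s - s / real (Suc n)) \<omega> $ i) \<longlonglongrightarrow> left_lim (\<lambda>q. \<pi> q \<omega> $ i) s" .
qed

text \<open>\<open>gen_filtration\<close> lists \<pi> only at times strictly before
  \<open>s\<close>. At a fixed positive time \<pi> almost surely equals its left limit, which is
  measurable, and the null sets in \<open>F s\<close> bridge the difference; at time 0 it is
  constantly 0.\<close>

lemma \<pi>_measurable_F:
  assumes "0 \<le> r" "r \<le> s"
  shows "(\<lambda>\<omega>. \<pi> r \<omega> $ i) \<in> borel_measurable (F s)"
proof -
  have "(\<lambda>\<omega>. \<pi> r \<omega> $ i) \<in> borel_measurable (F r)"
  proof (cases "r = 0")
    case True
    have "(\<lambda>\<omega>. \<pi> r \<omega> $ i) \<in> borel_measurable (F r) \<longleftrightarrow> (\<lambda>\<omega>. 0 :: real) \<in> borel_measurable (F r)"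
      using counting True by (intro measurable_cong) (auto simp: counting_path_def)
    then show ?thesis by simp
  next
    case False
    then show ?thesis
      using assms poisson_no_jump_at[OF poisson, of r i]
      by (intro measurable_F_AE_cong[OF left_lim_measurable_F[of r i] \<pi>_measurable]) auto
  qed
  then show ?thesis using measurable_F_mono assms by blast
qed

text \<open>The product formula is checked on boxes and null sets, which form an intersection-stable
  system, and then extends to the sigma-algebra that they generate; \<open>F a\<close> is contained
  in it.\<close>

lemma increment_indep:
  assumes ab: "0 \<le> a" "a \<le> b" and A: "A \<in> sets (F a)" and B: "B \<in> sets borel"
  shows "prob (A \<inter> {\<omega>\<in>space M. \<pi> b \<omega> $ i - \<pi> a \<omega> $ i \<in> B})
    = prob A * prob {\<omega>\<in>space M. \<pi> b \<omega> $ i - \<pi> a \<omega> $ i \<in> B}"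
proof -
  let ?E = "{\<omega>\<in>space M. \<pi> b \<omega> $ i - \<pi> a \<omega> $ i \<in> B}"
  let ?S = "sets (PiM UNIV (\<lambda>_::real. borel :: real measure))"
  \<comment> \<open>Only for component \<open>i\<close> must the past be cut off at
    \<open>a\<close>, and finite cylinders over \<open>{0..a}\<close> are what
    \<open>poisson_past_indep\<close> can treat. \<open>P\<close> and the other components may
    contribute events of their whole paths, being independent of component \<open>i\<close>.\<close>
  define cyl where "cyl = {{f :: real \<Rightarrow> real. \<forall>r\<in>R. f r \<in> D r} | R D. finite R \<and> R \<subseteq> {0..a} \<and> (\<forall>r. D r \<in> sets borel)}"
  define box where "box A0 Aj = {\<omega>\<in>space M. (\<lambda>s. P s \<omega>) \<in> A0 \<and> (\<forall>j. (\<lambda>s. \<pi> s \<omega> $ j) \<in> Aj j)}"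
    for A0 :: "(real \<Rightarrow> real^'n) set" and Aj :: "'n \<Rightarrow> (real \<Rightarrow> real) set"
  define G where "G = {box A0 Aj | A0 Aj. A0 \<in> sets (PiM UNIV (\<lambda>_. borel)) \<and> (\<forall>j. Aj j \<in> ?S) \<and> Aj i \<in> cyl}"
  have cyl_sets: "Z \<in> ?S" if Z: "Z \<in> cyl" for Z
  proof -
    obtain R D where Z: "Z = {f. \<forall>r\<in>R. f r \<in> D r}" and R: "finite R" and D: "\<And>r. D r \<in> sets borel"
      using Z unfolding cyl_def by blast
    have "{f \<in> space (PiM UNIV (\<lambda>_::real. borel :: real measure)). \<forall>r\<in>R. f r \<in> D r} \<in> ?S"
    proof (rule sets.sets_Collect_finite_All[OF _ R])
      fix r
      have [measurable]: "D r \<in> sets borel" by (rule D)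
      show "{f \<in> space (PiM UNIV (\<lambda>_::real. borel :: real measure)). f r \<in> D r} \<in> ?S" by measurable
    qed
    then show ?thesis by (simp add: Z space_PiM)
  qed
  have cyl_Int: "Z \<inter> Z' \<in> cyl" if ZZ: "Z \<in> cyl" "Z' \<in> cyl" for Z Z'
  proof -
    obtain R D where Z: "Z = {f. \<forall>r\<in>R. f r \<in> D r}" "finite R" "R \<subseteq> {0..a}" "\<And>r. D r \<in> sets borel"
      using ZZ(1) unfolding cyl_def by blast
    obtain R' D' where Z': "Z' = {f. \<forall>r\<in>R'. f r \<in> D' r}" "finite R'" "R' \<subseteq> {0..a}" "\<And>r. D' r \<in> sets borel"
      using ZZ(2) unfolding cyl_def by blast
    have "Z \<inter> Z' = {f. \<forall>r\<in>R \<union> R'. f r \<in> (if r \<in> R then D r else UNIV) \<inter> (if r \<in> R' then D' r else UNIV)}"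
      unfolding Z(1) Z'(1) by auto
    then show ?thesis
      unfolding cyl_def using Z(2-4) Z'(2-4)
      by (intro CollectI exI[of _ "R \<union> R'"] exI[of _ "\<lambda>r. (if r \<in> R then D r else UNIV) \<inter> (if r \<in> R' then D' r else UNIV)"]) auto
  qed
  have cyl1: "{f. f r \<in> Y} \<in> cyl" if "0 \<le> r" "r \<le> a" "Y \<in> sets borel" for r Y
    unfolding cyl_def using that by (intro CollectI exI[of _ "{r}"] exI[of _ "\<lambda>_. Y"]) auto
  have cylU: "UNIV \<in> cyl" unfolding cyl_def by (intro CollectI exI[of _ "{}"] exI[of _ "\<lambda>_. UNIV"]) auto
  note mP = indep_var_rv1[OF indep_P] and m\<pi> = indep_var_rv2[OF indep_P]
  have mj: "(\<lambda>\<omega> s. \<pi> s \<omega> $ j) \<in> measurable M (PiM UNIV (\<lambda>_. borel))" for j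
    using indep_components by (auto simp: indep_vars_def)
  have prob_box: "prob (box A0 Aj) = prob ((\<lambda>\<omega> s. P s \<omega>) -` A0 \<inter> space M) *
      (\<Prod>j\<in>UNIV. prob ((\<lambda>\<omega> s. \<pi> s \<omega> $ j) -` Aj j \<inter> space M))"
    if A0: "A0 \<in> sets (PiM UNIV (\<lambda>_. borel))" and Aj: "\<And>j. Aj j \<in> ?S" for A0 Aj
  proof -
    define Z where "Z = {g \<in> space (PiM UNIV (\<lambda>_::real. borel :: (real^'n) measure)). \<forall>j\<in>UNIV. (\<lambda>s. g s $ j) \<in> Aj j}"
    have "Z \<in> sets (PiM UNIV (\<lambda>_::real. borel :: (real^'n) measure))"
      unfolding Z_def
    proof (rule sets.sets_Collect_finite_All[OF _ finite])
      fix j :: 'n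
      have [measurable]: "Aj j \<in> ?S" by (rule Aj)
      have [measurable]: "(\<lambda>g s. g s $ j) \<in> measurable (PiM UNIV (\<lambda>_::real. borel :: (real^'n) measure)) (PiM UNIV (\<lambda>_::real. borel :: real measure))"
        by (intro measurable_PiM_single') (auto simp: space_PiM)
      show "{g \<in> space (PiM UNIV (\<lambda>_::real. borel :: (real^'n) measure)). (\<lambda>s. g s $ j) \<in> Aj j} \<in> sets (PiM UNIV (\<lambda>_. borel))"
        by measurable
    qed
    from indep_varD[OF indep_P A0 this]
    have "prob (box A0 Aj) = prob ((\<lambda>\<omega> s. P s \<omega>) -` A0 \<inter> space M) * prob ((\<lambda>\<omega> s. \<pi> s \<omega>) -` Z \<inter> space M)"
      by (simp add: box_def Z_def vimage_def Int_def space_PiM conj_ac)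
    also have "(\<lambda>\<omega> s. \<pi> s \<omega>) -` Z \<inter> space M = (\<Inter>j\<in>UNIV. (\<lambda>\<omega> s. \<pi> s \<omega> $ j) -` Aj j \<inter> space M)"
      by (auto simp: Z_def space_PiM)
    also have "prob \<dots> = (\<Prod>j\<in>UNIV. prob ((\<lambda>\<omega> s. \<pi> s \<omega> $ j) -` Aj j \<inter> space M))"
      by (rule indep_varsD[OF indep_components]) (auto simp: Aj)
    finally show ?thesis .
  qed
  have box_ev: "box A0 Aj \<in> events" if A0: "A0 \<in> sets (PiM UNIV (\<lambda>_. borel))" and Aj: "\<And>j. Aj j \<in> ?S" for A0 Aj
  proof -
    have "box A0 Aj = ((\<lambda>\<omega> s. P s \<omega>) -` A0 \<inter> space M) \<inter> (\<Inter>j\<in>UNIV. (\<lambda>\<omega> s. \<pi> s \<omega> $ j) -` Aj j \<inter> space M)"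
      by (auto simp: box_def)
    then show ?thesis
      by (simp only:) (intro sets.Int sets.finite_INT measurable_sets[OF mP A0] measurable_sets[OF mj Aj]; simp)
  qed
  have Eev: "?E \<in> events"
  proof -
    have [measurable]: "(\<lambda>\<omega>. \<pi> b \<omega> $ i) \<in> borel_measurable M" "(\<lambda>\<omega>. \<pi> a \<omega> $ i) \<in> borel_measurable M" "B \<in> sets borel"
      using ab B by (auto intro: \<pi>_measurable)
    show ?thesis by measurable
  qed
  have indepG: "prob (g \<inter> ?E) = prob g * prob ?E" if g: "g \<in> G" for g
  proof -
    obtain A0 Aj where gg: "g = box A0 Aj" and A0: "A0 \<in> sets (PiM UNIV (\<lambda>_. borel))"
      and Aj: "\<And>j. Aj j \<in> ?S" and Ai: "Aj i \<in> cyl" using g unfolding G_def by blast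
    obtain R D where RD: "Aj i = {f. \<forall>r\<in>R. f r \<in> D r}" "finite R" "R \<subseteq> {0..a}" "\<And>r. D r \<in> sets borel"
      using Ai unfolding cyl_def by blast
    let ?I = "{f :: real \<Rightarrow> real. f b - f a \<in> B}"
    have I: "?I \<in> ?S"
    proof -
      have [measurable]: "B \<in> sets borel" by (rule B)
      have "{f \<in> space (PiM UNIV (\<lambda>_::real. borel :: real measure)). f b - f a \<in> B} \<in> ?S" by measurable
      then show ?thesis by (simp add: space_PiM)
    qed
    \<comment> \<open>Moving the increment event into the \<open>i\<close>-th factor keeps the shape
      of a box, so \<open>prob_box\<close> applies with and without it and only the
      \<open>i\<close>-th factor has to be split.\<close>
    define Bj where "Bj = Aj(i := Aj i \<inter> ?I)"
    have Bj: "\<And>j. Bj j \<in> ?S" using Aj I by (auto simp: Bj_def)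
    let ?p = "\<lambda>Aj. \<Prod>j\<in>UNIV - {i}. prob ((\<lambda>\<omega> s. \<pi> s \<omega> $ j) -` Aj j \<inter> space M)"
    have split: "(\<Prod>j\<in>UNIV. prob ((\<lambda>\<omega> s. \<pi> s \<omega> $ j) -` Aj j \<inter> space M))
        = prob ((\<lambda>\<omega> s. \<pi> s \<omega> $ i) -` Aj i \<inter> space M) * ?p Aj" for Aj :: "'n \<Rightarrow> (real \<Rightarrow> real) set"
      by (rule prod.remove) auto
    have "g \<inter> ?E = box A0 Bj"
      unfolding gg box_def Bj_def by auto
    then have "prob (g \<inter> ?E) = prob ((\<lambda>\<omega> s. P s \<omega>) -` A0 \<inter> space M) *
        (prob ((\<lambda>\<omega> s. \<pi> s \<omega> $ i) -` Bj i \<inter> space M) * ?p Bj)"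
      using prob_box[OF A0 Bj] split[of Bj] by simp
    also have "?p Bj = ?p Aj" by (intro prod.cong) (auto simp: Bj_def)
    also have "(\<lambda>\<omega> s. \<pi> s \<omega> $ i) -` Bj i \<inter> space M = {\<omega>\<in>space M. \<forall>r\<in>R. \<pi> r \<omega> $ i \<in> D r} \<inter> ?E"
      by (auto simp: Bj_def RD(1))
    also have "prob \<dots> = prob {\<omega>\<in>space M. \<forall>r\<in>R. \<pi> r \<omega> $ i \<in> D r} * prob ?E"
      by (rule poisson_past_indep[OF poisson[of i] ab RD(2,3,4) B])
    also have "{\<omega>\<in>space M. \<forall>r\<in>R. \<pi> r \<omega> $ i \<in> D r} = (\<lambda>\<omega> s. \<pi> s \<omega> $ i) -` Aj i \<inter> space M"
      by (auto simp: RD(1))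
    finally show ?thesis using prob_box[OF A0 Aj] split[of Aj] unfolding gg by simp
  qed
  have GI: "Int_stable (G \<union> null_sets M)"
    unfolding Int_stable_def
  proof (intro ballI)
    fix g h assume gh: "g \<in> G \<union> null_sets M" "h \<in> G \<union> null_sets M"
    have ev: "g \<in> events" "h \<in> events" using gh box_ev by (auto simp: G_def)
    show "g \<inter> h \<in> G \<union> null_sets M"
    proof (cases "g \<in> null_sets M \<or> h \<in> null_sets M")
      case True
      then show ?thesis using ev by (auto intro: null_set_Int1 null_set_Int2)
    next
      case False
      with gh obtain A0 Aj A0' Aj' where *: "g = box A0 Aj" "h = box A0' Aj'"
        "A0 \<in> sets (PiM UNIV (\<lambda>_. borel))" "\<And>j. Aj j \<in> ?S" "Aj i \<in> cyl"
        "A0' \<in> sets (PiM UNIV (\<lambda>_. borel))" "\<And>j. Aj' j \<in> ?S" "Aj' i \<in> cyl"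
        unfolding G_def by blast
      have "g \<inter> h = box (A0 \<inter> A0') (\<lambda>j. Aj j \<inter> Aj' j)" unfolding *(1,2) box_def by auto
      then show ?thesis
        unfolding G_def using *(3-) cyl_Int
        by (intro UnI1 CollectI exI[of _ "A0 \<inter> A0'"] exI[of _ "\<lambda>j. Aj j \<inter> Aj' j"]) auto
    qed
  qed
  have Gev: "G \<union> null_sets M \<subseteq> events" using box_ev by (auto simp: G_def)
  have "indep_set (G \<union> null_sets M) {?E}"
  proof (rule indep_setI)
    fix g e assume g: "g \<in> G \<union> null_sets M" and e: "e \<in> {?E}"
    show "prob (g \<inter> e) = prob g * prob e"
    proof (cases "g \<in> null_sets M")
      case True
      then have "g \<inter> ?E \<in> null_sets M" using Eev by (rule null_set_Int2)
      then show ?thesis using True e by (simp add: measure_eq_0_null_sets)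
    next
      case False
      then show ?thesis using g e indepG by blast
    qed
  qed (use Gev Eev in auto)
  then have ind: "indep_set (sigma_sets (space M) (G \<union> null_sets M)) (sigma_sets (space M) {?E})"
    by (rule indep_set_sigma_sets[OF _ GI]) (auto simp: Int_stable_def)
  let ?N = "sigma (space M) (G \<union> null_sets M)"
  have Gpow: "G \<union> null_sets M \<subseteq> Pow (space M)" using Gev sets.space_closed by blast
  have spN: "space ?N = space M" by (rule space_measure_of[OF Gpow])
  have seN: "sets ?N = sigma_sets (space M) (G \<union> null_sets M)" by (rule sets_measure_of[OF Gpow])
  have PN: "P r \<in> borel_measurable ?N" for r
  proof (rule measurableI)
    fix Y :: "(real^'n) set" assume Y: "Y \<in> sets borel"
    have "{f \<in> space (PiM UNIV (\<lambda>_::real. borel :: (real^'n) measure)). f r \<in> Y} \<in> sets (PiM UNIV (\<lambda>_. borel))"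
      using Y by measurable
    then have "box {f. f r \<in> Y} (\<lambda>_. UNIV) \<in> G"
      unfolding G_def using cylU cyl_sets[OF cylU] by (auto simp: space_PiM)
    moreover have "P r -` Y \<inter> space ?N = box {f. f r \<in> Y} (\<lambda>_. UNIV)"
      unfolding spN box_def by auto
    ultimately show "P r -` Y \<inter> space ?N \<in> sets ?N" unfolding seN by (auto intro: sigma_sets.Basic)
  qed simp
  \<comment> \<open>Generators of the filtration are boxes with one nontrivial factor. The
    restriction \<open>r \<le> a\<close> makes this factor a member of \<open>cyl\<close>, which is
    required when \<open>j = i\<close>.\<close>
  have "(\<lambda>\<omega>. \<pi> r \<omega> $ j) \<in> borel_measurable ?N" if r: "0 \<le> r" "r \<le> a" for r j
  proof (rule measurableI)
    fix Y :: "real set" assume Y: "Y \<in> sets borel"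
    let ?A = "(\<lambda>_. UNIV)(j := {f. f r \<in> Y})"
    have "?A k \<in> cyl" for k using cyl1[OF r Y] cylU by auto
    then have "box UNIV ?A \<in> G"
      unfolding G_def using cyl_sets sets.top[of "PiM UNIV (\<lambda>_::real. borel :: (real^'n) measure)"]
      by (intro CollectI exI[of _ UNIV] exI[of _ ?A]) (auto simp: space_PiM)
    moreover have "(\<lambda>\<omega>. \<pi> r \<omega> $ j) -` Y \<inter> space ?N = box UNIV ?A"
      unfolding spN box_def by auto
    ultimately show "(\<lambda>\<omega>. \<pi> r \<omega> $ j) -` Y \<inter> space ?N \<in> sets ?N" unfolding seN by (auto intro: sigma_sets.Basic)
  qed simp
  then have \<pi>N: "\<pi> r \<in> borel_measurable ?N" if "0 \<le> r" "r \<le> a" for r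
    using that borel_measurable_vec_iff by blast
  have "F_gen a \<subseteq> sets ?N"
  proof -
    have "P r -` Y \<inter> space M \<in> sets ?N" if "Y \<in> sets borel" for r Y
      using measurable_sets[OF PN that] spN by simp
    moreover have "\<pi> r -` Y \<inter> space M \<in> sets ?N" if "0 \<le> r" "r < a" "Y \<in> sets borel" for r Y
      using measurable_sets[OF \<pi>N that(3)] that spN by simp
    moreover have "null_sets M \<subseteq> sets ?N" unfolding seN by (auto intro: sigma_sets.Basic)
    ultimately show ?thesis by auto
  qed
  then have "sets (F a) \<subseteq> sets ?N"
    unfolding sets_F using sets.sigma_sets_subset[of "F_gen a" ?N] spN by simp
  then have "A \<in> sigma_sets (space M) (G \<union> null_sets M)" using A seN by auto
  from indep_setD[OF ind this] show ?thesis by (auto intro: sigma_sets.Basic)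
qed

end

subsection \<open>Compensation formula\<close>

locale poisson_horizon = poisson_filtration M P \<pi> \<theta>
  for M :: "'w measure" and P \<pi> :: "real \<Rightarrow> 'w \<Rightarrow> real^'n::finite" and \<theta> :: "'n \<Rightarrow> real" +
  fixes t T :: real
  assumes t_nonneg: "0 \<le> t" and t_less_T: "t < T"
begin

text \<open>Jumps at \<open>T\<close> itself are left out: strategies live on
  \<open>{t..<T}\<close>, and the terminal position is a left limit at \<open>T\<close>.\<close>

definition JT :: "'n \<Rightarrow> real \<Rightarrow> 'w \<Rightarrow> real set" where
  "JT i s \<omega> = {r \<in> jump_times (\<lambda>q. \<pi> q \<omega> $ i) t s. r < T}"

definition \<Delta> :: "'n \<Rightarrow> real \<Rightarrow> 'w \<Rightarrow> real" where
  "\<Delta> i r \<omega> = \<pi> r \<omega> $ i - left_lim (\<lambda>q. \<pi> q \<omega> $ i) r"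

text \<open>The counting process without its possible jump at \<open>T\<close>, so that its
  increments match the jump sets \<open>JT\<close>; it almost surely agrees with \<pi> up to
  \<open>T\<close>.\<close>

definition Nl :: "'n \<Rightarrow> real \<Rightarrow> 'w \<Rightarrow> real" where
  "Nl i u \<omega> = (if u < T then \<pi> u \<omega> $ i else left_lim (\<lambda>q. \<pi> q \<omega> $ i) T)"

text \<open>The pathwise integral of \<open>H\<close> against component \<open>i\<close>, with
  values in \<open>ennreal\<close> so that monotone class arguments need no integrability. Its
  real-valued counterpart is \<open>jS\<close>.\<close>

definition nJ :: "'n \<Rightarrow> real \<Rightarrow> (real \<times> 'w \<Rightarrow> ennreal) \<Rightarrow> 'w \<Rightarrow> ennreal" where
  "nJ i s H \<omega> = (\<Sum>r\<in>JT i s \<omega>. ennreal (\<Delta> i r \<omega>) * H (r, \<omega>))"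

definition jS :: "'n \<Rightarrow> real \<Rightarrow> (real \<Rightarrow> 'w \<Rightarrow> real) \<Rightarrow> 'w \<Rightarrow> real" where
  "jS i s H \<omega> = (\<Sum>r\<in>JT i s \<omega>. H r \<omega> * \<Delta> i r \<omega>)"

abbreviation "Pr \<equiv> predictable_sigma F t T"
abbreviation "\<Omega> \<equiv> {t..<T} \<times> space M"
abbreviation "PG \<equiv> {({a<..b} \<inter> {t..<T}) \<times> A | a b A. t \<le> a \<and> a \<le> b \<and> A \<in> sets (F a)}
      \<union> {{t} \<times> A | A. A \<in> sets (F t)}"

lemma T_pos: "0 < T" using t_nonneg t_less_T by simp

lemma finite_JT: "\<omega> \<in> space M \<Longrightarrow> finite (JT i s \<omega>)"
proof (cases "t \<le> s")
  case True
  assume "\<omega> \<in> space M"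
  then show ?thesis
    using counting_path_jumps[OF counting t_nonneg True] by (simp add: JT_def)
next
  case False
  then show ?thesis by (auto simp: JT_def jump_times_def)
qed

lemma JT_subset: "JT i s \<omega> \<subseteq> {t<..<T}" "JT i s \<omega> \<subseteq> {..s}"
  by (auto simp: JT_def jump_times_def)

lemma JT_eq: "s \<le> T \<Longrightarrow> JT i s \<omega> = JT i T \<omega> \<inter> {..s}"
  by (auto simp: JT_def jump_times_def)

lemma \<Delta>_ge_1: "\<omega> \<in> space M \<Longrightarrow> r \<in> JT i s \<omega> \<Longrightarrow> \<Delta> i r \<omega> \<ge> 1"
proof -
  assume \<omega>: "\<omega> \<in> space M" and r: "r \<in> JT i s \<omega>"
  then have "t \<le> s" by (auto simp: JT_def jump_times_def)
  then show ?thesis using counting_path_jumps[OF counting[OF \<omega>] t_nonneg] r by (auto simp: JT_def \<Delta>_def)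
qed

lemma jump_sum_interval:
  assumes \<omega>: "\<omega> \<in> space M" and ab: "t \<le> a" "a \<le> b" and s: "s \<in> {t..T}"
  shows "(\<Sum>r\<in>JT i s \<omega> \<inter> {a<..b}. \<Delta> i r \<omega>) = Nl i (min b s) \<omega> - Nl i (min a s) \<omega>"
proof -
  define a' b' where "a' = min a s" and "b' = min b s"
  have ab': "t \<le> a'" "a' \<le> b'" "b' \<le> s" "0 \<le> a'" "b' \<le> T" using ab s t_nonneg by (auto simp: a'_def b'_def)
  let ?f = "\<lambda>q. \<pi> q \<omega> $ i"
  have J: "JT i s \<omega> \<inter> {a<..b} = {r \<in> jump_times ?f a' b'. r < T}"
    using ab by (auto simp: JT_def jump_times_def a'_def b'_def)
  note cp = counting_path_jumps[OF counting[OF \<omega>, of i] ab'(4) ab'(2)]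
  show ?thesis
  proof (cases "b' < T")
    case True
    then have "{r \<in> jump_times ?f a' b'. r < T} = jump_times ?f a' b'" by (auto simp: jump_times_def)
    then show ?thesis using cp True ab' unfolding J a'_def[symmetric] b'_def[symmetric] by (simp add: Nl_def \<Delta>_def)
  next
    case False
    then have b': "b' = T" using ab' by simp
    show ?thesis
    proof (cases "a' < T")
      case True
      \<comment> \<open>With \<open>b' = T\<close> a possible jump at \<open>T\<close> has to be
        removed from the sum; the left limit in \<open>Nl\<close> is the right end value whether or
        not there is such a jump.\<close>
      have eq: "{r \<in> jump_times ?f a' b'. r < T} = jump_times ?f a' T - {T}" by (auto simp: jump_times_def b')
      have "(\<Sum>r\<in>jump_times ?f a' T - {T}. \<Delta> i r \<omega>) = left_lim ?f T - \<pi> a' \<omega> $ i"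
      proof (cases "T \<in> jump_times ?f a' T")
        case True
        have fin: "finite (jump_times ?f a' T)" using cp b' by simp
        from sum.remove[OF fin True, of "\<lambda>r. \<Delta> i r \<omega>"] cp show ?thesis by (simp add: b' \<Delta>_def)
      next
        case False
        then have "\<pi> T \<omega> $ i = left_lim ?f T" using \<open>a' < T\<close> by (auto simp: jump_times_def)
        then show ?thesis using cp False by (simp add: b' \<Delta>_def)
      qed
      then show ?thesis using True unfolding J eq a'_def[symmetric] b'_def[symmetric] by (simp add: Nl_def b')
    next
      case False
      then have "a' = T" using ab' by simp
      then show ?thesis unfolding J a'_def[symmetric] b'_def[symmetric] by (auto simp: jump_times_def b')
    qed
  qed
qed

lemma nJ_rect:
  assumes \<omega>: "\<omega> \<in> space M" and ab: "t \<le> a" "a \<le> b" and s: "s \<in> {t..T}"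
  shows "nJ i s (indicator (({a<..b} \<inter> {t..<T}) \<times> A)) \<omega>
    = indicator A \<omega> * ennreal (Nl i (min b s) \<omega> - Nl i (min a s) \<omega>)"
proof -
  have "nJ i s (indicator (({a<..b} \<inter> {t..<T}) \<times> A)) \<omega>
      = (\<Sum>r\<in>JT i s \<omega> \<inter> {a<..b}. ennreal (\<Delta> i r \<omega>) * indicator A \<omega>)"
    unfolding nJ_def using finite_JT[OF \<omega>] JT_subset[of i s \<omega>]
    by (intro sum.mono_neutral_cong_right) (auto simp: indicator_def)
  also have "\<dots> = (\<Sum>r\<in>JT i s \<omega> \<inter> {a<..b}. ennreal (\<Delta> i r \<omega>)) * indicator A \<omega>"
    by (simp add: sum_distrib_right)
  also have "(\<Sum>r\<in>JT i s \<omega> \<inter> {a<..b}. ennreal (\<Delta> i r \<omega>)) = ennreal (\<Sum>r\<in>JT i s \<omega> \<inter> {a<..b}. \<Delta> i r \<omega>)"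
    using \<Delta>_ge_1[OF \<omega>] by (intro sum_ennreal) (force intro: order_trans[of 0 1])
  finally show ?thesis unfolding jump_sum_interval[OF assms] by (simp add: mult.commute)
qed

lemma nJ_start: "nJ i s (indicator ({t} \<times> A)) \<omega> = 0"
  unfolding nJ_def using JT_subset[of i s \<omega>] by (intro sum.neutral) (auto simp: indicator_def)

lemma Nl_measurable: "u \<in> {t..s} \<Longrightarrow> s \<le> T \<Longrightarrow> Nl i u \<in> borel_measurable (F s)"
  unfolding Nl_def[abs_def]
  using \<pi>_measurable_F[of u s i] left_lim_measurable_F[of T i] t_nonneg T_pos
  by (cases "u < T") (auto intro: measurable_F_mono)

lemma Nl_AE: "AE \<omega> in M. \<forall>u\<le>T. Nl i u \<omega> = \<pi> u \<omega> $ i"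
  using poisson_no_jump_at[OF poisson[of i] T_pos] by eventually_elim (auto simp: Nl_def)

section \<open>The predictable sigma-algebra\<close>

lemma PG_Pow: "PG \<subseteq> Pow \<Omega>"
proof -
  have "A \<subseteq> space M" if "A \<in> sets (F a)" for A a using sets.sets_into_space[OF that] by simp
  then show ?thesis using t_less_T by auto
qed

lemma space_Pr [simp]: "space Pr = \<Omega>"
  unfolding predictable_sigma_def space_F by (rule space_measure_of[OF PG_Pow])

lemma sets_Pr: "sets Pr = sigma_sets \<Omega> PG"
  unfolding predictable_sigma_def space_F by (rule sets_measure_of[OF PG_Pow])

lemma Pr_rect: "t \<le> a \<Longrightarrow> A \<in> sets (F a) \<Longrightarrow> ({a<..b} \<inter> {t..<T}) \<times> A \<in> sets Pr"
proof (cases "a \<le> b")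
  case True
  assume "t \<le> a" "A \<in> sets (F a)"
  with True show ?thesis unfolding sets_Pr by (intro sigma_sets.Basic) blast
qed auto

lemma Pr_start: "A \<in> sets (F t) \<Longrightarrow> {t} \<times> A \<in> sets Pr"
  unfolding sets_Pr by (intro sigma_sets.Basic) blast

lemma PG_Int_stable: "Int_stable PG"
  unfolding Int_stable_def
proof (intro ballI)
  have empty: "{} \<in> PG"
    by (intro UnI1 CollectI exI[of _ t] exI[of _ t] exI[of _ "{}"]) auto
  fix R R' assume R: "R \<in> PG" "R' \<in> PG"
  from R(1) show "R \<inter> R' \<in> PG"
  proof
    assume "R \<in> {({a<..b} \<inter> {t..<T}) \<times> A | a b A. t \<le> a \<and> a \<le> b \<and> A \<in> sets (F a)}"
    then obtain a b A where *: "R = ({a<..b} \<inter> {t..<T}) \<times> A" "t \<le> a" "a \<le> b" "A \<in> sets (F a)" by blast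
    from R(2) show ?thesis
    proof
      assume "R' \<in> {({a<..b} \<inter> {t..<T}) \<times> A | a b A. t \<le> a \<and> a \<le> b \<and> A \<in> sets (F a)}"
      then obtain a' b' A' where **: "R' = ({a'<..b'} \<inter> {t..<T}) \<times> A'" "t \<le> a'" "a' \<le> b'" "A' \<in> sets (F a')" by blast
      \<comment> \<open>Generators demand ordered end points. The outer \<open>max\<close> in the
        upper end point ensures this also when the two intervals do not meet.\<close>
      have "R \<inter> R' = ({max a a'<..max (max a a') (min b b')} \<inter> {t..<T}) \<times> (A \<inter> A')"
        unfolding *(1) **(1) by auto
      moreover have "A \<inter> A' \<in> sets (F (max a a'))"
        using *(4) **(4) sets_F_mono[of a "max a a'"] sets_F_mono[of a' "max a a'"] by auto
      ultimately show ?thesis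
        using *(2) by (intro UnI1 CollectI exI[of _ "max a a'"] exI[of _ "max (max a a') (min b b')"] exI[of _ "A \<inter> A'"]) auto
    next
      assume "R' \<in> {{t} \<times> A | A. A \<in> sets (F t)}"
      then have "R \<inter> R' = {}" using * by auto
      then show ?thesis using empty by simp
    qed
  next
    assume "R \<in> {{t} \<times> A | A. A \<in> sets (F t)}"
    then obtain A where *: "R = {t} \<times> A" "A \<in> sets (F t)" by blast
    from R(2) show ?thesis
    proof
      assume "R' \<in> {({a<..b} \<inter> {t..<T}) \<times> A | a b A. t \<le> a \<and> a \<le> b \<and> A \<in> sets (F a)}"
      then have "R \<inter> R' = {}" using * by auto
      then show ?thesis using empty by simp
    next
      assume "R' \<in> {{t} \<times> A | A. A \<in> sets (F t)}"
      then obtain A' where **: "R' = {t} \<times> A'" "A' \<in> sets (F t)" by blast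
      have "R \<inter> R' = {t} \<times> (A \<inter> A')" unfolding *(1) **(1) by auto
      then show ?thesis using * ** by (intro UnI2) auto
    qed
  qed
qed

lemma sets_Pr_product: "sets Pr \<subseteq> sets (borel \<Otimes>\<^sub>M M)"
proof -
  have "PG \<subseteq> sets (borel \<Otimes>\<^sub>M M)"
    using sets_F_events by (auto intro!: pair_measureI)
  moreover have "\<Omega> \<in> sets (borel \<Otimes>\<^sub>M M)" by auto
  ultimately show ?thesis unfolding sets_Pr by (rule sets.sigma_sets_subset')
qed

lemma Pr_measurable_product:
  fixes H :: "real \<times> 'w \<Rightarrow> ennreal"
  assumes H: "H \<in> borel_measurable Pr"
  shows "(\<lambda>(r, \<omega>). indicator {t..<T} r * H (r, \<omega>)) \<in> borel_measurable (borel \<Otimes>\<^sub>M M)"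
proof -
  have "H \<in> borel_measurable (restrict_space (borel \<Otimes>\<^sub>M M) \<Omega>)"
  proof (rule measurableI)
    fix B :: "ennreal set" assume "B \<in> sets borel"
    then have S: "H -` B \<inter> \<Omega> \<in> sets Pr" using measurable_sets[OF H] by simp
    have "H -` B \<inter> space (restrict_space (borel \<Otimes>\<^sub>M M) \<Omega>) = \<Omega> \<inter> (H -` B \<inter> \<Omega>)"
      by (auto simp: space_restrict_space space_pair_measure)
    moreover have "\<Omega> \<inter> (H -` B \<inter> \<Omega>) \<in> sets (restrict_space (borel \<Otimes>\<^sub>M M) \<Omega>)"
      using S sets_Pr_product unfolding sets_restrict_space by blast
    ultimately show "H -` B \<inter> space (restrict_space (borel \<Otimes>\<^sub>M M) \<Omega>) \<in> sets (restrict_space (borel \<Otimes>\<^sub>M M) \<Omega>)"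
      by (simp only:)
  qed auto
  moreover have "\<Omega> \<inter> space (borel \<Otimes>\<^sub>M M) \<in> sets (borel \<Otimes>\<^sub>M M)" by auto
  ultimately have "(\<lambda>p. H p * indicator \<Omega> p) \<in> borel_measurable (borel \<Otimes>\<^sub>M M)"
    by (simp add: borel_measurable_restrict_space_iff_ennreal)
  then show ?thesis
    by (rule measurable_cong[THEN iffD1, rotated]) (auto simp: indicator_def space_pair_measure)
qed

text \<open>The increment has integer values, so its integral over a set is a series over the events
  that it equals \<open>k\<close>, and independence is applied to each of them. The same series with
  the whole space in place of \<open>A\<close> gives back the mean.\<close>

lemma nn_increment_past:
  assumes ab: "0 \<le> a" "a \<le> b" and A: "A \<in> sets (F a)"
  shows "(\<integral>\<^sup>+\<omega>. indicator A \<omega> * ennreal (\<pi> b \<omega> $ i - \<pi> a \<omega> $ i) \<partial>M) = emeasure M A * ennreal (\<theta> i * (b - a))"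
proof -
  let ?D = "\<lambda>\<omega>. \<pi> b \<omega> $ i - \<pi> a \<omega> $ i"
  have [measurable]: "(\<lambda>\<omega>. \<pi> b \<omega> $ i) \<in> borel_measurable M" "(\<lambda>\<omega>. \<pi> a \<omega> $ i) \<in> borel_measurable M" "A \<in> events"
    using ab A sets_F_events[of a] by (auto intro: \<pi>_measurable)
  have *: "(\<integral>\<^sup>+\<omega>. indicator B \<omega> * ennreal (?D \<omega>) \<partial>M)
      = (\<Sum>k. ennreal (real k) * emeasure M (B \<inter> {\<omega>\<in>space M. ?D \<omega> \<in> {real k}}))" if [measurable]: "B \<in> events" for B
  proof -
    have "(\<integral>\<^sup>+\<omega>. indicator B \<omega> * ennreal (?D \<omega>) \<partial>M)
        = (\<integral>\<^sup>+\<omega>. (\<Sum>k. ennreal (real k) * indicator (B \<inter> {\<omega>\<in>space M. ?D \<omega> \<in> {real k}}) \<omega>) \<partial>M)"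
    proof (rule nn_integral_cong)
      fix \<omega> assume \<omega>: "\<omega> \<in> space M"
      obtain k where k: "?D \<omega> = real k" using poisson_increment_Nats[OF poisson ab \<omega>] by blast
      have "(\<Sum>j. ennreal (real j) * indicator (B \<inter> {\<omega>\<in>space M. ?D \<omega> \<in> {real j}}) \<omega>)
          = (\<Sum>j\<in>{k}. ennreal (real j) * indicator (B \<inter> {\<omega>\<in>space M. ?D \<omega> \<in> {real j}}) \<omega>)"
        using k by (intro suminf_finite) (auto simp: indicator_def)
      then show "indicator B \<omega> * ennreal (?D \<omega>) = (\<Sum>k. ennreal (real k) * indicator (B \<inter> {\<omega>\<in>space M. ?D \<omega> \<in> {real k}}) \<omega>)"
        using k \<omega> by (auto simp: indicator_def)
    qed
    also have "\<dots> = (\<Sum>k. \<integral>\<^sup>+\<omega>. ennreal (real k) * indicator (B \<inter> {\<omega>\<in>space M. ?D \<omega> \<in> {real k}}) \<omega> \<partial>M)"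
      by (intro nn_integral_suminf) measurable
    also have "\<dots> = (\<Sum>k. ennreal (real k) * emeasure M (B \<inter> {\<omega>\<in>space M. ?D \<omega> \<in> {real k}}))"
      by (intro suminf_cong nn_integral_cmult_indicator) measurable
    finally show ?thesis .
  qed
  have "(\<integral>\<^sup>+\<omega>. indicator A \<omega> * ennreal (?D \<omega>) \<partial>M)
      = (\<Sum>k. emeasure M A * (ennreal (real k) * emeasure M (space M \<inter> {\<omega>\<in>space M. ?D \<omega> \<in> {real k}})))"
  proof (subst *, simp, rule suminf_cong)
    fix k
    have "emeasure M (A \<inter> {\<omega>\<in>space M. ?D \<omega> \<in> {real k}}) = emeasure M A * emeasure M {\<omega>\<in>space M. ?D \<omega> \<in> {real k}}"
      using increment_indep[OF ab A, of "{real k}" i] by (simp add: emeasure_eq_measure ennreal_mult)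
    moreover have "space M \<inter> {\<omega>\<in>space M. ?D \<omega> \<in> {real k}} = {\<omega>\<in>space M. ?D \<omega> \<in> {real k}}" by auto
    ultimately show "ennreal (real k) * emeasure M (A \<inter> {\<omega>\<in>space M. ?D \<omega> \<in> {real k}})
        = emeasure M A * (ennreal (real k) * emeasure M (space M \<inter> {\<omega>\<in>space M. ?D \<omega> \<in> {real k}}))"
      by (simp only: mult_ac)
  qed
  also have "\<dots> = emeasure M A * (\<integral>\<^sup>+\<omega>. indicator (space M) \<omega> * ennreal (?D \<omega>) \<partial>M)"
    by (subst *, simp, rule ennreal_suminf_cmult)
  also have "(\<integral>\<^sup>+\<omega>. indicator (space M) \<omega> * ennreal (?D \<omega>) \<partial>M) = (\<integral>\<^sup>+\<omega>. ennreal (?D \<omega>) \<partial>M)"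
    by (intro nn_integral_cong) simp
  also have "\<dots> = ennreal (\<theta> i * (b - a))" by (rule poisson_increment_mean[OF poisson ab])
  finally show ?thesis .
qed

text \<open>Dynkin argument over the predictable rectangles. Adaptedness and the expectation are
  proved together, since the complement and union steps need measurability in order to split
  integrals.\<close>

lemma nJ_set:
  assumes "S \<in> sets Pr"
  shows "(\<forall>s\<in>{t..T}. nJ i s (indicator S) \<in> borel_measurable (F s)) \<and>
    (\<integral>\<^sup>+\<omega>. nJ i T (indicator S) \<omega> \<partial>M) = ennreal (\<theta> i) * (\<integral>\<^sup>+\<omega>. (\<integral>\<^sup>+r. indicator S (r, \<omega>) \<partial>lborel) \<partial>M)"
  using PG_Int_stable PG_Pow assms[unfolded sets_Pr]
proof (induction S rule: sigma_sets_induct_disjoint)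
  case (basic S)
  then show ?case
  proof
    assume "S \<in> {({a<..b} \<inter> {t..<T}) \<times> A | a b A. t \<le> a \<and> a \<le> b \<and> A \<in> sets (F a)}"
    then obtain a b A where S: "S = ({a<..b} \<inter> {t..<T}) \<times> A" and ab: "t \<le> a" "a \<le> b" and A: "A \<in> sets (F a)" by blast
    have Aev: "A \<in> events" using A sets_F_events by blast
    have meas: "nJ i s (indicator S) \<in> borel_measurable (F s)" if s: "s \<in> {t..T}" for s
    proof (cases "a \<le> s")
      case True
      have "(\<lambda>\<omega>. indicator A \<omega> * ennreal (Nl i (min b s) \<omega> - Nl i (min a s) \<omega>)) \<in> borel_measurable (F s)"
        using A True sets_F_mono[OF True] ab s Nl_measurable[of "min b s" s i] Nl_measurable[of "min a s" s i]
        by (intro borel_measurable_times_ennreal borel_measurable_indicator measurable_compose[OF _ measurable_ennreal] borel_measurable_diff) auto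
      then show ?thesis
        by (rule measurable_cong[THEN iffD2, rotated]) (simp add: S nJ_rect[OF _ ab s])
    next
      case False
      then have "nJ i s (indicator S) \<omega> = 0" if "\<omega> \<in> space M" for \<omega>
        unfolding S using that ab by (subst nJ_rect[OF that ab s]) simp
      then show ?thesis by (subst measurable_cong[where g = "\<lambda>_. 0"]) auto
    qed
    have "(\<integral>\<^sup>+\<omega>. nJ i T (indicator S) \<omega> \<partial>M) = (\<integral>\<^sup>+\<omega>. indicator A \<omega> * ennreal (\<pi> (min b T) \<omega> $ i - \<pi> (min a T) \<omega> $ i) \<partial>M)"
    proof (rule nn_integral_cong_AE)
      show "AE \<omega> in M. nJ i T (indicator S) \<omega> = indicator A \<omega> * ennreal (\<pi> (min b T) \<omega> $ i - \<pi> (min a T) \<omega> $ i)"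
        using Nl_AE[of i] AE_space
      proof eventually_elim
        case (elim \<omega>)
        then show ?case unfolding S using nJ_rect[OF elim(2) ab, of T i A] t_less_T by simp
      qed
    qed
    also have "\<dots> = emeasure M A * ennreal (\<theta> i * (min b T - min a T))"
    proof (cases "a \<le> T")
      case True
      then show ?thesis using nn_increment_past[of "min a T" "min b T" A i] A ab t_nonneg by auto
    next
      case False
      then show ?thesis using ab by (simp)
    qed
    also have "\<dots> = ennreal (\<theta> i) * (ennreal (min b T - min a T) * emeasure M A)"
      using ab \<theta>_nonneg[of i] by (subst ennreal_mult) (auto simp: mult_ac)
    also have "ennreal (min b T - min a T) * emeasure M A = (\<integral>\<^sup>+\<omega>. (\<integral>\<^sup>+r. indicator S (r, \<omega>) \<partial>lborel) \<partial>M)"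
    proof -
      have "(\<integral>\<^sup>+r. indicator S (r, \<omega>) \<partial>lborel) = ennreal (min b T - min a T) * indicator A \<omega>" for \<omega>
      proof -
        have "(\<integral>\<^sup>+r. indicator S (r, \<omega>) \<partial>lborel) = (\<integral>\<^sup>+r. indicator {min a T<..min b T} r * indicator A \<omega> \<partial>lborel)"
        proof (rule nn_integral_cong_AE)
          show "AE r in lborel. indicator S (r, \<omega>) = (indicator {min a T<..min b T} r * indicator A \<omega> :: ennreal)"
            using AE_lborel_singleton[of T] by eventually_elim (use ab in \<open>auto simp: S indicator_def\<close>)
        qed
        also have "\<dots> = ennreal (min b T - min a T) * indicator A \<omega>"
          using ab by (subst nn_integral_multc) auto
        finally show ?thesis .
      qed
      then show ?thesis using Aev by (simp add: nn_integral_cmult_indicator)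
    qed
    finally show ?thesis using meas by blast
  next
    assume "S \<in> {{t} \<times> A | A. A \<in> sets (F t)}"
    then obtain A where S: "S = {t} \<times> A" by blast
    have "(\<integral>\<^sup>+r. indicator S (r, \<omega>) \<partial>lborel) = 0" for \<omega>
    proof -
      have "(\<integral>\<^sup>+r. indicator S (r, \<omega>) \<partial>lborel) = (\<integral>\<^sup>+(r::real). 0 \<partial>lborel)"
      proof (rule nn_integral_cong_AE)
        show "AE r in lborel. indicator S (r, \<omega>) = (0::ennreal)"
          using AE_lborel_singleton[of t] by eventually_elim (simp add: S indicator_def)
      qed
      then show ?thesis by simp
    qed
    then show ?thesis by (simp add: S nJ_start)
  qed
next
  case empty
  have "nJ i s (\<lambda>_. 0) = (\<lambda>_. 0)" for s by (simp add: nJ_def fun_eq_iff)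
  then show ?case by simp
next
  case (compl S)
  have S: "S \<in> sets Pr" using compl(1) by (simp add: sets_Pr)
  have [measurable]: "S \<in> sets (borel \<Otimes>\<^sub>M M)" using S sets_Pr_product by blast
  have SO: "S \<subseteq> \<Omega>" using sets.sets_into_space[OF S] by simp
  have split: "nJ i s (indicator S) \<omega> + nJ i s (indicator (\<Omega> - S)) \<omega> = ennreal (Nl i s \<omega> - Nl i t \<omega>)"
    if s: "s \<in> {t..T}" and \<omega>: "\<omega> \<in> space M" for s \<omega>
  proof -
    have "nJ i s (indicator S) \<omega> + nJ i s (indicator (\<Omega> - S)) \<omega> = nJ i s (indicator (({t<..T} \<inter> {t..<T}) \<times> space M)) \<omega>"
      unfolding nJ_def sum.distrib[symmetric] using JT_subset[of i s \<omega>] \<omega> SO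
      by (intro sum.cong) (auto simp: indicator_def)
    also have "\<dots> = ennreal (Nl i s \<omega> - Nl i t \<omega>)"
      using nJ_rect[OF \<omega> _ _ s, of t T i "space M"] t_less_T \<omega> s by (simp add: min_absorb1 min_absorb2)
    finally show ?thesis .
  qed
  \<comment> \<open>The jumps inside and outside \<open>S\<close> together have finite total size,
    so the subtraction in \<open>ennreal\<close> is legitimate.\<close>
  have diff: "nJ i s (indicator (\<Omega> - S)) \<omega> = ennreal (Nl i s \<omega> - Nl i t \<omega>) - nJ i s (indicator S) \<omega>"
    and fin: "nJ i s (indicator S) \<omega> < \<infinity>"
    if s: "s \<in> {t..T}" and \<omega>: "\<omega> \<in> space M" for s \<omega>
  proof -
    show fin: "nJ i s (indicator S) \<omega> < \<infinity>"
      using split[OF that] by (metis ennreal_less_top ennreal_add_eq_top infinity_ennreal_def less_top top.not_eq_extremum)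
    show "nJ i s (indicator (\<Omega> - S)) \<omega> = ennreal (Nl i s \<omega> - Nl i t \<omega>) - nJ i s (indicator S) \<omega>"
      using fin unfolding split[OF that, symmetric] by (simp add: add_diff_eq_iff_ennreal)
  qed
  have meas: "nJ i s (indicator (\<Omega> - S)) \<in> borel_measurable (F s)" if s: "s \<in> {t..T}" for s
  proof -
    have "(\<lambda>\<omega>. ennreal (Nl i s \<omega> - Nl i t \<omega>) - nJ i s (indicator S) \<omega>) \<in> borel_measurable (F s)"
      using s compl(2) Nl_measurable[of s s i] Nl_measurable[of t s i]
      by (intro borel_measurable_minus_ennreal measurable_compose[OF _ measurable_ennreal] borel_measurable_diff) auto
    then show ?thesis
      by (rule measurable_cong[THEN iffD2, rotated]) (simp add: diff[OF s])
  qed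
  have m1: "nJ i T (indicator S) \<in> borel_measurable M" "nJ i T (indicator (\<Omega> - S)) \<in> borel_measurable M"
    using compl(2) meas[of T] t_less_T by (auto intro!: measurable_F_M[where s = T])
  have "(\<integral>\<^sup>+\<omega>. nJ i T (indicator S) \<omega> \<partial>M) + (\<integral>\<^sup>+\<omega>. nJ i T (indicator (\<Omega> - S)) \<omega> \<partial>M)
      = (\<integral>\<^sup>+\<omega>. ennreal (\<pi> T \<omega> $ i - \<pi> t \<omega> $ i) \<partial>M)"
  proof -
    have "(\<integral>\<^sup>+\<omega>. nJ i T (indicator S) \<omega> \<partial>M) + (\<integral>\<^sup>+\<omega>. nJ i T (indicator (\<Omega> - S)) \<omega> \<partial>M)
       = (\<integral>\<^sup>+\<omega>. nJ i T (indicator S) \<omega> + nJ i T (indicator (\<Omega> - S)) \<omega> \<partial>M)"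
      by (rule nn_integral_add[OF m1, symmetric])
    also have "\<dots> = (\<integral>\<^sup>+\<omega>. ennreal (\<pi> T \<omega> $ i - \<pi> t \<omega> $ i) \<partial>M)"
    proof (rule nn_integral_cong_AE)
      show "AE \<omega> in M. nJ i T (indicator S) \<omega> + nJ i T (indicator (\<Omega> - S)) \<omega> = ennreal (\<pi> T \<omega> $ i - \<pi> t \<omega> $ i)"
        using Nl_AE[of i] AE_space by eventually_elim (use split[of T] t_less_T in auto)
    qed
    finally show ?thesis .
  qed
  also have "\<dots> = ennreal (\<theta> i * (T - t))"
    using t_nonneg t_less_T by (intro poisson_increment_mean[OF poisson]) auto
  finally have L: "(\<integral>\<^sup>+\<omega>. nJ i T (indicator S) \<omega> \<partial>M) + (\<integral>\<^sup>+\<omega>. nJ i T (indicator (\<Omega> - S)) \<omega> \<partial>M) = ennreal (\<theta> i * (T - t))" .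
  have "(\<integral>\<^sup>+\<omega>. (\<integral>\<^sup>+r. indicator S (r, \<omega>) \<partial>lborel) \<partial>M) + (\<integral>\<^sup>+\<omega>. (\<integral>\<^sup>+r. indicator (\<Omega> - S) (r, \<omega>) \<partial>lborel) \<partial>M)
      = (\<integral>\<^sup>+\<omega>. (\<integral>\<^sup>+r. indicator S (r, \<omega>) + indicator (\<Omega> - S) (r, \<omega>) \<partial>lborel) \<partial>M)"
    by (subst nn_integral_add[symmetric]) (auto intro!: nn_integral_cong nn_integral_add[symmetric])
  also have "\<dots> = (\<integral>\<^sup>+\<omega>. (\<integral>\<^sup>+r. indicator {t..<T} r \<partial>lborel) \<partial>M)"
    using SO by (intro nn_integral_cong) (auto simp: indicator_def)
  also have "\<dots> = ennreal (T - t)" using t_less_T by (simp add: emeasure_space_1)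
  finally have R: "(\<integral>\<^sup>+\<omega>. (\<integral>\<^sup>+r. indicator S (r, \<omega>) \<partial>lborel) \<partial>M) + (\<integral>\<^sup>+\<omega>. (\<integral>\<^sup>+r. indicator (\<Omega> - S) (r, \<omega>) \<partial>lborel) \<partial>M)
      = ennreal (T - t)" .
  have "(\<integral>\<^sup>+\<omega>. nJ i T (indicator S) \<omega> \<partial>M) + (\<integral>\<^sup>+\<omega>. nJ i T (indicator (\<Omega> - S)) \<omega> \<partial>M)
      = ennreal (\<theta> i) * ((\<integral>\<^sup>+\<omega>. (\<integral>\<^sup>+r. indicator S (r, \<omega>) \<partial>lborel) \<partial>M) + (\<integral>\<^sup>+\<omega>. (\<integral>\<^sup>+r. indicator (\<Omega> - S) (r, \<omega>) \<partial>lborel) \<partial>M))"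
    unfolding L R using \<theta>_nonneg t_less_T by (intro ennreal_mult) auto
  also have "\<dots> = (\<integral>\<^sup>+\<omega>. nJ i T (indicator S) \<omega> \<partial>M) + ennreal (\<theta> i) * (\<integral>\<^sup>+\<omega>. (\<integral>\<^sup>+r. indicator (\<Omega> - S) (r, \<omega>) \<partial>lborel) \<partial>M)"
    using compl(2) by (simp add: distrib_left)
  finally have "(\<integral>\<^sup>+\<omega>. nJ i T (indicator (\<Omega> - S)) \<omega> \<partial>M) = ennreal (\<theta> i) * (\<integral>\<^sup>+\<omega>. (\<integral>\<^sup>+r. indicator (\<Omega> - S) (r, \<omega>) \<partial>lborel) \<partial>M)"
  proof -
    \<comment> \<open>Cancelling a summand in \<open>ennreal\<close> needs it to be finite, which
      the total mean \<open>\<theta> i * (T - t)\<close> provides.\<close>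
    have "(\<integral>\<^sup>+\<omega>. nJ i T (indicator S) \<omega> \<partial>M) \<noteq> \<infinity>"
      using L by (metis ennreal_add_eq_top ennreal_neq_top infinity_ennreal_def)
    then show "(\<integral>\<^sup>+\<omega>. nJ i T (indicator S) \<omega> \<partial>M) + (\<integral>\<^sup>+\<omega>. nJ i T (indicator (\<Omega> - S)) \<omega> \<partial>M)
        = (\<integral>\<^sup>+\<omega>. nJ i T (indicator S) \<omega> \<partial>M) + ennreal (\<theta> i) * (\<integral>\<^sup>+\<omega>. (\<integral>\<^sup>+r. indicator (\<Omega> - S) (r, \<omega>) \<partial>lborel) \<partial>M) \<Longrightarrow> ?thesis"
      by (simp add: ennreal_add_left_cancel)
  qed
  then show ?case using meas by blast
next
  case (union S)
  have S: "S n \<in> sets Pr" for n using union(2) by (auto simp: sets_Pr)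
  have [measurable]: "S n \<in> sets (borel \<Otimes>\<^sub>M M)" for n using S sets_Pr_product by blast
  have eq: "nJ i s (indicator (\<Union>n. S n)) \<omega> = (\<Sum>n. nJ i s (indicator (S n)) \<omega>)" for s \<omega>
    unfolding nJ_def suminf_indicator[OF union(1), symmetric]
    by (subst suminf_sum) (auto simp: ennreal_suminf_cmult)
  have "(\<integral>\<^sup>+\<omega>. nJ i T (indicator (\<Union>n. S n)) \<omega> \<partial>M) = (\<Sum>n. \<integral>\<^sup>+\<omega>. nJ i T (indicator (S n)) \<omega> \<partial>M)"
    unfolding eq using union(3) t_less_T by (intro nn_integral_suminf measurable_F_M[where s = T]) auto
  also have "\<dots> = (\<Sum>n. ennreal (\<theta> i) * (\<integral>\<^sup>+\<omega>. (\<integral>\<^sup>+r. indicator (S n) (r, \<omega>) \<partial>lborel) \<partial>M))"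
    using union(3) by simp
  also have "\<dots> = ennreal (\<theta> i) * (\<integral>\<^sup>+\<omega>. (\<Sum>n. \<integral>\<^sup>+r. indicator (S n) (r, \<omega>) \<partial>lborel) \<partial>M)"
    by (subst nn_integral_suminf) (auto simp: ennreal_suminf_cmult)
  also have "(\<integral>\<^sup>+\<omega>. (\<Sum>n. \<integral>\<^sup>+r. indicator (S n) (r, \<omega>) \<partial>lborel) \<partial>M) = (\<integral>\<^sup>+\<omega>. (\<integral>\<^sup>+r. indicator (\<Union>n. S n) (r, \<omega>) \<partial>lborel) \<partial>M)"
    unfolding suminf_indicator[OF union(1), symmetric]
    by (intro nn_integral_cong nn_integral_suminf[symmetric]) measurable
  finally show ?case
    unfolding eq using union(3) by (intro conjI ballI borel_measurable_suminf_order) auto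
qed

text \<open>Monotone class extension of \<open>nJ_set\<close> from indicators. For a fixed outcome
  \<open>nJ\<close> is a finite sum, so it commutes with suprema of increasing sequences.\<close>

lemma nJ_fun:
  assumes "H \<in> borel_measurable Pr"
  shows "(\<forall>s\<in>{t..T}. nJ i s H \<in> borel_measurable (F s)) \<and>
    (\<integral>\<^sup>+\<omega>. nJ i T H \<omega> \<partial>M)
      = ennreal (\<theta> i) * (\<integral>\<^sup>+\<omega>. (\<integral>\<^sup>+r. indicator {t..<T} r * H (r, \<omega>) \<partial>lborel) \<partial>M)"
  using assms
proof (induction H rule: borel_measurable_induct)
  case (cong f g)
  have eq: "nJ i s f \<omega> = nJ i s g \<omega>" if "\<omega> \<in> space M" for s \<omega>
    unfolding nJ_def using JT_subset[of i s \<omega>] that cong(3) by (intro sum.cong) auto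
  have "nJ i s f \<in> borel_measurable (F s)" if "s \<in> {t..T}" for s
    using cong(4) that by (subst measurable_cong[where g = "nJ i s g"]) (auto simp: eq)
  moreover have "(\<integral>\<^sup>+\<omega>. nJ i T f \<omega> \<partial>M) = (\<integral>\<^sup>+\<omega>. nJ i T g \<omega> \<partial>M)"
    by (intro nn_integral_cong eq)
  moreover have "(\<integral>\<^sup>+\<omega>. (\<integral>\<^sup>+r. indicator {t..<T} r * f (r, \<omega>) \<partial>lborel) \<partial>M)
      = (\<integral>\<^sup>+\<omega>. (\<integral>\<^sup>+r. indicator {t..<T} r * g (r, \<omega>) \<partial>lborel) \<partial>M)"
    using cong(3) by (intro nn_integral_cong) (auto simp: indicator_def)
  ultimately show ?case using cong(4) by simp
next
  case (set A)
  have "indicator {t..<T} r * indicator A (r, \<omega>) = (indicator A (r, \<omega>) :: ennreal)" for r \<omega>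
    using sets.sets_into_space[OF set] by (auto simp: indicator_def)
  then show ?case using nJ_set[OF set, of i] by simp
next
  case (mult u c)
  note [measurable] = Pr_measurable_product[OF mult(2)]
  have eq: "nJ i s (\<lambda>x. c * u x) \<omega> = c * nJ i s u \<omega>" for s \<omega>
    unfolding nJ_def by (simp add: sum_distrib_left mult_ac)
  have "(\<integral>\<^sup>+\<omega>. nJ i T (\<lambda>x. c * u x) \<omega> \<partial>M) = c * (\<integral>\<^sup>+\<omega>. nJ i T u \<omega> \<partial>M)"
    unfolding eq using mult(4) t_less_T by (intro nn_integral_cmult measurable_F_M[where s = T]) auto
  moreover have "(\<integral>\<^sup>+\<omega>. (\<integral>\<^sup>+r. indicator {t..<T} r * (c * u (r, \<omega>)) \<partial>lborel) \<partial>M)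
      = (\<integral>\<^sup>+\<omega>. (\<integral>\<^sup>+r. c * (indicator {t..<T} r * u (r, \<omega>)) \<partial>lborel) \<partial>M)"
    by (simp add: mult_ac)
  moreover have "\<dots> = (\<integral>\<^sup>+\<omega>. c * (\<integral>\<^sup>+r. indicator {t..<T} r * u (r, \<omega>) \<partial>lborel) \<partial>M)"
    by (intro nn_integral_cong nn_integral_cmult) measurable
  moreover have "\<dots> = c * (\<integral>\<^sup>+\<omega>. (\<integral>\<^sup>+r. indicator {t..<T} r * u (r, \<omega>) \<partial>lborel) \<partial>M)"
    by (intro nn_integral_cmult) measurable
  ultimately show ?case
    unfolding eq using mult(4) by (auto simp: mult_ac intro!: borel_measurable_times_ennreal)
next
  case (add u v)
  note [measurable] = Pr_measurable_product[OF add(1)] Pr_measurable_product[OF add(3)]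
  have eq: "nJ i s (\<lambda>x. v x + u x) \<omega> = nJ i s v \<omega> + nJ i s u \<omega>" for s \<omega>
    unfolding nJ_def by (simp add: sum.distrib distrib_left)
  have "(\<integral>\<^sup>+\<omega>. nJ i T (\<lambda>x. v x + u x) \<omega> \<partial>M) = (\<integral>\<^sup>+\<omega>. nJ i T v \<omega> \<partial>M) + (\<integral>\<^sup>+\<omega>. nJ i T u \<omega> \<partial>M)"
    unfolding eq using add t_less_T by (intro nn_integral_add measurable_F_M[where s = T]) auto
  moreover have "(\<integral>\<^sup>+\<omega>. (\<integral>\<^sup>+r. indicator {t..<T} r * (v (r, \<omega>) + u (r, \<omega>)) \<partial>lborel) \<partial>M)
      = (\<integral>\<^sup>+\<omega>. (\<integral>\<^sup>+r. indicator {t..<T} r * v (r, \<omega>) \<partial>lborel) + (\<integral>\<^sup>+r. indicator {t..<T} r * u (r, \<omega>) \<partial>lborel) \<partial>M)"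
    unfolding distrib_left by (intro nn_integral_cong nn_integral_add) measurable
  moreover have "\<dots> = (\<integral>\<^sup>+\<omega>. (\<integral>\<^sup>+r. indicator {t..<T} r * v (r, \<omega>) \<partial>lborel) \<partial>M) + (\<integral>\<^sup>+\<omega>. (\<integral>\<^sup>+r. indicator {t..<T} r * u (r, \<omega>) \<partial>lborel) \<partial>M)"
    by (intro nn_integral_add) measurable
  ultimately show ?case
    unfolding eq using add by (auto simp: distrib_left intro!: borel_measurable_add)
next
  case (seq U)
  note [measurable] = Pr_measurable_product[OF seq(1)]
  have inc: "incseq (\<lambda>n. U n x)" for x using seq(3) by (cases x) (auto simp: incseq_def le_fun_def)
  have eq: "nJ i s (Sup (range U)) \<omega> = (SUP n. nJ i s (U n) \<omega>)" for s \<omega>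
  proof -
    have "nJ i s (Sup (range U)) \<omega> = (\<Sum>r\<in>JT i s \<omega>. SUP n. ennreal (\<Delta> i r \<omega>) * U n (r, \<omega>))"
      unfolding nJ_def by (simp add: SUP_mult_left_ennreal image_comp)
    also have "\<dots> = (SUP n. nJ i s (U n) \<omega>)"
      unfolding nJ_def using inc
      by (intro ennreal_SUP_sum[symmetric]) (auto simp: incseq_def intro!: mult_left_mono)
    finally show ?thesis .
  qed
  have incJ: "incseq (\<lambda>n. nJ i T (U n))"
    using inc unfolding incseq_def le_fun_def nJ_def by (intro allI impI sum_mono mult_left_mono) auto
  have "(\<integral>\<^sup>+\<omega>. nJ i T (Sup (range U)) \<omega> \<partial>M) = (SUP n. \<integral>\<^sup>+\<omega>. nJ i T (U n) \<omega> \<partial>M)"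
    unfolding eq using seq(5) t_less_T
    by (intro nn_integral_monotone_convergence_SUP incJ measurable_F_M[where s = T]) auto
  moreover have "(\<integral>\<^sup>+\<omega>. (\<integral>\<^sup>+r. indicator {t..<T} r * (Sup (range U)) (r, \<omega>) \<partial>lborel) \<partial>M)
      = (\<integral>\<^sup>+\<omega>. (SUP n. \<integral>\<^sup>+r. indicator {t..<T} r * U n (r, \<omega>) \<partial>lborel) \<partial>M)"
  proof (rule nn_integral_cong)
    fix \<omega> assume [measurable]: "\<omega> \<in> space M"
    have "(\<integral>\<^sup>+r. indicator {t..<T} r * (Sup (range U)) (r, \<omega>) \<partial>lborel) = (\<integral>\<^sup>+r. (SUP n. indicator {t..<T} r * U n (r, \<omega>)) \<partial>lborel)"
      by (intro nn_integral_cong) (simp add: SUP_mult_left_ennreal image_comp)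
    also have "\<dots> = (SUP n. \<integral>\<^sup>+r. indicator {t..<T} r * U n (r, \<omega>) \<partial>lborel)"
      using inc by (intro nn_integral_monotone_convergence_SUP)
        (auto simp: incseq_def le_fun_def intro!: mult_left_mono)
    finally show "(\<integral>\<^sup>+r. indicator {t..<T} r * (Sup (range U)) (r, \<omega>) \<partial>lborel) = (SUP n. \<integral>\<^sup>+r. indicator {t..<T} r * U n (r, \<omega>) \<partial>lborel)" .
  qed
  moreover have "\<dots> = (SUP n. \<integral>\<^sup>+\<omega>. (\<integral>\<^sup>+r. indicator {t..<T} r * U n (r, \<omega>) \<partial>lborel) \<partial>M)"
    using inc by (intro nn_integral_monotone_convergence_SUP)
      (auto simp: incseq_def le_fun_def intro!: nn_integral_mono mult_left_mono)
  ultimately show ?case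
    unfolding eq using seq(5) by (auto simp: SUP_mult_left_ennreal intro!: borel_measurable_SUP)
qed

lemma jS_eq_nJ:
  assumes "\<omega> \<in> space M"
  shows "ennreal (jS i s (\<lambda>r \<omega>. max 0 (H r \<omega>)) \<omega>) = nJ i s (\<lambda>(r, \<omega>). ennreal (H r \<omega>)) \<omega>"
proof -
  have \<Delta>0: "\<Delta> i r \<omega> \<ge> 0" if "r \<in> JT i s \<omega>" for r using \<Delta>_ge_1[OF assms that] by simp
  have "nJ i s (\<lambda>(r, \<omega>). ennreal (H r \<omega>)) \<omega> = (\<Sum>r\<in>JT i s \<omega>. ennreal (max 0 (H r \<omega>) * \<Delta> i r \<omega>))"
    unfolding nJ_def using \<Delta>0 by (intro sum.cong) (auto simp: ennreal_mult max_def ennreal_neg mult.commute)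
  also have "\<dots> = ennreal (jS i s (\<lambda>r \<omega>. max 0 (H r \<omega>)) \<omega>)"
    unfolding jS_def using \<Delta>0 by (intro sum_ennreal) auto
  finally show ?thesis by simp
qed

lemma jS_nonneg: "\<omega> \<in> space M \<Longrightarrow> (\<And>r. H r \<omega> \<ge> 0) \<Longrightarrow> jS i s H \<omega> \<ge> 0"
  unfolding jS_def using \<Delta>_ge_1[of \<omega> _ i s] by (intro sum_nonneg mult_nonneg_nonneg) (auto intro: order_trans[of 0 1])

lemma jS_pos_neg: "jS i s H \<omega> = jS i s (\<lambda>r \<omega>. max 0 (H r \<omega>)) \<omega> - jS i s (\<lambda>r \<omega>. max 0 (- H r \<omega>)) \<omega>"
  unfolding jS_def sum_subtractf[symmetric] by (intro sum.cong) (auto simp: max_def)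

lemma Pr_ennreal:
  "(\<lambda>(r, \<omega>). H r \<omega> :: real) \<in> borel_measurable Pr \<Longrightarrow> (\<lambda>(r, \<omega>). ennreal (H r \<omega>)) \<in> borel_measurable Pr"
  using measurable_compose[OF _ measurable_ennreal] by (simp add: case_prod_beta' comp_def)

lemma jS_measurable:
  assumes H: "(\<lambda>(r, \<omega>). H r \<omega>) \<in> borel_measurable Pr" and s: "s \<in> {t..T}"
  shows "jS i s H \<in> borel_measurable (F s)"
proof -
  have pos: "jS i s (\<lambda>r \<omega>. max 0 (H r \<omega>)) \<in> borel_measurable (F s)"
    if H: "(\<lambda>(r, \<omega>). H r \<omega>) \<in> borel_measurable Pr" for H
  proof -
    have "(\<lambda>\<omega>. enn2real (nJ i s (\<lambda>(r, \<omega>). ennreal (H r \<omega>)) \<omega>)) \<in> borel_measurable (F s)"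
      using nJ_fun[OF Pr_ennreal[OF H], of i] s by (intro borel_measurable_enn2real) auto
    then show ?thesis
      by (rule measurable_cong[THEN iffD1, rotated])
        (auto simp: jS_eq_nJ[symmetric] intro!: jS_nonneg enn2real_ennreal)
  qed
  have "(\<lambda>(r, \<omega>). - H r \<omega>) \<in> borel_measurable Pr"
    using borel_measurable_uminus[OF H] by (simp add: case_prod_beta')
  from pos[OF H] pos[OF this] show ?thesis
    by (subst jS_pos_neg[abs_def]) (intro borel_measurable_diff)
qed

text \<open>Both parts of \<open>H\<close> are treated by \<open>nJ_fun\<close>; the finite integral
  of the absolute value makes the two expectations finite, so that they may be subtracted.\<close>

lemma jS_compensation:
  assumes H: "(\<lambda>(r, \<omega>). H r \<omega>) \<in> borel_measurable Pr"
    and fin: "(\<integral>\<^sup>+\<omega>. (\<integral>\<^sup>+r. indicator {t..<T} r * ennreal \<bar>H r \<omega>\<bar> \<partial>lborel) \<partial>M) < \<infinity>"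
  shows "integrable M (jS i T H)"
    and "integrable M (\<lambda>\<omega>. LINT r:{t..<T}|lborel. H r \<omega>)"
    and "AE \<omega> in M. set_integrable lborel {t..<T} (\<lambda>r. H r \<omega>)"
    and "expectation (jS i T H) = \<theta> i * expectation (\<lambda>\<omega>. LINT r:{t..<T}|lborel. H r \<omega>)"
proof -
  interpret pair: pair_sigma_finite lborel M ..
  let ?K = "\<lambda>(r, \<omega>). indicator {t..<T} r * H r \<omega>"
  let ?L = "lborel \<Otimes>\<^sub>M M"
  have Hm: "(\<lambda>(r, \<omega>). - H r \<omega>) \<in> borel_measurable Pr"
    using borel_measurable_uminus[OF H] by (simp add: case_prod_beta')
  have Kp: "(\<lambda>(r, \<omega>). indicator {t..<T} r * ennreal (H r \<omega>)) \<in> borel_measurable (borel \<Otimes>\<^sub>M M)"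
    and Kn: "(\<lambda>(r, \<omega>). indicator {t..<T} r * ennreal (- H r \<omega>)) \<in> borel_measurable (borel \<Otimes>\<^sub>M M)"
    using Pr_measurable_product[OF Pr_ennreal[OF H]] Pr_measurable_product[OF Pr_ennreal[OF Hm]] by simp_all
  \<comment> \<open>\<open>Pr_measurable_product\<close> speaks of functions with values in
    \<open>ennreal\<close>; the real integrand is recovered as the difference of its two
    parts.\<close>
  have Keq: "?K = (\<lambda>p. enn2real ((\<lambda>(r, \<omega>). indicator {t..<T} r * ennreal (H r \<omega>)) p)
      - enn2real ((\<lambda>(r, \<omega>). indicator {t..<T} r * ennreal (- H r \<omega>)) p))"
  proof (rule ext, clarify)
    fix r \<omega>
    show "indicator {t..<T} r * H r \<omega> = enn2real (indicator {t..<T} r * ennreal (H r \<omega>)) - enn2real (indicator {t..<T} r * ennreal (- H r \<omega>))"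
      by (cases "H r \<omega> \<ge> 0") (auto simp: indicator_def ennreal_neg)
  qed
  have Kb: "?K \<in> borel_measurable (borel \<Otimes>\<^sub>M M)"
    unfolding Keq using Kp Kn by (intro borel_measurable_diff borel_measurable_enn2real)
  then have K [measurable]: "?K \<in> borel_measurable ?L" by simp
  have Km [measurable]: "(\<lambda>(r, \<omega>). indicator {t..<T} r * ennreal (H r \<omega>)) \<in> borel_measurable ?L"
    "(\<lambda>(r, \<omega>). indicator {t..<T} r * ennreal (- H r \<omega>)) \<in> borel_measurable ?L"
    using Kp Kn by simp_all
  have swap: "(\<integral>\<^sup>+p. g p \<partial>?L) = (\<integral>\<^sup>+\<omega>. (\<integral>\<^sup>+r. g (r, \<omega>) \<partial>lborel) \<partial>M)" if "g \<in> borel_measurable ?L" for g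
    by (rule pair.nn_integral_snd[OF that, symmetric])
  have absI: "(\<integral>\<^sup>+p. ennreal (norm (?K p)) \<partial>?L) = (\<integral>\<^sup>+\<omega>. (\<integral>\<^sup>+r. indicator {t..<T} r * ennreal \<bar>H r \<omega>\<bar> \<partial>lborel) \<partial>M)"
    by (subst swap, measurable) (auto intro!: nn_integral_cong simp: indicator_def abs_mult)
  have intK: "integrable ?L ?K" using fin absI by (intro integrableI_bounded K) simp
  have "AE \<omega> in M. integrable lborel (\<lambda>r. ?K (r, \<omega>))"
    using pair.AE_integrable_snd[of "\<lambda>r \<omega>. ?K (r, \<omega>)"] intK by simp
  then show "AE \<omega> in M. set_integrable lborel {t..<T} (\<lambda>r. H r \<omega>)"
    by eventually_elim (simp add: set_integrable_def)
  have LI: "(LINT r:{t..<T}|lborel. H r \<omega>) = (\<integral>r. ?K (r, \<omega>) \<partial>lborel)" for \<omega>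
    by (simp add: set_lebesgue_integral_def)
  show "integrable M (\<lambda>\<omega>. LINT r:{t..<T}|lborel. H r \<omega>)"
    unfolding LI using pair.integrable_snd[of "\<lambda>r \<omega>. ?K (r, \<omega>)"] intK by simp
  have EL: "expectation (\<lambda>\<omega>. LINT r:{t..<T}|lborel. H r \<omega>) = (\<integral>p. ?K p \<partial>?L)"
    unfolding LI using pair.integral_snd[of "\<lambda>r \<omega>. ?K (r, \<omega>)"] intK by simp
  let ?p = "\<lambda>H \<omega>. jS i T (\<lambda>r \<omega>. max 0 (H r \<omega>)) \<omega>"
  have part: "integrable M (?p G) \<and> expectation (?p G) = \<theta> i * enn2real (\<integral>\<^sup>+p. ennreal ((\<lambda>(r, \<omega>). indicator {t..<T} r * G r \<omega>) p) \<partial>?L)"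
    if G: "(\<lambda>(r, \<omega>). G r \<omega>) \<in> borel_measurable Pr" and le: "\<And>r \<omega>. G r \<omega> \<le> \<bar>H r \<omega>\<bar>"
     and Gm: "(\<lambda>(r, \<omega>). indicator {t..<T} r * G r \<omega>) \<in> borel_measurable ?L" for G :: "real \<Rightarrow> 'w \<Rightarrow> real"
  proof -
    have I: "(\<integral>\<^sup>+p. ennreal ((\<lambda>(r, \<omega>). indicator {t..<T} r * G r \<omega>) p) \<partial>?L)
        = (\<integral>\<^sup>+\<omega>. (\<integral>\<^sup>+r. indicator {t..<T} r * ennreal (G r \<omega>) \<partial>lborel) \<partial>M)"
      using Gm by (subst swap) (auto intro!: nn_integral_cong simp: indicator_def)
    have "(\<integral>\<^sup>+\<omega>. (\<integral>\<^sup>+r. indicator {t..<T} r * ennreal (G r \<omega>) \<partial>lborel) \<partial>M)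
        \<le> (\<integral>\<^sup>+\<omega>. (\<integral>\<^sup>+r. indicator {t..<T} r * ennreal \<bar>H r \<omega>\<bar> \<partial>lborel) \<partial>M)"
      using le by (intro nn_integral_mono mult_left_mono ennreal_leI) auto
    then have finG: "(\<integral>\<^sup>+\<omega>. (\<integral>\<^sup>+r. indicator {t..<T} r * ennreal (G r \<omega>) \<partial>lborel) \<partial>M) < \<infinity>"
      using fin by (rule le_less_trans)
    have N: "(\<integral>\<^sup>+\<omega>. ennreal (?p G \<omega>) \<partial>M) = ennreal (\<theta> i) * (\<integral>\<^sup>+\<omega>. (\<integral>\<^sup>+r. indicator {t..<T} r * ennreal (G r \<omega>) \<partial>lborel) \<partial>M)"
    proof -
      have "(\<integral>\<^sup>+\<omega>. ennreal (?p G \<omega>) \<partial>M) = (\<integral>\<^sup>+\<omega>. nJ i T (\<lambda>(r, \<omega>). ennreal (G r \<omega>)) \<omega> \<partial>M)"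
        by (intro nn_integral_cong jS_eq_nJ)
      then show ?thesis using nJ_fun[OF Pr_ennreal[OF G], of i] by simp
    qed
    have meas: "?p G \<in> borel_measurable M"
    proof -
      have "(\<lambda>(r, \<omega>). max 0 (G r \<omega>)) \<in> borel_measurable Pr"
        using borel_measurable_max[OF borel_measurable_const G, of 0] by (simp add: case_prod_beta' max.commute)
      from jS_measurable[OF this, of T i] t_less_T show ?thesis by (intro measurable_F_M[where s = T]) auto
    qed
    have nn: "AE \<omega> in M. 0 \<le> ?p G \<omega>" by (intro AE_I2 jS_nonneg) auto
    have "integrable M (?p G)"
      using N finG meas nn by (intro integrableI_nonneg) (auto simp: ennreal_mult_less_top)
    moreover have "expectation (?p G) = enn2real (\<integral>\<^sup>+\<omega>. ennreal (?p G \<omega>) \<partial>M)"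
      by (rule integral_eq_nn_integral[OF meas nn])
    ultimately show ?thesis unfolding N I using \<theta>_nonneg by (simp add: enn2real_mult)
  qed
  have K' [measurable]: "(\<lambda>(r, \<omega>). indicator {t..<T} r * - H r \<omega>) \<in> borel_measurable ?L"
    using borel_measurable_uminus[OF K] by (simp add: case_prod_beta')
  have p1: "integrable M (?p H)" "expectation (?p H) = \<theta> i * enn2real (\<integral>\<^sup>+p. ennreal (?K p) \<partial>?L)"
    using part[OF H] K by auto
  have p2: "integrable M (?p (\<lambda>r \<omega>. - H r \<omega>))"
    "expectation (?p (\<lambda>r \<omega>. - H r \<omega>)) = \<theta> i * enn2real (\<integral>\<^sup>+p. ennreal (- ?K p) \<partial>?L)"
  proof -
    have "(\<integral>\<^sup>+p. ennreal (- ?K p) \<partial>?L) = (\<integral>\<^sup>+p. ennreal ((\<lambda>(r, \<omega>). indicator {t..<T} r * - H r \<omega>) p) \<partial>?L)"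
      by (intro nn_integral_cong) auto
    then show "integrable M (?p (\<lambda>r \<omega>. - H r \<omega>))"
      "expectation (?p (\<lambda>r \<omega>. - H r \<omega>)) = \<theta> i * enn2real (\<integral>\<^sup>+p. ennreal (- ?K p) \<partial>?L)"
      using part[OF Hm _ K'] by auto
  qed
  show "integrable M (jS i T H)"
    by (subst jS_pos_neg[abs_def]) (intro Bochner_Integration.integrable_diff p1 p2)
  have "expectation (jS i T H) = expectation (?p H) - expectation (?p (\<lambda>r \<omega>. - H r \<omega>))"
    by (subst jS_pos_neg[abs_def]) (intro Bochner_Integration.integral_diff p1 p2)
  then show "expectation (jS i T H) = \<theta> i * expectation (\<lambda>\<omega>. LINT r:{t..<T}|lborel. H r \<omega>)"
    unfolding EL p1 p2 real_lebesgue_integral_def[OF intK] by (simp add: right_diff_distrib)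
qed

subsection \<open>Predictability and progressive measurability\<close>

lemma Pr_rect_mult:
  fixes y :: "'w \<Rightarrow> real"
  assumes R: "R \<times> space M \<in> sets Pr" and y: "\<And>B. B \<in> sets borel \<Longrightarrow> R \<times> (y -` B \<inter> space M) \<in> sets Pr"
  shows "(\<lambda>(s, \<omega>). indicator R s * y \<omega>) \<in> borel_measurable Pr"
proof (rule measurableI)
  fix B :: "real set" assume B: "B \<in> sets borel"
  have sub: "R \<times> space M \<subseteq> \<Omega>" using sets.sets_into_space[OF R] by simp
  have "(\<lambda>(s, \<omega>). indicator R s * y \<omega>) -` B \<inter> space Pr
      = R \<times> (y -` B \<inter> space M) \<union> (if 0 \<in> B then space Pr - R \<times> space M else {})"
  proof (intro set_eqI, clarify)
    fix s \<omega>
    show "(s, \<omega>) \<in> (\<lambda>(s, \<omega>). indicator R s * y \<omega>) -` B \<inter> space Pr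
      \<longleftrightarrow> (s, \<omega>) \<in> R \<times> (y -` B \<inter> space M) \<union> (if 0 \<in> B then space Pr - R \<times> space M else {})"
      using sub by (cases "s \<in> R") auto
  qed
  moreover have "(if 0 \<in> B then space Pr - R \<times> space M else {}) \<in> sets Pr"
    using R by (simp add: sets.compl_sets del: space_Pr)
  ultimately show "(\<lambda>(s, \<omega>). indicator R s * y \<omega>) -` B \<inter> space Pr \<in> sets Pr" using y[OF B] by simp
qed simp

text \<open>A process of left limits of an adapted process is a pointwise limit of step processes
  that freeze \<open>Y\<close> at the left end of each grid cell. The grid points used at time
  \<open>s\<close> lie strictly to the left of \<open>s\<close> and tend to it.\<close>

lemma predictable_left_limit:
  fixes Y Z :: "real \<Rightarrow> 'w \<Rightarrow> real"
  assumes Y: "\<And>s. s \<in> {t..<T} \<Longrightarrow> Y s \<in> borel_measurable (F s)"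
    and Zt: "\<And>\<omega>. \<omega> \<in> space M \<Longrightarrow> Z t \<omega> = Y t \<omega>"
    and Z: "\<And>s \<omega>. s \<in> {t<..<T} \<Longrightarrow> \<omega> \<in> space M \<Longrightarrow> ((\<lambda>q. Y q \<omega>) \<longlongrightarrow> Z s \<omega>) (at_left s)"
  shows "(\<lambda>(s, \<omega>). Z s \<omega>) \<in> borel_measurable Pr"
proof -
  define g where "g n k = t + real k * (T - t) / real (Suc n)" for n k :: nat
  \<comment> \<open>On the cell from \<open>g n k\<close> to \<open>g n (Suc k)\<close> the value is
    known at time \<open>g n k\<close>, which makes the summand predictable. The start
    \<open>t\<close> gets its own term because the cells are open on the left.\<close>
  define Zn where "Zn n p = indicator {t} (fst p) * Y t (snd p)
      + (\<Sum>k<Suc n. indicator ({g n k<..g n (Suc k)} \<inter> {t..<T}) (fst p) * Y (g n k) (snd p))" for n p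
  have gt: "t \<le> g n k" for n k using t_less_T by (simp add: g_def)
  have gT: "g n k < T" if "k < Suc n" for n k
  proof -
    have "real k / real (Suc n) * (T - t) < 1 * (T - t)"
      using that t_less_T by (intro mult_strict_right_mono) auto
    then show ?thesis by (simp add: g_def)
  qed
  have ginc: "g n k \<le> g n (Suc k)" for n k using t_less_T by (simp add: g_def divide_right_mono)
  have gmono: "g n k \<le> g n k'" if "k \<le> k'" for n k k'
    using that ginc by (rule lift_Suc_mono_le[rotated])
  have meas: "Zn n \<in> borel_measurable Pr" for n
  proof -
    have "(\<lambda>(s, \<omega>). indicator {t} s * Y t \<omega>) \<in> borel_measurable Pr"
      using Y[of t] t_less_T sets.top[of "F t"] measurable_sets[of "Y t" "F t" borel]
      by (intro Pr_rect_mult Pr_start) auto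
    moreover have "(\<lambda>(s, \<omega>). indicator ({g n k<..g n (Suc k)} \<inter> {t..<T}) s * Y (g n k) \<omega>) \<in> borel_measurable Pr"
      if "k < Suc n" for k
      using Y[of "g n k"] gt gT[OF that] sets.top[of "F (g n k)"] measurable_sets[of "Y (g n k)" "F (g n k)" borel]
      by (intro Pr_rect_mult Pr_rect) auto
    ultimately show ?thesis
      unfolding Zn_def by (intro borel_measurable_add borel_measurable_sum) (auto simp: case_prod_beta')
  qed
  have "(\<lambda>p. case p of (s, \<omega>) \<Rightarrow> Z s \<omega>) \<in> borel_measurable Pr"
  proof (rule borel_measurable_LIMSEQ_metric[OF meas])
    fix p assume p: "p \<in> space Pr"
    obtain s \<omega> where p_eq: "p = (s, \<omega>)" by (cases p)
    have s: "t \<le> s" "s < T" and \<omega>: "\<omega> \<in> space M" using p p_eq by auto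
    show "(\<lambda>n. Zn n p) \<longlonglongrightarrow> (case p of (s, \<omega>) \<Rightarrow> Z s \<omega>)"
    proof (cases "s = t")
      case True
      have "(\<Sum>k<Suc n. indicator ({g n k<..g n (Suc k)} \<inter> {t..<T}) s * Y (g n k) \<omega>) = 0" for n
        using True gt by (intro sum.neutral) (auto simp: indicator_def not_less)
      then have "Zn n p = Z s \<omega>" for n using True Zt[OF \<omega>] by (simp add: Zn_def p_eq)
      then show ?thesis by (simp add: p_eq)
    next
      case False
      then have ts: "t < s" using s by simp
      have "\<exists>k<Suc n. g n k < s \<and> s \<le> g n (Suc k)" for n
      proof -
        obtain k where "k < Suc n" "real k * (T - t) / real (Suc n) < s - t" "s - t \<le> real (Suc k) * (T - t) / real (Suc n)"
          using partition_index[of "s - t" "T - t" "Suc n"] ts s by auto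
        then show ?thesis by (intro exI[of _ k]) (auto simp: g_def)
      qed
      then obtain k where k: "\<And>n. k n < Suc n" "\<And>n. g n (k n) < s" "\<And>n. s \<le> g n (Suc (k n))" by metis
      have Zn: "Zn n p = Y (g n (k n)) \<omega>" for n
      proof -
        have "indicator ({g n j<..g n (Suc j)} \<inter> {t..<T}) s * Y (g n j) \<omega> = (if j = k n then Y (g n (k n)) \<omega> else 0)"
          if "j < Suc n" for j
        proof (cases j "k n" rule: linorder_cases)
          case less
          then have "g n (Suc j) \<le> g n (k n)" by (intro gmono) auto
          then have "g n (Suc j) < s" using k(2)[of n] by simp
          then show ?thesis using less by (auto simp: indicator_def)
        next
          case equal
          then show ?thesis using k(2,3)[of n] s by (auto simp: indicator_def)
        next
          case greater
          then have "g n (Suc (k n)) \<le> g n j" by (intro gmono) auto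
          then have "s \<le> g n j" using k(3)[of n] by simp
          then show ?thesis using greater by (auto simp: indicator_def)
        qed
        then have "(\<Sum>j<Suc n. indicator ({g n j<..g n (Suc j)} \<inter> {t..<T}) s * Y (g n j) \<omega>)
            = (\<Sum>j<Suc n. if j = k n then Y (g n (k n)) \<omega> else 0)" by (intro sum.cong) auto
        then show ?thesis using k(1)[of n] False by (simp add: Zn_def p_eq)
      qed
      have "(\<lambda>n. g n (k n)) \<longlonglongrightarrow> s"
      proof (rule real_tendsto_sandwich)
        show "\<forall>\<^sub>F n in sequentially. s - (T - t) / real (Suc n) \<le> g n (k n)"
        proof (intro always_eventually allI)
          fix n
          show "s - (T - t) / real (Suc n) \<le> g n (k n)"
            using k(3)[of n] unfolding g_def of_nat_Suc[of "k n"] distrib_right add_divide_distrib by linarith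
        qed
        show "\<forall>\<^sub>F n in sequentially. g n (k n) \<le> s"
          by (intro always_eventually allI less_imp_le k(2))
        have "(\<lambda>n. s - (T - t) / real (Suc n)) \<longlonglongrightarrow> s - 0"
          using LIMSEQ_inverse_real_of_nat[THEN tendsto_mult_right_zero, of "T - t"]
          by (intro tendsto_diff tendsto_const) (simp add: divide_inverse)
        then show "(\<lambda>n. s - (T - t) / real (Suc n)) \<longlonglongrightarrow> s" by simp
      qed simp
      then have "filterlim (\<lambda>n. g n (k n)) (at_left s) sequentially"
        using k(2) by (auto simp: filterlim_at less_imp_neq)
      from filterlim_compose[OF Z[OF _ \<omega>] this] have "(\<lambda>n. Y (g n (k n)) \<omega>) \<longlonglongrightarrow> Z s \<omega>" using ts s by auto
      then show ?thesis unfolding Zn by (simp add: p_eq)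
    qed
  qed
  then show ?thesis by simp
qed

text \<open>The value at \<open>r\<close> is approximated by the value at the next point, strictly
  after \<open>r\<close>, of a grid of mesh \<open>1 / Suc n\<close>. Capping at \<open>s\<close>
  keeps every approximation measurable for \<open>F s\<close>, and at \<open>r = s\<close> it makes
  the approximation exact.\<close>

lemma progressive_right_continuous:
  fixes Y :: "real \<Rightarrow> 'w \<Rightarrow> real"
  assumes Y: "\<And>r. r \<in> {t..s} \<Longrightarrow> Y r \<in> borel_measurable (F r)"
    and rc: "\<And>r \<omega>. r \<in> {t..<s} \<Longrightarrow> \<omega> \<in> space M \<Longrightarrow> ((\<lambda>q. Y q \<omega>) \<longlongrightarrow> Y r \<omega>) (at_right r)"
    and ts: "t \<le> s"
  shows "(\<lambda>(r, \<omega>). Y r \<omega>) \<in> borel_measurable (restrict_space borel {t..s} \<Otimes>\<^sub>M F s)"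
proof -
  define q where "q n r = min s (t + (real (nat \<lfloor>(r - t) * real (Suc n)\<rfloor>) + 1) / real (Suc n))" for n :: nat and r :: real
  let ?A = "restrict_space borel {t..s} \<Otimes>\<^sub>M F s"
  have meas: "(\<lambda>p. Y (q n (fst p)) (snd p)) \<in> borel_measurable ?A" for n
    unfolding q_def
  proof (rule measurable_compose_countable[where f = "\<lambda>k p. Y (min s (t + (real k + 1) / real (Suc n))) (snd p)"])
    fix k :: nat
    have "min s (t + (real k + 1) / real (Suc n)) \<in> {t..s}" using ts by auto
    then have "Y (min s (t + (real k + 1) / real (Suc n))) \<in> borel_measurable (F s)"
      using Y measurable_F_mono by (metis atLeastAtMost_iff)
    then show "(\<lambda>p. Y (min s (t + (real k + 1) / real (Suc n))) (snd p)) \<in> borel_measurable ?A"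
      by (rule measurable_compose[OF measurable_snd])
    have [measurable]: "fst \<in> borel_measurable ?A"
      using measurable_compose[OF measurable_fst measurable_restrict_space1[OF measurable_ident, of borel "{t..s}"], of "F s"]
      by (simp add: comp_def id_def)
    show "(\<lambda>p. nat \<lfloor>(fst p - t) * real (Suc n)\<rfloor>) \<in> measurable ?A (count_space UNIV)" by measurable
  qed
  have "(\<lambda>p. Y (fst p) (snd p)) \<in> borel_measurable ?A"
  proof (rule borel_measurable_LIMSEQ_metric[OF meas])
    fix p assume "p \<in> space ?A"
    then have r: "t \<le> fst p" "fst p \<le> s" and \<omega>: "snd p \<in> space M"
      by (auto simp: space_pair_measure space_restrict_space)
    show "(\<lambda>n. Y (q n (fst p)) (snd p)) \<longlonglongrightarrow> Y (fst p) (snd p)"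
    proof (cases "fst p = s")
      case True
      have fl: "(s - t) * real (Suc n) \<le> real (nat \<lfloor>(s - t) * real (Suc n)\<rfloor>) + 1" for n
        using ts by linarith
      have "s \<le> t + (real (nat \<lfloor>(s - t) * real (Suc n)\<rfloor>) + 1) / real (Suc n)" for n
        using fl[of n] by (simp add: field_simps)
      then have "q n (fst p) = s" for n unfolding True q_def by (simp add: min_absorb1)
      then show ?thesis by (simp add: True)
    next
      case False
      define r where "r = fst p"
      have rs: "t \<le> r" "r < s" using r False by (auto simp: r_def)
      have fl: "(r - t) * real (Suc n) < real (nat \<lfloor>(r - t) * real (Suc n)\<rfloor>) + 1"
        "real (nat \<lfloor>(r - t) * real (Suc n)\<rfloor>) \<le> (r - t) * real (Suc n)" for n
      proof -
        have "0 \<le> (r - t) * real (Suc n)" using rs by simp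
        then show "(r - t) * real (Suc n) < real (nat \<lfloor>(r - t) * real (Suc n)\<rfloor>) + 1"
          "real (nat \<lfloor>(r - t) * real (Suc n)\<rfloor>) \<le> (r - t) * real (Suc n)" by linarith+
      qed
      have gt: "r < q n r" for n
      proof -
        have "r - t < (real (nat \<lfloor>(r - t) * real (Suc n)\<rfloor>) + 1) / real (Suc n)"
          using fl(1)[of n] by (subst pos_less_divide_eq) auto
        then show ?thesis using rs by (simp add: q_def)
      qed
      have le: "q n r \<le> r + 1 / real (Suc n)" for n
      proof -
        have "real (nat \<lfloor>(r - t) * real (Suc n)\<rfloor>) / real (Suc n) \<le> r - t"
          using fl(2)[of n] by (subst pos_divide_le_eq) auto
        then show ?thesis by (simp add: q_def add_divide_distrib min_le_iff_disj)
      qed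
      have "(\<lambda>n. q n r) \<longlonglongrightarrow> r"
      proof (rule real_tendsto_sandwich)
        show "\<forall>\<^sub>F n in sequentially. r \<le> q n r"
          by (intro always_eventually allI less_imp_le gt)
        show "\<forall>\<^sub>F n in sequentially. q n r \<le> r + 1 / real (Suc n)"
          by (intro always_eventually allI le)
        have "(\<lambda>n. r + 1 / real (Suc n)) \<longlonglongrightarrow> r + 0"
          using LIMSEQ_inverse_real_of_nat by (intro tendsto_add tendsto_const) (simp add: inverse_eq_divide)
        then show "(\<lambda>n. r + 1 / real (Suc n)) \<longlonglongrightarrow> r" by simp
      qed simp
      then have "filterlim (\<lambda>n. q n r) (at_right r) sequentially"
        using gt by (simp add: filterlim_at order.strict_implies_not_eq[OF gt, symmetric])
      from filterlim_compose[OF rc[OF _ \<omega>] this] rs show ?thesis by (auto simp: r_def)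
    qed
  qed
  then show ?thesis by (simp add: case_prod_beta')
qed

end

subsection \<open>Positions of admissible strategies\<close>

lemma measurable_indicator_extend:
  fixes f :: "'a \<Rightarrow> real"
  assumes f: "f \<in> borel_measurable N" and sub: "sets N \<subseteq> sets K" and sp: "space N \<in> sets K"
  shows "(\<lambda>p. indicator (space N) p * f p) \<in> borel_measurable K"
proof (rule measurableI)
  fix B :: "real set" assume B: "B \<in> sets borel"
  have "space N \<subseteq> space K" using sets.sets_into_space[OF sp] .
  then have "(\<lambda>p. indicator (space N) p * f p) -` B \<inter> space K
      = (f -` B \<inter> space N) \<union> (if 0 \<in> B then space K - space N else {})"
  proof (intro set_eqI)
    fix p
    assume "space N \<subseteq> space K"
    then show "p \<in> (\<lambda>p. indicator (space N) p * f p) -` B \<inter> space K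
      \<longleftrightarrow> p \<in> (f -` B \<inter> space N) \<union> (if 0 \<in> B then space K - space N else {})"
      by (cases "p \<in> space N") auto
  qed
  moreover have "f -` B \<inter> space N \<in> sets K" using measurable_sets[OF f B] sub by blast
  ultimately show "(\<lambda>p. indicator (space N) p * f p) -` B \<inter> space K \<in> sets K" using sp by auto
qed simp

lemma measurable_sets_mono:
  "f \<in> measurable A L \<Longrightarrow> sets A \<subseteq> sets B \<Longrightarrow> space A = space B \<Longrightarrow> f \<in> measurable B L"
  unfolding measurable_def by auto

lemma sets_pair_mono:
  assumes "sets A \<subseteq> sets A'" "sets B \<subseteq> sets B'"
  shows "sets (A \<Otimes>\<^sub>M B) \<subseteq> sets (A' \<Otimes>\<^sub>M B')"
  unfolding sets_pair_measure[of A B]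
proof (rule sets.sigma_sets_subset')
  show "{a \<times> b |a b. a \<in> sets A \<and> b \<in> sets B} \<subseteq> sets (A' \<Otimes>\<^sub>M B')"
    using assms by (auto intro!: pair_measureI)
  show "space A \<times> space B \<in> sets (A' \<Otimes>\<^sub>M B')"
    using assms sets.top[of A] sets.top[of B] by (auto intro!: pair_measureI)
qed

lemma set_integral_Icc_Ico:
  fixes f :: "real \<Rightarrow> real"
  shows "set_integrable lborel {a..b} f \<longleftrightarrow> set_integrable lborel {a..<b} f"
    and "(LINT r:{a..b}|lborel. f r) = (LINT r:{a..<b}|lborel. f r)"
  by (rule set_integrable_discrete_difference[of "{b}"] set_integral_discrete_difference[of "{b}"]; auto)+

text \<open>This is the nonnegativity of the variance of \<open>\<bar>f r\<bar>\<close> over the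
  interval, with \<open>c\<close> its mean.\<close>

lemma set_integral_Cauchy_Schwarz:
  fixes f :: "real \<Rightarrow> real"
  assumes ab: "a < b" and f: "set_integrable lborel {a..b} f" and f2: "set_integrable lborel {a..b} (\<lambda>r. (f r)\<^sup>2)"
  shows "(LINT r:{a..b}|lborel. \<bar>f r\<bar>)\<^sup>2 \<le> (b - a) * (LINT r:{a..b}|lborel. (f r)\<^sup>2)"
proof -
  define L where "L = b - a"
  define u where "u = (LINT r:{a..b}|lborel. \<bar>f r\<bar>)"
  define c where "c = u / L"
  have L: "L > 0" using ab by (simp add: L_def)
  have i1: "set_integrable lborel {a..b} (\<lambda>r. 2 * c * \<bar>f r\<bar>)" using set_integrable_abs[OF f] by auto
  have i2: "set_integrable lborel {a..b} (\<lambda>r. c\<^sup>2)"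
    unfolding set_integrable_def using ab
    by (intro integrable_scaleR_left integrable_real_indicator) auto
  have "0 \<le> (LINT r:{a..b}|lborel. (\<bar>f r\<bar> - c)\<^sup>2)"
    unfolding set_lebesgue_integral_def by (intro Bochner_Integration.integral_nonneg) auto
  also have "\<dots> = (LINT r:{a..b}|lborel. ((f r)\<^sup>2 - 2 * c * \<bar>f r\<bar>) + c\<^sup>2)"
    by (intro set_lebesgue_integral_cong) (auto simp: power2_diff algebra_simps)
  also have "\<dots> = (LINT r:{a..b}|lborel. (f r)\<^sup>2) - 2 * c * u + c\<^sup>2 * L"
  proof -
    have "(LINT r:{a..b}|lborel. c\<^sup>2) = c\<^sup>2 * L" using ab by (simp add: set_lebesgue_integral_def L_def)
    then show ?thesis using f2 i1 i2 by (simp add: u_def del: set_integrable_mult_right_iff)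
  qed
  also have "\<dots> = (LINT r:{a..b}|lborel. (f r)\<^sup>2) - u\<^sup>2 / L"
    using L by (simp add: c_def power2_eq_square field_simps)
  finally have "u\<^sup>2 / L \<le> (LINT r:{a..b}|lborel. (f r)\<^sup>2)" by simp
  then have "u\<^sup>2 \<le> L * (LINT r:{a..b}|lborel. (f r)\<^sup>2)" using L by (simp add: field_simps)
  then show ?thesis by (simp add: u_def L_def)
qed

text \<open>Squares of jump sums have no direct compensation formula. With \<open>n\<close> summands
  the square is at most \<open>n\<close> times the sum of squares, and
  \<open>n * a\<^sup>2 \<le> n\<^sup>2 + a ^ 4\<close> leaves a plain sum of fourth powers plus
  \<open>n ^ 3\<close>, which an exponential dominates. The constant 27 is the cube of 3, from
  \<open>n / 3 \<le> exp (n / 3)\<close>.\<close>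

lemma sum_square_le_quartic:
  fixes a :: "'a \<Rightarrow> real"
  assumes "finite S"
  shows "(\<Sum>r\<in>S. a r)\<^sup>2 \<le> (\<Sum>r\<in>S. (a r) ^ 4) + 27 * exp (real (card S))"
proof -
  define n where "n = real (card S)"
  have n: "n \<ge> 0" by (simp add: n_def)
  have "(\<Sum>r\<in>S. a r)\<^sup>2 \<le> n * (\<Sum>r\<in>S. (a r)\<^sup>2)"
    using sum_squared_le_sum_of_squares[of a S] by (simp add: n_def mult.commute)
  also have "\<dots> = (\<Sum>r\<in>S. n * (a r)\<^sup>2)" by (simp add: sum_distrib_left)
  also have "\<dots> \<le> (\<Sum>r\<in>S. n\<^sup>2 + (a r) ^ 4)"
  proof (rule sum_mono)
    fix r
    have "0 \<le> (n - (a r)\<^sup>2)\<^sup>2 + n\<^sup>2 + (a r)^4" by simp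
    then have "0 \<le> 2 * (n\<^sup>2 + (a r)^4 - n * (a r)\<^sup>2)"
      by (simp add: power2_diff power2_eq_square power4_eq_xxxx algebra_simps)
    then show "n * (a r)\<^sup>2 \<le> n\<^sup>2 + (a r)^4" by simp
  qed
  also have "\<dots> = n ^ 3 + (\<Sum>r\<in>S. (a r) ^ 4)" by (simp add: sum.distrib n_def power2_eq_square power3_eq_cube)
  also have "n ^ 3 \<le> 27 * exp n"
  proof -
    have "(n / 3) ^ 3 \<le> exp (n / 3) ^ 3"
    proof (rule power_mono)
      show "n / 3 \<le> exp (n / 3)" using exp_ge_add_one_self[of "n / 3"] by linarith
    qed (use n in simp)
    also have "exp (n / 3) ^ 3 = exp n" by (simp flip: exp_of_nat_mult)
    finally show ?thesis by (simp add: power_divide)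
  qed
  finally show ?thesis by (simp add: n_def)
qed

context poisson_horizon
begin

lemma AE_good_jumps:
  "AE \<omega> in M. (\<forall>i. \<forall>r\<in>JT i T \<omega>. \<Delta> i r \<omega> = 1) \<and> (\<forall>i j. i \<noteq> j \<longrightarrow> JT i T \<omega> \<inter> JT j T \<omega> = {})"
proof -
  have "AE \<omega> in M. \<forall>i\<in>UNIV. \<forall>r\<in>{0<..T}. \<pi> r \<omega> $ i - left_lim (\<lambda>q. \<pi> q \<omega> $ i) r < 2"
    by (rule AE_ball_countable[THEN iffD2]) (use poisson_simple_jumps[OF poisson T_pos] in auto)
  moreover have "AE \<omega> in M. \<forall>ij\<in>{ij. fst ij \<noteq> snd ij}. \<forall>r\<in>{0<..T}. \<pi> r \<omega> $ fst ij = left_lim (\<lambda>q. \<pi> q \<omega> $ fst ij) r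
      \<or> \<pi> r \<omega> $ snd ij = left_lim (\<lambda>q. \<pi> q \<omega> $ snd ij) r"
  proof (rule AE_ball_countable[THEN iffD2])
    show "\<forall>ij\<in>{ij. fst ij \<noteq> snd ij}. AE \<omega> in M. \<forall>r\<in>{0<..T}. \<pi> r \<omega> $ fst ij = left_lim (\<lambda>q. \<pi> q \<omega> $ fst ij) r
      \<or> \<pi> r \<omega> $ snd ij = left_lim (\<lambda>q. \<pi> q \<omega> $ snd ij) r"
    proof
      fix ij :: "'n \<times> 'n" assume "ij \<in> {ij. fst ij \<noteq> snd ij}"
      then have ne: "fst ij \<noteq> snd ij" by simp
      let ?P = "\<lambda>_::'n. PiM UNIV (\<lambda>_::real. borel :: real measure)"
      have ind: "indep_var (PiM {fst ij} ?P) (\<lambda>\<omega>. restrict (\<lambda>i s. \<pi> s \<omega> $ i) {fst ij})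
          (PiM {snd ij} ?P) (\<lambda>\<omega>. restrict (\<lambda>i s. \<pi> s \<omega> $ i) {snd ij})"
        using ne by (intro indep_var_restrict[OF indep_components]) auto
      have "indep_var borel (\<lambda>\<omega>. \<pi> b \<omega> $ fst ij - \<pi> a \<omega> $ fst ij) borel (\<lambda>\<omega>. \<pi> b \<omega> $ snd ij - \<pi> a \<omega> $ snd ij)" for a b
      proof -
        have "(\<lambda>f. f k) \<in> measurable (PiM {k} ?P) (PiM UNIV (\<lambda>_. borel))" for k
          by (rule measurable_component_singleton) simp
        moreover have "(\<lambda>g. g b - g a) \<in> borel_measurable (PiM UNIV (\<lambda>_::real. borel :: real measure))"
          by measurable
        ultimately have "(\<lambda>f. f k b - f k a) \<in> borel_measurable (PiM {k} ?P)" for k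
          by (rule measurable_compose)
        from indep_var_compose[OF ind this this] show ?thesis by (simp add: comp_def)
      qed
      from poisson_no_common_jumps[OF poisson poisson T_pos this]
      show "AE \<omega> in M. \<forall>r\<in>{0<..T}. \<pi> r \<omega> $ fst ij = left_lim (\<lambda>q. \<pi> q \<omega> $ fst ij) r
        \<or> \<pi> r \<omega> $ snd ij = left_lim (\<lambda>q. \<pi> q \<omega> $ snd ij) r" .
    qed
  qed simp
  ultimately show ?thesis using AE_space
  proof eventually_elim
    case (elim \<omega>)
    have in0: "r \<in> {0<..T}" if "r \<in> JT i T \<omega>" for r i
      using that JT_subset[of i T \<omega>] t_nonneg by force
    have "\<Delta> i r \<omega> = 1" if r: "r \<in> JT i T \<omega>" for i r
    proof -
      have r0: "0 < r" using in0[OF r] by simp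
      have nat: "\<pi> r \<omega> $ i \<in> \<nat>" "left_lim (\<lambda>q. \<pi> q \<omega> $ i) r + 1 \<in> \<nat>"
        using counting[OF elim(3), of i] counting_path_left_lim_le(3)[OF counting[OF elim(3), of i] _ r0] r0
        by (auto simp: counting_path_def)
      have "\<Delta> i r \<omega> < 2" using elim(1) in0[OF r] by (auto simp: \<Delta>_def)
      moreover have "\<Delta> i r \<omega> \<ge> 1" by (rule \<Delta>_ge_1[OF elim(3) r])
      ultimately have "\<pi> r \<omega> $ i = left_lim (\<lambda>q. \<pi> q \<omega> $ i) r + 1"
        by (intro Nats_diff_less_one nat) (auto simp: \<Delta>_def)
      then show ?thesis by (simp add: \<Delta>_def)
    qed
    moreover have "JT i T \<omega> \<inter> JT j T \<omega> = {}" if ij: "i \<noteq> j" for i j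
    proof (rule ccontr)
      assume "JT i T \<omega> \<inter> JT j T \<omega> \<noteq> {}"
      then obtain r where r: "r \<in> JT i T \<omega>" "r \<in> JT j T \<omega>" by blast
      have "\<pi> r \<omega> $ i = left_lim (\<lambda>q. \<pi> q \<omega> $ i) r \<or> \<pi> r \<omega> $ j = left_lim (\<lambda>q. \<pi> q \<omega> $ j) r"
        using elim(2)[THEN bspec, of "(i, j)"] ij in0[OF r(1)] by auto
      then show False using r by (auto simp: JT_def jump_times_def)
    qed
    ultimately show ?case by blast
  qed
qed

text \<open>Every jump adds at least 1 to the increment, so the number of jumps inherits the
  exponential moment of the increment.\<close>

lemma card_JT_le:
  assumes "\<omega> \<in> space M"
  shows "real (card (JT i T \<omega>)) \<le> \<pi> T \<omega> $ i - \<pi> t \<omega> $ i"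
proof -
  let ?J = "jump_times (\<lambda>q. \<pi> q \<omega> $ i) t T"
  have J: "finite ?J" "(\<Sum>r\<in>?J. \<Delta> i r \<omega>) = \<pi> T \<omega> $ i - \<pi> t \<omega> $ i" "\<forall>r\<in>?J. 1 \<le> \<Delta> i r \<omega>"
    using counting_path_jumps[OF counting[OF assms, of i] t_nonneg, of T] t_less_T by (auto simp: \<Delta>_def)
  have "real (card (JT i T \<omega>)) \<le> real (card ?J)" using J(1) by (auto simp: JT_def intro!: card_mono)
  also have "\<dots> = (\<Sum>r\<in>?J. 1)" by simp
  also have "\<dots> \<le> (\<Sum>r\<in>?J. \<Delta> i r \<omega>)" using J(3) by (intro sum_mono) auto
  finally show ?thesis using J by simp
qed

lemma JT_gap_left:
  assumes "\<omega> \<in> space M" "s \<in> {t<..T}"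
  shows "\<forall>\<^sub>F q in at_left s. t < q \<and> q < s \<and> JT i q \<omega> = JT i T \<omega> \<inter> {..<s}"
proof -
  define u where "u = Max (insert t (JT i T \<omega> \<inter> {..<s}))"
  have fin: "finite (JT i T \<omega> \<inter> {..<s})" using finite_JT[OF assms(1)] by simp
  have "u \<in> insert t (JT i T \<omega> \<inter> {..<s})" unfolding u_def using fin by (intro Max_in) auto
  then have u: "t \<le> u" "u < s" using assms JT_subset[of i T \<omega>] by auto
  have max: "r \<le> u" if "r \<in> JT i T \<omega>" "r < s" for r unfolding u_def using fin that by (intro Max_ge) auto
  have "\<forall>\<^sub>F q in at_left s. q \<in> {u<..<s}" by (rule eventually_at_left_real[OF u(2)])
  then show ?thesis
  proof eventually_elim
    case (elim q)
    have "JT i q \<omega> = JT i T \<omega> \<inter> {..q}" using elim assms by (intro JT_eq) auto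
    also have "\<dots> = JT i T \<omega> \<inter> {..<s}" using max elim by force
    finally show ?case using elim u by auto
  qed
qed

lemma JT_gap_right:
  assumes "\<omega> \<in> space M" "s \<in> {t..<T}"
  shows "\<forall>\<^sub>F q in at_right s. s < q \<and> q < T \<and> JT i q \<omega> = JT i s \<omega>"
proof -
  define u where "u = Min (insert T (JT i T \<omega> \<inter> {s<..}))"
  have fin: "finite (JT i T \<omega> \<inter> {s<..})" using finite_JT[OF assms(1)] by simp
  have "u \<in> insert T (JT i T \<omega> \<inter> {s<..})" unfolding u_def using fin by (intro Min_in) auto
  then have u: "s < u" "u \<le> T" using assms JT_subset[of i T \<omega>] by auto
  have min: "u \<le> r" if "r \<in> JT i T \<omega>" "s < r" for r unfolding u_def using fin that by (intro Min_le) auto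
  have "\<forall>\<^sub>F q in at_right s. q \<in> {s<..<u}" by (rule eventually_at_right_real[OF u(1)])
  then show ?thesis
  proof eventually_elim
    case (elim q)
    have "JT i q \<omega> = JT i T \<omega> \<inter> {..q}" using elim u by (intro JT_eq) auto
    also have "\<dots> = JT i T \<omega> \<inter> {..s}" using min elim by force
    also have "\<dots> = JT i s \<omega>" using assms by (intro JT_eq[symmetric]) auto
    finally show ?case using elim u by auto
  qed
qed

lemma jS_left_limit:
  assumes "\<omega> \<in> space M" "s \<in> {t<..T}"
  shows "((\<lambda>q. jS i q H \<omega>) \<longlongrightarrow> (\<Sum>r\<in>JT i T \<omega> \<inter> {..<s}. H r \<omega> * \<Delta> i r \<omega>)) (at_left s)"
proof (rule tendsto_eventually)
  show "\<forall>\<^sub>F q in at_left s. jS i q H \<omega> = (\<Sum>r\<in>JT i T \<omega> \<inter> {..<s}. H r \<omega> * \<Delta> i r \<omega>)"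
    using JT_gap_left[OF assms, of i] by eventually_elim (simp add: jS_def)
qed

lemma jS_right_limit:
  assumes "\<omega> \<in> space M" "s \<in> {t..<T}"
  shows "((\<lambda>q. jS i q H \<omega>) \<longlongrightarrow> jS i s H \<omega>) (at_right s)"
proof (rule tendsto_eventually)
  show "\<forall>\<^sub>F q in at_right s. jS i q H \<omega> = jS i s H \<omega>"
    using JT_gap_right[OF assms, of i] by eventually_elim (simp add: jS_def)
qed

end

locale admissible_strategy = poisson_horizon M P \<pi> \<theta> t T
  for M :: "'w measure" and P \<pi> :: "real \<Rightarrow> 'w \<Rightarrow> real^'n::finite" and \<theta> :: "'n \<Rightarrow> real" and t T :: real +
  fixes x :: "real^'n" and \<xi> \<eta> :: "real \<Rightarrow> 'w \<Rightarrow> real^'n"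
  assumes adm: "admissible M F \<theta> T t \<xi> \<eta>"
begin

text \<open>The position without the jumps at \<open>T\<close>: it equals \<open>position\<close>
  before \<open>T\<close>, and on good paths its value at \<open>T\<close> is the terminal
  position.\<close>

definition Xb :: "real \<Rightarrow> 'w \<Rightarrow> real^'n" where
  "Xb s \<omega> = (\<chi> i. x $ i - (LINT r:{t..s}|lborel. \<xi> r \<omega> $ i) - jS i s (\<lambda>r \<omega>. \<eta> r \<omega> $ i) \<omega>)"

text \<open>The candidate for the left limit of \<open>Xb\<close>: the drift integral is continuous,
  so only the jump at \<open>s\<close> itself is left out. It is defined on all paths, also where no
  convergence is known.\<close>

definition Xl :: "real \<Rightarrow> 'w \<Rightarrow> real^'n" where
  "Xl s \<omega> = (\<chi> i. x $ i - (LINT r:{t..s}|lborel. \<xi> r \<omega> $ i)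
     - (\<Sum>r\<in>JT i T \<omega> \<inter> {..<s}. \<eta> r \<omega> $ i * \<Delta> i r \<omega>))"

definition good :: "'w \<Rightarrow> bool" where
  "good \<omega> \<longleftrightarrow> \<omega> \<in> space M \<and> (\<forall>i. \<forall>r\<in>JT i T \<omega>. \<Delta> i r \<omega> = 1) \<and>
     (\<forall>i j. i \<noteq> j \<longrightarrow> JT i T \<omega> \<inter> JT j T \<omega> = {}) \<and>
     (\<forall>i. set_integrable lborel {t..T} (\<lambda>r. \<xi> r \<omega> $ i)) \<and>
     (\<forall>i j. set_integrable lborel {t..T} (\<lambda>r. \<xi> r \<omega> $ i * \<xi> r \<omega> $ j))"

lemma position_eq: "s < T \<Longrightarrow> position \<pi> x t \<xi> \<eta> s \<omega> = Xb s \<omega>"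
proof -
  assume "s < T"
  then have "jump_times (\<lambda>q. \<pi> q \<omega> $ i) t s = JT i s \<omega>" for i by (auto simp: JT_def jump_times_def)
  then show ?thesis by (simp add: position_def Xb_def jS_def \<Delta>_def)
qed

lemma \<xi>_measurable_F:
  assumes s: "s \<in> {t..<T}"
  shows "(\<lambda>p. indicator ({t..s} \<times> space M) p * \<xi> (fst p) (snd p) $ i) \<in> borel_measurable (borel \<Otimes>\<^sub>M F s)"
proof -
  let ?N = "restrict_space borel {t..s} \<Otimes>\<^sub>M F s"
  have sp: "space ?N = {t..s} \<times> space M" by (simp add: space_pair_measure space_restrict_space)
  have "(\<lambda>(r, \<omega>). \<xi> r \<omega>) \<in> borel_measurable ?N"
    using adm s unfolding admissible_def progressive_def by blast
  then have m: "(\<lambda>p. \<xi> (fst p) (snd p) $ i) \<in> borel_measurable ?N"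
    by (intro borel_measurable_vec_nth) (simp add: case_prod_beta')
  have "(\<lambda>p. indicator (space ?N) p * \<xi> (fst p) (snd p) $ i) \<in> borel_measurable (borel \<Otimes>\<^sub>M F s)"
  proof (rule measurable_indicator_extend[OF m])
    show "sets ?N \<subseteq> sets (borel \<Otimes>\<^sub>M F s)"
      by (rule sets_pair_mono) (auto simp: sets_restrict_space)
    have "{t..s} \<times> space (F s) \<in> sets (borel \<Otimes>\<^sub>M F s)" by (intro pair_measureI sets.top) auto
    then show "space ?N \<in> sets (borel \<Otimes>\<^sub>M F s)" by (simp add: sp)
  qed
  then show ?thesis by (simp add: sp)
qed

text \<open>Progressive measurability speaks of \<open>{t..s}\<close> with \<open>s < T\<close>
  only; the interval \<open>{t..<T}\<close> is exhausted by times \<open>s n\<close> that increase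
  to \<open>T\<close>.\<close>

lemma \<xi>_product: "(\<lambda>p. indicator ({t..<T} \<times> space M) p * \<xi> (fst p) (snd p) $ i) \<in> borel_measurable (borel \<Otimes>\<^sub>M M)"
proof -
  define s where "s n = T - (T - t) / real (Suc n)" for n :: nat
  have s: "s n \<in> {t..<T}" for n
  proof -
    have "(T - t) / real (Suc n) \<le> (T - t) / 1" using t_less_T by (intro divide_left_mono) auto
    then show ?thesis using t_less_T by (simp add: s_def)
  qed
  have lim: "s \<longlonglongrightarrow> T"
  proof -
    have "(\<lambda>n. T - (T - t) / real (Suc n)) \<longlonglongrightarrow> T - 0"
      using LIMSEQ_inverse_real_of_nat[THEN tendsto_mult_right_zero, of "T - t"]
      by (intro tendsto_diff tendsto_const) (simp add: divide_inverse)
    then show ?thesis by (simp add: s_def[abs_def])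
  qed
  show ?thesis
  proof (rule borel_measurable_LIMSEQ_metric)
    fix n
    have "sets (borel \<Otimes>\<^sub>M F (s n)) \<subseteq> sets (borel \<Otimes>\<^sub>M M)" by (rule sets_pair_mono) (use sets_F_events in auto)
    moreover have "space (borel \<Otimes>\<^sub>M F (s n)) = space (borel \<Otimes>\<^sub>M M)" by (simp add: space_pair_measure)
    ultimately show "(\<lambda>p. indicator ({t..s n} \<times> space M) p * \<xi> (fst p) (snd p) $ i) \<in> borel_measurable (borel \<Otimes>\<^sub>M M)"
      by (rule measurable_sets_mono[OF \<xi>_measurable_F[OF s[of n], of i]])
  next
    fix p :: "real \<times> 'w"
    show "(\<lambda>n. indicator ({t..s n} \<times> space M) p * \<xi> (fst p) (snd p) $ i)
        \<longlonglongrightarrow> indicator ({t..<T} \<times> space M) p * \<xi> (fst p) (snd p) $ i"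
    proof (cases "fst p < T")
      case True
      have "\<forall>\<^sub>F n in sequentially. fst p < s n" by (rule order_tendstoD(1)[OF lim True])
      then have "\<forall>\<^sub>F n in sequentially. indicator ({t..s n} \<times> space M) p * \<xi> (fst p) (snd p) $ i
          = indicator ({t..<T} \<times> space M) p * \<xi> (fst p) (snd p) $ i"
        by eventually_elim (use True in \<open>auto simp: indicator_def mem_Times_iff\<close>)
      then show ?thesis by (rule tendsto_eventually)
    next
      case False
      have "s n < T" for n using s[of n] by simp
      then have "indicator ({t..s n} \<times> space M) p = (0::real)" "indicator ({t..<T} \<times> space M) p = (0::real)" for n
        using False less_le_trans[of "s n" T "fst p"] by (auto simp: indicator_def mem_Times_iff not_less not_le)
      then show ?thesis by simp
    qed
  qed
qed

lemma \<eta>_Pr: "(\<lambda>(r, \<omega>). \<eta> r \<omega> $ i) \<in> borel_measurable Pr"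
proof -
  have "(\<lambda>p. \<eta> (fst p) (snd p)) \<in> borel_measurable Pr"
    using adm unfolding admissible_def predictable_def by (simp add: case_prod_beta')
  then show ?thesis using borel_measurable_vec_nth by (simp add: case_prod_beta')
qed

lemma integral_\<xi>_measurable:
  assumes s: "s \<in> {t..<T}"
  shows "(\<lambda>\<omega>. LINT r:{t..s}|lborel. \<xi> r \<omega> $ i) \<in> borel_measurable (F s)"
proof -
  have [measurable]: "(\<lambda>p. indicator ({t..s} \<times> space M) p * \<xi> (fst p) (snd p) $ i) \<in> borel_measurable (lborel \<Otimes>\<^sub>M F s)"
    using \<xi>_measurable_F[OF s] by simp
  have "(\<lambda>(\<omega>, r). indicator ({t..s} \<times> space M) (r, \<omega>) * \<xi> r \<omega> $ i) \<in> borel_measurable (F s \<Otimes>\<^sub>M lborel)"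
    using measurable_compose[OF measurable_pair_swap'[of "F s" lborel], of "\<lambda>p. indicator ({t..s} \<times> space M) p * \<xi> (fst p) (snd p) $ i" borel]
    by (simp add: case_prod_beta')
  then have "(\<lambda>\<omega>. \<integral>r. indicator ({t..s} \<times> space M) (r, \<omega>) * \<xi> r \<omega> $ i \<partial>lborel) \<in> borel_measurable (F s)"
    by (intro lborel.borel_measurable_lebesgue_integral) simp
  then show ?thesis
    by (rule measurable_cong[THEN iffD1, rotated])
      (auto simp: set_lebesgue_integral_def indicator_def intro!: Bochner_Integration.integral_cong)
qed

lemma Xb_measurable: "s \<in> {t..<T} \<Longrightarrow> (\<lambda>\<omega>. Xb s \<omega> $ i) \<in> borel_measurable (F s)"
  unfolding Xb_def vec_lambda_beta
  by (intro borel_measurable_diff integral_\<xi>_measurable jS_measurable \<eta>_Pr) auto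

lemma \<xi>_norm_product: "(\<lambda>p. indicator ({t..<T} \<times> space M) p * norm (\<xi> (fst p) (snd p))) \<in> borel_measurable (borel \<Otimes>\<^sub>M M)"
proof -
  have "(\<lambda>p. \<chi> i. indicator ({t..<T} \<times> space M) p * \<xi> (fst p) (snd p) $ i) \<in> borel_measurable (borel \<Otimes>\<^sub>M M)"
    by (subst borel_measurable_vec_iff) (simp add: \<xi>_product)
  then have "(\<lambda>p. norm (\<chi> i. indicator ({t..<T} \<times> space M) p * \<xi> (fst p) (snd p) $ i)) \<in> borel_measurable (borel \<Otimes>\<^sub>M M)"
    by measurable
  moreover have "(\<chi> i. indicator ({t..<T} \<times> space M) p * \<xi> (fst p) (snd p) $ i) = indicator ({t..<T} \<times> space M) p *\<^sub>R \<xi> (fst p) (snd p)" for p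
    by (simp add: vec_eq_iff)
  ultimately show ?thesis by simp
qed

lemma AE_good: "AE \<omega> in M. good \<omega>"
proof -
  have fin: "(\<integral>\<^sup>+\<omega>. (\<integral>\<^sup>+s. indicator {t..<T} s * ennreal (norm (\<xi> s \<omega>) ^ 4) \<partial>lborel) \<partial>M) < \<infinity>"
    using adm by (simp add: admissible_def)
  have [measurable]: "(\<lambda>p. indicator ({t..<T} \<times> space M) p * norm (\<xi> (fst p) (snd p))) \<in> borel_measurable (lborel \<Otimes>\<^sub>M M)"
    using \<xi>_norm_product by simp
  have eq: "indicator {t..<T} s * ennreal (norm (\<xi> s \<omega>) ^ 4)
      = ennreal ((indicator ({t..<T} \<times> space M) (s, \<omega>) * norm (\<xi> (fst (s, \<omega>)) (snd (s, \<omega>)))) ^ 4)"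
    if "\<omega> \<in> space M" for s \<omega> using that by (auto simp: indicator_def)
  have "(\<lambda>\<omega>. \<integral>\<^sup>+s. ennreal ((indicator ({t..<T} \<times> space M) (s, \<omega>) * norm (\<xi> (fst (s, \<omega>)) (snd (s, \<omega>)))) ^ 4) \<partial>lborel) \<in> borel_measurable M"
    by measurable
  then have "(\<lambda>\<omega>. \<integral>\<^sup>+s. indicator {t..<T} s * ennreal (norm (\<xi> s \<omega>) ^ 4) \<partial>lborel) \<in> borel_measurable M"
    by (rule measurable_cong[THEN iffD1, rotated]) (auto simp: eq intro!: nn_integral_cong)
  then have "AE \<omega> in M. (\<integral>\<^sup>+s. indicator {t..<T} s * ennreal (norm (\<xi> s \<omega>) ^ 4) \<partial>lborel) \<noteq> \<infinity>"
    using fin by (intro nn_integral_PInf_AE) auto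
  with AE_good_jumps AE_space show ?thesis
  proof eventually_elim
    case (elim \<omega>)
    have sec: "(\<lambda>r. indicator {t..<T} r * \<xi> r \<omega> $ i) \<in> borel_measurable lborel" for i
    proof -
      have "(\<lambda>r. indicator ({t..<T} \<times> space M) (r, \<omega>) * \<xi> (fst (r, \<omega>)) (snd (r, \<omega>)) $ i) \<in> borel_measurable borel"
        using measurable_compose[OF measurable_Pair2'[OF elim(2), of borel] \<xi>_product[of i]] by simp
      then show ?thesis using elim(2) by (simp add: indicator_def)
    qed
    have int4: "integrable lborel (\<lambda>r. indicator {t..<T} r * norm (\<xi> r \<omega>) ^ 4)"
    proof (rule integrableI_nonneg)
      have "(\<lambda>r. (indicator ({t..<T} \<times> space M) (r, \<omega>) * norm (\<xi> (fst (r, \<omega>)) (snd (r, \<omega>)))) ^ 4) \<in> borel_measurable borel"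
        using measurable_compose[OF measurable_Pair2'[OF elim(2), of borel] \<xi>_norm_product] by simp
      moreover have "(indicator ({t..<T} \<times> space M) (r, \<omega>) * norm (\<xi> (fst (r, \<omega>)) (snd (r, \<omega>)))) ^ 4 = indicator {t..<T} r * norm (\<xi> r \<omega>) ^ 4" for r
        using elim(2) by (auto simp: indicator_def)
      ultimately show "(\<lambda>r. indicator {t..<T} r * norm (\<xi> r \<omega>) ^ 4) \<in> borel_measurable lborel" by simp
      have "(\<integral>\<^sup>+r. ennreal (indicator {t..<T} r * norm (\<xi> r \<omega>) ^ 4) \<partial>lborel) = (\<integral>\<^sup>+s. indicator {t..<T} s * ennreal (norm (\<xi> s \<omega>) ^ 4) \<partial>lborel)"
        by (intro nn_integral_cong) (auto simp: indicator_def)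
      then show "(\<integral>\<^sup>+r. ennreal (indicator {t..<T} r * norm (\<xi> r \<omega>) ^ 4) \<partial>lborel) < \<infinity>"
        using elim(3) by (simp add: less_top)
    qed (auto simp: indicator_def)
    \<comment> \<open>On a bounded interval \<open>1 + norm \<xi> ^ 4\<close> is integrable and
      dominates both the first power and the products of two coordinates.\<close>
    have bound: "integrable lborel (\<lambda>r. indicator {t..<T} r * (1 + norm (\<xi> r \<omega>) ^ 4))"
      unfolding distrib_left using int4 t_less_T
      by (intro Bochner_Integration.integrable_add integrable_mult_left integrable_real_indicator) auto
    have p: "a \<le> 1 + a ^ 4" "a * a \<le> 1 + a ^ 4" if "a \<ge> 0" for a :: real
    proof -
      show aa: "a * a \<le> 1 + a ^ 4"
      proof -
        have "0 \<le> (a * a - 1)\<^sup>2 + 1 + a^4" by simp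
        then show ?thesis by (simp add: power2_eq_square power4_eq_xxxx algebra_simps)
      qed
      show "a \<le> 1 + a ^ 4"
      proof (cases "a \<le> 1")
        case False
        then have "a * 1 \<le> a * a" by (intro mult_left_mono) auto
        then show ?thesis using aa by linarith
      qed (simp add: add_increasing2)
    qed
    have "set_integrable lborel {t..<T} (\<lambda>r. \<xi> r \<omega> $ i)" for i
      unfolding set_integrable_def
    proof (rule Bochner_Integration.integrable_bound[OF bound])
      show "AE r in lborel. norm (indicator {t..<T} r *\<^sub>R \<xi> r \<omega> $ i) \<le> norm (indicator {t..<T} r * (1 + norm (\<xi> r \<omega>) ^ 4))"
        using p(1)[OF norm_ge_zero] component_le_norm_cart[of "\<xi> _ \<omega>" i]
        by (auto simp: indicator_def intro: order_trans)
    qed (use sec in simp)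
    moreover have "set_integrable lborel {t..<T} (\<lambda>r. \<xi> r \<omega> $ i * \<xi> r \<omega> $ j)" for i j
      unfolding set_integrable_def
    proof (rule Bochner_Integration.integrable_bound[OF bound])
      have "(\<lambda>r. (indicator {t..<T} r * \<xi> r \<omega> $ i) * (indicator {t..<T} r * \<xi> r \<omega> $ j)) \<in> borel_measurable lborel"
        by (intro borel_measurable_times sec)
      moreover have "(indicator {t..<T} r * \<xi> r \<omega> $ i) * (indicator {t..<T} r * \<xi> r \<omega> $ j) = indicator {t..<T} r *\<^sub>R (\<xi> r \<omega> $ i * \<xi> r \<omega> $ j)" for r
        by (auto simp: indicator_def)
      ultimately show "(\<lambda>r. indicator {t..<T} r *\<^sub>R (\<xi> r \<omega> $ i * \<xi> r \<omega> $ j)) \<in> borel_measurable lborel" by simp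
      have "\<bar>\<xi> r \<omega> $ i\<bar> * \<bar>\<xi> r \<omega> $ j\<bar> \<le> 1 + norm (\<xi> r \<omega>) ^ 4" for r
        by (rule order_trans[OF mult_mono p(2)[OF norm_ge_zero]]) (auto simp: component_le_norm_cart)
      then show "AE r in lborel. norm (indicator {t..<T} r *\<^sub>R (\<xi> r \<omega> $ i * \<xi> r \<omega> $ j)) \<le> norm (indicator {t..<T} r * (1 + norm (\<xi> r \<omega>) ^ 4))"
        by (auto simp: indicator_def abs_mult)
    qed
    ultimately show ?case using elim(1,2) by (simp add: good_def set_integral_Icc_Ico)
  qed
qed

lemma Xb_left_limit:
  assumes "good \<omega>" "s \<in> {t<..T}"
  shows "((\<lambda>q. Xb q \<omega>) \<longlongrightarrow> Xl s \<omega>) (at_left s)"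
proof (rule vec_tendstoI)
  fix i
  have int: "set_integrable lborel {t..T} (\<lambda>r. \<xi> r \<omega> $ i)" and \<omega>: "\<omega> \<in> space M" using assms by (auto simp: good_def)
  have "continuous_on {t..T} (\<lambda>q. LINT r:{t..q}|lborel. \<xi> r \<omega> $ i)" by (rule continuous_on_set_integral_upper[OF int])
  then have "((\<lambda>q. LINT r:{t..q}|lborel. \<xi> r \<omega> $ i) \<longlongrightarrow> (LINT r:{t..s}|lborel. \<xi> r \<omega> $ i)) (at s within {t..T})"
    using assms by (auto simp: continuous_on_def)
  then have "((\<lambda>q. LINT r:{t..q}|lborel. \<xi> r \<omega> $ i) \<longlongrightarrow> (LINT r:{t..s}|lborel. \<xi> r \<omega> $ i)) (at s within {t..s})"
    by (rule tendsto_within_subset) (use assms in auto)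
  then have "((\<lambda>q. LINT r:{t..q}|lborel. \<xi> r \<omega> $ i) \<longlongrightarrow> (LINT r:{t..s}|lborel. \<xi> r \<omega> $ i)) (at_left s)"
    using assms by (simp add: at_within_Icc_at_left)
  then show "((\<lambda>q. Xb q \<omega> $ i) \<longlongrightarrow> Xl s \<omega> $ i) (at_left s)"
    unfolding Xb_def Xl_def vec_lambda_beta by (intro tendsto_intros jS_left_limit[OF \<omega> assms(2)])
qed

lemma terminal_position_eq: "good \<omega> \<Longrightarrow> terminal_position \<pi> x t T \<xi> \<eta> \<omega> = Xb T \<omega>"
proof -
  assume g: "good \<omega>"
  have "((\<lambda>q. Xb q \<omega>) \<longlongrightarrow> Xl T \<omega>) (at_left T)" using Xb_left_limit[OF g, of T] t_less_T by simp
  moreover have "Xl T \<omega> = Xb T \<omega>"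
  proof -
    have "JT i T \<omega> \<inter> {..<T} = JT i T \<omega>" for i using JT_subset[of i T \<omega>] by auto
    then show ?thesis by (simp add: Xl_def Xb_def jS_def)
  qed
  ultimately have "((\<lambda>q. Xb q \<omega>) \<longlongrightarrow> Xb T \<omega>) (at_left T)" by simp
  moreover have "\<forall>\<^sub>F q in at_left T. Xb q \<omega> = position \<pi> x t \<xi> \<eta> q \<omega>"
    using eventually_at_left_real[OF t_less_T] by eventually_elim (simp add: position_eq)
  ultimately have "((\<lambda>q. position \<pi> x t \<xi> \<eta> q \<omega>) \<longlongrightarrow> Xb T \<omega>) (at_left T)"
    using tendsto_cong by force
  then show ?thesis unfolding terminal_position_def by (intro tendsto_Lim trivial_limit_at_left_real)
qed

text \<open>\<open>Xb\<close> is known to converge to \<open>Xl\<close> from the left on good paths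
  only, but the compensation formula needs an integrand that is predictable on every path. The set
  \<open>G\<close> of full measure lies in every \<open>F s\<close>, since null sets do, so a
  process set to 0 outside \<open>G\<close> stays adapted.\<close>

lemma predictable_version:
  obtains G Z where "AE \<omega> in M. \<omega> \<in> G" "\<And>\<omega>. \<omega> \<in> G \<Longrightarrow> good \<omega>"
    "\<And>i. (\<lambda>(s, \<omega>). Z s \<omega> $ i) \<in> borel_measurable Pr"
    "\<And>s \<omega>. \<omega> \<in> G \<Longrightarrow> Z s \<omega> = Xl s \<omega>" "\<And>s \<omega>. \<omega> \<notin> G \<Longrightarrow> Z s \<omega> = 0"
proof -
  obtain N where N: "{\<omega>\<in>space M. \<not> good \<omega>} \<subseteq> N" "N \<in> null_sets M"
    using AE_good by (auto elim!: AE_E simp: null_sets_def)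
  define G where "G = space M - N"
  define Z where "Z s \<omega> = indicator G \<omega> *\<^sub>R Xl s \<omega>" for s \<omega>
  have good: "good \<omega>" if "\<omega> \<in> G" for \<omega> using that N by (auto simp: G_def)
  have GF: "G \<in> sets (F s)" for s
    using null_sets_F[OF N(2), of s] sets.compl_sets[of N "F s"] by (simp add: G_def)
  show thesis
  proof (rule that[of G Z])
    show "AE \<omega> in M. \<omega> \<in> G" using AE_not_in[OF N(2)] AE_space by eventually_elim (simp add: G_def)
    show "(\<lambda>(s, \<omega>). Z s \<omega> $ i) \<in> borel_measurable Pr" for i
    proof (rule predictable_left_limit[where Y = "\<lambda>s \<omega>. indicator G \<omega> * Xb s \<omega> $ i"])
      show "(\<lambda>\<omega>. indicator G \<omega> * Xb s \<omega> $ i) \<in> borel_measurable (F s)" if "s \<in> {t..<T}" for s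
        using GF[of s] Xb_measurable[OF that] by (intro borel_measurable_times borel_measurable_indicator)
      show "Z t \<omega> $ i = indicator G \<omega> * Xb t \<omega> $ i" for \<omega>
      proof -
        have "JT j T \<omega> \<inter> {..<t} = {}" "JT j t \<omega> = {}" for j using JT_subset[of j T \<omega>] JT_subset[of j t \<omega>] by force+
        then have "Xl t \<omega> = Xb t \<omega>" by (simp add: Xl_def Xb_def jS_def)
        then show ?thesis by (simp add: Z_def)
      qed
      show "((\<lambda>q. indicator G \<omega> * Xb q \<omega> $ i) \<longlongrightarrow> Z s \<omega> $ i) (at_left s)" if "s \<in> {t<..<T}" for s \<omega>
      proof (cases "\<omega> \<in> G")
        case True
        have "((\<lambda>q. Xb q \<omega> $ i) \<longlongrightarrow> Xl s \<omega> $ i) (at_left s)"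
          using Xb_left_limit[OF good[OF True], of s] that by (intro tendsto_vec_nth) auto
        then show ?thesis using True by (simp add: Z_def)
      qed (simp add: Z_def)
    qed
  qed (auto simp: Z_def good)
qed

lemma Xb_eq_Xl: "s \<notin> (\<Union>i. JT i T \<omega>) \<Longrightarrow> s \<le> T \<Longrightarrow> Xb s \<omega> = Xl s \<omega>"
proof -
  assume s: "s \<notin> (\<Union>i. JT i T \<omega>)" "s \<le> T"
  then have "JT i T \<omega> \<inter> {..<s} = JT i s \<omega>" for i using JT_eq[of s i \<omega>] by (auto simp: less_le)
  then show ?thesis by (simp add: Xb_def Xl_def jS_def)
qed

lemma AE_Xb_eq_Xl: "\<omega> \<in> space M \<Longrightarrow> AE r in lborel. r \<le> T \<longrightarrow> Xb r \<omega> = Xl r \<omega>"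
proof -
  assume \<omega>: "\<omega> \<in> space M"
  have "finite (\<Union>i. JT i T \<omega>)" using finite_JT[OF \<omega>] by simp
  then have "(\<Union>i. JT i T \<omega>) \<in> null_sets lborel"
    using finite_imp_null_set_lborel by blast
  from AE_not_in[OF this] show ?thesis by eventually_elim (use Xb_eq_Xl in auto)
qed

end

subsection \<open>Moment bounds\<close>

text \<open>Here \<open>D\<close> is centred while the mean of \<open>Q\<close> may be infinite. In
  that case \<open>Q\<close> is at most the total plus \<open>\<bar>D \<omega>\<bar>\<close>, and
  the integrability of \<open>D\<close> forces the total to have infinite mean too.\<close>

lemma (in prob_space) nn_integral_add_centered:
  fixes Q D :: "'a \<Rightarrow> real"
  assumes Q: "Q \<in> borel_measurable M" "\<And>\<omega>. Q \<omega> \<ge> 0" and D: "integrable M D" "expectation D = 0"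
    and a: "a \<ge> 0" and nn: "AE \<omega> in M. 0 \<le> a + Q \<omega> + D \<omega>"
  shows "(\<integral>\<^sup>+\<omega>. ennreal (a + Q \<omega> + D \<omega>) \<partial>M) = ennreal a + (\<integral>\<^sup>+\<omega>. ennreal (Q \<omega>) \<partial>M)"
proof (cases "(\<integral>\<^sup>+\<omega>. ennreal (Q \<omega>) \<partial>M) = \<infinity>")
  case False
  then have iQ: "integrable M Q" using Q by (intro integrableI_nonneg) (auto simp: less_top)
  have "(\<integral>\<^sup>+\<omega>. ennreal (a + Q \<omega> + D \<omega>) \<partial>M) = ennreal (expectation (\<lambda>\<omega>. a + Q \<omega> + D \<omega>))"
    using iQ D nn by (intro nn_integral_eq_integral) auto
  also have "expectation (\<lambda>\<omega>. a + Q \<omega> + D \<omega>) = a + expectation Q"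
    using iQ D by (simp add: prob_space)
  also have "ennreal (a + expectation Q) = ennreal a + ennreal (expectation Q)"
    using a Q by (intro ennreal_plus integral_nonneg_AE) auto
  also have "ennreal (expectation Q) = (\<integral>\<^sup>+\<omega>. ennreal (Q \<omega>) \<partial>M)"
    using iQ Q by (intro nn_integral_eq_integral[symmetric]) auto
  finally show ?thesis .
next
  case True
  have [measurable]: "Q \<in> borel_measurable M" "D \<in> borel_measurable M" using Q D by auto
  have "(\<integral>\<^sup>+\<omega>. ennreal (Q \<omega>) \<partial>M) \<le> (\<integral>\<^sup>+\<omega>. ennreal (a + Q \<omega> + D \<omega>) + ennreal \<bar>D \<omega>\<bar> \<partial>M)"
  proof (rule nn_integral_mono_AE)
    show "AE \<omega> in M. ennreal (Q \<omega>) \<le> ennreal (a + Q \<omega> + D \<omega>) + ennreal \<bar>D \<omega>\<bar>"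
      using nn
    proof eventually_elim
      case (elim \<omega>)
      have "ennreal (Q \<omega>) \<le> ennreal ((a + Q \<omega> + D \<omega>) + \<bar>D \<omega>\<bar>)" using a by (intro ennreal_leI) linarith
      also have "\<dots> = ennreal (a + Q \<omega> + D \<omega>) + ennreal \<bar>D \<omega>\<bar>" using elim by (intro ennreal_plus) auto
      finally show ?case .
    qed
  qed
  also have "\<dots> = (\<integral>\<^sup>+\<omega>. ennreal (a + Q \<omega> + D \<omega>) \<partial>M) + (\<integral>\<^sup>+\<omega>. ennreal \<bar>D \<omega>\<bar> \<partial>M)"
    by (intro nn_integral_add) auto
  finally have "(\<integral>\<^sup>+\<omega>. ennreal (a + Q \<omega> + D \<omega>) \<partial>M) + (\<integral>\<^sup>+\<omega>. ennreal \<bar>D \<omega>\<bar> \<partial>M) = \<infinity>" using True by (simp add: top_unique)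
  moreover have "(\<integral>\<^sup>+\<omega>. ennreal \<bar>D \<omega>\<bar> \<partial>M) < \<infinity>" using D(1) by (simp add: integrable_iff_bounded)
  ultimately have "(\<integral>\<^sup>+\<omega>. ennreal (a + Q \<omega> + D \<omega>) \<partial>M) = \<infinity>" by (auto simp: less_top)
  then show ?thesis using True by simp
qed

lemma add_square_le: "(a + b + c :: real)\<^sup>2 \<le> 3 * (a\<^sup>2 + b\<^sup>2 + c\<^sup>2)"
proof -
  have "0 \<le> (a - b)\<^sup>2 + (a - c)\<^sup>2 + (b - c)\<^sup>2" by simp
  then show ?thesis by (simp add: power2_eq_square algebra_simps)
qed

lemma ennreal_bound_expand:
  assumes "a \<ge> 0" "b \<ge> 0" "c \<ge> 0" "d \<ge> 0" "e \<ge> 0"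
  shows "ennreal (3 * (a + b * c + (d + 27 * e))) = 3 * (ennreal a + ennreal b * ennreal c + (ennreal d + 27 * ennreal e))"
proof -
  have "3 * (ennreal a + ennreal b * ennreal c + (ennreal d + 27 * ennreal e))
      = ennreal 3 * (ennreal a + ennreal b * ennreal c + (ennreal d + ennreal 27 * ennreal e))" by simp
  also have "\<dots> = ennreal (3 * (a + b * c + (d + 27 * e)))"
    using assms by (simp only: ennreal_mult[symmetric] ennreal_plus[symmetric] mult_nonneg_nonneg add_nonneg_nonneg zero_le_numeral)
  finally show ?thesis by simp
qed

lemma power_4_le_8: "(a::real) ^ 4 \<le> 1 + a ^ 8"
proof -
  have "0 \<le> (a^4 - 1)\<^sup>2 + 1 + a^8" by simp
  then show ?thesis by (simp add: power2_eq_square power_add[symmetric] algebra_simps)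
qed

lemma square_le_power_4: "(a::real)\<^sup>2 \<le> 1 + a ^ 4"
proof -
  have "0 \<le> (a\<^sup>2 - 1)\<^sup>2 + 1 + a^4" by simp
  then show ?thesis by (simp add: power2_eq_square power4_eq_xxxx algebra_simps)
qed

section \<open>Jointly measurable processes and their double integrals\<close>

context poisson_horizon
begin

abbreviation \<Omega>ind :: "real \<times> 'w \<Rightarrow> real" where "\<Omega>ind \<equiv> indicator ({t..<T} \<times> space M)"

text \<open>Processes are constrained on \<open>{t..<T}\<close> and \<open>space M\<close> only; the
  indicator allows joint measurability to be stated on the full product space.\<close>

abbreviation prod_measurable :: "(real \<Rightarrow> 'w \<Rightarrow> real) \<Rightarrow> bool" where
  "prod_measurable f \<equiv> (\<lambda>p. \<Omega>ind p * f (fst p) (snd p)) \<in> borel_measurable (borel \<Otimes>\<^sub>M M)"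

lemma Pr_prod_measurable:
  assumes "(\<lambda>(r, \<omega>). f r \<omega> :: real) \<in> borel_measurable Pr"
  shows "prod_measurable f"
proof -
  have "(\<lambda>p. indicator (space Pr) p * f (fst p) (snd p)) \<in> borel_measurable (borel \<Otimes>\<^sub>M M)"
    by (rule measurable_indicator_extend) (use assms sets_Pr_product in \<open>auto simp: case_prod_beta'\<close>)
  then show ?thesis by simp
qed

lemma prod_measurable_add: "prod_measurable f \<Longrightarrow> prod_measurable g \<Longrightarrow> prod_measurable (\<lambda>r \<omega>. f r \<omega> + g r \<omega>)"
  using borel_measurable_add[of "\<lambda>p. \<Omega>ind p * f (fst p) (snd p)" _ "\<lambda>p. \<Omega>ind p * g (fst p) (snd p)"]
  by (simp add: distrib_left)

lemma prod_measurable_mult: "prod_measurable f \<Longrightarrow> prod_measurable g \<Longrightarrow> prod_measurable (\<lambda>r \<omega>. f r \<omega> * g r \<omega>)"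
proof -
  assume "prod_measurable f" "prod_measurable g"
  from borel_measurable_times[OF this] show ?thesis
    by (rule measurable_cong[THEN iffD1, rotated]) (auto simp: indicator_def)
qed

lemma prod_measurable_sum: "(\<And>i. i \<in> I \<Longrightarrow> prod_measurable (f i)) \<Longrightarrow> prod_measurable (\<lambda>r \<omega>. \<Sum>i\<in>I. f i r \<omega>)"
  using borel_measurable_sum[of I "\<lambda>i p. \<Omega>ind p * f i (fst p) (snd p)" "borel \<Otimes>\<^sub>M M"] by (simp add: sum_distrib_left)

lemma prod_measurable_const: "prod_measurable (\<lambda>r \<omega>. c)"
  by measurable

lemma prod_measurable_continuous:
  assumes "continuous_on {t..T} f"
  shows "prod_measurable (\<lambda>r \<omega>. f r)"
proof -
  have "(\<lambda>r. indicator {t..T} r *\<^sub>R f r) \<in> borel_measurable borel"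
    by (rule borel_measurable_continuous_on_indicator[OF _ assms]) simp
  then have "(\<lambda>p. indicator {t..T} (fst p) *\<^sub>R f (fst p)) \<in> borel_measurable (borel \<Otimes>\<^sub>M M)"
    by (rule measurable_compose[OF measurable_fst])
  then have "(\<lambda>p. \<Omega>ind p * (indicator {t..T} (fst p) *\<^sub>R f (fst p))) \<in> borel_measurable (borel \<Otimes>\<^sub>M M)"
    by (intro borel_measurable_times) auto
  then show ?thesis
    by (rule measurable_cong[THEN iffD1, rotated]) (auto simp: indicator_def)
qed

lemma prod_measurable_diff: "prod_measurable f \<Longrightarrow> prod_measurable g \<Longrightarrow> prod_measurable (\<lambda>r \<omega>. f r \<omega> - g r \<omega>)"
  using borel_measurable_diff[of "\<lambda>p. \<Omega>ind p * f (fst p) (snd p)" _ "\<lambda>p. \<Omega>ind p * g (fst p) (snd p)"]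
  by (simp add: right_diff_distrib)

lemma prod_measurable_power: "prod_measurable f \<Longrightarrow> prod_measurable (\<lambda>r \<omega>. f r \<omega> ^ n)"
  by (induction n) (use prod_measurable_const[of 1] prod_measurable_mult in auto)

lemma prod_measurable_norm:
  fixes f :: "real \<Rightarrow> 'w \<Rightarrow> real^'n"
  assumes "\<And>i. prod_measurable (\<lambda>r \<omega>. f r \<omega> $ i)"
  shows "prod_measurable (\<lambda>r \<omega>. norm (f r \<omega>))"
proof -
  have "(\<lambda>p. \<chi> i. \<Omega>ind p * f (fst p) (snd p) $ i) \<in> borel_measurable (borel \<Otimes>\<^sub>M M)"
    by (subst borel_measurable_vec_iff) (simp add: assms)
  then have "(\<lambda>p. norm (\<chi> i. \<Omega>ind p * f (fst p) (snd p) $ i)) \<in> borel_measurable (borel \<Otimes>\<^sub>M M)"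
    by measurable
  moreover have "(\<chi> i. \<Omega>ind p * f (fst p) (snd p) $ i) = \<Omega>ind p *\<^sub>R f (fst p) (snd p)" for p
    by (simp add: vec_eq_iff)
  ultimately show ?thesis by simp
qed

lemma prod_measurable_inner_matrix:
  fixes u v :: "real \<Rightarrow> 'w \<Rightarrow> real^'n"
  assumes u: "\<And>i. prod_measurable (\<lambda>r \<omega>. u r \<omega> $ i)" and v: "\<And>i. prod_measurable (\<lambda>r \<omega>. v r \<omega> $ i)"
    and A: "\<And>i j. continuous_on {t..T} (\<lambda>r. A r $ i $ j)"
  shows "prod_measurable (\<lambda>r \<omega>. u r \<omega> \<bullet> (A r *v v r \<omega>))" "prod_measurable (\<lambda>r \<omega>. (A r *v v r \<omega>) $ i)"
  unfolding inner_vec_def matrix_vector_mult_def vec_lambda_beta inner_real_def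
  by (intro prod_measurable_sum prod_measurable_mult prod_measurable_continuous A u v)+

text \<open>Since \<open>ennreal\<close> sends negative numbers to 0, this expected time integral
  sees the positive part of \<open>f\<close> only; integrability conditions are therefore stated
  with absolute values.\<close>

definition dnn :: "(real \<Rightarrow> 'w \<Rightarrow> real) \<Rightarrow> ennreal" where
  "dnn f = (\<integral>\<^sup>+\<omega>. (\<integral>\<^sup>+r. indicator {t..<T} r * ennreal (f r \<omega>) \<partial>lborel) \<partial>M)"

lemma ind_ennreal:
  "\<omega> \<in> space M \<Longrightarrow> indicator {t..<T} r * ennreal (f r \<omega>) = ennreal ((\<lambda>p. \<Omega>ind p * f (fst p) (snd p)) (r, \<omega>))"
  by (auto simp: indicator_def)

lemma section_nn_measurable:
  assumes "prod_measurable f"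
  shows "(\<lambda>\<omega>. \<integral>\<^sup>+r. indicator {t..<T} r * ennreal (f r \<omega>) \<partial>lborel) \<in> borel_measurable M"
proof -
  have [measurable]: "(\<lambda>p. \<Omega>ind p * f (fst p) (snd p)) \<in> borel_measurable (lborel \<Otimes>\<^sub>M M)" using assms by simp
  have "(\<lambda>\<omega>. \<integral>\<^sup>+r. ennreal ((\<lambda>p. \<Omega>ind p * f (fst p) (snd p)) (r, \<omega>)) \<partial>lborel) \<in> borel_measurable M"
    by measurable
  then show ?thesis
    by (rule measurable_cong[THEN iffD1, rotated]) (simp add: ind_ennreal)
qed

lemma section_measurable:
  assumes "prod_measurable f" "\<omega> \<in> space M"
  shows "(\<lambda>r. indicator {t..<T} r * f r \<omega>) \<in> borel_measurable borel"
proof -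
  have "(\<lambda>r. \<Omega>ind (r, \<omega>) * f (fst (r, \<omega>)) (snd (r, \<omega>))) \<in> borel_measurable borel"
    using measurable_compose[OF measurable_Pair2'[OF assms(2), of borel] assms(1)] by simp
  then show ?thesis using assms(2) by (simp add: indicator_def)
qed

lemma dnn_mono:
  "(\<And>r \<omega>. r \<in> {t..<T} \<Longrightarrow> \<omega> \<in> space M \<Longrightarrow> f r \<omega> \<le> g r \<omega>) \<Longrightarrow> dnn f \<le> dnn g"
  unfolding dnn_def by (intro nn_integral_mono) (auto simp: indicator_def intro!: ennreal_leI)

lemma dnn_const: "dnn (\<lambda>r \<omega>. c) < \<infinity>"
proof -
  have "(\<integral>\<^sup>+r. indicator {t..<T} r * ennreal c \<partial>lborel) = ennreal c * ennreal (T - t)"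
    using t_less_T by (subst nn_integral_multc) (auto simp: mult.commute)
  then show ?thesis unfolding dnn_def by (simp add: ennreal_mult_less_top emeasure_space_1)
qed

lemma dnn_add:
  assumes f: "prod_measurable f" and g: "prod_measurable g"
    and nn: "\<And>r \<omega>. f r \<omega> \<ge> 0" "\<And>r \<omega>. g r \<omega> \<ge> 0"
  shows "dnn (\<lambda>r \<omega>. f r \<omega> + g r \<omega>) = dnn f + dnn g"
proof -
  have "dnn (\<lambda>r \<omega>. f r \<omega> + g r \<omega>) = (\<integral>\<^sup>+\<omega>. (\<integral>\<^sup>+r. indicator {t..<T} r * ennreal (f r \<omega>) \<partial>lborel)
      + (\<integral>\<^sup>+r. indicator {t..<T} r * ennreal (g r \<omega>) \<partial>lborel) \<partial>M)"
    unfolding dnn_def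
  proof (rule nn_integral_cong)
    fix \<omega> assume \<omega>: "\<omega> \<in> space M"
    have m: "(\<lambda>r. indicator {t..<T} r * ennreal (h r \<omega>)) \<in> borel_measurable lborel" if "prod_measurable h" for h
    proof -
      have "(\<lambda>r. ennreal (indicator {t..<T} r * h r \<omega>)) \<in> borel_measurable lborel"
        using section_measurable[OF that \<omega>] by measurable
      moreover have "ennreal (indicator {t..<T} r * h r \<omega>) = indicator {t..<T} r * ennreal (h r \<omega>)" for r
        by (simp add: indicator_def)
      ultimately show ?thesis by simp
    qed
    show "(\<integral>\<^sup>+r. indicator {t..<T} r * ennreal (f r \<omega> + g r \<omega>) \<partial>lborel) = (\<integral>\<^sup>+r. indicator {t..<T} r * ennreal (f r \<omega>) \<partial>lborel)
      + (\<integral>\<^sup>+r. indicator {t..<T} r * ennreal (g r \<omega>) \<partial>lborel)"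
      unfolding nn_integral_add[OF m[OF f] m[OF g], symmetric]
      using nn by (intro nn_integral_cong) (simp add: ennreal_plus distrib_left del: ennreal_plus[symmetric])
  qed
  also have "\<dots> = dnn f + dnn g"
    unfolding dnn_def by (intro nn_integral_add section_nn_measurable f g)
  finally show ?thesis .
qed

lemma dnn_cmult: "c \<ge> 0 \<Longrightarrow> prod_measurable f \<Longrightarrow> (\<And>r \<omega>. f r \<omega> \<ge> 0) \<Longrightarrow> dnn f < \<infinity> \<Longrightarrow> dnn (\<lambda>r \<omega>. c * f r \<omega>) < \<infinity>"
proof -
  assume c: "c \<ge> 0" and f: "prod_measurable f" and nn: "\<And>r \<omega>. f r \<omega> \<ge> 0" and fin: "dnn f < \<infinity>"
  have "dnn (\<lambda>r \<omega>. c * f r \<omega>) = (\<integral>\<^sup>+\<omega>. ennreal c * (\<integral>\<^sup>+r. indicator {t..<T} r * ennreal (f r \<omega>) \<partial>lborel) \<partial>M)"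
    unfolding dnn_def
  proof (rule nn_integral_cong)
    fix \<omega> assume \<omega>: "\<omega> \<in> space M"
    have "(\<lambda>r. ennreal (indicator {t..<T} r * f r \<omega>)) \<in> borel_measurable lborel"
      using section_measurable[OF f \<omega>] by measurable
    moreover have "ennreal (indicator {t..<T} r * f r \<omega>) = indicator {t..<T} r * ennreal (f r \<omega>)" for r
      by (simp add: indicator_def)
    ultimately have m: "(\<lambda>r. indicator {t..<T} r * ennreal (f r \<omega>)) \<in> borel_measurable lborel" by simp
    show "(\<integral>\<^sup>+r. indicator {t..<T} r * ennreal (c * f r \<omega>) \<partial>lborel)
        = ennreal c * (\<integral>\<^sup>+r. indicator {t..<T} r * ennreal (f r \<omega>) \<partial>lborel)"
      unfolding nn_integral_cmult[OF m, symmetric] using c nn by (intro nn_integral_cong) (simp add: ennreal_mult mult_ac)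
  qed
  also have "\<dots> = ennreal c * dnn f"
    unfolding dnn_def by (intro nn_integral_cmult section_nn_measurable f)
  finally show ?thesis using fin by (simp add: ennreal_mult_less_top)
qed

lemma dnn_sum:
  assumes "finite I" "\<And>i. i \<in> I \<Longrightarrow> prod_measurable (f i)" "\<And>i r \<omega>. f i r \<omega> \<ge> 0" "\<And>i. i \<in> I \<Longrightarrow> dnn (f i) < \<infinity>"
  shows "dnn (\<lambda>r \<omega>. \<Sum>i\<in>I. f i r \<omega>) < \<infinity>"
  using assms
proof (induction I rule: finite_induct)
  case empty
  then show ?case using dnn_const[of 0] by simp
next
  case (insert i I)
  have "dnn (\<lambda>r \<omega>. f i r \<omega> + (\<Sum>i\<in>I. f i r \<omega>)) = dnn (f i) + dnn (\<lambda>r \<omega>. \<Sum>i\<in>I. f i r \<omega>)"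
    using insert.prems by (intro dnn_add prod_measurable_sum) (auto intro!: sum_nonneg)
  then show ?case using insert by simp
qed

lemma AE_section_integrable:
  assumes f: "prod_measurable f" and fin: "dnn (\<lambda>r \<omega>. \<bar>f r \<omega>\<bar>) < \<infinity>"
  shows "AE \<omega> in M. set_integrable lborel {t..<T} (\<lambda>r. f r \<omega>)"
proof -
  have "prod_measurable (\<lambda>r \<omega>. \<bar>f r \<omega>\<bar>)"
  proof -
    have "(\<lambda>p. \<bar>\<Omega>ind p * f (fst p) (snd p)\<bar>) \<in> borel_measurable (borel \<Otimes>\<^sub>M M)" using f by measurable
    then show ?thesis by (simp add: abs_mult)
  qed
  then have "AE \<omega> in M. (\<integral>\<^sup>+r. indicator {t..<T} r * ennreal \<bar>f r \<omega>\<bar> \<partial>lborel) \<noteq> \<infinity>"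
    using fin unfolding dnn_def by (intro nn_integral_PInf_AE section_nn_measurable) auto
  with AE_space show ?thesis
  proof eventually_elim
    case (elim \<omega>)
    have "(\<integral>\<^sup>+r. ennreal (norm (indicator {t..<T} r *\<^sub>R f r \<omega>)) \<partial>lborel) = (\<integral>\<^sup>+r. indicator {t..<T} r * ennreal \<bar>f r \<omega>\<bar> \<partial>lborel)"
      by (intro nn_integral_cong) (auto simp: indicator_def)
    then show ?case
      unfolding set_integrable_def using elim section_measurable[OF f elim(1)]
      by (intro integrableI_bounded) (auto simp: less_top)
  qed
qed

end

context admissible_strategy
begin

lemma \<xi>_prod: "prod_measurable (\<lambda>r \<omega>. \<xi> r \<omega> $ i)" by (rule \<xi>_product)
lemma \<eta>_prod: "prod_measurable (\<lambda>r \<omega>. \<eta> r \<omega> $ i)" by (rule Pr_prod_measurable[OF \<eta>_Pr])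

lemma dnn_\<xi>4: "dnn (\<lambda>r \<omega>. norm (\<xi> r \<omega>) ^ 4) < \<infinity>"
  using adm by (simp add: admissible_def dnn_def)

lemma dnn_\<eta>8: "dnn (\<lambda>r \<omega>. norm (\<eta> r \<omega>) ^ 8) < \<infinity>"
  using adm by (simp add: admissible_def dnn_def)

lemma \<xi>4_prod: "prod_measurable (\<lambda>r \<omega>. norm (\<xi> r \<omega>) ^ 4)"
  by (intro prod_measurable_power prod_measurable_norm \<xi>_prod)

lemma \<eta>8_prod: "prod_measurable (\<lambda>r \<omega>. norm (\<eta> r \<omega>) ^ 8)"
  by (intro prod_measurable_power prod_measurable_norm \<eta>_prod)

lemma dnn_\<xi>2: "dnn (\<lambda>r \<omega>. (norm (\<xi> r \<omega>))\<^sup>2) < \<infinity>"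
proof -
  have "dnn (\<lambda>r \<omega>. (norm (\<xi> r \<omega>))\<^sup>2) \<le> dnn (\<lambda>r \<omega>. 1 + norm (\<xi> r \<omega>) ^ 4)"
    by (intro dnn_mono square_le_power_4)
  also have "\<dots> = dnn (\<lambda>r \<omega>. 1) + dnn (\<lambda>r \<omega>. norm (\<xi> r \<omega>) ^ 4)"
    by (intro dnn_add prod_measurable_const \<xi>4_prod) auto
  finally show ?thesis using dnn_const[of 1] dnn_\<xi>4 by (simp add: le_less_trans)
qed

lemma dnn_\<eta>4: "dnn (\<lambda>r \<omega>. norm (\<eta> r \<omega>) ^ 4) < \<infinity>"
proof -
  have "dnn (\<lambda>r \<omega>. norm (\<eta> r \<omega>) ^ 4) \<le> dnn (\<lambda>r \<omega>. 1 + norm (\<eta> r \<omega>) ^ 8)"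
    by (intro dnn_mono power_4_le_8)
  also have "\<dots> = dnn (\<lambda>r \<omega>. 1) + dnn (\<lambda>r \<omega>. norm (\<eta> r \<omega>) ^ 8)"
    by (intro dnn_add prod_measurable_const \<eta>8_prod) auto
  finally show ?thesis using dnn_const[of 1] dnn_\<eta>8 by (simp add: le_less_trans)
qed

lemma dnn_\<eta>2: "dnn (\<lambda>r \<omega>. (norm (\<eta> r \<omega>))\<^sup>2) < \<infinity>"
proof -
  have "dnn (\<lambda>r \<omega>. (norm (\<eta> r \<omega>))\<^sup>2) \<le> dnn (\<lambda>r \<omega>. 1 + norm (\<eta> r \<omega>) ^ 4)"
    by (intro dnn_mono square_le_power_4)
  also have "\<dots> = dnn (\<lambda>r \<omega>. 1) + dnn (\<lambda>r \<omega>. norm (\<eta> r \<omega>) ^ 4)"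
    by (intro dnn_add prod_measurable_const prod_measurable_power prod_measurable_norm \<eta>_prod) auto
  finally show ?thesis using dnn_const[of 1] dnn_\<eta>4 by (simp add: le_less_trans)
qed

text \<open>A pathwise bound that is uniform in \<open>r\<close>: the drift is controlled by
  Cauchy-Schwarz, the jump sum by \<open>sum_square_le_quartic\<close>, and the number of jumps by
  the increment of the counting process.\<close>

lemma Xl_square_le:
  assumes g: "good \<omega>" and r: "r \<in> {t..<T}"
  shows "(Xl r \<omega> $ i)\<^sup>2 \<le> 3 * ((x $ i)\<^sup>2 + (T - t) * (LINT q:{t..T}|lborel. (\<xi> q \<omega> $ i)\<^sup>2)
    + (jS i T (\<lambda>q \<omega>. (\<eta> q \<omega> $ i) ^ 4) \<omega> + 27 * exp (\<pi> T \<omega> $ i - \<pi> t \<omega> $ i)))"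
proof -
  have \<omega>: "\<omega> \<in> space M" and \<Delta>1: "\<And>r. r \<in> JT i T \<omega> \<Longrightarrow> \<Delta> i r \<omega> = 1"
    and int: "set_integrable lborel {t..T} (\<lambda>r. \<xi> r \<omega> $ i)"
    and int2: "set_integrable lborel {t..T} (\<lambda>r. (\<xi> r \<omega> $ i)\<^sup>2)"
    using g by (auto simp: good_def power2_eq_square)
  define a where "a = (LINT q:{t..T}|lborel. \<bar>\<xi> q \<omega> $ i\<bar>)"
  define b where "b = (\<Sum>q\<in>JT i T \<omega>. \<bar>\<eta> q \<omega> $ i\<bar>)"
  have fin: "finite (JT i T \<omega>)" by (rule finite_JT[OF \<omega>])
  have sub: "set_integrable lborel {t..r} (\<lambda>r. \<xi> r \<omega> $ i)" using r by (intro set_integrable_subset[OF int]) auto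
  have a1: "\<bar>LINT q:{t..r}|lborel. \<xi> q \<omega> $ i\<bar> \<le> a"
  proof -
    have "\<bar>LINT q:{t..r}|lborel. \<xi> q \<omega> $ i\<bar> \<le> (\<integral>q. norm (indicator {t..r} q *\<^sub>R \<xi> q \<omega> $ i) \<partial>lborel)"
      unfolding set_lebesgue_integral_def real_norm_def[symmetric] by (rule integral_norm_bound)
    also have "\<dots> \<le> a"
      unfolding a_def set_lebesgue_integral_def
      using sub set_integrable_abs[OF int] r
      by (intro integral_mono) (auto simp: set_integrable_def indicator_def)
    finally show ?thesis .
  qed
  have b1: "\<bar>\<Sum>q\<in>JT i T \<omega> \<inter> {..<r}. \<eta> q \<omega> $ i * \<Delta> i q \<omega>\<bar> \<le> b"
  proof -
    have "\<bar>\<Sum>q\<in>JT i T \<omega> \<inter> {..<r}. \<eta> q \<omega> $ i * \<Delta> i q \<omega>\<bar> \<le> (\<Sum>q\<in>JT i T \<omega> \<inter> {..<r}. \<bar>\<eta> q \<omega> $ i * \<Delta> i q \<omega>\<bar>)" by (rule sum_abs)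
    also have "\<dots> = (\<Sum>q\<in>JT i T \<omega> \<inter> {..<r}. \<bar>\<eta> q \<omega> $ i\<bar>)" using \<Delta>1 by (intro sum.cong) auto
    also have "\<dots> \<le> b" unfolding b_def using fin by (intro sum_mono2) auto
    finally show ?thesis .
  qed
  have "\<bar>Xl r \<omega> $ i\<bar> \<le> \<bar>x $ i\<bar> + a + b" unfolding Xl_def vec_lambda_beta using a1 b1 by linarith
  then have "\<bar>Xl r \<omega> $ i\<bar>\<^sup>2 \<le> (\<bar>x $ i\<bar> + a + b)\<^sup>2" by (intro power_mono) auto
  also have "\<dots> \<le> 3 * ((x $ i)\<^sup>2 + a\<^sup>2 + b\<^sup>2)" using add_square_le[of "\<bar>x $ i\<bar>" a b] by simp
  finally have X2: "(Xl r \<omega> $ i)\<^sup>2 \<le> 3 * ((x $ i)\<^sup>2 + a\<^sup>2 + b\<^sup>2)" by simp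
  have "a\<^sup>2 \<le> (T - t) * (LINT q:{t..T}|lborel. (\<xi> q \<omega> $ i)\<^sup>2)"
    unfolding a_def by (rule set_integral_Cauchy_Schwarz[OF t_less_T int int2])
  moreover have "b\<^sup>2 \<le> jS i T (\<lambda>q \<omega>. (\<eta> q \<omega> $ i) ^ 4) \<omega> + 27 * exp (\<pi> T \<omega> $ i - \<pi> t \<omega> $ i)"
  proof -
    have "b\<^sup>2 \<le> (\<Sum>q\<in>JT i T \<omega>. \<bar>\<eta> q \<omega> $ i\<bar> ^ 4) + 27 * exp (real (card (JT i T \<omega>)))"
      unfolding b_def by (rule sum_square_le_quartic[OF fin])
    moreover have "(\<Sum>q\<in>JT i T \<omega>. \<bar>\<eta> q \<omega> $ i\<bar> ^ 4) = jS i T (\<lambda>q \<omega>. (\<eta> q \<omega> $ i) ^ 4) \<omega>"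
      unfolding jS_def using \<Delta>1 by (intro sum.cong) auto
    moreover have "exp (real (card (JT i T \<omega>))) \<le> exp (\<pi> T \<omega> $ i - \<pi> t \<omega> $ i)" using card_JT_le[OF \<omega>] by simp
    ultimately show ?thesis by linarith
  qed
  ultimately have "(x $ i)\<^sup>2 + a\<^sup>2 + b\<^sup>2 \<le> (x $ i)\<^sup>2 + (T - t) * (LINT q:{t..T}|lborel. (\<xi> q \<omega> $ i)\<^sup>2)
      + (jS i T (\<lambda>q \<omega>. (\<eta> q \<omega> $ i) ^ 4) \<omega> + 27 * exp (\<pi> T \<omega> $ i - \<pi> t \<omega> $ i))"
    by (intro add_mono) auto
  with X2 show ?thesis by (meson mult_left_mono order_trans zero_le_numeral)
qed

text \<open>Jump gains contain the product of \<eta> and \<open>C X\<close>, so their integrability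
  rests on a square integrable position. The fourth powers of \<eta> in the pathwise bound are
  integrated by \<open>nJ_fun\<close>; their mean is finite by the eighth moment in
  admissibility.\<close>

lemma dnn_Xl:
  assumes G: "\<And>\<omega>. \<omega> \<in> G \<Longrightarrow> good \<omega>"
    and Z: "\<And>s \<omega>. \<omega> \<in> G \<Longrightarrow> Z s \<omega> = Xl s \<omega>" "\<And>s \<omega>. \<omega> \<notin> G \<Longrightarrow> Z s \<omega> = 0"
  shows "dnn (\<lambda>r \<omega>. (Z r \<omega> $ i)\<^sup>2) < \<infinity>"
proof -
  let ?S = "\<lambda>\<omega>. \<integral>\<^sup>+q. indicator {t..<T} q * ennreal ((norm (\<xi> q \<omega>))\<^sup>2) \<partial>lborel"
  let ?J = "nJ i T (\<lambda>(q, \<omega>). ennreal ((\<eta> q \<omega> $ i) ^ 4))"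
  define b where "b \<omega> = 3 * (ennreal ((x $ i)\<^sup>2) + ennreal (T - t) * ?S \<omega> + (?J \<omega> + 27 * ennreal (exp (\<pi> T \<omega> $ i - \<pi> t \<omega> $ i))))" for \<omega>
  have le: "(\<integral>\<^sup>+r. indicator {t..<T} r * ennreal ((Z r \<omega> $ i)\<^sup>2) \<partial>lborel) \<le> ennreal (T - t) * b \<omega>" for \<omega>
  proof (cases "\<omega> \<in> G")
    case True
    note g = G[OF True]
    have \<omega>: "\<omega> \<in> space M" and int2: "set_integrable lborel {t..T} (\<lambda>r. (\<xi> r \<omega> $ i)\<^sup>2)"
      using g by (auto simp: good_def power2_eq_square)
    have S: "ennreal (LINT q:{t..T}|lborel. (\<xi> q \<omega> $ i)\<^sup>2) \<le> ?S \<omega>"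
    proof -
      have "ennreal (LINT q:{t..T}|lborel. (\<xi> q \<omega> $ i)\<^sup>2) = ennreal (LINT q:{t..<T}|lborel. (\<xi> q \<omega> $ i)\<^sup>2)"
        by (simp add: set_integral_Icc_Ico)
      also have "\<dots> = (\<integral>\<^sup>+q. ennreal (indicator {t..<T} q *\<^sub>R (\<xi> q \<omega> $ i)\<^sup>2) \<partial>lborel)"
        unfolding set_lebesgue_integral_def
        using int2[unfolded set_integral_Icc_Ico(1), unfolded set_integrable_def]
        by (intro nn_integral_eq_integral[symmetric]) auto
      also have "\<dots> \<le> ?S \<omega>"
      proof (rule nn_integral_mono)
        fix q
        have "(\<xi> q \<omega> $ i)\<^sup>2 \<le> (norm (\<xi> q \<omega>))\<^sup>2"
          using component_le_norm_cart[of "\<xi> q \<omega>" i] by (simp add: abs_le_square_iff[symmetric])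
        then show "ennreal (indicator {t..<T} q *\<^sub>R (\<xi> q \<omega> $ i)\<^sup>2) \<le> indicator {t..<T} q * ennreal ((norm (\<xi> q \<omega>))\<^sup>2)"
          by (auto simp: indicator_def intro: ennreal_leI)
      qed
      finally show ?thesis .
    qed
    have J: "ennreal (jS i T (\<lambda>q \<omega>. (\<eta> q \<omega> $ i) ^ 4) \<omega>) = ?J \<omega>"
      using jS_eq_nJ[OF \<omega>, of i T "\<lambda>q \<omega>. (\<eta> q \<omega> $ i) ^ 4"] by (simp add: max_def)
    have J0: "jS i T (\<lambda>q \<omega>. (\<eta> q \<omega> $ i) ^ 4) \<omega> \<ge> 0" by (intro jS_nonneg \<omega>) auto
    have S0: "(LINT q:{t..T}|lborel. (\<xi> q \<omega> $ i)\<^sup>2) \<ge> 0"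
      unfolding set_lebesgue_integral_def by (intro Bochner_Integration.integral_nonneg) auto
    have Zb: "ennreal ((Z r \<omega> $ i)\<^sup>2) \<le> b \<omega>" if r: "r \<in> {t..<T}" for r
    proof -
      have "ennreal ((Z r \<omega> $ i)\<^sup>2) \<le> ennreal (3 * ((x $ i)\<^sup>2 + (T - t) * (LINT q:{t..T}|lborel. (\<xi> q \<omega> $ i)\<^sup>2)
          + (jS i T (\<lambda>q \<omega>. (\<eta> q \<omega> $ i) ^ 4) \<omega> + 27 * exp (\<pi> T \<omega> $ i - \<pi> t \<omega> $ i))))"
        using Xl_square_le[OF g r, of i] Z(1)[OF True, of r] by (intro ennreal_leI) simp
      also have "\<dots> = 3 * (ennreal ((x $ i)\<^sup>2) + ennreal (T - t) * ennreal (LINT q:{t..T}|lborel. (\<xi> q \<omega> $ i)\<^sup>2)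
          + (ennreal (jS i T (\<lambda>q \<omega>. (\<eta> q \<omega> $ i) ^ 4) \<omega>) + 27 * ennreal (exp (\<pi> T \<omega> $ i - \<pi> t \<omega> $ i))))"
        using S0 J0 t_less_T by (intro ennreal_bound_expand) auto
      also have "\<dots> \<le> b \<omega>"
        unfolding b_def J using S by (intro mult_left_mono add_mono) auto
      finally show ?thesis .
    qed
    have "(\<integral>\<^sup>+r. indicator {t..<T} r * ennreal ((Z r \<omega> $ i)\<^sup>2) \<partial>lborel) \<le> (\<integral>\<^sup>+r. indicator {t..<T} r * b \<omega> \<partial>lborel)"
      using Zb by (intro nn_integral_mono) (auto simp: indicator_def)
    also have "\<dots> = ennreal (T - t) * b \<omega>" using t_less_T by (subst nn_integral_multc) auto
    finally show ?thesis .
  next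
    case False
    then show ?thesis by (simp add: Z(2))
  qed
  have [measurable]: "?S \<in> borel_measurable M"
    by (intro section_nn_measurable prod_measurable_power prod_measurable_norm \<xi>_prod)
  have \<eta>4: "(\<lambda>(q, \<omega>). (\<eta> q \<omega> $ i) ^ 4) \<in> borel_measurable Pr"
    using borel_measurable_power[OF \<eta>_Pr[of i], of 4] by (simp add: case_prod_beta')
  note nJ = nJ_fun[OF Pr_ennreal[OF \<eta>4], of i]
  have [measurable]: "?J \<in> borel_measurable M" using nJ t_less_T by (intro measurable_F_M[where s = T]) auto
  have [measurable]: "(\<lambda>\<omega>. \<pi> T \<omega> $ i) \<in> borel_measurable M" "(\<lambda>\<omega>. \<pi> t \<omega> $ i) \<in> borel_measurable M"
    using t_nonneg T_pos by (auto intro!: \<pi>_measurable)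
  have "dnn (\<lambda>r \<omega>. (Z r \<omega> $ i)\<^sup>2) \<le> (\<integral>\<^sup>+\<omega>. ennreal (T - t) * b \<omega> \<partial>M)"
    unfolding dnn_def by (intro nn_integral_mono le)
  also have "\<dots> = ennreal (T - t) * (3 * (ennreal ((x $ i)\<^sup>2) + ennreal (T - t) * (\<integral>\<^sup>+\<omega>. ?S \<omega> \<partial>M)
      + ((\<integral>\<^sup>+\<omega>. ?J \<omega> \<partial>M) + 27 * (\<integral>\<^sup>+\<omega>. ennreal (exp (\<pi> T \<omega> $ i - \<pi> t \<omega> $ i)) \<partial>M))))"
    unfolding b_def by (simp add: nn_integral_cmult nn_integral_add emeasure_space_1)
  also have "\<dots> < \<infinity>"
  proof -
    have "(\<integral>\<^sup>+\<omega>. ?J \<omega> \<partial>M) = ennreal (\<theta> i) * dnn (\<lambda>r \<omega>. (\<eta> r \<omega> $ i) ^ 4)"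
      using nJ by (simp add: dnn_def)
    also have "\<dots> \<le> ennreal (\<theta> i) * dnn (\<lambda>r \<omega>. norm (\<eta> r \<omega>) ^ 4)"
    proof (intro mult_left_mono dnn_mono)
      fix r \<omega>
      have "\<bar>\<eta> r \<omega> $ i\<bar> ^ 4 \<le> norm (\<eta> r \<omega>) ^ 4" by (intro power_mono component_le_norm_cart) auto
      then show "(\<eta> r \<omega> $ i) ^ 4 \<le> norm (\<eta> r \<omega>) ^ 4" by simp
    qed simp
    finally have "(\<integral>\<^sup>+\<omega>. ?J \<omega> \<partial>M) < \<infinity>" using dnn_\<eta>4 by (simp add: ennreal_mult_less_top le_less_trans)
    moreover have "(\<integral>\<^sup>+\<omega>. ?S \<omega> \<partial>M) < \<infinity>" using dnn_\<xi>2 by (simp add: dnn_def)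
    moreover have "(\<integral>\<^sup>+\<omega>. ennreal (exp (\<pi> T \<omega> $ i - \<pi> t \<omega> $ i)) \<partial>M) < \<infinity>"
      using t_nonneg t_less_T by (intro poisson_increment_exp_moment[OF poisson]) auto
    ultimately show ?thesis by (simp add: ennreal_mult_less_top)
  qed
  finally show ?thesis .
qed

end

subsection \<open>The cost identity\<close>

context riccati
begin

text \<open>The sum of the completed squares in the two controls; they vanish at the drift and at
  the trades of the feedback law. \<open>X\<close> is meant to be the position before a possible
  jump.\<close>

definition gap :: "real \<Rightarrow> real^'n \<Rightarrow> real^'n \<Rightarrow> real^'n \<Rightarrow> real" where
  "gap s u v X = (u - matrix_inv \<Lambda> *v (C s *v X)) \<bullet> (\<Lambda> *v (u - matrix_inv \<Lambda> *v (C s *v X)))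
     + (\<Sum>i\<in>UNIV. \<theta> i * (C s $ i $ i * (v $ i - (C s *v X) $ i / C s $ i $ i)\<^sup>2))"

text \<open>The change of \<open>X \<bullet> (C s *v X)\<close> when coordinate \<open>i\<close> of
  the position drops by \<open>v $ i\<close>.\<close>

definition jump_gain :: "'n \<Rightarrow> real \<Rightarrow> real^'n \<Rightarrow> real^'n \<Rightarrow> real" where
  "jump_gain i s v X = C s $ i $ i * (v $ i)\<^sup>2 - 2 * v $ i * (C s *v X) $ i"

lemma gap_nonneg: "s \<le> T \<Longrightarrow> gap s u v X \<ge> 0"
  unfolding gap_def
  using pos_def_imp_nonneg_def[OF \<Lambda>_pos] C_diag_pos[of s] \<theta>_nonneg
  by (intro add_nonneg_nonneg sum_nonneg mult_nonneg_nonneg) (auto simp: nonneg_def_def less_imp_le)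

text \<open>Completing the squares; the Riccati equation makes the terms quadratic in $X$ alone cancel.\<close>

lemma drift_eq_gap:
  assumes s: "s \<le> T"
  shows "X \<bullet> (C' s *v X) - 2 * (u \<bullet> (C s *v X))
    = gap s u v X - u \<bullet> (\<Lambda> *v u) - \<alpha> * (X \<bullet> (\<Sigma> *v X)) - (\<Sum>i\<in>UNIV. \<theta> i * jump_gain i s v X)"
proof -
  define y where "y = C s *v X"
  define z where "z = matrix_inv \<Lambda> *v y"
  have L: "\<Lambda> *v z = y"
    unfolding z_def by (simp add: matrix_vector_mul_assoc matrix_inv_inverse[OF pos_def_invertible[OF \<Lambda>_pos]])
  have sL: "sym_mat \<Lambda>" using \<Lambda>_pos by (simp add: pos_def_def)
  have "(u + (-1) *\<^sub>R z) \<bullet> (\<Lambda> *v (u + (-1) *\<^sub>R z)) = u \<bullet> (\<Lambda> *v u) + 2 * (-1) * (u \<bullet> (\<Lambda> *v z)) + (-1)\<^sup>2 * (z \<bullet> (\<Lambda> *v z))"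
    by (rule quadratic_form_add[OF sL])
  then have 1: "(u - z) \<bullet> (\<Lambda> *v (u - z)) = u \<bullet> (\<Lambda> *v u) - 2 * (u \<bullet> y) + y \<bullet> z"
    unfolding L by (simp add: inner_commute)
  have "C s $ i $ i * (v $ i - y $ i / C s $ i $ i)\<^sup>2 = C s $ i $ i * (v $ i)\<^sup>2 - 2 * v $ i * y $ i + (y $ i)\<^sup>2 / C s $ i $ i" for i
    using C_diag_pos[OF s, of i] by (simp add: power2_diff power_divide power2_eq_square field_simps)
  then have 2: "(\<Sum>i\<in>UNIV. \<theta> i * (C s $ i $ i * (v $ i - y $ i / C s $ i $ i)\<^sup>2))
      = (\<Sum>i\<in>UNIV. \<theta> i * jump_gain i s v X) + (\<Sum>i\<in>UNIV. \<theta> i * (y $ i)\<^sup>2 / C s $ i $ i)"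
    unfolding sum.distrib[symmetric] by (intro sum.cong) (auto simp: jump_gain_def y_def distrib_left)
  have 3: "X \<bullet> (C' s *v X) = y \<bullet> z + (\<Sum>i\<in>UNIV. \<theta> i * (y $ i)\<^sup>2 / C s $ i $ i) - \<alpha> * (X \<bullet> (\<Sigma> *v X))"
    unfolding y_def z_def by (rule C'_quadratic[OF s])
  show ?thesis
    unfolding gap_def y_def[symmetric] z_def[symmetric] 1 2 3 by simp
qed

lemma C_entry_continuous: "continuous_on {a..T} (\<lambda>s. C s $ i $ j)"
  by (intro continuous_on_component continuous_on_subset[OF C_continuous]) auto

end

locale liquidation_strategy =
  admissible_strategy M P \<pi> \<theta> t T x \<xi> \<eta> + riccati \<theta> \<alpha> T l \<Lambda> \<Sigma> C
  for M :: "'w measure" and P \<pi> :: "real \<Rightarrow> 'w \<Rightarrow> real^'n::finite" and \<theta> :: "'n \<Rightarrow> real" and t T :: real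
    and x :: "real^'n" and \<xi> \<eta> :: "real \<Rightarrow> 'w \<Rightarrow> real^'n" and \<alpha> l :: real and \<Lambda> \<Sigma> :: "real^'n^'n"
    and C :: "real \<Rightarrow> real^'n^'n"
begin

lemma Xb_components:
  assumes g: "good \<omega>" and s: "s \<in> {t..T}"
  shows "Xb s \<omega> $ i = x $ i - (LINT r:{t..s}|lborel. \<xi> r \<omega> $ i) - (\<Sum>r\<in>JT i T \<omega> \<inter> {..s}. \<eta> r \<omega> $ i)"
proof -
  have "jS i s (\<lambda>r \<omega>. \<eta> r \<omega> $ i) \<omega> = (\<Sum>r\<in>JT i T \<omega> \<inter> {..s}. \<eta> r \<omega> $ i)"
    unfolding jS_def using JT_eq[of s i \<omega>] s g by (intro sum.cong) (auto simp: good_def)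
  then show ?thesis by (simp add: Xb_def)
qed

text \<open>On good paths no two components jump together and every jump has size 1, so exactly one
  coordinate moves, by the full trade.\<close>

lemma Xl_jump:
  assumes g: "good \<omega>" and r: "r \<in> JT i T \<omega>"
  shows "Xl r \<omega> = Xb r \<omega> + \<eta> r \<omega> $ i *\<^sub>R axis i 1"
proof -
  have \<omega>: "\<omega> \<in> space M" using g by (simp add: good_def)
  have rT: "r \<in> {t..T}" using JT_subset[of i T \<omega>] r by auto
  have eq: "(\<Sum>q\<in>JT j T \<omega> \<inter> {..<r}. \<eta> q \<omega> $ j * \<Delta> j q \<omega>) = (\<Sum>q\<in>JT j T \<omega> \<inter> {..<r}. \<eta> q \<omega> $ j)" for j
    using g by (intro sum.cong) (auto simp: good_def)
  have "Xl r \<omega> $ j = Xb r \<omega> $ j + \<eta> r \<omega> $ i * (axis i 1 :: real^'n) $ j" for j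
  proof (cases "j = i")
    case True
    have "JT i T \<omega> \<inter> {..r} = insert r (JT i T \<omega> \<inter> {..<r})" using r by auto
    then have "(\<Sum>q\<in>JT i T \<omega> \<inter> {..r}. \<eta> q \<omega> $ i) = \<eta> r \<omega> $ i + (\<Sum>q\<in>JT i T \<omega> \<inter> {..<r}. \<eta> q \<omega> $ i)"
      using finite_JT[OF \<omega>] by simp
    then show ?thesis using Xb_components[OF g rT, of i] eq[of i] True by (simp add: Xl_def)
  next
    case False
    have "JT i T \<omega> \<inter> JT j T \<omega> = {}" using g False by (simp add: good_def)
    then have "r \<notin> JT j T \<omega>" using r by blast
    then have "JT j T \<omega> \<inter> {..r} = JT j T \<omega> \<inter> {..<r}" by (auto simp: less_le)
    then show ?thesis using Xb_components[OF g rT, of j] eq[of j] False by (simp add: Xl_def axis_def)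
  qed
  then show ?thesis by (simp add: vec_eq_iff)
qed

lemma path_formula:
  fixes B B' :: "real \<Rightarrow> real^'n^'n"
  assumes g: "good \<omega>"
    and B: "\<And>s. s \<in> {t..T} \<Longrightarrow> (B has_vector_derivative B' s) (at s within {t..T})"
    and B': "continuous_on {t..T} B'" and sym: "\<And>s. s \<in> {t..T} \<Longrightarrow> sym_mat (B s)"
  shows "set_integrable lborel {t..T} (\<lambda>r. Xb r \<omega> \<bullet> (B' r *v Xb r \<omega>) - 2 * (\<xi> r \<omega> \<bullet> (B r *v Xb r \<omega>)))"
    and "s \<in> {t..T} \<Longrightarrow> Xb s \<omega> \<bullet> (B s *v Xb s \<omega>) = x \<bullet> (B t *v x)
      + (LINT r:{t..s}|lborel. Xb r \<omega> \<bullet> (B' r *v Xb r \<omega>) - 2 * (\<xi> r \<omega> \<bullet> (B r *v Xb r \<omega>)))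
      + (\<Sum>i\<in>UNIV. \<Sum>r\<in>JT i T \<omega> \<inter> {..s}. B r $ i $ i * (\<eta> r \<omega> $ i)\<^sup>2 - 2 * \<eta> r \<omega> $ i * (B r *v Xl r \<omega>) $ i)"
proof -
  have \<omega>: "\<omega> \<in> space M" using g by (simp add: good_def)
  have JT: "finite (JT i T \<omega>)" "JT i T \<omega> \<subseteq> {t<..T}" for i
    using finite_JT[OF \<omega>] JT_subset[of i T \<omega>] by auto
  have disj: "JT i T \<omega> \<inter> JT j T \<omega> = {}" if "i \<noteq> j" for i j using g that by (simp add: good_def)
  have int: "set_integrable lborel {t..T} (\<lambda>r. \<xi> r \<omega> $ i)" for i using g by (simp add: good_def)
  note qf = quadratic_form_jump_formula[of t T "\<lambda>i. JT i T \<omega>" "\<lambda>r. \<xi> r \<omega>" "\<lambda>s. Xb s \<omega>" x "\<lambda>r. \<eta> r \<omega>" "\<lambda>r. Xl r \<omega>" B B',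
      OF less_imp_le[OF t_less_T] JT disj int Xb_components[OF g] Xl_jump[OF g] B B' sym]
  show "set_integrable lborel {t..T} (\<lambda>r. Xb r \<omega> \<bullet> (B' r *v Xb r \<omega>) - 2 * (\<xi> r \<omega> \<bullet> (B r *v Xb r \<omega>)))"
    by (rule qf(1))
  show "s \<in> {t..T} \<Longrightarrow> Xb s \<omega> \<bullet> (B s *v Xb s \<omega>) = x \<bullet> (B t *v x)
      + (LINT r:{t..s}|lborel. Xb r \<omega> \<bullet> (B' r *v Xb r \<omega>) - 2 * (\<xi> r \<omega> \<bullet> (B r *v Xb r \<omega>)))
      + (\<Sum>i\<in>UNIV. \<Sum>r\<in>JT i T \<omega> \<inter> {..s}. B r $ i $ i * (\<eta> r \<omega> $ i)\<^sup>2 - 2 * \<eta> r \<omega> $ i * (B r *v Xl r \<omega>) $ i)"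
    by (rule qf(2))
qed

text \<open>On good paths the chain rule up to \<open>T\<close>, where \<open>C T\<close> is
  \<open>l\<close> times the identity, and the completed squares turn running plus terminal cost
  into \<open>a + Qn + D\<close>, with the time integral \<open>Qn\<close> of the gap and a centred
  term \<open>D\<close>. \<open>Z\<close> stands in for \<open>Xl\<close> because its jump gains are
  predictable on every path.\<close>

lemma cost_identity:
  obtains Z where "\<And>i. (\<lambda>(s, \<omega>). Z s \<omega> $ i) \<in> borel_measurable Pr"
    "AE \<omega> in M. good \<omega> \<and> (\<forall>s. Z s \<omega> = Xl s \<omega>)"
    "cost M \<pi> \<alpha> \<Lambda> \<Sigma> T l t x \<xi> \<eta> = ennreal (x \<bullet> (C t *v x)) + dnn (\<lambda>r \<omega>. gap r (\<xi> r \<omega>) (\<eta> r \<omega>) (Z r \<omega>))"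
    "prod_measurable (\<lambda>r \<omega>. gap r (\<xi> r \<omega>) (\<eta> r \<omega>) (Z r \<omega>))"
proof -
  obtain G Z where G: "AE \<omega> in M. \<omega> \<in> G" "\<And>\<omega>. \<omega> \<in> G \<Longrightarrow> good \<omega>"
    and ZPr: "\<And>i. (\<lambda>(s, \<omega>). Z s \<omega> $ i) \<in> borel_measurable Pr"
    and Z: "\<And>s \<omega>. \<omega> \<in> G \<Longrightarrow> Z s \<omega> = Xl s \<omega>" "\<And>s \<omega>. \<omega> \<notin> G \<Longrightarrow> Z s \<omega> = 0"
    using predictable_version by blast
  have Zp: "prod_measurable (\<lambda>r \<omega>. Z r \<omega> $ i)" for i by (rule Pr_prod_measurable[OF ZPr])
  have Zfin: "dnn (\<lambda>r \<omega>. (Z r \<omega> $ i)\<^sup>2) < \<infinity>" for i using G(2) Z by (rule dnn_Xl)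
  have tT: "t \<le> T" using t_less_T by simp
  have Cc: "continuous_on {t..T} (\<lambda>s. C s $ i $ j)" for i j by (rule C_entry_continuous)
  have cc: "continuous_on {t..T} (\<lambda>s. (A :: real^'n^'n) $ i $ j)" for A i j by simp
  have CZ: "prod_measurable (\<lambda>r \<omega>. (C r *v Z r \<omega>) $ i)" for i by (rule prod_measurable_inner_matrix[OF Zp Zp Cc])
  have \<Sigma>Z: "prod_measurable (\<lambda>r \<omega>. Z r \<omega> \<bullet> (\<Sigma> *v Z r \<omega>))"
    by (rule prod_measurable_inner_matrix(1)[where A = "\<lambda>_. \<Sigma>", OF Zp Zp cc])
  have \<Lambda>\<xi>: "prod_measurable (\<lambda>r \<omega>. \<xi> r \<omega> \<bullet> (\<Lambda> *v \<xi> r \<omega>))"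
    by (rule prod_measurable_inner_matrix(1)[where A = "\<lambda>_. \<Lambda>", OF \<xi>_prod \<xi>_prod cc])
  obtain K where K: "K > 0" "\<And>s. s \<in> {t..T} \<Longrightarrow> norm (C s) \<le> K" using C_norm_bound[of t] by blast
  have Z2eq: "(norm (Z r \<omega>))\<^sup>2 = (\<Sum>i\<in>UNIV. (Z r \<omega> $ i)\<^sup>2)" for r \<omega>
    unfolding power2_norm_eq_inner inner_vec_def by (simp add: power2_eq_square)
  have Z2p: "prod_measurable (\<lambda>r \<omega>. (norm (Z r \<omega>))\<^sup>2)"
    by (intro prod_measurable_power prod_measurable_norm Zp)
  have \<eta>2p: "prod_measurable (\<lambda>r \<omega>. (norm (\<eta> r \<omega>))\<^sup>2)"
    by (intro prod_measurable_power prod_measurable_norm \<eta>_prod)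
  have \<xi>2p: "prod_measurable (\<lambda>r \<omega>. (norm (\<xi> r \<omega>))\<^sup>2)"
    by (intro prod_measurable_power prod_measurable_norm \<xi>_prod)
  have Z2fin: "dnn (\<lambda>r \<omega>. (norm (Z r \<omega>))\<^sup>2) < \<infinity>"
    unfolding Z2eq by (intro dnn_sum prod_measurable_power Zp Zfin) auto
  \<comment> \<open>The gain of a jump in component \<open>i\<close>, evaluated at the position
    before the jump; with \<open>Z\<close> in it the compensation formula applies.\<close>
  define H where "H i r \<omega> = jump_gain i r (\<eta> r \<omega>) (Z r \<omega>)" for i r \<omega>
  have HPr: "(\<lambda>(r, \<omega>). H i r \<omega>) \<in> borel_measurable Pr" for i
  proof -
    have Cm: "(\<lambda>p. C (fst p) $ i $ j) \<in> borel_measurable Pr" for i j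
    proof (rule measurable_cong[THEN iffD1])
      have "{t..<T} = ({t<..T} \<inter> {t..<T}) \<union> {t}" using t_less_T by auto
      have R: "({a<..b} \<inter> {t..<T}) \<times> space M \<in> sets Pr" if "t \<le> a" for a b
        using Pr_rect[OF that, of "space M" b] sets.top[of "F a"] by simp
      show "(\<lambda>p. (\<lambda>(s, \<omega>). C s $ i $ j) p) \<in> borel_measurable Pr"
      proof (rule predictable_left_limit[where Y = "\<lambda>s \<omega>. C s $ i $ j"])
        fix s \<omega> assume s: "s \<in> {t<..<T}"
        have "((\<lambda>q. C q $ i $ j) \<longlongrightarrow> C s $ i $ j) (at s within {t..T})"
          using C_entry_continuous[of t i j] s by (auto simp: continuous_on_def)
        then have "((\<lambda>q. C q $ i $ j) \<longlongrightarrow> C s $ i $ j) (at s within {t..s})"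
          by (rule tendsto_within_subset) (use s in auto)
        then show "((\<lambda>q. C q $ i $ j) \<longlongrightarrow> C s $ i $ j) (at_left s)" using s by (simp add: at_within_Icc_at_left)
      qed auto
    qed auto
    have "(\<lambda>p. \<eta> (fst p) (snd p) $ i) \<in> borel_measurable Pr" "(\<lambda>p. Z (fst p) (snd p) $ j) \<in> borel_measurable Pr" for i j
      using \<eta>_Pr[of i] ZPr[of j] by (simp_all add: case_prod_beta')
    then have "(\<lambda>p. C (fst p) $ i $ i * (\<eta> (fst p) (snd p) $ i)\<^sup>2
        - 2 * \<eta> (fst p) (snd p) $ i * (\<Sum>j\<in>UNIV. C (fst p) $ i $ j * Z (fst p) (snd p) $ j)) \<in> borel_measurable Pr"
      by (intro borel_measurable_diff borel_measurable_times borel_measurable_power borel_measurable_sum Cm) auto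
    then show ?thesis by (simp add: H_def jump_gain_def matrix_vector_mult_def case_prod_beta')
  qed
  have Hp: "prod_measurable (H i)" for i by (rule Pr_prod_measurable[OF HPr])
  have Hfin: "dnn (\<lambda>r \<omega>. \<bar>H i r \<omega>\<bar>) < \<infinity>" for i
  proof -
    have "dnn (\<lambda>r \<omega>. \<bar>H i r \<omega>\<bar>) \<le> dnn (\<lambda>r \<omega>. 2 * K * (norm (\<eta> r \<omega>))\<^sup>2 + K * (norm (Z r \<omega>))\<^sup>2)"
    proof (rule dnn_mono)
      fix r \<omega> assume r: "r \<in> {t..<T}"
      define n where "n = norm (\<eta> r \<omega>)"
      define z where "z = norm (Z r \<omega>)"
      have n: "\<bar>\<eta> r \<omega> $ i\<bar> \<le> n" "0 \<le> n" unfolding n_def by (auto simp: component_le_norm_cart)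
      have KC: "norm (C r) \<le> K" using K(2)[of r] r by auto
      have c: "\<bar>C r $ i $ i\<bar> \<le> K"
        using component_le_norm_cart[of "C r $ i" i] Finite_Cartesian_Product.norm_nth_le[of "C r" i] KC by linarith
      have "\<bar>(C r *v Z r \<omega>) $ i\<bar> \<le> norm (C r *v Z r \<omega>)" by (rule component_le_norm_cart)
      also have "\<dots> \<le> norm (C r) * norm (Z r \<omega>)" by (rule norm_matrix_vector_mult_le)
      also have "\<dots> \<le> K * z" using KC by (auto simp: z_def intro!: mult_right_mono)
      finally have y: "\<bar>(C r *v Z r \<omega>) $ i\<bar> \<le> K * z" .
      have "(\<eta> r \<omega> $ i)\<^sup>2 \<le> n\<^sup>2" using n by (simp add: abs_le_square_iff[symmetric])
      then have 1: "\<bar>C r $ i $ i\<bar> * (\<eta> r \<omega> $ i)\<^sup>2 \<le> K * n\<^sup>2" using c K(1) by (intro mult_mono) auto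
      have 2: "\<bar>\<eta> r \<omega> $ i\<bar> * \<bar>(C r *v Z r \<omega>) $ i\<bar> \<le> n * (K * z)" using n y by (intro mult_mono) auto
      have 3: "2 * (n * (K * z)) \<le> K * n\<^sup>2 + K * z\<^sup>2"
      proof -
        have "0 \<le> K * (n - z)\<^sup>2" using K(1) by simp
        then show ?thesis by (simp add: power2_diff power2_eq_square algebra_simps)
      qed
      have "\<bar>H i r \<omega>\<bar> \<le> \<bar>C r $ i $ i * (\<eta> r \<omega> $ i)\<^sup>2\<bar> + \<bar>2 * \<eta> r \<omega> $ i * (C r *v Z r \<omega>) $ i\<bar>"
        unfolding H_def jump_gain_def by (rule abs_triangle_ineq4)
      also have "\<dots> = \<bar>C r $ i $ i\<bar> * (\<eta> r \<omega> $ i)\<^sup>2 + 2 * (\<bar>\<eta> r \<omega> $ i\<bar> * \<bar>(C r *v Z r \<omega>) $ i\<bar>)"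
        by (simp add: abs_mult)
      also have "\<dots> \<le> 2 * K * n\<^sup>2 + K * z\<^sup>2" using 1 2 3 by linarith
      finally show "\<bar>H i r \<omega>\<bar> \<le> 2 * K * (norm (\<eta> r \<omega>))\<^sup>2 + K * (norm (Z r \<omega>))\<^sup>2" by (simp add: n_def z_def)
    qed
    also have "\<dots> = dnn (\<lambda>r \<omega>. 2 * K * (norm (\<eta> r \<omega>))\<^sup>2) + dnn (\<lambda>r \<omega>. K * (norm (Z r \<omega>))\<^sup>2)"
      using K(1) by (intro dnn_add prod_measurable_mult[OF prod_measurable_const] \<eta>2p Z2p) auto
    also have "\<dots> < \<infinity>"
      using K(1) dnn_cmult[OF _ \<eta>2p _ dnn_\<eta>2, of "2 * K"] dnn_cmult[OF _ Z2p _ Z2fin, of K] by simp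
    finally show ?thesis .
  qed
  note comp = jS_compensation[OF HPr Hfin[unfolded dnn_def]]
  have \<Lambda>fin: "dnn (\<lambda>r \<omega>. \<bar>\<xi> r \<omega> \<bullet> (\<Lambda> *v \<xi> r \<omega>)\<bar>) < \<infinity>"
  proof -
    have "dnn (\<lambda>r \<omega>. \<bar>\<xi> r \<omega> \<bullet> (\<Lambda> *v \<xi> r \<omega>)\<bar>) \<le> dnn (\<lambda>r \<omega>. norm \<Lambda> * (norm (\<xi> r \<omega>))\<^sup>2)"
      by (rule dnn_mono) (simp add: quadratic_form_le_norm power2_norm_eq_inner)
    then show ?thesis using dnn_cmult[OF _ \<xi>2p _ dnn_\<xi>2, of "norm \<Lambda>"] by (simp add: le_less_trans)
  qed
  have \<Sigma>fin: "dnn (\<lambda>r \<omega>. \<bar>Z r \<omega> \<bullet> (\<Sigma> *v Z r \<omega>)\<bar>) < \<infinity>"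
  proof -
    have "dnn (\<lambda>r \<omega>. \<bar>Z r \<omega> \<bullet> (\<Sigma> *v Z r \<omega>)\<bar>) \<le> dnn (\<lambda>r \<omega>. norm \<Sigma> * (norm (Z r \<omega>))\<^sup>2)"
      by (rule dnn_mono) (simp add: quadratic_form_le_norm power2_norm_eq_inner)
    then show ?thesis using dnn_cmult[OF _ Z2p _ Z2fin, of "norm \<Sigma>"] by (simp add: le_less_trans)
  qed
  define q where "q r \<omega> = gap r (\<xi> r \<omega>) (\<eta> r \<omega>) (Z r \<omega>)" for r \<omega>
  have qp: "prod_measurable q"
  proof -
    have zi: "prod_measurable (\<lambda>r \<omega>. (matrix_inv \<Lambda> *v (C r *v Z r \<omega>)) $ i)" for i
      by (rule prod_measurable_inner_matrix(2)[where A = "\<lambda>_. matrix_inv \<Lambda>", OF CZ CZ cc])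
    have ui: "prod_measurable (\<lambda>r \<omega>. (\<xi> r \<omega> - matrix_inv \<Lambda> *v (C r *v Z r \<omega>)) $ i)" for i
      unfolding vector_minus_component by (rule prod_measurable_diff[OF \<xi>_prod zi])
    have "continuous_on {t..T} (\<lambda>s. 1 / C s $ i $ i)" for i
      using C_diag_pos[of _ i] by (intro continuous_intros Cc) (auto simp: less_imp_neq[symmetric])
    then have di: "prod_measurable (\<lambda>r \<omega>. (C r *v Z r \<omega>) $ i / C r $ i $ i)" for i
      using prod_measurable_mult[OF CZ prod_measurable_continuous[of "\<lambda>s. 1 / C s $ i $ i"]] by simp
    show ?thesis
      unfolding q_def gap_def
      by (intro prod_measurable_add prod_measurable_sum prod_measurable_mult prod_measurable_const
          prod_measurable_continuous Cc prod_measurable_power prod_measurable_diff \<eta>_prod di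
          prod_measurable_inner_matrix(1)[where A = "\<lambda>_. \<Lambda>", OF ui ui cc])
  qed
  have q0: "q r \<omega> \<ge> 0" if "r \<le> T" for r \<omega> unfolding q_def by (rule gap_nonneg[OF that])
  define Qn where "Qn \<omega> = (\<integral>\<^sup>+r. indicator {t..<T} r * ennreal (q r \<omega>) \<partial>lborel)" for \<omega>
  \<comment> \<open>Jump gains minus their compensators, summed over the components; the mean is 0
    by \<open>jS_compensation\<close>.\<close>
  define D where "D \<omega> = (\<Sum>i\<in>UNIV. jS i T (H i) \<omega> - \<theta> i * (LINT r:{t..<T}|lborel. H i r \<omega>))" for \<omega>
  define a where "a = x \<bullet> (C t *v x)"
  have a0: "a \<ge> 0" using pos_def_imp_nonneg_def[OF C_pos_def[OF tT]] by (simp add: a_def nonneg_def_def)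
  have D: "integrable M D" "expectation D = 0"
    unfolding D_def using comp(1,2,4) by auto
  have Qm: "Qn \<in> borel_measurable M" unfolding Qn_def by (rule section_nn_measurable[OF qp])
  have AEH: "AE \<omega> in M. \<forall>i\<in>UNIV. set_integrable lborel {t..<T} (\<lambda>r. H i r \<omega>)"
    by (rule AE_ball_countable[THEN iffD2]) (use comp(3) in auto)
  have main: "AE \<omega> in M. (\<integral>\<^sup>+s. indicator {t..<T} s *
          ennreal (\<xi> s \<omega> \<bullet> (\<Lambda> *v \<xi> s \<omega>)
                   + \<alpha> * (position \<pi> x t \<xi> \<eta> s \<omega> \<bullet> (\<Sigma> *v position \<pi> x t \<xi> \<eta> s \<omega>))) \<partial>lborel)
        + ennreal (l * (terminal_position \<pi> x t T \<xi> \<eta> \<omega> \<bullet> terminal_position \<pi> x t T \<xi> \<eta> \<omega>))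
      = ennreal (a + enn2real (Qn \<omega>) + D \<omega>) \<and> 0 \<le> a + enn2real (Qn \<omega>) + D \<omega> \<and> Qn \<omega> = ennreal (enn2real (Qn \<omega>))"
    using G(1) AEH AE_section_integrable[OF \<Lambda>\<xi> \<Lambda>fin] AE_section_integrable[OF \<Sigma>Z \<Sigma>fin]
  proof eventually_elim
    case (elim \<omega>)
    note g = G(2)[OF elim(1)]
    have \<omega>: "\<omega> \<in> space M" using g by (simp add: good_def)
    have Zl: "Z r \<omega> = Xl r \<omega>" for r using Z(1) elim(1) by simp
    have aeX: "AE r in lborel. r \<le> T \<longrightarrow> Xb r \<omega> = Z r \<omega>" unfolding Zl by (rule AE_Xb_eq_Xl[OF \<omega>])
    let ?c = "\<lambda>r. \<xi> r \<omega> \<bullet> (\<Lambda> *v \<xi> r \<omega>) + \<alpha> * (Z r \<omega> \<bullet> (\<Sigma> *v Z r \<omega>))"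
    have c0: "?c r \<ge> 0" for r
      using pos_def_imp_nonneg_def[OF \<Lambda>_pos] \<Sigma>_nonneg \<alpha>_nonneg by (simp add: nonneg_def_def)
    have ci: "set_integrable lborel {t..<T} ?c" using elim(3,4) by (intro set_integral_add) auto
    have Hi: "set_integrable lborel {t..<T} (\<lambda>r. \<Sum>i\<in>UNIV. \<theta> i * H i r \<omega>)"
      using elim(2) unfolding set_integrable_def scaleR_sum_right
      by (intro Bochner_Integration.integrable_sum) (auto simp: mult_ac intro!: integrable_mult_right)
    let ?d = "\<lambda>r. Xb r \<omega> \<bullet> (C' r *v Xb r \<omega>) - 2 * (\<xi> r \<omega> \<bullet> (C r *v Xb r \<omega>))"
    have deriv: "(C has_vector_derivative C' s) (at s within {t..T})" if "s \<in> {t..T}" for s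
      using that by (intro has_vector_derivative_within_subset[OF C_deriv]) auto
    have C'c: "continuous_on {t..T} C'" by (rule continuous_on_subset[OF C'_continuous]) auto
    have Cs: "sym_mat (C s)" if "s \<in> {t..T}" for s using C_sym that by simp
    note pf = path_formula[OF g deriv C'c Cs]
    have di: "set_integrable lborel {t..<T} ?d" using pf(1) set_integral_Icc_Ico(1) by blast
    \<comment> \<open>\<open>Xb\<close> and \<open>Z\<close> can differ at jump times only, so the
      identity between drift and gap holds for almost every time.\<close>
    have dq: "AE r in lborel. r \<in> {t..<T} \<longrightarrow> q r \<omega> = ?d r + ?c r + (\<Sum>i\<in>UNIV. \<theta> i * H i r \<omega>)"
      using aeX
    proof eventually_elim
      case (elim r)
      then show ?case
        using drift_eq_gap[of r "Z r \<omega>" "\<xi> r \<omega>" "\<eta> r \<omega>"] by (auto simp: q_def H_def)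
    qed
    have dch: "set_integrable lborel {t..<T} (\<lambda>r. ?d r + ?c r + (\<Sum>i\<in>UNIV. \<theta> i * H i r \<omega>))"
      by (intro set_integral_add(1) di ci Hi)
    have qi: "set_integrable lborel {t..<T} (\<lambda>r. q r \<omega>)"
      unfolding set_integrable_def
    proof (rule integrable_cong_AE[THEN iffD2, OF _ _ _ dch[unfolded set_integrable_def]])
      show "(\<lambda>r. indicator {t..<T} r *\<^sub>R q r \<omega>) \<in> borel_measurable lborel"
        using section_measurable[OF qp \<omega>] by simp
      show "AE r in lborel. indicator {t..<T} r *\<^sub>R q r \<omega> = indicator {t..<T} r *\<^sub>R (?d r + ?c r + (\<Sum>i\<in>UNIV. \<theta> i * H i r \<omega>))"
        using dq by eventually_elim (simp add: indicator_def)
    qed (rule borel_measurable_integrable[OF dch[unfolded set_integrable_def]])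
    have qI: "(LINT r:{t..<T}|lborel. q r \<omega>) = (LINT r:{t..<T}|lborel. ?d r) + (LINT r:{t..<T}|lborel. ?c r)
        + (\<Sum>i\<in>UNIV. \<theta> i * (LINT r:{t..<T}|lborel. H i r \<omega>))"
    proof -
      have "(LINT r:{t..<T}|lborel. q r \<omega>) = (LINT r:{t..<T}|lborel. ?d r + ?c r + (\<Sum>i\<in>UNIV. \<theta> i * H i r \<omega>))"
        unfolding set_lebesgue_integral_def
      proof (rule integral_cong_AE)
        show "AE r in lborel. indicator {t..<T} r *\<^sub>R q r \<omega> = indicator {t..<T} r *\<^sub>R (?d r + ?c r + (\<Sum>i\<in>UNIV. \<theta> i * H i r \<omega>))"
          using dq by eventually_elim (simp add: indicator_def)
      qed (use qi dch in \<open>simp_all only: set_integrable_def borel_measurable_integrable\<close>)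
      also have "\<dots> = (LINT r:{t..<T}|lborel. ?d r) + (LINT r:{t..<T}|lborel. ?c r) + (LINT r:{t..<T}|lborel. (\<Sum>i\<in>UNIV. \<theta> i * H i r \<omega>))"
        by (subst set_integral_add(2)[OF set_integral_add(1)[OF di ci] Hi], subst set_integral_add(2)[OF di ci]) simp
      also have "(LINT r:{t..<T}|lborel. (\<Sum>i\<in>UNIV. \<theta> i * H i r \<omega>)) = (\<Sum>i\<in>UNIV. \<theta> i * (LINT r:{t..<T}|lborel. H i r \<omega>))"
        unfolding set_lebesgue_integral_def scaleR_sum_right
        using elim(2) by (subst Bochner_Integration.integral_sum) (auto simp: set_integrable_def mult.left_commute)
      finally show ?thesis .
    qed
    have Qr: "Qn \<omega> = ennreal (LINT r:{t..<T}|lborel. q r \<omega>)"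
    proof -
      have "Qn \<omega> = (\<integral>\<^sup>+r. ennreal (indicator {t..<T} r *\<^sub>R q r \<omega>) \<partial>lborel)"
        unfolding Qn_def by (intro nn_integral_cong) (auto simp: indicator_def)
      also have "\<dots> = ennreal (LINT r:{t..<T}|lborel. q r \<omega>)"
        unfolding set_lebesgue_integral_def using qi q0
        by (intro nn_integral_eq_integral) (auto simp: set_integrable_def indicator_def)
      finally show ?thesis .
    qed
    have Qr0: "(LINT r:{t..<T}|lborel. q r \<omega>) \<ge> 0"
      unfolding set_lebesgue_integral_def using q0 by (intro Bochner_Integration.integral_nonneg) (auto simp: indicator_def)
    have Qe: "enn2real (Qn \<omega>) = (LINT r:{t..<T}|lborel. q r \<omega>)" unfolding Qr using Qr0 by simp
    have jump: "(\<Sum>r\<in>JT i T \<omega> \<inter> {..T}. C r $ i $ i * (\<eta> r \<omega> $ i)\<^sup>2 - 2 * \<eta> r \<omega> $ i * (C r *v Xl r \<omega>) $ i) = jS i T (H i) \<omega>" for i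
    proof -
      have "JT i T \<omega> \<inter> {..T} = JT i T \<omega>" using JT_subset[of i T \<omega>] by auto
      then show ?thesis unfolding jS_def using g by (intro sum.cong) (auto simp: H_def jump_gain_def Zl good_def)
    qed
    have "Xb T \<omega> \<bullet> (C T *v Xb T \<omega>) = a + (LINT r:{t..T}|lborel. ?d r)
      + (\<Sum>i\<in>UNIV. \<Sum>r\<in>JT i T \<omega> \<inter> {..T}. C r $ i $ i * (\<eta> r \<omega> $ i)\<^sup>2 - 2 * \<eta> r \<omega> $ i * (C r *v Xl r \<omega>) $ i)"
      unfolding a_def using tT by (intro pf(2)) auto
    then have final: "l * (Xb T \<omega> \<bullet> Xb T \<omega>) = a + (LINT r:{t..<T}|lborel. ?d r) + (\<Sum>i\<in>UNIV. jS i T (H i) \<omega>)"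
      unfolding jump C_T set_integral_Icc_Ico(2) by (simp flip: scaleR_matrix_vector_assoc)
    have L: "(LINT r:{t..<T}|lborel. ?c r) + l * (Xb T \<omega> \<bullet> Xb T \<omega>) = a + enn2real (Qn \<omega>) + D \<omega>"
      unfolding final Qe qI D_def by (simp add: sum_subtractf)
    have cI: "(\<integral>\<^sup>+s. indicator {t..<T} s * ennreal (\<xi> s \<omega> \<bullet> (\<Lambda> *v \<xi> s \<omega>)
          + \<alpha> * (position \<pi> x t \<xi> \<eta> s \<omega> \<bullet> (\<Sigma> *v position \<pi> x t \<xi> \<eta> s \<omega>))) \<partial>lborel) = ennreal (LINT r:{t..<T}|lborel. ?c r)"
    proof -
      have "(\<integral>\<^sup>+s. indicator {t..<T} s * ennreal (\<xi> s \<omega> \<bullet> (\<Lambda> *v \<xi> s \<omega>)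
          + \<alpha> * (position \<pi> x t \<xi> \<eta> s \<omega> \<bullet> (\<Sigma> *v position \<pi> x t \<xi> \<eta> s \<omega>))) \<partial>lborel) = (\<integral>\<^sup>+s. ennreal (indicator {t..<T} s *\<^sub>R ?c s) \<partial>lborel)"
      proof (rule nn_integral_cong_AE)
        show "AE s in lborel. indicator {t..<T} s * ennreal (\<xi> s \<omega> \<bullet> (\<Lambda> *v \<xi> s \<omega>)
          + \<alpha> * (position \<pi> x t \<xi> \<eta> s \<omega> \<bullet> (\<Sigma> *v position \<pi> x t \<xi> \<eta> s \<omega>))) = ennreal (indicator {t..<T} s *\<^sub>R ?c s)"
          using aeX by eventually_elim (auto simp: indicator_def position_eq)
      qed
      also have "\<dots> = ennreal (LINT r:{t..<T}|lborel. ?c r)"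
        unfolding set_lebesgue_integral_def using ci c0
        by (intro nn_integral_eq_integral) (auto simp: set_integrable_def)
      finally show ?thesis .
    qed
    have c0I: "(LINT r:{t..<T}|lborel. ?c r) \<ge> 0"
      unfolding set_lebesgue_integral_def using c0 by (intro Bochner_Integration.integral_nonneg) auto
    have lx: "l * (Xb T \<omega> \<bullet> Xb T \<omega>) \<ge> 0" using l_pos by simp
    show ?case
    proof (intro conjI)
      show "(\<integral>\<^sup>+s. indicator {t..<T} s *
          ennreal (\<xi> s \<omega> \<bullet> (\<Lambda> *v \<xi> s \<omega>)
                   + \<alpha> * (position \<pi> x t \<xi> \<eta> s \<omega> \<bullet> (\<Sigma> *v position \<pi> x t \<xi> \<eta> s \<omega>))) \<partial>lborel)
        + ennreal (l * (terminal_position \<pi> x t T \<xi> \<eta> \<omega> \<bullet> terminal_position \<pi> x t T \<xi> \<eta> \<omega>))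
        = ennreal (a + enn2real (Qn \<omega>) + D \<omega>)"
        unfolding cI terminal_position_eq[OF g] L[symmetric] by (rule ennreal_plus[OF c0I lx, symmetric])
      show "0 \<le> a + enn2real (Qn \<omega>) + D \<omega>" unfolding L[symmetric] using c0I lx by simp
      show "Qn \<omega> = ennreal (enn2real (Qn \<omega>))" unfolding Qe by (rule Qr)
    qed
  qed
  have "cost M \<pi> \<alpha> \<Lambda> \<Sigma> T l t x \<xi> \<eta> = (\<integral>\<^sup>+\<omega>. ennreal (a + enn2real (Qn \<omega>) + D \<omega>) \<partial>M)"
    unfolding cost_def using main by (intro nn_integral_cong_AE) (auto elim: eventually_mono)
  also have "\<dots> = ennreal a + (\<integral>\<^sup>+\<omega>. ennreal (enn2real (Qn \<omega>)) \<partial>M)"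
    using main D a0 Qm by (intro nn_integral_add_centered borel_measurable_enn2real) (auto elim: eventually_mono)
  also have "(\<integral>\<^sup>+\<omega>. ennreal (enn2real (Qn \<omega>)) \<partial>M) = (\<integral>\<^sup>+\<omega>. Qn \<omega> \<partial>M)"
  proof (rule nn_integral_cong_AE)
    show "AE \<omega> in M. ennreal (enn2real (Qn \<omega>)) = Qn \<omega>" using main by eventually_elim simp
  qed
  also have "\<dots> = dnn q" by (simp add: Qn_def dnn_def)
  finally have cost: "cost M \<pi> \<alpha> \<Lambda> \<Sigma> T l t x \<xi> \<eta> = ennreal a + dnn q" .
  have AEZ: "AE \<omega> in M. good \<omega> \<and> (\<forall>s. Z s \<omega> = Xl s \<omega>)"
    using G(1) by eventually_elim (use G(2) Z(1) in auto)
  show thesis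
    by (rule that[OF ZPr AEZ cost[unfolded a_def q_def] qp[unfolded q_def]])
qed

end

subsection \<open>Fundamental solutions of linear equations\<close>

lemma bounded_bilinear_matrix_matrix_mult:
  "bounded_bilinear ((**) :: real^'n^'n \<Rightarrow> real^'n^'n \<Rightarrow> real^'n^'n)"
proof -
  have "bilinear ((**) :: real^'n^'n \<Rightarrow> real^'n^'n \<Rightarrow> real^'n^'n)"
    unfolding bilinear_def
    by (intro conjI allI linearI)
      (auto simp: matrix_matrix_mult_def vec_eq_iff sum.distrib distrib_left distrib_right sum_distrib_left mult_ac)
  then show ?thesis by (simp add: bilinear_conv_bounded_bilinear)
qed

text \<open>Picard iteration written as a series (the Peano-Baker series). The majorant with
  \<open>fact n\<close> in the denominator gives uniform convergence, and the series may be
  differentiated term by term.\<close>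

lemma linear_ode_exists:
  fixes A :: "real \<Rightarrow> real^'n^'n"
  assumes tT: "t \<le> T" and A: "continuous_on {t..T} A"
  obtains \<Phi> where "\<Phi> t = mat 1"
    "\<And>s. s \<in> {t..T} \<Longrightarrow> (\<Phi> has_vector_derivative (A s ** \<Phi> s)) (at s within {t..T})"
proof -
  interpret mm: bounded_bilinear "(**) :: real^'n^'n \<Rightarrow> real^'n^'n \<Rightarrow> real^'n^'n"
    by (rule bounded_bilinear_matrix_matrix_mult)
  obtain K where K: "K > 0" "\<And>(a :: real^'n^'n) (b :: real^'n^'n). norm (a ** b) \<le> norm a * norm b * K"
    using mm.pos_bounded by blast
  have "bounded (A ` {t..T})" by (intro compact_imp_bounded compact_continuous_image A compact_Icc)
  then obtain b where b0: "b > 0" "\<forall>y\<in>A ` {t..T}. norm y \<le> b" using bounded_pos by blast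
  then have b: "b > 0" "\<And>s. s \<in> {t..T} \<Longrightarrow> norm (A s) \<le> b" by auto
  define m where "m = b * K"
  have m: "m > 0" using b K by (simp add: m_def)
  have An: "norm (A s ** y) \<le> m * norm y" if "s \<in> {t..T}" for s and y :: "real^'n^'n"
  proof -
    have "norm (A s ** y) \<le> norm (A s) * norm y * K" by (rule K(2))
    also have "\<dots> \<le> b * norm y * K" using b(2)[OF that] K(1) by (intro mult_right_mono) auto
    finally show ?thesis by (simp add: m_def mult_ac)
  qed
  \<comment> \<open>\<open>u n\<close> is the \<open>n\<close>-fold iterated integral of
    \<open>A\<close>, starting from the identity matrix.\<close>
  define u where "u = rec_nat (\<lambda>s. mat 1 :: real^'n^'n) (\<lambda>n f s. integral {t..s} (\<lambda>r. A r ** f r))"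
  have u0: "u 0 s = mat 1" and uS: "u (Suc n) s = integral {t..s} (\<lambda>r. A r ** u n r)" for n s
    by (simp_all add: u_def)
  have cont: "continuous_on {t..T} (u n)" for n
  proof (induction n)
    case (Suc n)
    have "(\<lambda>r. A r ** u n r) integrable_on {t..T}"
      by (intro integrable_continuous_real mm.continuous_on A Suc)
    then show ?case unfolding uS by (rule indefinite_integral_continuous_1)
  qed (simp add: u0)
  have deriv: "(u (Suc n) has_vector_derivative (A s ** u n s)) (at s within {t..T})" if "s \<in> {t..T}" for n s
    unfolding uS[abs_def] by (rule integral_has_vector_derivative[OF mm.continuous_on[OF A cont] that])
  define c where "c = norm (mat 1 :: real^'n^'n)"
  have bound: "norm (u n s) \<le> c * (m * (s - t)) ^ n / fact n" if "s \<in> {t..T}" for n s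
    using that
  proof (induction n arbitrary: s)
    case 0
    then show ?case by (simp add: u0 c_def)
  next
    case (Suc n)
    have "((\<lambda>r. c * (m * (r - t)) ^ Suc n / fact (Suc n)) has_vector_derivative (m * (c * (m * (r - t)) ^ n / fact n))) (at r within {t..s})"
      for r
    proof -
      have "((\<lambda>r. c * (m * (r - t)) ^ Suc n / fact (Suc n)) has_real_derivative
          (c * (real (Suc n) * (m * (r - t)) ^ n * m) / fact (Suc n))) (at r within {t..s})"
        by (auto intro!: derivative_eq_intros simp del: fact_Suc power_Suc)
      moreover have "c * (real (Suc n) * (m * (r - t)) ^ n * m) / fact (Suc n) = m * (c * (m * (r - t)) ^ n / fact n)"
        by (simp add: divide_simps)
      ultimately show ?thesis by (simp only: has_real_derivative_iff_has_vector_derivative)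
    qed
    then have "((\<lambda>r. m * (c * (m * (r - t)) ^ n / fact n)) has_integral
        (c * (m * (s - t)) ^ Suc n / fact (Suc n) - c * (m * (t - t)) ^ Suc n / fact (Suc n))) {t..s}"
      using Suc.prems by (intro fundamental_theorem_of_calculus) auto
    then have I: "((\<lambda>r. m * (c * (m * (r - t)) ^ n / fact n)) has_integral (c * (m * (s - t)) ^ Suc n / fact (Suc n))) {t..s}"
      by simp
    have "norm (u (Suc n) s) \<le> integral {t..s} (\<lambda>r. m * (c * (m * (r - t)) ^ n / fact n))"
      unfolding uS
    proof (rule integral_norm_bound_integral)
      show "(\<lambda>r. A r ** u n r) integrable_on {t..s}"
        using Suc.prems by (intro integrable_continuous_real mm.continuous_on continuous_on_subset[OF A] continuous_on_subset[OF cont]) auto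
      show "(\<lambda>r. m * (c * (m * (r - t)) ^ n / fact n)) integrable_on {t..s}" using I by blast
      fix r assume r: "r \<in> {t..s}"
      then have rT: "r \<in> {t..T}" using Suc.prems by auto
      have "norm (A r ** u n r) \<le> m * norm (u n r)" by (rule An[OF rT])
      also have "\<dots> \<le> m * (c * (m * (r - t)) ^ n / fact n)" using m by (intro mult_left_mono Suc.IH[OF rT]) auto
      finally show "norm (A r ** u n r) \<le> m * (c * (m * (r - t)) ^ n / fact n)" .
    qed
    also have "\<dots> = c * (m * (s - t)) ^ Suc n / fact (Suc n)" using I by (rule integral_unique)
    finally show ?case .
  qed
  define Mn where "Mn n = c * (m * (T - t)) ^ n / fact n" for n
  have Mn: "norm (u n s) \<le> Mn n" if "s \<in> {t..T}" for n s
  proof -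
    have "norm (u n s) \<le> c * (m * (s - t)) ^ n / fact n" by (rule bound[OF that])
    also have "\<dots> \<le> Mn n"
      unfolding Mn_def using that m by (intro divide_right_mono mult_left_mono power_mono) (auto simp: c_def)
    finally show ?thesis .
  qed
  have sumMn: "summable Mn"
  proof -
    have "summable (\<lambda>n. c * (inverse (fact n) * (m * (T - t)) ^ n))" by (intro summable_mult summable_exp)
    then show ?thesis by (simp add: Mn_def[abs_def] divide_inverse mult_ac)
  qed
  define S where "S s = (\<Sum>n. u n s)" for s
  have unif: "uniform_limit {t..T} (\<lambda>n s. \<Sum>i<n. u i s) S sequentially"
    unfolding S_def[abs_def] by (rule Weierstrass_m_test[OF Mn sumMn])
  have sumsS: "(\<lambda>n. u n s) sums S s" if "s \<in> {t..T}" for s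
    unfolding S_def using summable_comparison_test'[OF sumMn, of 0 "\<lambda>n. u n s"] Mn[OF that] by (auto intro: summable_sums)
  \<comment> \<open>The constant term has derivative 0 and \<open>u (Suc k)\<close> has derivative
    \<open>A s ** u k s\<close>, so \<open>Suc n\<close> terms of the differentiated series
    correspond to \<open>n\<close> terms of the series itself.\<close>
  define f' where "f' n s h = (case n of 0 \<Rightarrow> 0 | Suc k \<Rightarrow> h *\<^sub>R (A s ** u k s))" for n s and h :: real
  have "\<exists>g. \<forall>s\<in>{t..T}. (\<lambda>n. u n s) sums g s \<and> (g has_derivative (\<lambda>h. h *\<^sub>R (A s ** S s))) (at s within {t..T})"
  proof (rule has_derivative_series[where f' = f'])
    show "convex {t..T}" by simp
    show "(u n has_derivative f' n s) (at s within {t..T})" if "s \<in> {t..T}" for n s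
    proof (cases n)
      case 0
      have "u 0 = (\<lambda>s. mat 1)" by (rule ext) (rule u0)
      then show ?thesis by (simp add: 0 f'_def[abs_def])
    next
      case (Suc k)
      then show ?thesis using deriv[OF that, of k] by (simp add: has_vector_derivative_def f'_def[abs_def])
    qed
    show "\<forall>\<^sub>F n in sequentially. \<forall>s\<in>{t..T}. \<forall>h. norm ((\<Sum>i<n. f' i s h) - h *\<^sub>R (A s ** S s)) \<le> e * norm h"
      if e: "e > 0" for e
    proof -
      have "\<forall>\<^sub>F n in sequentially. \<forall>s\<in>{t..T}. dist (\<Sum>i<n. u i s) (S s) < e / m"
        using uniform_limitD[OF unif, of "e / m"] e m by simp
      then have "\<forall>\<^sub>F n in sequentially. \<forall>s\<in>{t..T}. \<forall>h. norm ((\<Sum>i<Suc n. f' i s h) - h *\<^sub>R (A s ** S s)) \<le> e * norm h"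
      proof eventually_elim
        case (elim n)
        show ?case
        proof (intro ballI allI)
          fix s h assume s: "s \<in> {t..T}"
          have "(\<Sum>i<Suc n. f' i s h) = (\<Sum>i<n. h *\<^sub>R (A s ** u i s))"
            unfolding sum.lessThan_Suc_shift by (simp add: f'_def)
          also have "\<dots> = h *\<^sub>R (A s ** (\<Sum>i<n. u i s))" by (simp add: mm.sum_right scaleR_sum_right)
          finally have "norm ((\<Sum>i<Suc n. f' i s h) - h *\<^sub>R (A s ** S s)) = norm (h *\<^sub>R (A s ** ((\<Sum>i<n. u i s) - S s)))"
            by (simp add: mm.diff_right scaleR_diff_right)
          also have "\<dots> \<le> \<bar>h\<bar> * (m * norm ((\<Sum>i<n. u i s) - S s))"
            using An[OF s] by (simp add: mult_left_mono)
          also have "\<dots> \<le> \<bar>h\<bar> * (m * (e / m))"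
            using elim s m by (intro mult_left_mono) (auto simp: dist_norm less_imp_le)
          finally show "norm ((\<Sum>i<Suc n. f' i s h) - h *\<^sub>R (A s ** S s)) \<le> e * norm h" using m by (simp add: mult.commute)
        qed
      qed
      then show ?thesis by (subst eventually_sequentially_Suc[symmetric])
    qed
    show "t \<in> {t..T}" using tT by simp
    then show "(\<lambda>n. u n t) sums S t" by (rule sumsS)
  qed
  then obtain g where g: "\<And>s. s \<in> {t..T} \<Longrightarrow> (\<lambda>n. u n s) sums g s"
    "\<And>s. s \<in> {t..T} \<Longrightarrow> (g has_derivative (\<lambda>h. h *\<^sub>R (A s ** S s))) (at s within {t..T})" by blast
  have gS: "g s = S s" if "s \<in> {t..T}" for s using g(1)[OF that] sumsS[OF that] by (rule sums_unique2)
  show thesis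
  proof (rule that)
    have "u n t = (if n = 0 then mat 1 else 0)" for n by (cases n) (auto simp: u0 uS)
    then have "(\<lambda>n. u n t) sums mat 1" using sums_single[of 0 "\<lambda>_. mat 1 :: real^'n^'n"] by (simp add: eq_commute cong: if_cong)
    then show "g t = mat 1" using g(1)[of t] tT sums_unique2 by fastforce
    show "(g has_vector_derivative (A s ** g s)) (at s within {t..T})" if "s \<in> {t..T}" for s
      using g(2)[OF that] gS[OF that] by (simp add: has_vector_derivative_def)
  qed
qed

text \<open>The inverse comes from the adjoint equation: if \<open>Y\<close> solves the equation
  with \<open>- transpose (A s)\<close>, then \<open>transpose (Y s) ** \<Phi> s\<close> has
  derivative 0 and is the identity at \<open>t\<close>. For square matrices this left inverse is
  also a right inverse, and it is continuous by construction.\<close>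

lemma fundamental_solution:
  fixes A :: "real \<Rightarrow> real^'n^'n"
  assumes tT: "t \<le> T" and A: "continuous_on {t..T} A"
  obtains \<Phi> \<Psi> where "\<Phi> t = mat 1"
    "\<And>s. s \<in> {t..T} \<Longrightarrow> (\<Phi> has_vector_derivative (A s ** \<Phi> s)) (at s within {t..T})"
    "\<And>s. s \<in> {t..T} \<Longrightarrow> \<Phi> s ** \<Psi> s = mat 1" "continuous_on {t..T} \<Phi>" "continuous_on {t..T} \<Psi>"
proof -
  interpret mm: bounded_bilinear "(**) :: real^'n^'n \<Rightarrow> real^'n^'n \<Rightarrow> real^'n^'n"
    by (rule bounded_bilinear_matrix_matrix_mult)
  have bl: "bounded_linear (transpose :: real^'n^'n \<Rightarrow> real^'n^'n)"
    by (intro linear_conv_bounded_linear[THEN iffD1] linearI) (simp_all add: transpose_def vec_eq_iff)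
  obtain \<Phi> where \<Phi>: "\<Phi> t = mat 1"
    "\<And>s. s \<in> {t..T} \<Longrightarrow> (\<Phi> has_vector_derivative (A s ** \<Phi> s)) (at s within {t..T})"
    using linear_ode_exists[OF tT A] by blast
  have "continuous_on {t..T} (\<lambda>s. - transpose (A s))"
    by (intro continuous_on_minus bounded_linear.continuous_on[OF bl] A)
  then obtain Y where Y: "Y t = mat 1"
    "\<And>s. s \<in> {t..T} \<Longrightarrow> (Y has_vector_derivative ((- transpose (A s)) ** Y s)) (at s within {t..T})"
    using linear_ode_exists[OF tT] by blast
  define \<Psi> where "\<Psi> s = transpose (Y s)" for s
  have \<Psi>d: "(\<Psi> has_vector_derivative (- (\<Psi> s ** A s))) (at s within {t..T})" if "s \<in> {t..T}" for s
  proof -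
    have "(\<Psi> has_vector_derivative transpose ((- transpose (A s)) ** Y s)) (at s within {t..T})"
      unfolding \<Psi>_def[abs_def] by (rule bounded_linear.has_vector_derivative[OF bl Y(2)[OF that]])
    moreover have "transpose ((- transpose (A s)) ** Y s) = - (\<Psi> s ** A s)"
    proof -
      have "transpose (- B) = - transpose B" for B :: "real^'n^'n" by (simp add: transpose_def vec_eq_iff)
      then show ?thesis by (simp add: mm.minus_left matrix_transpose_mul \<Psi>_def)
    qed
    ultimately show ?thesis by simp
  qed
  have "((\<lambda>s. \<Psi> s ** \<Phi> s) has_vector_derivative 0) (at s within {t..T})" if "s \<in> {t..T}" for s
  proof -
    have "((\<lambda>s. \<Psi> s ** \<Phi> s) has_vector_derivative (\<Psi> s ** (A s ** \<Phi> s) + (- (\<Psi> s ** A s)) ** \<Phi> s)) (at s within {t..T})"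
      by (rule mm.has_vector_derivative[OF \<Psi>d[OF that] \<Phi>(2)[OF that]])
    then show ?thesis by (simp add: mm.minus_left matrix_mul_assoc)
  qed
  then obtain c where c: "\<And>s. s \<in> {t..T} \<Longrightarrow> \<Psi> s ** \<Phi> s = c"
    using has_vector_derivative_zero_constant[OF convex_real_interval(5)] by blast
  have "c = mat 1" using c[of t] tT \<Phi>(1) Y(1) by (simp add: \<Psi>_def transpose_mat)
  then have inv: "\<Phi> s ** \<Psi> s = mat 1" if "s \<in> {t..T}" for s
    using c[OF that] matrix_left_right_inverse by blast
  have c1: "continuous_on {t..T} \<Phi>"
    using \<Phi>(2) has_vector_derivative_continuous continuous_on_eq_continuous_within by blast
  have c2: "continuous_on {t..T} \<Psi>"
    using \<Psi>d has_vector_derivative_continuous continuous_on_eq_continuous_within by blast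
  show thesis by (rule that[OF \<Phi> inv c1 c2])
qed

subsection \<open>The optimal strategy\<close>

context riccati
begin

definition feedback :: "real \<Rightarrow> real^'n^'n" where
  "feedback s = Itilde \<theta> ** Cbar (C s) ** C s"

lemma feedback_nth: "(feedback s *v y) $ i = (if \<theta> i > 0 then (C s *v y) $ i / C s $ i $ i else 0)"
  unfolding feedback_def Itilde_def Cbar_def matrix_vector_mul_assoc[symmetric] diag_mat_vector_mult by simp

lemma feedback_entry_continuous: "continuous_on {a..T} (\<lambda>s. feedback s $ i $ j)"
proof -
  have "feedback s $ i $ j = (if \<theta> i > 0 then C s $ i $ j / C s $ i $ i else 0)" for s
    using feedback_nth[of s "axis j 1" i] by (simp add: matrix_vector_mul_component inner_axis)
  moreover have "continuous_on {a..T} (\<lambda>s. C s $ i $ j / C s $ i $ i)"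
    using C_diag_pos[of _ i] by (intro continuous_intros C_entry_continuous) (auto simp: less_imp_neq[symmetric])
  ultimately show ?thesis by (cases "\<theta> i > 0") auto
qed

text \<open>Up to the factor \<open>exp (- \<Theta> * s)\<close> this is the drift of the discounted
  value under the feedback. The Riccati equation leaves minus the form of
  \<open>matrix_inv \<Lambda>\<close> at \<open>C s *v X\<close>, minus the risk term, and the jump
  term; the discount absorbs the latter by \<open>jump_term_le\<close>.\<close>

lemma optimal_drift_nonpos:
  assumes s: "s \<le> T"
  shows "X \<bullet> (C' s *v X) - (\<Sum>i\<in>UNIV. \<theta> i) * (X \<bullet> (C s *v X)) - 2 * ((matrix_inv \<Lambda> *v (C s *v X)) \<bullet> (C s *v X)) \<le> 0"
proof -
  have "(C s *v X) \<bullet> (matrix_inv \<Lambda> *v (C s *v X)) \<ge> 0"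
    using pos_def_imp_nonneg_def[OF pos_def_matrix_inv[OF \<Lambda>_pos]] by (simp add: nonneg_def_def)
  moreover have "\<alpha> * (X \<bullet> (\<Sigma> *v X)) \<ge> 0" using \<alpha>_nonneg \<Sigma>_nonneg by (simp add: nonneg_def_def)
  moreover have "(\<Sum>i\<in>UNIV. \<theta> i * ((C s *v X) $ i)\<^sup>2 / C s $ i $ i) \<le> (\<Sum>i\<in>UNIV. \<theta> i) * (X \<bullet> (C s *v X))"
    by (rule jump_term_le[OF pos_def_imp_nonneg_def[OF C_pos_def[OF s]] s])
  ultimately show ?thesis
    unfolding C'_quadratic[OF s] inner_commute[of "matrix_inv \<Lambda> *v (C s *v X)"] by linarith
qed

text \<open>With positive intensity the feedback trade minimises the gain of a jump, and the minimum
  is minus a square over the diagonal entry; with intensity 0 there is no trade.\<close>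

lemma optimal_jump_nonpos:
  assumes s: "s \<le> T"
  shows "C s $ i $ i * ((feedback s *v X) $ i)\<^sup>2 - 2 * (feedback s *v X) $ i * (C s *v X) $ i \<le> 0"
proof (cases "\<theta> i > 0")
  case True
  have "C s $ i $ i * ((feedback s *v X) $ i)\<^sup>2 - 2 * (feedback s *v X) $ i * (C s *v X) $ i
      = - (((C s *v X) $ i)\<^sup>2 / C s $ i $ i)"
    using C_diag_pos[OF s, of i] True by (simp add: feedback_nth power2_eq_square field_simps)
  then show ?thesis using C_diag_pos[OF s, of i] by simp
qed (simp add: feedback_nth)

end

locale liquidation = poisson_horizon M P \<pi> \<theta> t T + riccati \<theta> \<alpha> T l \<Lambda> \<Sigma> C
  for M :: "'w measure" and P \<pi> :: "real \<Rightarrow> 'w \<Rightarrow> real^'n::finite" and \<theta> :: "'n \<Rightarrow> real" and t T :: real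
    and \<alpha> l :: real and \<Lambda> \<Sigma> :: "real^'n^'n" and C :: "real \<Rightarrow> real^'n^'n"
begin

lemma Pr_continuous:
  assumes "continuous_on {t..T} f"
  shows "(\<lambda>(s, \<omega>). f s :: real) \<in> borel_measurable Pr"
proof (rule predictable_left_limit[where Y = "\<lambda>s \<omega>. f s"])
  fix s \<omega> assume s: "s \<in> {t<..<T}"
  have "(f \<longlongrightarrow> f s) (at s within {t..T})" using assms s by (auto simp: continuous_on_def)
  then have "(f \<longlongrightarrow> f s) (at s within {t..s})" by (rule tendsto_within_subset) (use s in auto)
  then show "(f \<longlongrightarrow> f s) (at_left s)" using s by (simp add: at_within_Icc_at_left)
qed auto

lemma Pr_matrix_vector:
  assumes A: "\<And>i j. continuous_on {t..T} (\<lambda>s. A s $ i $ j)" and W: "\<And>j. (\<lambda>(s, \<omega>). W s \<omega> $ j) \<in> borel_measurable Pr"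
  shows "(\<lambda>(s, \<omega>). ((A s :: real^'n^'n) *v W s \<omega>) $ i) \<in> borel_measurable Pr"
proof -
  have "(\<lambda>p. A (fst p) $ i $ j) \<in> borel_measurable Pr" "(\<lambda>p. W (fst p) (snd p) $ j) \<in> borel_measurable Pr" for j
    using Pr_continuous[OF A[of i j]] W[of j] by (simp_all add: case_prod_beta')
  then have "(\<lambda>p. \<Sum>j\<in>UNIV. A (fst p) $ i $ j * W (fst p) (snd p) $ j) \<in> borel_measurable Pr"
    by (intro borel_measurable_sum borel_measurable_times)
  then show ?thesis by (simp add: matrix_vector_mult_def case_prod_beta')
qed

text \<open>After the substitution \<open>X = \<Phi> Z\<close> with the fundamental solution \<open>\<Phi>\<close> of the equation without jumps, \<open>Z\<close>
  is constant between jumps; its left limits are obtained by an iteration that is stationary after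
  as many steps as there are jumps.\<close>

lemma pure_jump_solution:
  fixes g b :: "'n \<Rightarrow> real \<Rightarrow> real^'n" and x :: "real^'n"
  assumes g: "\<And>i j. continuous_on {t..T} (\<lambda>s. g i s $ j)" and b: "\<And>i j. continuous_on {t..T} (\<lambda>s. b i s $ j)"
  obtains W where "\<And>k. (\<lambda>(s, \<omega>). W s \<omega> $ k) \<in> borel_measurable Pr"
    "\<And>s \<omega> k. \<omega> \<in> space M \<Longrightarrow> s \<in> {t..<T} \<Longrightarrow>
       W s \<omega> $ k = x $ k - (\<Sum>i\<in>UNIV. \<Sum>r\<in>JT i T \<omega> \<inter> {..<s}. (g i r \<bullet> W r \<omega>) * b i r $ k * \<Delta> i r \<omega>)"
proof -
  define step where "step V s \<omega> = (\<chi> k. x $ k - (\<Sum>i\<in>UNIV. \<Sum>r\<in>JT i T \<omega> \<inter> {..<s}. (g i r \<bullet> V r \<omega>) * b i r $ k * \<Delta> i r \<omega>))"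
    for V :: "real \<Rightarrow> 'w \<Rightarrow> real^'n" and s \<omega>
  \<comment> \<open>Fixed point iteration: every step inserts the previous approximation into the
    jump sum.\<close>
  define W where "W n = (step ^^ n) (\<lambda>_ _. x)" for n
  have W0: "W 0 s \<omega> = x" and WS: "W (Suc n) s \<omega> = step (W n) s \<omega>" for n s \<omega> by (simp_all add: W_def)
  have Wm: "(\<lambda>(s, \<omega>). W n s \<omega> $ k) \<in> borel_measurable Pr" for n k
  proof (induction n arbitrary: k)
    case 0
    then show ?case by (simp add: W0)
  next
    case (Suc n)
    have int: "(\<lambda>(r, \<omega>). (g i r \<bullet> W n r \<omega>) * b i r $ k) \<in> borel_measurable Pr" for i
    proof -
      have "(\<lambda>p. g i (fst p) $ j) \<in> borel_measurable Pr" "(\<lambda>p. b i (fst p) $ k) \<in> borel_measurable Pr"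
        "(\<lambda>p. W n (fst p) (snd p) $ j) \<in> borel_measurable Pr" for j
        using Pr_continuous[OF g[of i j]] Pr_continuous[OF b[of i k]] Suc.IH[of j] by (simp_all add: case_prod_beta')
      then have "(\<lambda>p. (\<Sum>j\<in>UNIV. g i (fst p) $ j * W n (fst p) (snd p) $ j) * b i (fst p) $ k) \<in> borel_measurable Pr"
        by (intro borel_measurable_sum borel_measurable_times)
      then show ?thesis by (simp add: inner_vec_def case_prod_beta')
    qed
    show ?case
    proof (rule predictable_left_limit[where Y = "\<lambda>s \<omega>. x $ k - (\<Sum>i\<in>UNIV. jS i s (\<lambda>r \<omega>. (g i r \<bullet> W n r \<omega>) * b i r $ k) \<omega>)"])
      show "(\<lambda>\<omega>. x $ k - (\<Sum>i\<in>UNIV. jS i s (\<lambda>r \<omega>. (g i r \<bullet> W n r \<omega>) * b i r $ k) \<omega>)) \<in> borel_measurable (F s)"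
        if "s \<in> {t..<T}" for s
        using that by (intro borel_measurable_diff borel_measurable_sum jS_measurable int) auto
      show "W (Suc n) t \<omega> $ k = x $ k - (\<Sum>i\<in>UNIV. jS i t (\<lambda>r \<omega>. (g i r \<bullet> W n r \<omega>) * b i r $ k) \<omega>)" for \<omega>
      proof -
        have "JT i T \<omega> \<inter> {..<t} = {}" "JT i t \<omega> = {}" for i using JT_subset[of i T \<omega>] JT_subset[of i t \<omega>] by force+
        then show ?thesis by (simp add: WS step_def jS_def)
      qed
      show "((\<lambda>q. x $ k - (\<Sum>i\<in>UNIV. jS i q (\<lambda>r \<omega>. (g i r \<bullet> W n r \<omega>) * b i r $ k) \<omega>)) \<longlongrightarrow> W (Suc n) s \<omega> $ k) (at_left s)"
        if "s \<in> {t<..<T}" "\<omega> \<in> space M" for s \<omega>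
        unfolding WS step_def vec_lambda_beta using that by (intro tendsto_intros jS_left_limit) auto
    qed
  qed
  define JJ where "JJ \<omega> = (\<Union>i. JT i T \<omega>)" for \<omega>
  have fin: "finite (JJ \<omega>)" if "\<omega> \<in> space M" for \<omega> using finite_JT[OF that] by (simp add: JJ_def)
  \<comment> \<open>The value at \<open>s\<close> uses values at strictly earlier jump times only,
    so every jump costs one step: after as many steps as there are jumps before \<open>s\<close>,
    nothing changes any more.\<close>
  have stat: "W (Suc n) s \<omega> = W n s \<omega>" if \<omega>: "\<omega> \<in> space M" and "card (JJ \<omega> \<inter> {..<s}) \<le> n" for n s \<omega>
    using that(2)
  proof (induction n arbitrary: s)
    case 0
    then have "JJ \<omega> \<inter> {..<s} = {}" using fin[OF that(1)] by simp
    then have "JT i T \<omega> \<inter> {..<s} = {}" for i by (auto simp: JJ_def)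
    then show ?case by (simp add: WS W0 step_def vec_eq_iff)
  next
    case (Suc n)
    have "W (Suc n) r \<omega> = W n r \<omega>" if r: "r \<in> JT i T \<omega> \<inter> {..<s}" for r i
    proof (rule Suc.IH)
      have "JJ \<omega> \<inter> {..<r} \<subset> JJ \<omega> \<inter> {..<s}" using r by (auto simp: JJ_def)
      then have "card (JJ \<omega> \<inter> {..<r}) < card (JJ \<omega> \<inter> {..<s})" using fin[OF \<omega>] by (intro psubset_card_mono) auto
      then show "card (JJ \<omega> \<inter> {..<r}) \<le> n" using Suc.prems by simp
    qed
    then show ?case unfolding WS[of "Suc n"] WS[of n] step_def vec_eq_iff vec_lambda_beta
      by (intro allI arg_cong2[where f = minus] sum.cong) auto
  qed
  \<comment> \<open>The number of steps depends on the outcome, so predictability of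
    \<open>Wl\<close> does not come from a single iterate; it holds because \<open>Wl\<close> is the
    pointwise limit of all of them.\<close>
  define Wl where "Wl s \<omega> = W (card (JJ \<omega>)) s \<omega>" for s \<omega>
  have Wl: "W n s \<omega> = Wl s \<omega>" if "\<omega> \<in> space M" "card (JJ \<omega>) \<le> n" for n s \<omega>
    using that(2)
  proof (induction n rule: dec_induct)
    case base
    then show ?case by (simp add: Wl_def)
  next
    case (step n)
    have "card (JJ \<omega> \<inter> {..<s}) \<le> card (JJ \<omega>)" using fin[OF that(1)] by (intro card_mono) auto
    then show ?case using stat[OF that(1), of s n] step by simp
  qed
  show thesis
  proof (rule that[of Wl])
    show "(\<lambda>(s, \<omega>). Wl s \<omega> $ k) \<in> borel_measurable Pr" for k
    proof (rule borel_measurable_LIMSEQ_metric[OF Wm[of _ k]])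
      fix p assume p: "p \<in> space Pr"
      obtain s \<omega> where pe: "p = (s, \<omega>)" by (cases p)
      have \<omega>: "\<omega> \<in> space M" using p pe by auto
      have "\<forall>\<^sub>F n in sequentially. W n s \<omega> $ k = Wl s \<omega> $ k"
        using eventually_ge_at_top[of "card (JJ \<omega>)"] by eventually_elim (simp add: Wl[OF \<omega>])
      then show "(\<lambda>n. case p of (s, \<omega>) \<Rightarrow> W n s \<omega> $ k) \<longlonglongrightarrow> (case p of (s, \<omega>) \<Rightarrow> Wl s \<omega> $ k)"
        unfolding pe by (simp add: tendsto_eventually)
    qed
    fix s \<omega> k assume \<omega>: "\<omega> \<in> space M"
    have "Wl s \<omega> $ k = step (W (card (JJ \<omega>))) s \<omega> $ k"
      using Wl[OF \<omega>, of "Suc (card (JJ \<omega>))" s] by (simp add: WS)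
    then show "Wl s \<omega> $ k = x $ k - (\<Sum>i\<in>UNIV. \<Sum>r\<in>JT i T \<omega> \<inter> {..<s}. (g i r \<bullet> Wl r \<omega>) * b i r $ k * \<Delta> i r \<omega>)"
      by (simp add: step_def Wl_def)
  qed
qed

end

context liquidation
begin

text \<open>The closed-loop equation couples strategy and position. The candidate \<open>Xr\<close>
  for the position and its left limit \<open>Xm\<close> are therefore built first, the strategy is
  read off from them, and then its position is shown to be \<open>Xr\<close>. Admissibility follows
  from a uniform bound on \<open>Xr\<close>.\<close>

lemma optimal_strategy_exists:
  fixes x :: "real^'n"
  obtains \<xi> \<eta> where "admissible M F \<theta> T t \<xi> \<eta>"
    "AE \<omega> in M. \<forall>s\<in>{t..<T}. \<xi> s \<omega> = matrix_inv \<Lambda> *v (C s *v position \<pi> x t \<xi> \<eta> s \<omega>)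
       \<and> \<eta> s \<omega> = feedback s *v left_lim (\<lambda>q. position \<pi> x t \<xi> \<eta> q \<omega>) s"
proof -
  have tT: "t \<le> T" using t_less_T by simp
  interpret mm: bounded_bilinear "(**) :: real^'n^'n \<Rightarrow> real^'n^'n \<Rightarrow> real^'n^'n"
    by (rule bounded_bilinear_matrix_matrix_mult)
  define A where "A s = - (matrix_inv \<Lambda> ** C s)" for s
  have Cc: "continuous_on {t..T} C" by (rule continuous_on_subset[OF C_continuous]) auto
  have Ac: "continuous_on {t..T} A"
    unfolding A_def by (intro continuous_on_minus mm.continuous_on continuous_on_const Cc)
  obtain \<Phi> \<Psi> where \<Phi>t: "\<Phi> t = mat 1"
    and \<Phi>d: "\<And>s. s \<in> {t..T} \<Longrightarrow> (\<Phi> has_vector_derivative (A s ** \<Phi> s)) (at s within {t..T})"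
    and inv: "\<And>s. s \<in> {t..T} \<Longrightarrow> \<Phi> s ** \<Psi> s = mat 1"
    and \<Phi>c: "continuous_on {t..T} \<Phi>" and \<Psi>c: "continuous_on {t..T} \<Psi>"
    using fundamental_solution[OF tT Ac] by blast
  have comp: "continuous_on {t..T} (\<lambda>s. B s $ i $ j)" if "continuous_on {t..T} B" for B :: "real \<Rightarrow> real^'n^'n" and i j
    by (intro continuous_on_component that)
  \<comment> \<open>In \<open>X = \<Phi> Z\<close> the drift of \<open>X\<close> is carried by
    \<open>\<Phi>\<close>. A jump of component \<open>i\<close> lowers \<open>X\<close> along axis
    \<open>i\<close> by the feedback trade, hence lowers \<open>Z\<close> by that trade times the
    \<open>i\<close>-th column \<open>b i\<close> of \<open>\<Psi>\<close>; the row
    \<open>g i\<close> computes the trade from \<open>Z\<close>.\<close>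
  define g where "g i s = (feedback s ** \<Phi> s) $ i" for i s
  define b where "b i s = (\<chi> j. \<Psi> s $ j $ i)" for i s
  have gc: "continuous_on {t..T} (\<lambda>s. g i s $ j)" for i j
    unfolding g_def matrix_matrix_mult_def vec_lambda_beta
    by (intro continuous_on_sum continuous_on_mult feedback_entry_continuous comp[OF \<Phi>c])
  have bc: "continuous_on {t..T} (\<lambda>s. b i s $ j)" for i j
    unfolding b_def vec_lambda_beta by (rule comp[OF \<Psi>c])
  obtain W where WPr: "\<And>k. (\<lambda>(s, \<omega>). W s \<omega> $ k) \<in> borel_measurable Pr"
    and W: "\<And>s \<omega> k. \<omega> \<in> space M \<Longrightarrow> s \<in> {t..<T} \<Longrightarrow>
       W s \<omega> $ k = x $ k - (\<Sum>i\<in>UNIV. \<Sum>r\<in>JT i T \<omega> \<inter> {..<s}. (g i r \<bullet> W r \<omega>) * b i r $ k * \<Delta> i r \<omega>)"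
    using pure_jump_solution[of g b x] gc bc by blast
  define \<gamma> where "\<gamma> i r \<omega> = g i r \<bullet> W r \<omega>" for i r \<omega>
  \<comment> \<open>\<open>W\<close> holds the left limits, from which trades are computed, while
    \<open>Zr\<close> also counts the jump at \<open>s\<close> itself.\<close>
  define Zr where "Zr s \<omega> = (\<chi> k. x $ k - (\<Sum>i\<in>UNIV. jS i s (\<lambda>r \<omega>. \<gamma> i r \<omega> * b i r $ k) \<omega>))" for s \<omega>
  define Xr where "Xr s \<omega> = \<Phi> s *v Zr s \<omega>" for s \<omega>
  define Xm where "Xm s \<omega> = \<Phi> s *v W s \<omega>" for s \<omega>
  have \<gamma>: "\<gamma> i r \<omega> = (feedback r *v Xm r \<omega>) $ i" for i r \<omega>
    unfolding \<gamma>_def g_def Xm_def matrix_vector_mul_assoc by (simp add: matrix_vector_mul_component)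
  \<comment> \<open>The strategy is set to 0 off \<open>G\<close>. As \<open>G\<close> lies in every
    \<open>F s\<close>, measurability is kept, and the bounds on the strategy then hold for every
    outcome.\<close>
  obtain N where N: "{\<omega>\<in>space M. \<not> ((\<forall>i. \<forall>r\<in>JT i T \<omega>. \<Delta> i r \<omega> = 1) \<and> (\<forall>i j. i \<noteq> j \<longrightarrow> JT i T \<omega> \<inter> JT j T \<omega> = {}))} \<subseteq> N"
    "N \<in> null_sets M" by (rule AE_E[OF AE_good_jumps], rule that, assumption, rule null_setsI)
  define G where "G = space M - N"
  have GM: "\<omega> \<in> space M" if "\<omega> \<in> G" for \<omega> using that by (simp add: G_def)
  have \<Delta>1: "\<Delta> i r \<omega> = 1" if "\<omega> \<in> G" "r \<in> JT i T \<omega>" for i r \<omega> using that N(1) by (auto simp: G_def)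
  have disj: "JT i T \<omega> \<inter> JT j T \<omega> = {}" if "\<omega> \<in> G" "i \<noteq> j" for i j \<omega> using that N(1) unfolding G_def by blast
  have GF: "G \<in> sets (F s)" for s
    using null_sets_F[OF N(2), of s] sets.compl_sets[of N "F s"] by (simp add: G_def)
  have AEG: "AE \<omega> in M. \<omega> \<in> G" using AE_not_in[OF N(2)] AE_space by eventually_elim (simp add: G_def)
  define \<xi> where "\<xi> s \<omega> = indicator G \<omega> *\<^sub>R (matrix_inv \<Lambda> *v (C s *v Xr s \<omega>))" for s \<omega>
  define \<eta> where "\<eta> s \<omega> = indicator G \<omega> *\<^sub>R (feedback s *v Xm s \<omega>)" for s \<omega>
  have \<eta>\<gamma>: "\<eta> r \<omega> $ i = \<gamma> i r \<omega>" if "\<omega> \<in> G" for i r \<omega> using that by (simp add: \<eta>_def \<gamma>)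

  \<comment> \<open>Product rule for \<open>\<Phi> Zr\<close>: the derivative of
    \<open>\<Phi>\<close> produces \<open>- \<xi>\<close>, and
    \<open>\<Phi> s ** \<Psi> s = mat 1\<close> turns the jump of \<open>Zr\<close> into a jump of a
    single coordinate of \<open>Xr\<close>.\<close>
  have path: "set_integrable lborel {t..T} (\<lambda>r. \<xi> r \<omega> $ k) \<and> (\<forall>s\<in>{t..T}. Xr s \<omega> $ k =
      x $ k - (LINT r:{t..s}|lborel. \<xi> r \<omega> $ k) - (\<Sum>r\<in>JT k T \<omega> \<inter> {..s}. \<eta> r \<omega> $ k))" if \<omega>G: "\<omega> \<in> G" for \<omega> k
  proof -
    note \<omega> = GM[OF \<omega>G]
    define JJ where "JJ = (\<Union>i. JT i T \<omega>)"
    have sub: "JT i T \<omega> \<subseteq> {t<..T}" for i using JT_subset(1)[of i T \<omega>] by force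
    have JJ: "finite JJ" "JJ \<subseteq> {t<..T}" using finite_JT[OF \<omega>] sub unfolding JJ_def by simp_all blast
    define d where "d j r = (\<Sum>i\<in>UNIV. if r \<in> JT i T \<omega> then - (\<gamma> i r \<omega> * b i r $ j) else 0)" for j r
    have Zt: "Zr t \<omega> = x"
    proof -
      have "JT i t \<omega> = {}" for i using JT_subset[of i t \<omega>] by force
      then show ?thesis by (simp add: Zr_def jS_def vec_eq_iff)
    qed
    have pZ: "jump_path t T JJ (\<lambda>s. Zr s \<omega> $ j) (\<lambda>s. 0) (d j)" for j
    proof (rule jump_pathI[OF tT JJ])
      show "set_integrable lborel {t..T} (\<lambda>s. 0 :: real)" by (simp add: set_integrable_def)
      fix s assume s: "s \<in> {t..T}"
      have "(\<Sum>r\<in>JJ \<inter> {..s}. d j r) = (\<Sum>i\<in>UNIV. \<Sum>r\<in>JJ \<inter> {..s}. if r \<in> JT i T \<omega> then - (\<gamma> i r \<omega> * b i r $ j) else 0)"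
        unfolding d_def by (rule sum.swap)
      also have "\<dots> = (\<Sum>i\<in>UNIV. - jS i s (\<lambda>r \<omega>. \<gamma> i r \<omega> * b i r $ j) \<omega>)"
      proof (rule sum.cong[OF refl])
        fix i
        have "(\<Sum>r\<in>JJ \<inter> {..s}. if r \<in> JT i T \<omega> then - (\<gamma> i r \<omega> * b i r $ j) else 0) = (\<Sum>r\<in>JT i s \<omega>. - (\<gamma> i r \<omega> * b i r $ j * \<Delta> i r \<omega>))"
          using JJ(1) s JT_eq[of s i \<omega>] \<Delta>1[OF \<omega>G] by (intro sum.mono_neutral_cong_right) (auto simp: JJ_def)
        then show "(\<Sum>r\<in>JJ \<inter> {..s}. if r \<in> JT i T \<omega> then - (\<gamma> i r \<omega> * b i r $ j) else 0) = - jS i s (\<lambda>r \<omega>. \<gamma> i r \<omega> * b i r $ j) \<omega>"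
          by (simp add: jS_def sum_negf)
      qed
      finally have "(\<Sum>r\<in>JJ \<inter> {..s}. d j r) = - (\<Sum>i\<in>UNIV. jS i s (\<lambda>r \<omega>. \<gamma> i r \<omega> * b i r $ j) \<omega>)" by (simp add: sum_negf)
      then show "Zr s \<omega> $ j = Zr t \<omega> $ j + (LINT r:{t..s}|lborel. 0) + (\<Sum>r\<in>JJ \<inter> {..s}. d j r)"
        unfolding Zt by (simp add: Zr_def)
    qed
    have p\<Phi>: "jump_path t T JJ (\<lambda>s. \<Phi> s $ k $ j) (\<lambda>s. (A s ** \<Phi> s) $ k $ j) (\<lambda>r. 0)" for j
    proof (rule jump_path_C1[OF tT JJ])
      show "((\<lambda>s. \<Phi> s $ k $ j) has_vector_derivative (A s ** \<Phi> s) $ k $ j) (at s within {t..T})" if "s \<in> {t..T}" for s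
        by (intro bounded_linear.has_vector_derivative[OF bounded_linear_vec_nth] \<Phi>d that)
      show "continuous_on {t..T} (\<lambda>s. (A s ** \<Phi> s) $ k $ j)"
        by (intro comp mm.continuous_on Ac \<Phi>c)
    qed
    have p: "jump_path t T JJ (\<lambda>s. \<Sum>j\<in>UNIV. \<Phi> s $ k $ j * Zr s \<omega> $ j)
        (\<lambda>s. \<Sum>j\<in>UNIV. \<Phi> s $ k $ j * 0 + (A s ** \<Phi> s) $ k $ j * Zr s \<omega> $ j)
        (\<lambda>r. \<Sum>j\<in>UNIV. \<Phi> r $ k $ j * Zr r \<omega> $ j - (\<Phi> r $ k $ j - 0) * (Zr r \<omega> $ j - d j r))"
      by (intro jump_path_sum finite tT JJ jump_path_mult p\<Phi> pZ)
    have Xrk: "(\<Sum>j\<in>UNIV. \<Phi> s $ k $ j * Zr s \<omega> $ j) = Xr s \<omega> $ k" for s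
      by (simp add: Xr_def matrix_vector_mult_def)
    have drift: "(\<Sum>j\<in>UNIV. \<Phi> s $ k $ j * 0 + (A s ** \<Phi> s) $ k $ j * Zr s \<omega> $ j) = - \<xi> s \<omega> $ k" for s
    proof -
      have "(\<Sum>j\<in>UNIV. \<Phi> s $ k $ j * 0 + (A s ** \<Phi> s) $ k $ j * Zr s \<omega> $ j) = ((A s ** \<Phi> s) *v Zr s \<omega>) $ k"
        by (simp add: matrix_vector_mult_def)
      also have "(A s ** \<Phi> s) *v Zr s \<omega> = A s *v Xr s \<omega>" by (simp add: Xr_def matrix_vector_mul_assoc)
      also have "\<dots> = - (matrix_inv \<Lambda> *v (C s *v Xr s \<omega>))"
        using bounded_bilinear.minus_left[OF bounded_bilinear_matrix_vector_mult, of "matrix_inv \<Lambda> ** C s" "Xr s \<omega>"]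
        by (simp add: A_def matrix_vector_mul_assoc)
      finally show ?thesis using \<omega>G by (simp add: \<xi>_def)
    qed
    have jump: "(\<Sum>j\<in>UNIV. \<Phi> r $ k $ j * Zr r \<omega> $ j - (\<Phi> r $ k $ j - 0) * (Zr r \<omega> $ j - d j r))
        = (if r \<in> JT k T \<omega> then - \<eta> r \<omega> $ k else 0)" if r: "r \<in> {t..T}" for r
    proof -
      have "(\<Sum>j\<in>UNIV. \<Phi> r $ k $ j * Zr r \<omega> $ j - (\<Phi> r $ k $ j - 0) * (Zr r \<omega> $ j - d j r)) = (\<Sum>j\<in>UNIV. \<Phi> r $ k $ j * d j r)"
        by (intro sum.cong) (auto simp: algebra_simps)
      also have "\<dots> = (\<Sum>j\<in>UNIV. \<Sum>i\<in>UNIV. if r \<in> JT i T \<omega> then - \<gamma> i r \<omega> * (\<Phi> r $ k $ j * \<Psi> r $ j $ i) else 0)"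
        unfolding d_def sum_distrib_left by (intro sum.cong) (auto simp: b_def)
      also have "\<dots> = (\<Sum>i\<in>UNIV. \<Sum>j\<in>UNIV. if r \<in> JT i T \<omega> then - \<gamma> i r \<omega> * (\<Phi> r $ k $ j * \<Psi> r $ j $ i) else 0)" by (rule sum.swap)
      also have "\<dots> = (\<Sum>i\<in>UNIV. if r \<in> JT i T \<omega> then - \<gamma> i r \<omega> * (\<Phi> r ** \<Psi> r) $ k $ i else 0)"
        by (intro sum.cong) (auto simp: matrix_matrix_mult_def sum_distrib_left)
      also have "\<dots> = (\<Sum>i\<in>UNIV. if i = k then (if r \<in> JT k T \<omega> then - \<gamma> k r \<omega> else 0) else 0)"
        unfolding inv[OF r] by (intro sum.cong) (auto simp: mat_def)
      finally show ?thesis using \<eta>\<gamma>[OF \<omega>G] by simp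
    qed
    have "set_integrable lborel {t..T} (\<lambda>s. - \<xi> s \<omega> $ k)" using jump_path_props(4)[OF p] unfolding drift .
    then have int: "set_integrable lborel {t..T} (\<lambda>s. \<xi> s \<omega> $ k)"
      using set_integrable_mult_right[of "-1" lborel "{t..T}" "\<lambda>s. - \<xi> s \<omega> $ k"] by simp
    have "Xr s \<omega> $ k = x $ k - (LINT r:{t..s}|lborel. \<xi> r \<omega> $ k) - (\<Sum>r\<in>JT k T \<omega> \<inter> {..s}. \<eta> r \<omega> $ k)" if s: "s \<in> {t..T}" for s
    proof -
      have "Xr s \<omega> $ k = Xr t \<omega> $ k + (LINT r:{t..s}|lborel. - \<xi> r \<omega> $ k)
          + (\<Sum>r\<in>JJ \<inter> {..s}. \<Sum>j\<in>UNIV. \<Phi> r $ k $ j * Zr r \<omega> $ j - (\<Phi> r $ k $ j - 0) * (Zr r \<omega> $ j - d j r))"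
        using jump_pathD(1)[OF p s] unfolding Xrk drift .
      also have "Xr t \<omega> = x" by (simp add: Xr_def Zt \<Phi>t)
      also have "(LINT r:{t..s}|lborel. - \<xi> r \<omega> $ k) = - (LINT r:{t..s}|lborel. \<xi> r \<omega> $ k)"
        using s by (intro set_integral_uminus set_integrable_subset[OF int]) auto
      also have "(\<Sum>r\<in>JJ \<inter> {..s}. \<Sum>j\<in>UNIV. \<Phi> r $ k $ j * Zr r \<omega> $ j - (\<Phi> r $ k $ j - 0) * (Zr r \<omega> $ j - d j r))
         = (\<Sum>r\<in>JJ \<inter> {..s}. if r \<in> JT k T \<omega> then - \<eta> r \<omega> $ k else 0)"
        using JJ(2) by (intro sum.cong[OF refl] jump) force
      also have "\<dots> = (\<Sum>r\<in>JT k T \<omega> \<inter> {..s}. - \<eta> r \<omega> $ k)"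
        using JJ(1) by (intro sum.mono_neutral_cong_right) (auto simp: JJ_def)
      finally show ?thesis by (simp add: sum_negf)
    qed
    with int show ?thesis by blast
  qed
  have pos: "position \<pi> x t \<xi> \<eta> s \<omega> = Xr s \<omega>" if "\<omega> \<in> G" "s \<in> {t..<T}" for s \<omega>
  proof -
    have "(\<Sum>r\<in>jump_times (\<lambda>q. \<pi> q \<omega> $ k) t s. \<eta> r \<omega> $ k * (\<pi> r \<omega> $ k - left_lim (\<lambda>q. \<pi> q \<omega> $ k) r))
        = (\<Sum>r\<in>JT k T \<omega> \<inter> {..s}. \<eta> r \<omega> $ k)" for k
    proof (rule sum.cong)
      show "jump_times (\<lambda>q. \<pi> q \<omega> $ k) t s = JT k T \<omega> \<inter> {..s}" using that(2) by (auto simp: JT_def jump_times_def)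
      fix r assume "r \<in> JT k T \<omega> \<inter> {..s}"
      then show "\<eta> r \<omega> $ k * (\<pi> r \<omega> $ k - left_lim (\<lambda>q. \<pi> q \<omega> $ k) r) = \<eta> r \<omega> $ k"
        using \<Delta>1[OF that(1), of r k] by (simp add: \<Delta>_def)
    qed
    then show ?thesis using path[OF that(1)] that(2) by (simp add: position_def vec_eq_iff)
  qed
  have Zlim: "((\<lambda>q. Zr q \<omega> $ k) \<longlongrightarrow> W s \<omega> $ k) (at_left s)" if "\<omega> \<in> space M" "s \<in> {t<..<T}" for s \<omega> k
  proof -
    have "W s \<omega> $ k = x $ k - (\<Sum>i\<in>UNIV. \<Sum>r\<in>JT i T \<omega> \<inter> {..<s}. \<gamma> i r \<omega> * b i r $ k * \<Delta> i r \<omega>)"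
      using W[OF that(1), of s k] that(2) by (simp add: \<gamma>_def)
    then show ?thesis
      unfolding Zr_def vec_lambda_beta using that by (auto intro!: tendsto_intros jS_left_limit)
  qed
  have left_cont: "(f \<longlongrightarrow> f s) (at_left s)" if "continuous_on {t..T} f" "s \<in> {t<..<T}" for f :: "real \<Rightarrow> real" and s
  proof -
    have "(f \<longlongrightarrow> f s) (at s within {t..T})" using that by (auto simp: continuous_on_def)
    then have "(f \<longlongrightarrow> f s) (at s within {t..s})" by (rule tendsto_within_subset) (use that in auto)
    then show ?thesis using that by (simp add: at_within_Icc_at_left)
  qed
  have right_cont: "(f \<longlongrightarrow> f s) (at_right s)" if "continuous_on {t..T} f" "s \<in> {t..<T}" for f :: "real \<Rightarrow> real" and s
  proof -
    have "(f \<longlongrightarrow> f s) (at s within {t..T})" using that by (auto simp: continuous_on_def)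
    then have "(f \<longlongrightarrow> f s) (at s within {s..T})" by (rule tendsto_within_subset) (use that in auto)
    then show ?thesis using that by (simp add: at_within_Icc_at_right)
  qed
  have Xlim: "((\<lambda>q. Xr q \<omega>) \<longlongrightarrow> Xm s \<omega>) (at_left s)" if "\<omega> \<in> space M" "s \<in> {t<..<T}" for s \<omega>
  proof (rule vec_tendstoI)
    fix k
    show "((\<lambda>q. Xr q \<omega> $ k) \<longlongrightarrow> Xm s \<omega> $ k) (at_left s)"
      unfolding Xr_def Xm_def matrix_vector_mult_def vec_lambda_beta
      by (intro tendsto_sum tendsto_mult left_cont[OF comp[OF \<Phi>c] that(2)] Zlim[OF that])
  qed
  have Xm_t: "Xm t \<omega> = x" if "\<omega> \<in> space M" for \<omega>
  proof -
    have "JT i T \<omega> \<inter> {..<t} = {}" for i using JT_subset[of i T \<omega>] by auto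
    then have "W t \<omega> = x" using W[OF that, of t] t_less_T by (simp add: vec_eq_iff)
    then show ?thesis by (simp add: Xm_def \<Phi>t)
  qed
  have Xr_t: "Xr t \<omega> = x" for \<omega>
  proof -
    have "JT i t \<omega> = {}" for i using JT_subset[of i t \<omega>] by force
    then have "Zr t \<omega> = x" by (simp add: Zr_def jS_def vec_eq_iff)
    then show ?thesis by (simp add: Xr_def \<Phi>t)
  qed
  have left: "left_lim (\<lambda>q. position \<pi> x t \<xi> \<eta> q \<omega>) s = Xm s \<omega>" if "\<omega> \<in> G" "s \<in> {t..<T}" for s \<omega>
  proof (cases "s = t")
    case True
    \<comment> \<open>At \<open>s = t\<close> the left limit looks at times before \<open>t\<close>;
      there the integral and the jump sum run over empty sets, so \<open>position\<close> is
      constantly \<open>x\<close>.\<close>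
    have "position \<pi> x t \<xi> \<eta> q \<omega> = x" if "q < t" for q
    proof -
      have "{t..q} = {}" "jump_times f t q = {}" for f using that by (auto simp: jump_times_def)
      then show ?thesis by (simp add: position_def vec_eq_iff set_lebesgue_integral_def)
    qed
    then have "left_lim (\<lambda>q. position \<pi> x t \<xi> \<eta> q \<omega>) t = x" by (intro left_lim_eq_const[of "t - 1"]) auto
    then show ?thesis using True Xm_t[OF GM[OF that(1)]] by simp
  next
    case False
    then have s: "s \<in> {t<..<T}" using that by auto
    have "\<forall>\<^sub>F q in at_left s. Xr q \<omega> = position \<pi> x t \<xi> \<eta> q \<omega>"
      using eventually_at_left_real[of t s] s by (auto elim!: eventually_mono simp: pos[OF that(1)])
    then have "((\<lambda>q. position \<pi> x t \<xi> \<eta> q \<omega>) \<longlongrightarrow> Xm s \<omega>) (at_left s)"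
      using tendsto_cong Xlim[OF GM[OF that(1)] s] by force
    then show ?thesis by (rule left_lim_eqI)
  qed
  have Xjump: "Xm r \<omega> = Xr r \<omega> + \<eta> r \<omega> $ i *\<^sub>R axis i 1" if \<omega>G: "\<omega> \<in> G" and r: "r \<in> JT i T \<omega>" for r i \<omega>
  proof -
    note \<omega> = GM[OF \<omega>G]
    have rT: "r \<in> {t..<T}" "r \<in> {t..T}" using JT_subset[of i T \<omega>] r by auto
    have JTr: "JT j r \<omega> = JT j T \<omega> \<inter> {..r}" for j by (rule JT_eq) (use rT in auto)
    have "W r \<omega> $ k - Zr r \<omega> $ k = \<gamma> i r \<omega> * b i r $ k" for k
    proof -
      have "jS j r (\<lambda>r \<omega>. \<gamma> j r \<omega> * b j r $ k) \<omega> - (\<Sum>q\<in>JT j T \<omega> \<inter> {..<r}. \<gamma> j q \<omega> * b j q $ k * \<Delta> j q \<omega>)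
          = (if j = i then \<gamma> i r \<omega> * b i r $ k else 0)" for j
      proof (cases "j = i")
        case True
        have "JT i r \<omega> = insert r (JT i T \<omega> \<inter> {..<r})" unfolding JTr using r by (auto simp: less_le)
        then show ?thesis using True finite_JT[OF \<omega>, of i T] \<Delta>1[OF \<omega>G r] by (simp add: jS_def)
      next
        case False
        have "r \<notin> JT j T \<omega>" using disj[OF \<omega>G False] r by blast
        then have "JT j r \<omega> = JT j T \<omega> \<inter> {..<r}" unfolding JTr by (auto simp: less_le)
        then show ?thesis using False by (simp add: jS_def)
      qed
      then have "(\<Sum>j\<in>UNIV. jS j r (\<lambda>r \<omega>. \<gamma> j r \<omega> * b j r $ k) \<omega>) - (\<Sum>j\<in>UNIV. \<Sum>q\<in>JT j T \<omega> \<inter> {..<r}. \<gamma> j q \<omega> * b j q $ k * \<Delta> j q \<omega>)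
          = \<gamma> i r \<omega> * b i r $ k" unfolding sum_subtractf[symmetric] by simp
      then show ?thesis using W[OF \<omega> rT(1), of k] by (simp add: Zr_def \<gamma>_def)
    qed
    then have "W r \<omega> = Zr r \<omega> + \<gamma> i r \<omega> *\<^sub>R b i r" by (simp add: vec_eq_iff algebra_simps)
    then have "Xm r \<omega> = Xr r \<omega> + \<gamma> i r \<omega> *\<^sub>R (\<Phi> r *v b i r)"
      by (simp add: Xm_def Xr_def matrix_vector_right_distrib matrix_vector_mult_scaleR)
    moreover have "\<Phi> r *v b i r = axis i 1"
    proof -
      have "(\<Phi> r *v b i r) $ k = (\<Phi> r ** \<Psi> r) $ k $ i" for k
        by (simp add: matrix_vector_mult_def matrix_matrix_mult_def b_def)
      then show ?thesis unfolding inv[OF rT(2)] by (simp add: vec_eq_iff mat_def axis_def)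
    qed
    ultimately show ?thesis by (simp add: \<eta>\<gamma>[OF \<omega>G])
  qed

  text \<open>Along the feedback strategy the weighted value $e^{-\theta s} X \cdot C(s) X$ is nonincreasing, which bounds the
    position by a constant.\<close>
  define \<Theta> where "\<Theta> = (\<Sum>i\<in>UNIV. \<theta> i)"
  define B where "B s = exp (- \<Theta> * s) *\<^sub>R C s" for s
  define B' where "B' s = exp (- \<Theta> * s) *\<^sub>R (C' s - \<Theta> *\<^sub>R C s)" for s
  have decay: "Xr s \<omega> \<bullet> (B s *v Xr s \<omega>) \<le> x \<bullet> (B t *v x)" if \<omega>G: "\<omega> \<in> G" and s: "s \<in> {t..T}" for s \<omega>
  proof -
    note \<omega> = GM[OF \<omega>G]
    have Bd: "(B has_vector_derivative B' s) (at s within {t..T})" if "s \<in> {t..T}" for s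
    proof -
      have 1: "(C has_vector_derivative C' s) (at s within {t..T})"
        using that by (intro has_vector_derivative_within_subset[OF C_deriv]) auto
      have 2: "((\<lambda>s. exp (- \<Theta> * s)) has_real_derivative (- \<Theta> * exp (- \<Theta> * s))) (at s within {t..T})"
        by (auto intro!: derivative_eq_intros)
      have "((\<lambda>s. exp (- \<Theta> * s) *\<^sub>R C s) has_vector_derivative (exp (- \<Theta> * s) *\<^sub>R C' s + (- \<Theta> * exp (- \<Theta> * s)) *\<^sub>R C s)) (at s within {t..T})"
        by (rule has_vector_derivative_scaleR[OF 2 1])
      then show ?thesis by (simp add: B_def[abs_def] B'_def scaleR_diff_right mult.commute)
    qed
    have B'c: "continuous_on {t..T} B'"
      unfolding B'_def by (intro continuous_intros Cc continuous_on_subset[OF C'_continuous]) auto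
    have Bs: "sym_mat (B s)" if "s \<in> {t..T}" for s
    proof -
      have "transpose (c *\<^sub>R A) = c *\<^sub>R transpose A" for c and A :: "real^'n^'n" by (simp add: transpose_def vec_eq_iff)
      then show ?thesis using C_sym[of s] that by (simp add: B_def sym_mat_def)
    qed
    have JT: "finite (JT i T \<omega>)" "JT i T \<omega> \<subseteq> {t<..T}" for i
      using finite_JT[OF \<omega>] JT_subset[of i T \<omega>] by auto
    have int: "set_integrable lborel {t..T} (\<lambda>r. \<xi> r \<omega> $ i)" for i using path[OF \<omega>G] by blast
    have comps: "Xr s \<omega> $ i = x $ i - (LINT r:{t..s}|lborel. \<xi> r \<omega> $ i) - (\<Sum>r\<in>JT i T \<omega> \<inter> {..s}. \<eta> r \<omega> $ i)" if "s \<in> {t..T}" for s i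
      using path[OF \<omega>G] that by blast
    note qf = quadratic_form_jump_formula[of t T "\<lambda>i. JT i T \<omega>" "\<lambda>r. \<xi> r \<omega>" "\<lambda>s. Xr s \<omega>" x "\<lambda>r. \<eta> r \<omega>" "\<lambda>r. Xm r \<omega>" B B',
        OF tT JT disj[OF \<omega>G] int comps Xjump[OF \<omega>G] Bd B'c Bs]
    have "Xr s \<omega> \<bullet> (B s *v Xr s \<omega>) = x \<bullet> (B t *v x)
      + (LINT r:{t..s}|lborel. Xr r \<omega> \<bullet> (B' r *v Xr r \<omega>) - 2 * (\<xi> r \<omega> \<bullet> (B r *v Xr r \<omega>)))
      + (\<Sum>i\<in>UNIV. \<Sum>r\<in>JT i T \<omega> \<inter> {..s}. B r $ i $ i * (\<eta> r \<omega> $ i)\<^sup>2 - 2 * \<eta> r \<omega> $ i * (B r *v Xm r \<omega>) $ i)"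
      by (rule qf(2)[OF _ _ _ _ _ s])
    moreover have "(LINT r:{t..s}|lborel. Xr r \<omega> \<bullet> (B' r *v Xr r \<omega>) - 2 * (\<xi> r \<omega> \<bullet> (B r *v Xr r \<omega>))) \<le> 0"
    proof -
      have "Xr r \<omega> \<bullet> (B' r *v Xr r \<omega>) - 2 * (\<xi> r \<omega> \<bullet> (B r *v Xr r \<omega>)) \<le> 0" if r: "r \<in> {t..s}" for r
      proof -
        have rT: "r \<le> T" using r s by simp
        have "Xr r \<omega> \<bullet> (B' r *v Xr r \<omega>) - 2 * (\<xi> r \<omega> \<bullet> (B r *v Xr r \<omega>)) =
          exp (- \<Theta> * r) * (Xr r \<omega> \<bullet> (C' r *v Xr r \<omega>) - \<Theta> * (Xr r \<omega> \<bullet> (C r *v Xr r \<omega>))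
            - 2 * ((matrix_inv \<Lambda> *v (C r *v Xr r \<omega>)) \<bullet> (C r *v Xr r \<omega>)))"
          using \<omega>G by (simp add: B_def B'_def \<xi>_def matrix_vector_mult_diff_rdistrib inner_diff_right
              right_diff_distrib flip: scaleR_matrix_vector_assoc)
        also have "\<dots> \<le> 0"
          using optimal_drift_nonpos[OF rT, of "Xr r \<omega>"] unfolding \<Theta>_def by (intro mult_nonneg_nonpos) auto
        finally show ?thesis .
      qed
      then have "0 \<le> (\<integral>r. - (indicator {t..s} r *\<^sub>R (Xr r \<omega> \<bullet> (B' r *v Xr r \<omega>) - 2 * (\<xi> r \<omega> \<bullet> (B r *v Xr r \<omega>)))) \<partial>lborel)"
        by (intro Bochner_Integration.integral_nonneg) (auto simp: indicator_def)
      then show ?thesis unfolding set_lebesgue_integral_def by simp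
    qed
    moreover have "(\<Sum>i\<in>UNIV. \<Sum>r\<in>JT i T \<omega> \<inter> {..s}. B r $ i $ i * (\<eta> r \<omega> $ i)\<^sup>2 - 2 * \<eta> r \<omega> $ i * (B r *v Xm r \<omega>) $ i) \<le> 0"
    proof (intro sum_nonpos)
      fix i r assume "r \<in> JT i T \<omega> \<inter> {..s}"
      then have rT: "r \<le> T" using s by auto
      have "B r $ i $ i * (\<eta> r \<omega> $ i)\<^sup>2 - 2 * \<eta> r \<omega> $ i * (B r *v Xm r \<omega>) $ i
         = exp (- \<Theta> * r) * (C r $ i $ i * ((feedback r *v Xm r \<omega>) $ i)\<^sup>2 - 2 * (feedback r *v Xm r \<omega>) $ i * (C r *v Xm r \<omega>) $ i)"
        using \<eta>\<gamma>[OF \<omega>G, of r i] by (simp add: \<gamma> B_def right_diff_distrib flip: scaleR_matrix_vector_assoc)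
      also have "\<dots> \<le> 0" using optimal_jump_nonpos[OF rT, of i "Xm r \<omega>"] by (intro mult_nonneg_nonpos) auto
      finally show "B r $ i $ i * (\<eta> r \<omega> $ i)\<^sup>2 - 2 * \<eta> r \<omega> $ i * (B r *v Xm r \<omega>) $ i \<le> 0" .
    qed
    ultimately show ?thesis by linarith
  qed
  obtain m where m: "m > 0" "\<And>s v. s \<in> {t..T} \<Longrightarrow> m * (v \<bullet> v) \<le> v \<bullet> (C s *v v)" using C_lower_bound[OF tT] by blast
  obtain K where K: "K > 0" "\<And>s. s \<in> {t..T} \<Longrightarrow> norm (C s) \<le> K" using C_norm_bound[of t] by blast
  have \<Theta>0: "\<Theta> \<ge> 0" unfolding \<Theta>_def by (intro sum_nonneg) (rule \<theta>_nonneg)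
  \<comment> \<open>Undoing the discount costs at most the factor
    \<open>exp (\<Theta> * (T - t))\<close>, and the lower bound \<open>m\<close> converts the form
    into the square norm.\<close>
  define R where "R = sqrt (exp (\<Theta> * (T - t)) * (x \<bullet> (C t *v x)) / m)"
  have Xr_bound: "norm (Xr s \<omega>) \<le> R" if \<omega>G: "\<omega> \<in> G" and s: "s \<in> {t..T}" for s \<omega>
  proof -
    have xC: "x \<bullet> (C t *v x) \<ge> 0" using pos_def_imp_nonneg_def[OF C_pos_def[OF tT]] by (simp add: nonneg_def_def)
    have "exp (- \<Theta> * s) * (Xr s \<omega> \<bullet> (C s *v Xr s \<omega>)) \<le> exp (- \<Theta> * t) * (x \<bullet> (C t *v x))"
      using decay[OF that] by (simp add: B_def flip: scaleR_matrix_vector_assoc)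
    then have "exp (\<Theta> * s) * (exp (- \<Theta> * s) * (Xr s \<omega> \<bullet> (C s *v Xr s \<omega>))) \<le> exp (\<Theta> * s) * (exp (- \<Theta> * t) * (x \<bullet> (C t *v x)))"
      by (intro mult_left_mono) auto
    then have "Xr s \<omega> \<bullet> (C s *v Xr s \<omega>) \<le> exp (\<Theta> * (s - t)) * (x \<bullet> (C t *v x))"
      by (simp add: right_diff_distrib flip: exp_add mult.assoc)
    also have "\<dots> \<le> exp (\<Theta> * (T - t)) * (x \<bullet> (C t *v x))"
      using s \<Theta>0 xC by (intro mult_right_mono) (auto intro: mult_left_mono)
    finally have "m * (norm (Xr s \<omega>))\<^sup>2 \<le> exp (\<Theta> * (T - t)) * (x \<bullet> (C t *v x))"
      using m(2)[OF s, of "Xr s \<omega>"] by (simp add: power2_norm_eq_inner)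
    then have "(norm (Xr s \<omega>))\<^sup>2 \<le> exp (\<Theta> * (T - t)) * (x \<bullet> (C t *v x)) / m" using m(1) by (simp add: field_simps)
    then show ?thesis unfolding R_def by (rule real_le_rsqrt)
  qed
  have Xm_bound: "norm (Xm s \<omega>) \<le> R" if \<omega>G: "\<omega> \<in> G" and s: "s \<in> {t..<T}" for s \<omega>
  proof (cases "s = t")
    case True
    then show ?thesis using Xr_bound[OF \<omega>G, of t] Xm_t[OF GM[OF \<omega>G]] Xr_t[of \<omega>] tT by simp
  next
    case False
    then have s': "s \<in> {t<..<T}" using s by auto
    have "((\<lambda>q. norm (Xr q \<omega>)) \<longlongrightarrow> norm (Xm s \<omega>)) (at_left s)" by (intro tendsto_norm Xlim GM[OF \<omega>G] s')
    moreover have "\<forall>\<^sub>F q in at_left s. norm (Xr q \<omega>) \<le> R"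
      using eventually_at_left_real[of t s] s' by (auto elim!: eventually_mono intro!: Xr_bound[OF \<omega>G])
    ultimately show ?thesis by (rule tendsto_upperbound) simp
  qed
  define R1 where "R1 = norm (matrix_inv \<Lambda>) * (K * R)"
  define R2 where "R2 = (\<Sum>i\<in>(UNIV :: 'n set). K * R / m)"
  have \<xi>_bound: "norm (\<xi> s \<omega>) ^ 4 \<le> \<bar>R1\<bar> ^ 4" if s: "s \<in> {t..<T}" for s \<omega>
  proof (cases "\<omega> \<in> G")
    case True
    have "norm (matrix_inv \<Lambda> *v (C s *v Xr s \<omega>)) \<le> norm (matrix_inv \<Lambda>) * norm (C s *v Xr s \<omega>)" by (rule norm_matrix_vector_mult_le)
    also have "\<dots> \<le> norm (matrix_inv \<Lambda>) * (norm (C s) * norm (Xr s \<omega>))" by (intro mult_left_mono norm_matrix_vector_mult_le) auto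
    also have "\<dots> \<le> R1"
      unfolding R1_def using K Xr_bound[OF True, of s] s by (intro mult_left_mono mult_mono) auto
    finally show ?thesis using True by (intro power_mono) (auto simp: \<xi>_def)
  qed (simp add: \<xi>_def)
  have \<eta>_bound: "norm (\<eta> s \<omega>) ^ 8 \<le> \<bar>R2\<bar> ^ 8" if s: "s \<in> {t..<T}" for s \<omega>
  proof (cases "\<omega> \<in> G")
    case True
    have "\<bar>(feedback s *v Xm s \<omega>) $ i\<bar> \<le> K * R / m" for i
    proof -
      have sT: "s \<in> {t..T}" using s by auto
      have "\<bar>(C s *v Xm s \<omega>) $ i\<bar> \<le> norm (C s *v Xm s \<omega>)" by (rule component_le_norm_cart)
      also have "\<dots> \<le> norm (C s) * norm (Xm s \<omega>)" by (rule norm_matrix_vector_mult_le)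
      also have "\<dots> \<le> K * R" using K(1) K(2)[OF sT] Xm_bound[OF True s] by (intro mult_mono) auto
      finally have 1: "\<bar>(C s *v Xm s \<omega>) $ i\<bar> \<le> K * R" .
      \<comment> \<open>Testing the lower bound of the form with a unit vector keeps the diagonal
        away from 0, and with it the quotients in the feedback bounded.\<close>
      have 2: "m \<le> C s $ i $ i" using m(2)[OF sT, of "axis i 1"] by (simp add: C_entry inner_axis_axis)
      show ?thesis
      proof (cases "\<theta> i > 0")
        case True
        have "\<bar>(C s *v Xm s \<omega>) $ i\<bar> / C s $ i $ i \<le> K * R / m" using 1 2 m(1) by (intro frac_le) auto
        then show ?thesis using True 2 m(1) by (simp add: feedback_nth)
      next
        case False
        then show ?thesis using 1 m(1) by (simp add: feedback_nth)
      qed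
    qed
    then have "norm (feedback s *v Xm s \<omega>) \<le> R2"
      unfolding R2_def by (intro order_trans[OF norm_le_l1_cart] sum_mono)
    then show ?thesis using True by (intro power_mono) (auto simp: \<eta>_def)
  qed (simp add: \<eta>_def)

  have prog: "progressive F t T \<xi>"
    unfolding progressive_def
  proof (intro ballI)
    fix s assume s: "s \<in> {t..<T}"
    have Zm: "(\<lambda>\<omega>. Zr r \<omega> $ k) \<in> borel_measurable (F r)" if r: "r \<in> {t..s}" for r k
    proof -
      have "(\<lambda>(r, \<omega>). \<gamma> i r \<omega> * b i r $ k) \<in> borel_measurable Pr" for i
      proof -
        have "(\<lambda>p. g i (fst p) $ j) \<in> borel_measurable Pr" "(\<lambda>p. b i (fst p) $ k) \<in> borel_measurable Pr"
          "(\<lambda>p. W (fst p) (snd p) $ j) \<in> borel_measurable Pr" for j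
          using Pr_continuous[OF gc[of i j]] Pr_continuous[OF bc[of i k]] WPr[of j] by (simp_all add: case_prod_beta')
        then have "(\<lambda>p. (\<Sum>j\<in>UNIV. g i (fst p) $ j * W (fst p) (snd p) $ j) * b i (fst p) $ k) \<in> borel_measurable Pr"
          by (intro borel_measurable_sum borel_measurable_times)
        then show ?thesis by (simp add: \<gamma>_def inner_vec_def case_prod_beta')
      qed
      then show ?thesis
        unfolding Zr_def vec_lambda_beta using r s by (intro borel_measurable_diff borel_measurable_sum jS_measurable) auto
    qed
    \<comment> \<open>\<open>\<xi>\<close> is a continuous matrix function times \<open>Zr\<close>,
      cut off outside \<open>G\<close>. It is thus adapted and right-continuous, hence
      progressive.\<close>
    define D where "D r = matrix_inv \<Lambda> ** C r ** \<Phi> r" for r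
    have Dc: "continuous_on {t..T} D" unfolding D_def by (intro mm.continuous_on continuous_on_const Cc \<Phi>c)
    have \<xi>D: "\<xi> r \<omega> $ k = indicator G \<omega> * (\<Sum>j\<in>UNIV. D r $ k $ j * Zr r \<omega> $ j)" for r \<omega> k
    proof -
      have "matrix_inv \<Lambda> *v (C r *v Xr r \<omega>) = D r *v Zr r \<omega>" by (simp add: D_def Xr_def matrix_vector_mul_assoc matrix_mul_assoc)
      then show ?thesis by (simp add: \<xi>_def matrix_vector_mult_def)
    qed
    have "(\<lambda>(r, \<omega>). \<xi> r \<omega> $ k) \<in> borel_measurable (restrict_space borel {t..s} \<Otimes>\<^sub>M F s)" for k
    proof (rule progressive_right_continuous)
      show "(\<lambda>\<omega>. \<xi> r \<omega> $ k) \<in> borel_measurable (F r)" if r: "r \<in> {t..s}" for r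
        unfolding \<xi>D using GF[of r] Zm[OF r]
        by (intro borel_measurable_times borel_measurable_indicator borel_measurable_sum) auto
      show "((\<lambda>q. \<xi> q \<omega> $ k) \<longlongrightarrow> \<xi> r \<omega> $ k) (at_right r)" if "r \<in> {t..<s}" "\<omega> \<in> space M" for r \<omega>
      proof -
        have r: "r \<in> {t..<T}" using that s by auto
        show ?thesis
          unfolding \<xi>D Zr_def vec_lambda_beta
          by (intro tendsto_intros right_cont[OF comp[OF Dc] r] jS_right_limit[OF that(2) r])
      qed
      show "t \<le> s" using s by simp
    qed
    then show "(\<lambda>(r, \<omega>). \<xi> r \<omega>) \<in> borel_measurable (restrict_space borel {t..s} \<Otimes>\<^sub>M F s)"
      by (subst borel_measurable_vec_iff) (simp add: case_prod_beta')
  qed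
  have pred: "predictable F t T \<eta>"
  proof -
    \<comment> \<open>\<open>\<eta>\<close> is a continuous deterministic matrix function times the
      predictable \<open>W\<close>, and the cut-off set \<open>{t..<T} \<times> G\<close> is
      predictable.\<close>
    define E where "E s = feedback s ** \<Phi> s" for s
    have Ec: "continuous_on {t..T} (\<lambda>s. E s $ i $ j)" for i j using gc[of i j] by (simp add: E_def g_def)
    have "(\<lambda>(s, \<omega>). indicator G \<omega> * (E s *v W s \<omega>) $ k) \<in> borel_measurable Pr" for k
    proof -
      have "(\<lambda>p. indicator ({t..<T} \<times> G) p :: real) \<in> borel_measurable Pr"
      proof (rule borel_measurable_indicator)
        have "{t..<T} \<times> G = (({t<..T} \<inter> {t..<T}) \<times> G) \<union> ({t} \<times> G)" using t_less_T by auto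
        then show "{t..<T} \<times> G \<in> sets Pr" using Pr_rect[of t G T] Pr_start[of G] GF[of t] by auto
      qed
      moreover have "(\<lambda>p. (E (fst p) *v W (fst p) (snd p)) $ k) \<in> borel_measurable Pr"
        using Pr_matrix_vector[OF Ec WPr, of k] by (simp add: case_prod_beta')
      ultimately have "(\<lambda>p. indicator ({t..<T} \<times> G) p * (E (fst p) *v W (fst p) (snd p)) $ k) \<in> borel_measurable Pr"
        by (rule borel_measurable_times)
      then show ?thesis
        by (rule measurable_cong[THEN iffD1, rotated]) (auto simp: indicator_def)
    qed
    moreover have "\<eta> s \<omega> $ k = indicator G \<omega> * (E s *v W s \<omega>) $ k" for s \<omega> k
      by (simp add: \<eta>_def Xm_def E_def matrix_vector_mul_assoc)
    ultimately show ?thesis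
      unfolding predictable_def by (subst borel_measurable_vec_iff) (simp add: case_prod_beta')
  qed
  show thesis
  proof (rule that)
    show "admissible M F \<theta> T t \<xi> \<eta>"
      unfolding admissible_def
    proof (intro conjI prog pred)
      show "AE \<omega> in M. \<forall>s\<in>{t..<T}. \<forall>i. set_integrable lborel {t..s} (\<lambda>r. \<xi> r \<omega> $ i)"
        using AEG
      proof eventually_elim
        case (elim \<omega>)
        have int: "set_integrable lborel {t..T} (\<lambda>r. \<xi> r \<omega> $ i)" for i using path[OF elim] by blast
        then show ?case by (auto intro!: set_integrable_subset[OF int])
      qed
      have "(\<integral>\<^sup>+\<omega>. (\<integral>\<^sup>+s. indicator {t..<T} s * ennreal (norm (\<xi> s \<omega>) ^ 4) \<partial>lborel) \<partial>M) \<le> dnn (\<lambda>r \<omega>. \<bar>R1\<bar> ^ 4)"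
        unfolding dnn_def[symmetric] by (intro dnn_mono \<xi>_bound)
      then show "(\<integral>\<^sup>+\<omega>. (\<integral>\<^sup>+s. indicator {t..<T} s * ennreal (norm (\<xi> s \<omega>) ^ 4) \<partial>lborel) \<partial>M) < \<infinity>"
        using dnn_const by (rule le_less_trans)
      have "(\<integral>\<^sup>+\<omega>. (\<integral>\<^sup>+s. indicator {t..<T} s * ennreal (norm (\<eta> s \<omega>) ^ 8) \<partial>lborel) \<partial>M) \<le> dnn (\<lambda>r \<omega>. \<bar>R2\<bar> ^ 8)"
        unfolding dnn_def[symmetric] by (intro dnn_mono \<eta>_bound)
      then show "(\<integral>\<^sup>+\<omega>. (\<integral>\<^sup>+s. indicator {t..<T} s * ennreal (norm (\<eta> s \<omega>) ^ 8) \<partial>lborel) \<partial>M) < \<infinity>"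
        using dnn_const by (rule le_less_trans)
      show "\<forall>i. \<theta> i = 0 \<longrightarrow> (\<forall>s\<in>{t..<T}. \<forall>\<omega>\<in>space M. \<eta> s \<omega> $ i = 0)"
        by (simp add: \<eta>_def feedback_nth)
    qed
    show "AE \<omega> in M. \<forall>s\<in>{t..<T}. \<xi> s \<omega> = matrix_inv \<Lambda> *v (C s *v position \<pi> x t \<xi> \<eta> s \<omega>)
       \<and> \<eta> s \<omega> = feedback s *v left_lim (\<lambda>q. position \<pi> x t \<xi> \<eta> q \<omega>) s"
      using AEG
    proof eventually_elim
      case (elim \<omega>)
      show ?case
      proof
        fix s assume s: "s \<in> {t..<T}"
        show "\<xi> s \<omega> = matrix_inv \<Lambda> *v (C s *v position \<pi> x t \<xi> \<eta> s \<omega>)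
           \<and> \<eta> s \<omega> = feedback s *v left_lim (\<lambda>q. position \<pi> x t \<xi> \<eta> q \<omega>) s"
          unfolding pos[OF elim s] left[OF elim s] using elim by (simp add: \<xi>_def \<eta>_def)
      qed
    qed
  qed
qed

end

subsection \<open>Optimality and uniqueness\<close>

lemma norm_diff_power_le:
  fixes a b :: "'a::real_normed_vector"
  shows "norm (a - b) ^ n \<le> 2 ^ n * (norm a ^ n + norm b ^ n)"
proof -
  have "norm (a - b) \<le> 2 * max (norm a) (norm b)" using norm_triangle_ineq4[of a b] by linarith
  then have "norm (a - b) ^ n \<le> (2 * max (norm a) (norm b)) ^ n" by (rule power_mono) simp
  also have "\<dots> = 2 ^ n * max (norm a) (norm b) ^ n" by (rule power_mult_distrib)
  also have "\<dots> \<le> 2 ^ n * (norm a ^ n + norm b ^ n)" by (intro mult_left_mono) (auto simp: max_def)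
  finally show ?thesis .
qed

context riccati
begin

text \<open>All summands are nonnegative, so each of them vanishes. A component with intensity 0 is
  left undetermined by the gap; there admissibility makes \<eta> vanish.\<close>

lemma gap_eq_0_iff:
  assumes s: "s \<le> T"
  shows "gap s u v X = 0 \<longleftrightarrow> u = matrix_inv \<Lambda> *v (C s *v X) \<and>
    (\<forall>i. \<theta> i > 0 \<longrightarrow> v $ i = (C s *v X) $ i / C s $ i $ i)"
proof -
  define w where "w = u - matrix_inv \<Lambda> *v (C s *v X)"
  have 0: "w \<bullet> (\<Lambda> *v w) \<ge> 0" using pos_def_imp_nonneg_def[OF \<Lambda>_pos] by (simp add: nonneg_def_def)
  have 1: "w \<bullet> (\<Lambda> *v w) = 0 \<longleftrightarrow> w = 0" using \<Lambda>_pos by (auto simp: pos_def_def less_imp_neq)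
  define q where "q i = \<theta> i * (C s $ i $ i * (v $ i - (C s *v X) $ i / C s $ i $ i)\<^sup>2)" for i
  have q0: "q i \<ge> 0" for i using \<theta>_nonneg[of i] C_diag_pos[OF s, of i] by (simp add: q_def)
  have q: "q i = 0 \<longleftrightarrow> (\<theta> i > 0 \<longrightarrow> v $ i = (C s *v X) $ i / C s $ i $ i)" for i
    using \<theta>_nonneg[of i] C_diag_pos[OF s, of i] by (auto simp: q_def)
  have "gap s u v X = w \<bullet> (\<Lambda> *v w) + (\<Sum>i\<in>UNIV. q i)" by (simp add: gap_def w_def q_def)
  moreover have "(\<Sum>i\<in>UNIV. q i) \<ge> 0" by (intro sum_nonneg q0)
  moreover have "(\<Sum>i\<in>UNIV. q i) = 0 \<longleftrightarrow> (\<forall>i. q i = 0)" by (subst sum_nonneg_eq_0_iff) (auto simp: q0)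
  ultimately show ?thesis using 0 1 unfolding q w_def by (auto simp: add_nonneg_eq_0_iff)
qed

lemma gap_diff_eq_0:
  assumes s: "s \<le> T" and "gap s u v X = 0" "gap s u' v' X' = 0"
  shows "gap s (u - u') (v - v') (X - X') = 0"
  using assms(2,3) unfolding gap_eq_0_iff[OF s] by (simp add: matrix_vector_mult_diff_distrib diff_divide_distrib)

end

context poisson_horizon
begin

lemma dnn_eq_0D:
  assumes f: "prod_measurable f" and 0: "dnn f = 0"
  shows "AE \<omega> in M. AE r in lborel. r \<in> {t..<T} \<longrightarrow> f r \<omega> \<le> 0"
proof -
  have "AE \<omega> in M. (\<integral>\<^sup>+r. indicator {t..<T} r * ennreal (f r \<omega>) \<partial>lborel) = 0"
    using 0 unfolding dnn_def by (simp add: nn_integral_0_iff_AE section_nn_measurable[OF f])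
  then show ?thesis using AE_space
  proof eventually_elim
    case (elim \<omega>)
    have eq: "indicator {t..<T} r * ennreal (f r \<omega>) = ennreal (indicator {t..<T} r * f r \<omega>)" for r
      by (auto simp: indicator_def)
    have "(\<lambda>r. ennreal (indicator {t..<T} r * f r \<omega>)) \<in> borel_measurable lborel"
      using section_measurable[OF f elim(2)] by measurable
    then have "AE r in lborel. ennreal (indicator {t..<T} r * f r \<omega>) = 0"
      using elim(1) unfolding eq by (simp add: nn_integral_0_iff_AE)
    then show ?case by eventually_elim (auto simp: indicator_def ennreal_eq_0_iff)
  qed
qed

lemma dnn_eq_0I:
  assumes "AE \<omega> in M. AE r in lborel. r \<in> {t..<T} \<longrightarrow> f r \<omega> = 0"
  shows "dnn f = 0"
proof -
  have "AE \<omega> in M. (\<integral>\<^sup>+r. indicator {t..<T} r * ennreal (f r \<omega>) \<partial>lborel) = 0"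
    using assms
  proof eventually_elim
    case (elim \<omega>)
    then have "AE r in lborel. indicator {t..<T} r * ennreal (f r \<omega>) = 0" by eventually_elim (auto simp: indicator_def)
    then have "(\<integral>\<^sup>+r. indicator {t..<T} r * ennreal (f r \<omega>) \<partial>lborel) = (\<integral>\<^sup>+r. 0 \<partial>(lborel :: real measure))" by (rule nn_integral_cong_AE)
    then show ?case by simp
  qed
  then have "dnn f = (\<integral>\<^sup>+\<omega>. 0 \<partial>M)" unfolding dnn_def by (rule nn_integral_cong_AE)
  then show ?thesis by simp
qed

text \<open>Tonelli carries an iterated almost-everywhere statement over to the product measure; the
  exchange rests on joint measurability of a nonnegative function.\<close>

lemma AE_product_eq_0:
  assumes f: "prod_measurable f" and nn: "\<And>r \<omega>. f r \<omega> \<ge> 0"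
    and 0: "AE \<omega> in M. AE r in lborel. r \<in> {t..<T} \<longrightarrow> f r \<omega> = 0"
  shows "AE p in restrict_space lborel {t..<T} \<Otimes>\<^sub>M M. f (fst p) (snd p) = 0"
proof -
  let ?L = "restrict_space lborel {t..<T} :: real measure"
  interpret L: finite_measure ?L
    by (rule finite_measureI) (use t_less_T in \<open>simp add: emeasure_restrict_space space_restrict_space\<close>)
  interpret pair: pair_sigma_finite ?L M ..
  have m: "(\<lambda>p. ennreal (f (fst p) (snd p))) \<in> borel_measurable (?L \<Otimes>\<^sub>M M)"
  proof -
    have "(\<lambda>r. r) \<in> measurable ?L borel" by (rule measurable_restrict_space1) simp
    then have "(\<lambda>p. (fst p, snd p)) \<in> measurable (?L \<Otimes>\<^sub>M M) (borel \<Otimes>\<^sub>M M)"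
      by (intro measurable_Pair measurable_compose[OF measurable_fst] measurable_snd)
    from measurable_compose[OF this f]
    have "(\<lambda>p. f (fst p) (snd p)) \<in> borel_measurable (?L \<Otimes>\<^sub>M M)"
      by (rule measurable_cong[THEN iffD1, rotated]) (auto simp: space_pair_measure space_restrict_space)
    then show ?thesis by measurable
  qed
  have "(\<integral>\<^sup>+p. ennreal (f (fst p) (snd p)) \<partial>(?L \<Otimes>\<^sub>M M)) = (\<integral>\<^sup>+\<omega>. \<integral>\<^sup>+r. ennreal (f r \<omega>) \<partial>?L \<partial>M)"
    using pair.nn_integral_snd[OF m] by simp
  also have "\<dots> = dnn f"
    unfolding dnn_def by (intro nn_integral_cong) (simp add: nn_integral_restrict_space mult.commute)
  also have "\<dots> = 0" by (rule dnn_eq_0I[OF 0])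
  finally have "AE p in ?L \<Otimes>\<^sub>M M. ennreal (f (fst p) (snd p)) = 0" using m by (simp add: nn_integral_0_iff_AE)
  then show ?thesis by eventually_elim (use nn in \<open>auto simp: ennreal_eq_0_iff intro: antisym\<close>)
qed

lemma dnn_norm_diff_power:
  fixes f g :: "real \<Rightarrow> 'w \<Rightarrow> real^'n"
  assumes f: "\<And>i. prod_measurable (\<lambda>r \<omega>. f r \<omega> $ i)" "dnn (\<lambda>r \<omega>. norm (f r \<omega>) ^ n) < \<infinity>"
    and g: "\<And>i. prod_measurable (\<lambda>r \<omega>. g r \<omega> $ i)" "dnn (\<lambda>r \<omega>. norm (g r \<omega>) ^ n) < \<infinity>"
  shows "dnn (\<lambda>r \<omega>. norm (f r \<omega> - g r \<omega>) ^ n) < \<infinity>"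
proof -
  have m: "prod_measurable (\<lambda>r \<omega>. norm (f r \<omega>) ^ n)" "prod_measurable (\<lambda>r \<omega>. norm (g r \<omega>) ^ n)"
    by (intro prod_measurable_power prod_measurable_norm f g)+
  have "dnn (\<lambda>r \<omega>. norm (f r \<omega>) ^ n + norm (g r \<omega>) ^ n) < \<infinity>"
    using dnn_add[OF m] f(2) g(2) by simp
  then have "dnn (\<lambda>r \<omega>. 2 ^ n * (norm (f r \<omega>) ^ n + norm (g r \<omega>) ^ n)) < \<infinity>"
    by (intro dnn_cmult prod_measurable_add m) auto
  then show ?thesis by (rule le_less_trans[rotated]) (intro dnn_mono norm_diff_power_le)
qed

lemma admissible_diff:
  assumes 1: "admissible M F \<theta> T t \<xi> \<eta>" and 2: "admissible M F \<theta> T t \<xi>' \<eta>'"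
  shows "admissible M F \<theta> T t (\<lambda>r \<omega>. \<xi> r \<omega> - \<xi>' r \<omega>) (\<lambda>r \<omega>. \<eta> r \<omega> - \<eta>' r \<omega>)"
proof -
  \<comment> \<open>The facts taken from these interpretations concern measurability and moments and
    do not involve the initial position; 0 is a placeholder.\<close>
  interpret s1: admissible_strategy M P \<pi> \<theta> t T 0 \<xi> \<eta> by unfold_locales (rule 1)
  interpret s2: admissible_strategy M P \<pi> \<theta> t T 0 \<xi>' \<eta>' by unfold_locales (rule 2)
  show ?thesis
    unfolding admissible_def
  proof (intro conjI)
    show "progressive F t T (\<lambda>r \<omega>. \<xi> r \<omega> - \<xi>' r \<omega>)"
      using 1 2 unfolding admissible_def progressive_def case_prod_beta' by (intro ballI borel_measurable_diff) auto
    show "predictable F t T (\<lambda>r \<omega>. \<eta> r \<omega> - \<eta>' r \<omega>)"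
      using 1 2 unfolding admissible_def predictable_def case_prod_beta' by (intro borel_measurable_diff) auto
    have "AE \<omega> in M. \<forall>s\<in>{t..<T}. \<forall>i. set_integrable lborel {t..s} (\<lambda>r. \<xi> r \<omega> $ i)"
      "AE \<omega> in M. \<forall>s\<in>{t..<T}. \<forall>i. set_integrable lborel {t..s} (\<lambda>r. \<xi>' r \<omega> $ i)"
      using 1 2 by (simp_all add: admissible_def)
    then show "AE \<omega> in M. \<forall>s\<in>{t..<T}. \<forall>i. set_integrable lborel {t..s} (\<lambda>r. (\<xi> r \<omega> - \<xi>' r \<omega>) $ i)"
      by eventually_elim (auto intro!: set_integral_diff(1))
    show "(\<integral>\<^sup>+\<omega>. (\<integral>\<^sup>+s. indicator {t..<T} s * ennreal (norm (\<xi> s \<omega> - \<xi>' s \<omega>) ^ 4) \<partial>lborel) \<partial>M) < \<infinity>"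
      unfolding dnn_def[symmetric] by (intro dnn_norm_diff_power s1.\<xi>_prod s2.\<xi>_prod s1.dnn_\<xi>4 s2.dnn_\<xi>4)
    show "(\<integral>\<^sup>+\<omega>. (\<integral>\<^sup>+s. indicator {t..<T} s * ennreal (norm (\<eta> s \<omega> - \<eta>' s \<omega>) ^ 8) \<partial>lborel) \<partial>M) < \<infinity>"
      unfolding dnn_def[symmetric] by (intro dnn_norm_diff_power s1.\<eta>_prod s2.\<eta>_prod s1.dnn_\<eta>8 s2.dnn_\<eta>8)
    show "\<forall>i. \<theta> i = 0 \<longrightarrow> (\<forall>s\<in>{t..<T}. \<forall>\<omega>\<in>space M. (\<eta> s \<omega> - \<eta>' s \<omega>) $ i = 0)"
      using 1 2 by (simp add: admissible_def)
  qed
qed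

end

context liquidation_strategy
begin

lemma cost_ge: "ennreal (x \<bullet> (C t *v x)) \<le> cost M \<pi> \<alpha> \<Lambda> \<Sigma> T l t x \<xi> \<eta>"
  by (rule cost_identity) simp

lemma cost_eq_iff:
  "cost M \<pi> \<alpha> \<Lambda> \<Sigma> T l t x \<xi> \<eta> = ennreal (x \<bullet> (C t *v x)) \<longleftrightarrow>
   (AE \<omega> in M. AE r in lborel. r \<in> {t..<T} \<longrightarrow> gap r (\<xi> r \<omega>) (\<eta> r \<omega>) (Xl r \<omega>) = 0)"
proof -
  obtain Z where Z: "AE \<omega> in M. good \<omega> \<and> (\<forall>s. Z s \<omega> = Xl s \<omega>)"
    and c: "cost M \<pi> \<alpha> \<Lambda> \<Sigma> T l t x \<xi> \<eta> = ennreal (x \<bullet> (C t *v x)) + dnn (\<lambda>r \<omega>. gap r (\<xi> r \<omega>) (\<eta> r \<omega>) (Z r \<omega>))"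
    and m: "prod_measurable (\<lambda>r \<omega>. gap r (\<xi> r \<omega>) (\<eta> r \<omega>) (Z r \<omega>))" by (rule cost_identity)
  have "cost M \<pi> \<alpha> \<Lambda> \<Sigma> T l t x \<xi> \<eta> = ennreal (x \<bullet> (C t *v x)) \<longleftrightarrow> dnn (\<lambda>r \<omega>. gap r (\<xi> r \<omega>) (\<eta> r \<omega>) (Z r \<omega>)) = 0"
    unfolding c using ennreal_add_left_cancel[of "ennreal (x \<bullet> (C t *v x))" _ 0] by simp
  also have "\<dots> \<longleftrightarrow> (AE \<omega> in M. AE r in lborel. r \<in> {t..<T} \<longrightarrow> gap r (\<xi> r \<omega>) (\<eta> r \<omega>) (Z r \<omega>) = 0)"
  proof
    assume "dnn (\<lambda>r \<omega>. gap r (\<xi> r \<omega>) (\<eta> r \<omega>) (Z r \<omega>)) = 0"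
    from dnn_eq_0D[OF m this]
    show "AE \<omega> in M. AE r in lborel. r \<in> {t..<T} \<longrightarrow> gap r (\<xi> r \<omega>) (\<eta> r \<omega>) (Z r \<omega>) = 0"
    proof eventually_elim
      case (elim \<omega>)
      then show ?case
      proof eventually_elim
        case (elim r)
        then show ?case using gap_nonneg[of r "\<xi> r \<omega>" "\<eta> r \<omega>" "Z r \<omega>"] by auto
      qed
    qed
  qed (rule dnn_eq_0I)
  also have "\<dots> \<longleftrightarrow> (AE \<omega> in M. AE r in lborel. r \<in> {t..<T} \<longrightarrow> gap r (\<xi> r \<omega>) (\<eta> r \<omega>) (Xl r \<omega>) = 0)"
  proof (rule eventually_subst)
    show "AE \<omega> in M. (AE r in lborel. r \<in> {t..<T} \<longrightarrow> gap r (\<xi> r \<omega>) (\<eta> r \<omega>) (Z r \<omega>) = 0) =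
        (AE r in lborel. r \<in> {t..<T} \<longrightarrow> gap r (\<xi> r \<omega>) (\<eta> r \<omega>) (Xl r \<omega>) = 0)"
      using Z by eventually_elim simp
  qed
  finally show ?thesis .
qed

text \<open>The feedback law refers to \<open>position\<close> and its left limit. Both are
  identified with \<open>Xl\<close> off the jump times and \<open>t\<close>, a null set of times,
  and there the gap vanishes.\<close>

lemma feedback_cost:
  assumes "AE \<omega> in M. \<forall>s\<in>{t..<T}. \<xi> s \<omega> = matrix_inv \<Lambda> *v (C s *v position \<pi> x t \<xi> \<eta> s \<omega>)
       \<and> \<eta> s \<omega> = feedback s *v left_lim (\<lambda>q. position \<pi> x t \<xi> \<eta> q \<omega>) s"
  shows "cost M \<pi> \<alpha> \<Lambda> \<Sigma> T l t x \<xi> \<eta> = ennreal (x \<bullet> (C t *v x))"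
  unfolding cost_eq_iff
  using assms AE_good
proof eventually_elim
  case (elim \<omega>)
  have \<omega>: "\<omega> \<in> space M" using elim(2) by (simp add: good_def)
  show ?case using AE_Xb_eq_Xl[OF \<omega>] AE_lborel_singleton[of t]
  proof eventually_elim
    case (elim r)
    show ?case
    proof
      assume r: "r \<in> {t..<T}"
      have "\<forall>\<^sub>F q in at_left r. position \<pi> x t \<xi> \<eta> q \<omega> = Xb q \<omega>"
        using eventually_at_left_real[of t r] r elim by (auto elim!: eventually_mono intro!: position_eq)
      moreover have "((\<lambda>q. Xb q \<omega>) \<longlongrightarrow> Xl r \<omega>) (at_left r)"
        using r elim by (intro Xb_left_limit \<open>good \<omega>\<close>) auto
      ultimately have "((\<lambda>q. position \<pi> x t \<xi> \<eta> q \<omega>) \<longlongrightarrow> Xl r \<omega>) (at_left r)" by (simp cong: tendsto_cong)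
      then have "left_lim (\<lambda>q. position \<pi> x t \<xi> \<eta> q \<omega>) r = Xl r \<omega>" by (rule left_lim_eqI)
      moreover have "position \<pi> x t \<xi> \<eta> r \<omega> = Xl r \<omega>" using position_eq[of r \<omega>] elim r by simp
      ultimately have *: "\<xi> r \<omega> = matrix_inv \<Lambda> *v (C r *v Xl r \<omega>)" "\<eta> r \<omega> = feedback r *v Xl r \<omega>"
        using \<open>\<forall>s\<in>{t..<T}. _ s\<close> r by auto
      show "gap r (\<xi> r \<omega>) (\<eta> r \<omega>) (Xl r \<omega>) = 0"
        using r by (subst gap_eq_0_iff) (auto simp: * feedback_nth)
    qed
  qed
qed

text \<open>Cost 0 makes both the gap and the running cost vanish. Positivity of
  \<open>\<Lambda>\<close> gives \<open>\<xi> = 0\<close>, the first square of the gap then gives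
  \<open>C X = 0\<close>, and the others give \<open>\<eta> = 0\<close> in the components with
  positive intensity; in the remaining ones admissibility does.\<close>

lemma AE_zero_if_cost_zero:
  assumes "cost M \<pi> \<alpha> \<Lambda> \<Sigma> T l t x \<xi> \<eta> = 0"
  shows "AE \<omega> in M. AE r in lborel. r \<in> {t..<T} \<longrightarrow> \<xi> r \<omega> = 0 \<and> \<eta> r \<omega> = 0"
proof -
  have "cost M \<pi> \<alpha> \<Lambda> \<Sigma> T l t x \<xi> \<eta> = ennreal (x \<bullet> (C t *v x))"
    using cost_ge assms by simp
  then have gap0: "AE \<omega> in M. AE r in lborel. r \<in> {t..<T} \<longrightarrow> gap r (\<xi> r \<omega>) (\<eta> r \<omega>) (Xl r \<omega>) = 0"
    by (simp only: cost_eq_iff)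
  have \<Sigma>0: "y \<bullet> (\<Sigma> *v y) \<ge> 0" for y using \<Sigma>_nonneg by (simp add: nonneg_def_def)
  have "dnn (\<lambda>r \<omega>. \<xi> r \<omega> \<bullet> (\<Lambda> *v \<xi> r \<omega>)) \<le> cost M \<pi> \<alpha> \<Lambda> \<Sigma> T l t x \<xi> \<eta>"
    unfolding dnn_def cost_def
    by (intro nn_integral_mono order_trans[OF _ add_increasing2[OF _ order_refl]] mult_left_mono ennreal_leI)
      (auto simp: \<alpha>_nonneg \<Sigma>0)
  then have "dnn (\<lambda>r \<omega>. \<xi> r \<omega> \<bullet> (\<Lambda> *v \<xi> r \<omega>)) = 0" using assms by simp
  moreover have "prod_measurable (\<lambda>r \<omega>. \<xi> r \<omega> \<bullet> (\<Lambda> *v \<xi> r \<omega>))"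
    by (rule prod_measurable_inner_matrix(1)[where A = "\<lambda>_. \<Lambda>", OF \<xi>_prod \<xi>_prod]) simp
  ultimately have "AE \<omega> in M. AE r in lborel. r \<in> {t..<T} \<longrightarrow> \<xi> r \<omega> \<bullet> (\<Lambda> *v \<xi> r \<omega>) \<le> 0" by (intro dnn_eq_0D)
  then show ?thesis using gap0 AE_space
  proof eventually_elim
    case (elim \<omega>)
    from elim(1,2) show ?case
    proof eventually_elim
      case (elim r)
      show ?case
      proof
        assume r: "r \<in> {t..<T}"
        then have rT: "r \<le> T" by simp
        have \<xi>0: "\<xi> r \<omega> = 0" using elim(1) r \<Lambda>_pos by (force simp: pos_def_def)
        have g: "0 = matrix_inv \<Lambda> *v (C r *v Xl r \<omega>)" "\<And>i. \<theta> i > 0 \<Longrightarrow> \<eta> r \<omega> $ i = (C r *v Xl r \<omega>) $ i / C r $ i $ i"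
          using elim(2) r \<xi>0 unfolding gap_eq_0_iff[OF rT] by auto
        have "\<Lambda> *v (matrix_inv \<Lambda> *v (C r *v Xl r \<omega>)) = C r *v Xl r \<omega>"
          by (simp add: matrix_vector_mul_assoc matrix_mul_assoc matrix_inv_inverse[OF pos_def_invertible[OF \<Lambda>_pos]])
        then have C0: "C r *v Xl r \<omega> = 0" unfolding g(1)[symmetric] by simp
        have "\<eta> r \<omega> $ i = 0" for i
        proof (cases "\<theta> i > 0")
          case False
          then have "\<theta> i = 0" using \<theta>_nonneg[of i] by simp
          then show ?thesis using adm r \<open>\<omega> \<in> space M\<close> by (simp add: admissible_def)
        qed (simp add: g(2) C0)
        then show "\<xi> r \<omega> = 0 \<and> \<eta> r \<omega> = 0" using \<xi>0 by (simp add: vec_eq_iff)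
      qed
    qed
  qed
qed

end

context liquidation
begin

text \<open>The first-order conditions are linear in the strategy and the position, so the difference of two optimal
  strategies is optimal for the initial position $0$, where the value is $0$.\<close>

lemma optimal_strategy_unique:
  assumes 1: "admissible M F \<theta> T t \<xi> \<eta>" "cost M \<pi> \<alpha> \<Lambda> \<Sigma> T l t x \<xi> \<eta> = ennreal (x \<bullet> (C t *v x))"
    and 2: "admissible M F \<theta> T t \<xi>' \<eta>'" "cost M \<pi> \<alpha> \<Lambda> \<Sigma> T l t x \<xi>' \<eta>' = ennreal (x \<bullet> (C t *v x))"
  shows "AE p in restrict_space lborel {t..<T} \<Otimes>\<^sub>M M.
    \<xi> (fst p) (snd p) = \<xi>' (fst p) (snd p) \<and> \<eta> (fst p) (snd p) = \<eta>' (fst p) (snd p)"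
proof -
  let ?\<xi> = "\<lambda>r \<omega>. \<xi> r \<omega> - \<xi>' r \<omega>" and ?\<eta> = "\<lambda>r \<omega>. \<eta> r \<omega> - \<eta>' r \<omega>"
  interpret s1: liquidation_strategy M P \<pi> \<theta> t T x \<xi> \<eta> \<alpha> l \<Lambda> \<Sigma> C by unfold_locales (rule 1)
  interpret s2: liquidation_strategy M P \<pi> \<theta> t T x \<xi>' \<eta>' \<alpha> l \<Lambda> \<Sigma> C by unfold_locales (rule 2)
  interpret d: liquidation_strategy M P \<pi> \<theta> t T 0 ?\<xi> ?\<eta> \<alpha> l \<Lambda> \<Sigma> C
    by unfold_locales (rule admissible_diff[OF 1(1) 2(1)])
  have Xl: "d.Xl r \<omega> = s1.Xl r \<omega> - s2.Xl r \<omega>" if "s1.good \<omega>" "s2.good \<omega>" "r \<le> T" for r \<omega>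
  proof -
    have int: "set_integrable lborel {t..r} (\<lambda>q. \<xi> q \<omega> $ i)" "set_integrable lborel {t..r} (\<lambda>q. \<xi>' q \<omega> $ i)" for i
    proof -
      have "set_integrable lborel {t..T} (\<lambda>q. \<xi> q \<omega> $ i)" "set_integrable lborel {t..T} (\<lambda>q. \<xi>' q \<omega> $ i)"
        using that by (simp_all add: s1.good_def s2.good_def)
      then show "set_integrable lborel {t..r} (\<lambda>q. \<xi> q \<omega> $ i)" "set_integrable lborel {t..r} (\<lambda>q. \<xi>' q \<omega> $ i)"
        using that(3) by (auto elim!: set_integrable_subset)
    qed
    show ?thesis
      by (simp add: vec_eq_iff d.Xl_def s1.Xl_def s2.Xl_def set_integral_diff(2)[OF int] left_diff_distrib sum_subtractf)
  qed
  have "AE \<omega> in M. AE r in lborel. r \<in> {t..<T} \<longrightarrow> gap r (\<xi> r \<omega>) (\<eta> r \<omega>) (s1.Xl r \<omega>) = 0"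
    using 1(2) by (simp only: s1.cost_eq_iff)
  moreover have "AE \<omega> in M. AE r in lborel. r \<in> {t..<T} \<longrightarrow> gap r (\<xi>' r \<omega>) (\<eta>' r \<omega>) (s2.Xl r \<omega>) = 0"
    using 2(2) by (simp only: s2.cost_eq_iff)
  ultimately have "AE \<omega> in M. AE r in lborel. r \<in> {t..<T} \<longrightarrow> gap r (?\<xi> r \<omega>) (?\<eta> r \<omega>) (d.Xl r \<omega>) = 0"
    using s1.AE_good s2.AE_good
  proof eventually_elim
    case (elim \<omega>)
    note g = elim(3,4)
    from elim(1,2) show ?case
    proof eventually_elim
      case (elim r)
      then show ?case using Xl[OF g, of r] gap_diff_eq_0[of r] by auto
    qed
  qed
  then have "cost M \<pi> \<alpha> \<Lambda> \<Sigma> T l t 0 ?\<xi> ?\<eta> = 0" unfolding d.cost_eq_iff[symmetric] by simp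
  from d.AE_zero_if_cost_zero[OF this]
  \<comment> \<open>Two vector equations are packed into one nonnegative scalar function, the form
    that \<open>AE_product_eq_0\<close> takes.\<close>
  have 0: "AE \<omega> in M. AE r in lborel. r \<in> {t..<T} \<longrightarrow> norm (?\<xi> r \<omega>) + norm (?\<eta> r \<omega>) = 0"
  proof eventually_elim
    case (elim \<omega>)
    then show ?case by eventually_elim simp
  qed
  have "AE p in restrict_space lborel {t..<T} \<Otimes>\<^sub>M M. norm (?\<xi> (fst p) (snd p)) + norm (?\<eta> (fst p) (snd p)) = 0"
    by (rule AE_product_eq_0[OF _ _ 0])
      (intro prod_measurable_add prod_measurable_norm d.\<xi>_prod d.\<eta>_prod, simp)
  then show ?thesis by eventually_elim (simp add: add_nonneg_eq_0_iff)
qed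

end

theorem theorem3p5:
  fixes M :: "'w measure"
    and P :: "real \<Rightarrow> 'w \<Rightarrow> real^'n::finite"
    and \<pi> :: "real \<Rightarrow> 'w \<Rightarrow> real^'n"
    and \<theta> :: "'n \<Rightarrow> real"
    and \<Lambda> \<Sigma> :: "real^'n^'n"
    and T \<alpha> l t :: real
    and x :: "real^'n"
    and C :: "real \<Rightarrow> real^'n^'n"
  defines "F \<equiv> prob_space.gen_filtration M P \<pi>"
  assumes "prob_space M"
    and "T > 0" and "\<alpha> \<ge> 0"
    and "pos_def \<Lambda>" and "nonneg_def \<Sigma>"
    and "\<forall>s\<ge>0. P s \<in> borel_measurable M"
    and "\<forall>i. prob_space.sq_int_martingale M F (\<lambda>s \<omega>. P s \<omega> $ i)"
    and "\<forall>s\<ge>0. \<forall>i j. prob_space.expectation M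
            (\<lambda>\<omega>. (P s \<omega> $ i - prob_space.expectation M (\<lambda>\<omega>'. P s \<omega>' $ i))
                * (P s \<omega> $ j - prob_space.expectation M (\<lambda>\<omega>'. P s \<omega>' $ j))) = s * \<Sigma> $ i $ j"
    and "\<forall>\<omega>\<in>space M. \<forall>i. cadlag_on_nonneg (\<lambda>s. P s \<omega> $ i)"
    and "\<forall>i. prob_space.poisson_process M (\<theta> i) (\<lambda>s \<omega>. \<pi> s \<omega> $ i)"
    and "prob_space.indep_vars M (\<lambda>_. Pi\<^sub>M UNIV (\<lambda>_. borel)) (\<lambda>i \<omega> s. \<pi> s \<omega> $ i) UNIV"
    and "prob_space.indep_var M (Pi\<^sub>M UNIV (\<lambda>_. borel)) (\<lambda>\<omega> s. P s \<omega>)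
                                (Pi\<^sub>M UNIV (\<lambda>_. borel)) (\<lambda>\<omega> s. \<pi> s \<omega>)"
    and "l > l0 \<theta> \<alpha> \<Lambda> \<Sigma>"
    and "riccati_sol \<theta> \<alpha> \<Lambda> \<Sigma> T l C"
    and "0 \<le> t" and "t < T"
  shows "(INF u\<in>{(\<xi>, \<eta>). admissible M F \<theta> T t \<xi> \<eta>}. cost M \<pi> \<alpha> \<Lambda> \<Sigma> T l t x (fst u) (snd u))
            = ennreal (x \<bullet> (C t *v x))
       \<and> (\<exists>\<xi>s \<eta>s. admissible M F \<theta> T t \<xi>s \<eta>s
          \<and> (AE \<omega> in M. \<forall>s\<in>{t..<T}.
                \<xi>s s \<omega> = matrix_inv \<Lambda> *v (C s *v position \<pi> x t \<xi>s \<eta>s s \<omega>)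
              \<and> \<eta>s s \<omega> = (Itilde \<theta> ** Cbar (C s) ** C s)
                           *v left_lim (\<lambda>q. position \<pi> x t \<xi>s \<eta>s q \<omega>) s)
          \<and> cost M \<pi> \<alpha> \<Lambda> \<Sigma> T l t x \<xi>s \<eta>s = ennreal (x \<bullet> (C t *v x))
          \<and> (\<forall>\<xi> \<eta>. admissible M F \<theta> T t \<xi> \<eta>
                \<and> cost M \<pi> \<alpha> \<Lambda> \<Sigma> T l t x \<xi> \<eta> = ennreal (x \<bullet> (C t *v x))
                \<longrightarrow> (AE p in restrict_space lborel {t..<T} \<Otimes>\<^sub>M M.
                       \<xi> (fst p) (snd p) = \<xi>s (fst p) (snd p) \<and> \<eta> (fst p) (snd p) = \<eta>s (fst p) (snd p))))"
proof -
  interpret prob_space M by fact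
  have \<theta>: "\<theta> i \<ge> 0" for i using assms(11) by (simp add: poisson_process_def)
  \<comment> \<open>Here \<open>l > l0\<close> enters: it makes the terminal value positive, from
    which the backward continuation for \<open>C\<close> starts.\<close>
  have l: "l > 0" using l0_nonneg[OF \<open>pos_def \<Lambda>\<close> \<open>nonneg_def \<Sigma>\<close> \<open>\<alpha> \<ge> 0\<close>, of \<theta>] \<open>l > l0 \<theta> \<alpha> \<Lambda> \<Sigma>\<close> by linarith
  interpret liq: liquidation M P \<pi> \<theta> t T \<alpha> l \<Lambda> \<Sigma> C
    by unfold_locales (use assms \<theta> l in blast)+
  have F: "F = liq.F" by (simp add: F_def)
  obtain \<xi>s \<eta>s where s: "admissible M F \<theta> T t \<xi>s \<eta>s"
    "AE \<omega> in M. \<forall>s\<in>{t..<T}. \<xi>s s \<omega> = matrix_inv \<Lambda> *v (C s *v position \<pi> x t \<xi>s \<eta>s s \<omega>)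
       \<and> \<eta>s s \<omega> = liq.feedback s *v left_lim (\<lambda>q. position \<pi> x t \<xi>s \<eta>s q \<omega>) s"
    unfolding F by (rule liq.optimal_strategy_exists)
  interpret opt: liquidation_strategy M P \<pi> \<theta> t T x \<xi>s \<eta>s \<alpha> l \<Lambda> \<Sigma> C
    by unfold_locales (rule s(1)[unfolded F])
  have cost_opt: "cost M \<pi> \<alpha> \<Lambda> \<Sigma> T l t x \<xi>s \<eta>s = ennreal (x \<bullet> (C t *v x))" by (rule opt.feedback_cost[OF s(2)])
  have "(INF u\<in>{(\<xi>, \<eta>). admissible M F \<theta> T t \<xi> \<eta>}. cost M \<pi> \<alpha> \<Lambda> \<Sigma> T l t x (fst u) (snd u)) = ennreal (x \<bullet> (C t *v x))"
  proof (rule antisym)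
    show "(INF u\<in>{(\<xi>, \<eta>). admissible M F \<theta> T t \<xi> \<eta>}. cost M \<pi> \<alpha> \<Lambda> \<Sigma> T l t x (fst u) (snd u)) \<le> ennreal (x \<bullet> (C t *v x))"
      using s(1) cost_opt by (intro INF_lower2[of "(\<xi>s, \<eta>s)"]) auto
    show "ennreal (x \<bullet> (C t *v x)) \<le> (INF u\<in>{(\<xi>, \<eta>). admissible M F \<theta> T t \<xi> \<eta>}. cost M \<pi> \<alpha> \<Lambda> \<Sigma> T l t x (fst u) (snd u))"
    proof (rule INF_greatest, clarify)
      fix \<xi> \<eta> assume "admissible M F \<theta> T t \<xi> \<eta>"
      then interpret st: liquidation_strategy M P \<pi> \<theta> t T x \<xi> \<eta> \<alpha> l \<Lambda> \<Sigma> C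
        by unfold_locales (simp add: F)
      show "ennreal (x \<bullet> (C t *v x)) \<le> cost M \<pi> \<alpha> \<Lambda> \<Sigma> T l t x (fst (\<xi>, \<eta>)) (snd (\<xi>, \<eta>))" using st.cost_ge by simp
    qed
  qed
  moreover have "AE p in restrict_space lborel {t..<T} \<Otimes>\<^sub>M M.
      \<xi> (fst p) (snd p) = \<xi>s (fst p) (snd p) \<and> \<eta> (fst p) (snd p) = \<eta>s (fst p) (snd p)"
    if "admissible M F \<theta> T t \<xi> \<eta>" "cost M \<pi> \<alpha> \<Lambda> \<Sigma> T l t x \<xi> \<eta> = ennreal (x \<bullet> (C t *v x))" for \<xi> \<eta>
    by (rule liq.optimal_strategy_unique[OF that[unfolded F] s(1)[unfolded F] cost_opt])
  ultimately show ?thesis using s cost_opt unfolding liq.feedback_def by blast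
qed

end
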